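(* Let $\mathbf{Zeros}\{\mathcal{Z}_n(\beta):\beta\in\mathbb{C}\}$ be the measure on $\mathbb{C}$ counting the zeros of $\mathcal{Z}_n$ with multiplicities. The following convergence of random measures holds weakly on the space $\mathcal{M}(\mathbb{C})$ as $n\to\infty$: $$\frac1n\,\mathbf{Zeros}\{\mathcal{Z}_n(\beta):\beta\in\mathbb{C}\}\longrightarrow\frac{1}{2\pi}\,\Xi,$$ where $\Xi=\Delta p=\sum_{k=1}^d\Xi_k$ (here $\Delta$ is the Laplacian in the sense of generalized functions on $\mathbb{C}\equiv\mathbb{R}^2$).
   Context: GREM. Fix $d\in\mathbb{N}$, variances $a_1,\dots,a_d>0$, branching exponents $\alpha_1,\dots,\alpha_d>1$, and sequences of natural numbers $N_{n,1},\dots,N_{n,d}$ with $\lim_{n\to\infty}N_{n,j}/\alpha_j^n=1$ for each $j$. Let $\mathbb{S}_n=\{\varepsilon=(\varepsilon_1,\dots,\varepsilon_d)\in\mathbb{N}^d:1\le\varepsilon_j\le N_{n,j},\ 1\le j\le d\}$. Let $\{\xi_{\varepsilon_1\dots\varepsilon_j}:1\le j\le d,\ 1\le\varepsilon_i\le N_{n,i}\}$ be independent real standard normal random variables, $X_\varepsilon=\sum_{j=1}^d\sqrt{a_j}\,\xi_{\varepsilon_1\dots\varepsilon_j}$, and $\mathcal{Z}_n(\beta)=\sum_{\varepsilon\in\mathbb{S}_n}e^{\beta\sqrt n X_\varepsilon}$, $\beta=\sigma+i\tau\in\mathbb{C}$. Put $\sigma_j=\sqrt{2\log\alpha_j/a_j}$;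 it is assumed throughout that $\sigma_1<\dots<\sigma_d$. Phases. For $1\le k\le d$: $G_k=\{\beta:2|\sigma|>\sigma_k,\ |\sigma|+|\tau|>\sigma_k\}$, $F_k=\{\beta:2|\sigma|<\sigma_k,\ 2(\sigma^2+\tau^2)>\sigma_k^2\}$, $E_k=\mathbb{C}\setminus\overline{G_k\cup F_k}$. The function $p$: $p=\sum_{k=1}^dp_k$, where $p_k(\beta)=|\sigma|\sqrt{2a_k\log\alpha_k}$ on $\overline{G_k}$, $p_k(\beta)=\frac12\log\alpha_k+a_k\sigma^2$ on $\overline{F_k}$, $p_k(\beta)=\log\alpha_k+\frac12a_k(\sigma^2-\tau^2)$ on $\overline{E_k}$. The measures $\Xi_k$: $\Xi_k=\Xi_k^F+\Xi_k^{EF}+\Xi_k^{EG}$, where $\Xi_k^F$ is $2a_k$ times two-dimensional Lebesgue measure restricted to $F_k$; $\Xi_k^{EF}$ is $\sqrt{a_k\log\alpha_k}$ times the one-dimensional length measure on the boundary between $E_k$ and $F_k$ (two circular arcs); $\Xi_k^{EG}$ has density $\sqrt2\,a_k|\tau|$ with respect to the one-dimensional length measure on the boundary between $E_k$ and $G_k$ (four line segments). Convergence: $\mathcal{M}(\mathbb{C})$ is the space of Radon measures on $\mathbb{C}$ with the topology of vague convergence; weak convergence of random measures means convergence in distribution of random elements of $\mathcal{M}(\mathbb{C})$. *)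

theory Defs
  imports "HOL-Probability.Probability" "HOL-Complex_Analysis.Complex_Analysis"
begin

section \<open>The GREM partition function\<close>

text \<open>
  A multi-index \<open>(\<epsilon>\<^sub>1, \<dots>, \<epsilon>\<^sub>j)\<close> is a list of length \<open>j\<close>, so \<open>\<epsilon>\<^sub>i\<close> is \<open>\<epsilon> ! (i - 1)\<close>, whereas
  the parameters \<open>a\<close>, \<open>\<alpha>\<close>, \<open>N\<close> are functions used at the arguments \<open>1, \<dots>, d\<close> only.
\<close>

definition grem_paths :: "(nat \<Rightarrow> nat) \<Rightarrow> nat \<Rightarrow> nat list set" where
  "grem_paths N j = {\<epsilon>. length \<epsilon> = j \<and> (\<forall>i\<in>{1..j}. 1 \<le> \<epsilon> ! (i - 1) \<and> \<epsilon> ! (i - 1) \<le> N i)}"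

definition grem_nodes :: "(nat \<Rightarrow> nat) \<Rightarrow> nat \<Rightarrow> nat list set" where
  "grem_nodes N d = (\<Union>j\<in>{1..d}. grem_paths N j)"

definition grem_energy :: "nat \<Rightarrow> (nat \<Rightarrow> real) \<Rightarrow> (nat list \<Rightarrow> 'w \<Rightarrow> real) \<Rightarrow> nat list \<Rightarrow> 'w \<Rightarrow> real"
  where "grem_energy d a \<xi> \<epsilon> \<omega> = (\<Sum>j=1..d. sqrt (a j) * \<xi> (take j \<epsilon>) \<omega>)"

definition grem_partition ::
  "nat \<Rightarrow> (nat \<Rightarrow> real) \<Rightarrow> (nat \<Rightarrow> nat) \<Rightarrow> (nat list \<Rightarrow> 'w \<Rightarrow> real) \<Rightarrow> nat \<Rightarrow> 'w \<Rightarrow> complex \<Rightarrow> complex"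
  where "grem_partition d a N \<xi> n \<omega> \<beta> =
    (\<Sum>\<epsilon>\<in>grem_paths N d. exp (\<beta> * complex_of_real (sqrt (real n) * grem_energy d a \<xi> \<epsilon> \<omega>)))"

text \<open>
  Counting measure of the zeros of \<open>f\<close>, each weighted by its multiplicity; only meaningful for an
  entire function that does not vanish identically.
\<close>

definition zeros_measure :: "(complex \<Rightarrow> complex) \<Rightarrow> complex measure" where
  "zeros_measure f =
    distr (density (count_space {z. f z = 0}) (\<lambda>z. ennreal (of_int (zorder f z)))) borel (\<lambda>z. z)"

section \<open>Random measures\<close>

text \<open>On \<open>\<complex>\<close> every Borel measure that is finite on compact sets is automatically regular.\<close>

definition radon_measures :: "complex measure set" where
  "radon_measures = {\<mu>. sets \<mu> = sets borel \<and> (\<forall>K. compact K \<longrightarrow> emeasure \<mu> K < \<infinity>)}"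

definition compactly_supported :: "(complex \<Rightarrow> real) \<Rightarrow> bool" where
  "compactly_supported f \<longleftrightarrow> compact (closure {z. f z \<noteq> 0})"

text \<open>The coarsest topology making all \<open>\<mu> \<mapsto> \<integral>f d\<mu>\<close>, \<open>f \<in> C\<^sub>c(\<complex>)\<close>, continuous.\<close>

definition vague_topology :: "complex measure topology" where
  "vague_topology = topology_generated_by
    {{\<mu> \<in> radon_measures. integral\<^sup>L \<mu> f \<in> U} | f U.
       continuous_on UNIV f \<and> compactly_supported f \<and> open U}"

definition borel_of :: "'b topology \<Rightarrow> 'b measure" where
  "borel_of T = sigma (topspace T) {U. openin T U}"

text \<open>
  Convergence in distribution of random elements of a topological space. The \<open>X n\<close> need to be
  random elements for all large \<open>n\<close> only: in the application, a finite number of the partition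
  functions may be empty sums, which have no zero counting measure.
\<close>

definition converges_in_distribution ::
  "'w measure \<Rightarrow> 'b topology \<Rightarrow> (nat \<Rightarrow> 'w \<Rightarrow> 'b) \<Rightarrow> ('w \<Rightarrow> 'b) \<Rightarrow> bool" where
  "converges_in_distribution P T X Y \<longleftrightarrow>
    (\<forall>\<^sub>F n in sequentially. X n \<in> P \<rightarrow>\<^sub>M borel_of T) \<and> Y \<in> P \<rightarrow>\<^sub>M borel_of T \<and>
    (\<forall>\<Phi>. continuous_map T euclideanreal \<Phi> \<and> bounded (\<Phi> ` topspace T) \<longrightarrow>
      (\<lambda>n. \<integral>\<omega>. \<Phi> (X n \<omega>) \<partial>P) \<longlonglongrightarrow> (\<integral>\<omega>. \<Phi> (Y \<omega>) \<partial>P))"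

section \<open>Sums of measures, arc length, distributional Laplacian\<close>

definition borel_sum :: "'a::topological_space measure list \<Rightarrow> 'a measure" where
  "borel_sum Ms = measure_of UNIV (sets borel) (\<lambda>A. \<Sum>M\<leftarrow>Ms. emeasure M A)"

lemma sets_borel_sum [simp, measurable_cong]: "sets (borel_sum Ms) = sets borel"
  unfolding borel_sum_def using sets.sets_measure_of_eq[of borel] by simp

lemma space_borel_sum [simp]: "space (borel_sum Ms) = UNIV"
  unfolding borel_sum_def by (simp add: space_measure_of_conv)

lemma emeasure_borel_sum:
  fixes Ms :: "'a::topological_space measure list"
  assumes "\<And>M. M \<in> set Ms \<Longrightarrow> sets M = sets borel" and "A \<in> sets borel"
  shows "emeasure (borel_sum Ms) A = (\<Sum>M\<leftarrow>Ms. emeasure M A)"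
  unfolding borel_sum_def
proof (rule emeasure_measure_of_sigma)
  show "sigma_algebra UNIV (sets (borel :: 'a measure))"
    using sets.sigma_algebra_axioms[of "borel :: 'a measure"] by simp
  show "positive (sets borel) (\<lambda>A. \<Sum>M\<leftarrow>Ms. emeasure M A)"
    unfolding positive_def by (induction Ms) auto
  show "countably_additive (sets borel) (\<lambda>A. \<Sum>M\<leftarrow>Ms. emeasure M A)"
    unfolding countably_additive_def
  proof (intro allI impI)
    fix B :: "nat \<Rightarrow> 'a set"
    assume B: "range B \<subseteq> sets borel" "disjoint_family B"
    show "(\<Sum>i. \<Sum>M\<leftarrow>Ms. emeasure M (B i)) = (\<Sum>M\<leftarrow>Ms. emeasure M (\<Union>i. B i))"
      using assms(1)
    proof (induction Ms)
      case (Cons M Ms)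
      have "(\<Sum>i. emeasure M (B i)) = emeasure M (\<Union>i. B i)"
        using B Cons.prems by (intro suminf_emeasure) auto
      then show ?case
        using Cons by (simp add: suminf_add[symmetric])
    qed simp
  qed
qed (use assms in auto)

text \<open>
  The one-dimensional length measure on the image of an injective piecewise smooth path \<open>g\<close>:
  the push-forward under \<open>g\<close> of \<open>\<bar>g'(t)\<bar> dt\<close> on \<open>[0, 1]\<close>.
\<close>

definition length_measure :: "(real \<Rightarrow> complex) \<Rightarrow> complex measure" where
  "length_measure g =
    distr (density (restrict_space lborel {0..1})
             (\<lambda>t. ennreal (norm (vector_derivative g (at t within {0..1}))))) borel g"

definition partial_deriv :: "complex \<Rightarrow> (complex \<Rightarrow> real) \<Rightarrow> complex \<Rightarrow> real" where
  "partial_deriv v f z = frechet_derivative f (at z) v"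

text \<open>\<open>C\<^sup>\<infinity>\<close> with respect to the real structure: all iterated partial derivatives are differentiable.\<close>

definition smooth :: "(complex \<Rightarrow> real) \<Rightarrow> bool" where
  "smooth f \<longleftrightarrow> (\<forall>vs\<in>lists {1, \<i>}. \<forall>z. fold partial_deriv vs f differentiable at z)"

definition laplacian :: "(complex \<Rightarrow> real) \<Rightarrow> complex \<Rightarrow> real" where
  "laplacian f z = partial_deriv 1 (partial_deriv 1 f) z + partial_deriv \<i> (partial_deriv \<i> f) z"

text \<open>
  \<open>\<Delta>p = \<mu>\<close> in the sense of generalized functions. A continuous \<open>p\<close> is locally integrable, hence
  defines a generalized function.
\<close>

definition has_distributional_laplacian :: "(complex \<Rightarrow> real) \<Rightarrow> complex measure \<Rightarrow> bool" where
  "has_distributional_laplacian p \<mu> \<longleftrightarrow> continuous_on UNIV p \<and> \<mu> \<in> radon_measures \<and>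
    (\<forall>\<phi>. smooth \<phi> \<and> compactly_supported \<phi> \<longrightarrow>
      (\<integral>z. p z * laplacian \<phi> z \<partial>lborel) = (\<integral>z. \<phi> z \<partial>\<mu>))"

section \<open>Phases, the function \<open>p\<close> and the measure \<open>\<Xi>\<close>\<close>

text \<open>
  The objects belonging to level \<open>k\<close> depend on \<open>k\<close> only through \<open>a\<^sub>k\<close> and \<open>\<alpha>\<^sub>k\<close>, and the phases only
  through \<open>s = \<sigma>\<^sub>k\<close>; they are defined here for scalar parameters.
\<close>

definition crit :: "real \<Rightarrow> real \<Rightarrow> real" where
  "crit a \<alpha> = sqrt (2 * ln \<alpha> / a)"

definition phase_G :: "real \<Rightarrow> complex set" where
  "phase_G s = {\<beta>. 2 * \<bar>Re \<beta>\<bar> > s \<and> \<bar>Re \<beta>\<bar> + \<bar>Im \<beta>\<bar> > s}"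

definition phase_F :: "real \<Rightarrow> complex set" where
  "phase_F s = {\<beta>. 2 * \<bar>Re \<beta>\<bar> < s \<and> 2 * ((Re \<beta>)\<^sup>2 + (Im \<beta>)\<^sup>2) > s\<^sup>2}"

definition phase_E :: "real \<Rightarrow> complex set" where
  "phase_E s = - closure (phase_G s \<union> phase_F s)"

text \<open>
  The three closures cover the plane, and the three formulas agree where the closures overlap
  (see \<open>level_p_closures\<close> below).
\<close>

definition level_p :: "real \<Rightarrow> real \<Rightarrow> complex \<Rightarrow> real" where
  "level_p a \<alpha> \<beta> =
    (if \<beta> \<in> closure (phase_G (crit a \<alpha>)) then \<bar>Re \<beta>\<bar> * sqrt (2 * a * ln \<alpha>)
     else if \<beta> \<in> closure (phase_F (crit a \<alpha>)) then ln \<alpha> / 2 + a * (Re \<beta>)\<^sup>2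
     else ln \<alpha> + a / 2 * ((Re \<beta>)\<^sup>2 - (Im \<beta>)\<^sup>2))"

definition level_Xi_F :: "real \<Rightarrow> real \<Rightarrow> complex measure" where
  "level_Xi_F a \<alpha> = density lborel (\<lambda>\<beta>. ennreal (2 * a * indicator (phase_F (crit a \<alpha>)) \<beta>))"

text \<open>The arcs of \<open>\<bar>\<beta>\<bar> = s / \<surd>2\<close> in the strip \<open>2 \<bar>Re \<beta>\<bar> \<le> s\<close>; see \<open>boundary_EF\<close> below.\<close>

definition arcs_EF :: "real \<Rightarrow> (real \<Rightarrow> complex) list" where
  "arcs_EF s =
    [part_circlepath 0 (s / sqrt 2) (pi / 4) (3 * pi / 4),
     part_circlepath 0 (s / sqrt 2) (5 * pi / 4) (7 * pi / 4)]"

text \<open>The segments of \<open>\<bar>Re \<beta>\<bar> + \<bar>Im \<beta>\<bar> = s\<close> with \<open>2 \<bar>Re \<beta>\<bar> \<ge> s\<close>; see \<open>boundary_EG\<close> below.\<close>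

definition segments_EG :: "real \<Rightarrow> (real \<Rightarrow> complex) list" where
  "segments_EG s =
    [linepath (Complex s 0) (Complex (s / 2) (s / 2)),
     linepath (Complex s 0) (Complex (s / 2) (- s / 2)),
     linepath (Complex (- s) 0) (Complex (- s / 2) (s / 2)),
     linepath (Complex (- s) 0) (Complex (- s / 2) (- s / 2))]"

definition level_Xi_EF :: "real \<Rightarrow> real \<Rightarrow> complex measure" where
  "level_Xi_EF a \<alpha> =
    scale_measure (ennreal (sqrt (a * ln \<alpha>))) (borel_sum (map length_measure (arcs_EF (crit a \<alpha>))))"

definition level_Xi_EG :: "real \<Rightarrow> real \<Rightarrow> complex measure" where
  "level_Xi_EG a \<alpha> =
    density (borel_sum (map length_measure (segments_EG (crit a \<alpha>))))
      (\<lambda>\<beta>. ennreal (sqrt 2 * a * \<bar>Im \<beta>\<bar>))"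

definition level_Xi :: "real \<Rightarrow> real \<Rightarrow> complex measure" where
  "level_Xi a \<alpha> = borel_sum [level_Xi_F a \<alpha>, level_Xi_EF a \<alpha>, level_Xi_EG a \<alpha>]"

definition grem_p :: "nat \<Rightarrow> (nat \<Rightarrow> real) \<Rightarrow> (nat \<Rightarrow> real) \<Rightarrow> complex \<Rightarrow> real" where
  "grem_p d a \<alpha> \<beta> = (\<Sum>k=1..d. level_p (a k) (\<alpha> k) \<beta>)"

definition grem_Xi :: "nat \<Rightarrow> (nat \<Rightarrow> real) \<Rightarrow> (nat \<Rightarrow> real) \<Rightarrow> complex measure" where
  "grem_Xi d a \<alpha> = borel_sum (map (\<lambda>k. level_Xi (a k) (\<alpha> k)) [1..<Suc d])"

subsection \<open>Consistency of the encoding of the phases\<close>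

lemma closure_phase_G:
  assumes s: "s > 0"
  shows "closure (phase_G s) = {\<beta>. 2 * \<bar>Re \<beta>\<bar> \<ge> s \<and> \<bar>Re \<beta>\<bar> + \<bar>Im \<beta>\<bar> \<ge> s}" (is "_ = ?R")
proof
  have "closed ?R"
    by (intro closed_Collect_conj closed_Collect_le continuous_intros)
  moreover have "phase_G s \<subseteq> ?R" by (auto simp: phase_G_def)
  ultimately show "closure (phase_G s) \<subseteq> ?R" by (rule closure_minimal[rotated])
next
  show "?R \<subseteq> closure (phase_G s)"
  proof
    fix z assume z: "z \<in> ?R"
    have ev: "eventually (\<lambda>t. Complex (Re z * (1 + t)) (Im z) \<in> closure (phase_G s)) (at_right (0::real))"
    proof (rule eventually_mono[OF eventually_at_right_less])
      fix t :: real assume t: "0 < t"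
      have "\<bar>Re z\<bar> > 0" using z s by auto
      then have "\<bar>Re z * (1 + t)\<bar> > \<bar>Re z\<bar>" using t by (simp add: abs_mult)
      then have "Complex (Re z * (1 + t)) (Im z) \<in> phase_G s" using z by (simp add: phase_G_def)
      then show "Complex (Re z * (1 + t)) (Im z) \<in> closure (phase_G s)"
        using closure_subset by blast
    qed
    have "((\<lambda>t. Complex (Re z * (1 + t)) (Im z)) \<longlongrightarrow> Complex (Re z * (1 + 0)) (Im z)) (at_right (0::real))"
      by (intro tendsto_intros)
    then show "z \<in> closure (phase_G s)"
      using Lim_in_closed_set[OF closed_closure ev] by simp
  qed
qed

lemma closure_phase_F:
  assumes s: "s > 0"
  shows "closure (phase_F s) = {\<beta>. 2 * \<bar>Re \<beta>\<bar> \<le> s \<and> 2 * ((Re \<beta>)\<^sup>2 + (Im \<beta>)\<^sup>2) \<ge> s\<^sup>2}" (is "_ = ?R")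
proof
  have "closed ?R"
    by (intro closed_Collect_conj closed_Collect_le continuous_intros)
  moreover have "phase_F s \<subseteq> ?R" by (auto simp: phase_F_def)
  ultimately show "closure (phase_F s) \<subseteq> ?R" by (rule closure_minimal[rotated])
next
  show "?R \<subseteq> closure (phase_F s)"
  proof
    fix z assume z: "z \<in> ?R"
    let ?g = "\<lambda>t::real. Complex (Re z * (1 - t)) (Im z * (1 + t))"
    have x: "(Re z)\<^sup>2 \<le> (s / 2)\<^sup>2" using z s by (intro abs_le_square_iff[THEN iffD1]) auto
    have b: "s\<^sup>2 > 0" "(Re z)\<^sup>2 \<le> s\<^sup>2 / 4" "s\<^sup>2 \<le> 2 * (Re z)\<^sup>2 + 2 * (Im z)\<^sup>2"
      using z x s by (auto simp: power_divide)
    have y1: "(Re z)\<^sup>2 \<le> (Im z)\<^sup>2" using b by linarith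
    have y2: "(Im z)\<^sup>2 > 0" using b by linarith
    note y = y1 y2
    have ev: "eventually (\<lambda>t. ?g t \<in> closure (phase_F s)) (at_right (0::real))"
    proof -
      have "eventually (\<lambda>t. t \<in> {0<..<1}) (at_right (0::real))"
        by (rule eventually_at_right_real) simp
      then show ?thesis
      proof (rule eventually_mono)
        fix t :: real assume t: "t \<in> {0<..<1}"
        have 1: "2 * \<bar>Re z * (1 - t)\<bar> < s"
        proof (cases "Re z = 0")
          case False
          then have "\<bar>Re z\<bar> * (1 - t) < \<bar>Re z\<bar> * 1"
            using t by (intro mult_strict_left_mono) auto
          then have "\<bar>Re z * (1 - t)\<bar> < \<bar>Re z\<bar>" using t by (simp add: abs_mult)
          then show ?thesis using z by auto
        qed (use s in auto)
        have "(Re z * (1 - t))\<^sup>2 + (Im z * (1 + t))\<^sup>2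
            = (Re z)\<^sup>2 + (Im z)\<^sup>2 + 2 * t * ((Im z)\<^sup>2 - (Re z)\<^sup>2) + t\<^sup>2 * ((Re z)\<^sup>2 + (Im z)\<^sup>2)"
          by (simp add: power2_eq_square algebra_simps)
        moreover have "2 * t * ((Im z)\<^sup>2 - (Re z)\<^sup>2) \<ge> 0" using t y by auto
        moreover have "t\<^sup>2 * ((Re z)\<^sup>2 + (Im z)\<^sup>2) > 0" using t y
          by (intro mult_pos_pos add_nonneg_pos) auto
        ultimately have "2 * ((Re z * (1 - t))\<^sup>2 + (Im z * (1 + t))\<^sup>2) > s\<^sup>2" using z by simp
        with 1 have "?g t \<in> phase_F s" by (simp add: phase_F_def)
        then show "?g t \<in> closure (phase_F s)"
          using closure_subset by blast
      qed
    qed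
    have "(?g \<longlongrightarrow> Complex (Re z * (1 - 0)) (Im z * (1 + 0))) (at_right 0)"
      by (intro tendsto_intros)
    then show "z \<in> closure (phase_F s)"
      using Lim_in_closed_set[OF closed_closure ev] by simp
  qed
qed

lemma phase_E_iff:
  assumes s: "s > 0"
  shows "\<beta> \<in> phase_E s \<longleftrightarrow> (2 * \<bar>Re \<beta>\<bar> < s \<or> \<bar>Re \<beta>\<bar> + \<bar>Im \<beta>\<bar> < s) \<and>
    (2 * \<bar>Re \<beta>\<bar> > s \<or> 2 * ((Re \<beta>)\<^sup>2 + (Im \<beta>)\<^sup>2) < s\<^sup>2)"
  unfolding phase_E_def closure_Un closure_phase_G[OF s] closure_phase_F[OF s] by auto

lemma half_square_bound:
  fixes x y s :: real
  assumes "2 * \<bar>x\<bar> = s" "\<bar>x\<bar> + \<bar>y\<bar> \<le> s"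
  shows "2 * (x\<^sup>2 + y\<^sup>2) \<le> s\<^sup>2"
proof -
  have "x\<^sup>2 = (s / 2)\<^sup>2" using assms(1) by (metis nonzero_mult_div_cancel_left power2_abs zero_neq_numeral)
  moreover have "y\<^sup>2 \<le> (s / 2)\<^sup>2" using assms by (intro abs_le_square_iff[THEN iffD1]) auto
  ultimately show ?thesis by (simp add: power_divide)
qed

lemma closure_phase_E:
  assumes s: "s > 0"
  shows "closure (phase_E s) = {\<beta>. (2 * \<bar>Re \<beta>\<bar> \<ge> s \<and> \<bar>Re \<beta>\<bar> + \<bar>Im \<beta>\<bar> \<le> s) \<or>
    (2 * \<bar>Re \<beta>\<bar> \<le> s \<and> 2 * ((Re \<beta>)\<^sup>2 + (Im \<beta>)\<^sup>2) \<le> s\<^sup>2)}" (is "_ = ?R")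
proof
  have "closed ?R"
    by (intro closed_Collect_conj closed_Collect_disj closed_Collect_le continuous_intros)
  moreover have "phase_E s \<subseteq> ?R" using phase_E_iff[OF s] by auto
  ultimately show "closure (phase_E s) \<subseteq> ?R" by (rule closure_minimal[rotated])
next
  show "?R \<subseteq> closure (phase_E s)"
  proof
    fix z assume z: "z \<in> ?R"
    let ?g = "\<lambda>t::real. Complex ((1 - t) * Re z) ((1 - t) * Im z)"
    have lim: "(?g \<longlongrightarrow> Complex ((1 - 0) * Re z) ((1 - 0) * Im z)) (at_right 0)"
      by (intro tendsto_intros)
    have ev01: "eventually (\<lambda>t. t \<in> {0<..<1}) (at_right (0::real))"
      by (rule eventually_at_right_real) simp
    have "eventually (\<lambda>t. ?g t \<in> phase_E s) (at_right 0)"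
    proof (cases "2 * \<bar>Re z\<bar> > s")
      case True
      have "((\<lambda>t. 2 * \<bar>(1 - t) * Re z\<bar>) \<longlongrightarrow> 2 * \<bar>(1 - 0) * Re z\<bar>) (at_right (0::real))"
        by (intro tendsto_intros)
      then have "eventually (\<lambda>t. 2 * \<bar>(1 - t) * Re z\<bar> > s) (at_right 0)"
        using True by (intro order_tendstoD(1)) auto
      with ev01 show ?thesis
      proof eventually_elim
        case (elim t)
        have "\<bar>Re z\<bar> + \<bar>Im z\<bar> \<le> s" using z True by auto
        moreover have "(1 - t) * (\<bar>Re z\<bar> + \<bar>Im z\<bar>) < 1 * (\<bar>Re z\<bar> + \<bar>Im z\<bar>)"
          using elim True s by (intro mult_strict_right_mono) auto
        ultimately have "\<bar>(1 - t) * Re z\<bar> + \<bar>(1 - t) * Im z\<bar> < s"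
          using elim by (simp add: abs_mult distrib_left)
        then show ?case using elim by (simp add: phase_E_iff[OF s])
      qed
    next
      case False
      then have q: "2 * ((Re z)\<^sup>2 + (Im z)\<^sup>2) \<le> s\<^sup>2"
        using z half_square_bound[of "Re z" s "Im z"] by auto
      from ev01 show ?thesis
      proof eventually_elim
        case (elim t)
        have 1: "2 * \<bar>(1 - t) * Re z\<bar> < s"
        proof (cases "Re z = 0")
          case nz: False
          then have "(1 - t) * \<bar>Re z\<bar> < 1 * \<bar>Re z\<bar>"
            using elim by (intro mult_strict_right_mono) auto
          then show ?thesis using False elim by (simp add: abs_mult)
        qed (use s in auto)
        have "(1 - t)\<^sup>2 < 1" using elim by (simp add: power_less_one_iff abs_square_less_1)
        have "2 * (((1 - t) * Re z)\<^sup>2 + ((1 - t) * Im z)\<^sup>2) < s\<^sup>2"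
        proof (cases "z = 0")
          case nz: False
          have "(Re z)\<^sup>2 + (Im z)\<^sup>2 > 0" using nz by (simp add: complex_neq_0)
          then have "(1 - t)\<^sup>2 * ((Re z)\<^sup>2 + (Im z)\<^sup>2) < 1 * ((Re z)\<^sup>2 + (Im z)\<^sup>2)"
            using \<open>(1 - t)\<^sup>2 < 1\<close> by (intro mult_strict_right_mono) auto
          then show ?thesis using q by (simp add: power_mult_distrib distrib_left)
        qed (use s in auto)
        with 1 show ?case by (simp add: phase_E_iff[OF s])
      qed
    qed
    then have "eventually (\<lambda>t. ?g t \<in> closure (phase_E s)) (at_right 0)"
      by (rule eventually_mono) (use closure_subset in blast)
    from Lim_in_closed_set[OF closed_closure this _ lim] show "z \<in> closure (phase_E s)"
      by simp
  qed
qed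

lemma crit_pos: "a > 0 \<Longrightarrow> \<alpha> > 1 \<Longrightarrow> crit a \<alpha> > 0"
  by (simp add: crit_def)

lemma level_p_closures:
  assumes a: "a > 0" and \<alpha>: "\<alpha> > 1"
  shows "\<beta> \<in> closure (phase_G (crit a \<alpha>)) \<Longrightarrow>
           level_p a \<alpha> \<beta> = \<bar>Re \<beta>\<bar> * sqrt (2 * a * ln \<alpha>)"
    and "\<beta> \<in> closure (phase_F (crit a \<alpha>)) \<Longrightarrow>
           level_p a \<alpha> \<beta> = ln \<alpha> / 2 + a * (Re \<beta>)\<^sup>2"
    and "\<beta> \<in> closure (phase_E (crit a \<alpha>)) \<Longrightarrow>
           level_p a \<alpha> \<beta> = ln \<alpha> + a / 2 * ((Re \<beta>)\<^sup>2 - (Im \<beta>)\<^sup>2)"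
proof -
  define s where "s = crit a \<alpha>"
  have s: "s > 0" using crit_pos[OF a \<alpha>] by (simp add: s_def)
  have s2: "s\<^sup>2 = 2 * ln \<alpha> / a" using a \<alpha> by (simp add: s_def crit_def)
  have L: "ln \<alpha> = a * s\<^sup>2 / 2" using a by (simp add: s2)
  have "2 * a * ln \<alpha> = (a * s)\<^sup>2" by (simp add: L power2_eq_square)
  then have R: "sqrt (2 * a * ln \<alpha>) = a * s" using a s by simp
  have sq: "(Re \<beta>)\<^sup>2 = \<bar>Re \<beta>\<bar>\<^sup>2" "(Im \<beta>)\<^sup>2 = \<bar>Im \<beta>\<bar>\<^sup>2" by simp_all
  note cl = closure_phase_G[OF s] closure_phase_F[OF s] closure_phase_E[OF s]
  show "level_p a \<alpha> \<beta> = \<bar>Re \<beta>\<bar> * sqrt (2 * a * ln \<alpha>)"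
    if "\<beta> \<in> closure (phase_G (crit a \<alpha>))"
    using that by (simp add: level_p_def)
  show "level_p a \<alpha> \<beta> = ln \<alpha> / 2 + a * (Re \<beta>)\<^sup>2"
    if F: "\<beta> \<in> closure (phase_F (crit a \<alpha>))"
  proof (cases "\<beta> \<in> closure (phase_G (crit a \<alpha>))")
    case True
    then have h: "\<bar>Re \<beta>\<bar> = s / 2" using F by (simp add: s_def[symmetric] cl)
    have "\<bar>Re \<beta>\<bar> * (a * s) = a * s\<^sup>2 / 2 / 2 + a * (Re \<beta>)\<^sup>2"
      unfolding sq h by (simp add: power2_eq_square)
    then show ?thesis using True unfolding level_p_def R L[symmetric] by simp
  qed (use F in \<open>simp add: level_p_def\<close>)
  show "level_p a \<alpha> \<beta> = ln \<alpha> + a / 2 * ((Re \<beta>)\<^sup>2 - (Im \<beta>)\<^sup>2)"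
    if E: "\<beta> \<in> closure (phase_E (crit a \<alpha>))"
  proof (cases "\<beta> \<in> closure (phase_G (crit a \<alpha>))")
    case True
    then have G: "s \<le> 2 * \<bar>Re \<beta>\<bar>" "s \<le> \<bar>Re \<beta>\<bar> + \<bar>Im \<beta>\<bar>" by (simp_all add: s_def[symmetric] cl)
    have "\<bar>Re \<beta>\<bar> + \<bar>Im \<beta>\<bar> \<le> s"
    proof (rule ccontr)
      assume *: "\<not> \<bar>Re \<beta>\<bar> + \<bar>Im \<beta>\<bar> \<le> s"
      with E G have 1: "\<bar>Re \<beta>\<bar> = s / 2" "2 * ((Re \<beta>)\<^sup>2 + (Im \<beta>)\<^sup>2) \<le> s\<^sup>2"
        by (auto simp: s_def[symmetric] cl)
      then have "(s / 2)\<^sup>2 < \<bar>Im \<beta>\<bar>\<^sup>2" using * s by (intro power_strict_mono) auto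
      then show False using 1 unfolding sq 1(1) by (simp add: power_divide)
    qed
    with G have y: "\<bar>Im \<beta>\<bar> = s - \<bar>Re \<beta>\<bar>" by simp
    define x where "x = \<bar>Re \<beta>\<bar>"
    have "x * (a * s) = a * s\<^sup>2 / 2 + a / 2 * (x\<^sup>2 - (s - x)\<^sup>2)"
      by (simp add: power2_eq_square field_simps)
    then have "\<bar>Re \<beta>\<bar> * (a * s) = a * s\<^sup>2 / 2 + a / 2 * ((Re \<beta>)\<^sup>2 - (Im \<beta>)\<^sup>2)"
      unfolding sq y x_def .
    then show ?thesis using True unfolding level_p_def R L[symmetric] by simp
  next
    case nG: False
    show ?thesis
    proof (cases "\<beta> \<in> closure (phase_F (crit a \<alpha>))")
      case True
      have "2 * ((Re \<beta>)\<^sup>2 + (Im \<beta>)\<^sup>2) \<le> s\<^sup>2"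
        using True E half_square_bound[of "Re \<beta>" s "Im \<beta>"] by (auto simp: s_def[symmetric] cl)
      with True have e: "s\<^sup>2 = 2 * ((Re \<beta>)\<^sup>2 + (Im \<beta>)\<^sup>2)"
        unfolding s_def[symmetric] cl mem_Collect_eq by linarith
      then show ?thesis using True nG
        unfolding level_p_def L e by (simp add: field_simps)
    qed (use nG in \<open>simp add: level_p_def\<close>)
  qed
qed

lemma frontier_Int_frontier:
  fixes A B :: "'a::topological_space set"
  assumes "open A" "open B" "A \<inter> B = {}"
  shows "frontier A \<inter> frontier B = closure A \<inter> closure B"
proof -
  have "A \<inter> closure B = {}" "B \<inter> closure A = {}"
    using assms open_Int_closure_eq_empty[of A B] open_Int_closure_eq_empty[of B A] by auto
  then show ?thesis
    using assms by (auto simp: frontier_def interior_open)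
qed

lemma open_phases: "open (phase_G s)" "open (phase_F s)" "open (phase_E s)"
  unfolding phase_G_def phase_F_def phase_E_def
  by (intro open_Collect_conj open_Collect_less continuous_intros open_Compl closed_closure)+

lemma phase_E_disjoint: "phase_E s \<inter> phase_F s = {}" "phase_E s \<inter> phase_G s = {}"
  unfolding phase_E_def using closure_subset by fastforce+

lemma boundary_EG:
  assumes s: "s > 0"
  shows "(\<Union>g\<in>set (segments_EG s). path_image g) = frontier (phase_E s) \<inter> frontier (phase_G s)"
proof -
  have seg: "path_image (linepath (Complex (c * s) 0) (Complex (c * s / 2) (e * s / 2)))
      = {z. s / 2 \<le> c * Re z \<and> 0 \<le> e * Im z \<and> c * Re z + e * Im z = s}"
    if c: "c = 1 \<or> c = -1" and e: "e = 1 \<or> e = -1" for c e :: real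
  proof -
    have "closed_segment (Complex (c * s) 0) (Complex (c * s / 2) (e * s / 2))
        = {z. s / 2 \<le> c * Re z \<and> 0 \<le> e * Im z \<and> c * Re z + e * Im z = s}" (is "?A = ?B")
    proof (intro set_eqI iffI)
      fix z assume "z \<in> ?A"
      then obtain u where u: "0 \<le> u" "u \<le> 1"
        "z = (1 - u) *\<^sub>R Complex (c * s) 0 + u *\<^sub>R Complex (c * s / 2) (e * s / 2)"
        by (auto simp: in_segment)
      have "u * s \<le> s" "0 \<le> u * s" using u s by (auto simp: mult_left_le_one_le)
      then show "z \<in> ?B" using c e unfolding u(3) by (auto simp: field_simps)
    next
      fix z assume z: "z \<in> ?B"
      define u where "u = 2 * (e * Im z) / s"
      have "e * (e * Im z) = Im z" "c * (c * Re z) = Re z" using c e by auto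
      moreover have "c * Re z = s - e * Im z" using z by simp
      ultimately have "Im z = e * (u * s / 2)" "Re z = c * (s - u * s / 2)"
        using s by (simp_all add: u_def)
      then have "z = (1 - u) *\<^sub>R Complex (c * s) 0 + u *\<^sub>R Complex (c * s / 2) (e * s / 2)"
        by (simp add: complex_eq_iff algebra_simps)
      moreover have "0 \<le> u" "u \<le> 1" using z s by (auto simp: u_def field_simps)
      ultimately show "z \<in> ?A" by (auto simp: in_segment)
    qed
    then show ?thesis by simp
  qed
  have "(\<Union>g\<in>set (segments_EG s). path_image g) =
      {z. s / 2 \<le> \<bar>Re z\<bar> \<and> \<bar>Re z\<bar> + \<bar>Im z\<bar> = s}"
  proof -
    have "(\<Union>g\<in>set (segments_EG s). path_image g) =
        {z. s / 2 \<le> Re z \<and> 0 \<le> Im z \<and> Re z + Im z = s} \<union>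
        {z. s / 2 \<le> Re z \<and> Im z \<le> 0 \<and> Re z - Im z = s} \<union>
        {z. s / 2 \<le> - Re z \<and> 0 \<le> Im z \<and> - Re z + Im z = s} \<union>
        {z. s / 2 \<le> - Re z \<and> Im z \<le> 0 \<and> - Re z - Im z = s}"
      using seg[of 1 1] seg[of 1 "-1"] seg[of "-1" 1] seg[of "-1" "-1"]
      by (simp add: segments_EG_def Un_assoc del: path_image_linepath)
    also have "\<dots> = {z. s / 2 \<le> \<bar>Re z\<bar> \<and> \<bar>Re z\<bar> + \<bar>Im z\<bar> = s}"
    proof (intro set_eqI)
      fix z
      show "z \<in> {z. s / 2 \<le> Re z \<and> 0 \<le> Im z \<and> Re z + Im z = s} \<union>
          {z. s / 2 \<le> Re z \<and> Im z \<le> 0 \<and> Re z - Im z = s} \<union>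
          {z. s / 2 \<le> - Re z \<and> 0 \<le> Im z \<and> - Re z + Im z = s} \<union>
          {z. s / 2 \<le> - Re z \<and> Im z \<le> 0 \<and> - Re z - Im z = s} \<longleftrightarrow>
        z \<in> {z. s / 2 \<le> \<bar>Re z\<bar> \<and> \<bar>Re z\<bar> + \<bar>Im z\<bar> = s}"
        using s by (cases "Re z \<ge> 0"; cases "Im z \<ge> 0") (simp_all; linarith)+
    qed
    finally show ?thesis .
  qed
  also have "\<dots> = closure (phase_E s) \<inter> closure (phase_G s)"
  proof -
    have "\<bar>y\<bar> \<le> \<bar>x\<bar>" if "2 * \<bar>x\<bar> = s" "2 * (x\<^sup>2 + y\<^sup>2) \<le> s\<^sup>2" for x y :: real
    proof -
      have "s\<^sup>2 = 4 * x\<^sup>2" using that(1) by (metis four_x_squared power2_abs power_mult_distrib abs_mult abs_numeral)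
      then show ?thesis using that(2) by (simp add: abs_le_square_iff)
    qed
    then show ?thesis unfolding closure_phase_E[OF s] closure_phase_G[OF s]
      by (fastforce simp: field_simps)
  qed
  finally show ?thesis
    using frontier_Int_frontier[OF open_phases(3,1) phase_E_disjoint(2)] by simp
qed

lemma boundary_EF:
  assumes s: "s > 0"
  shows "(\<Union>g\<in>set (arcs_EF s). path_image g) = frontier (phase_E s) \<inter> frontier (phase_F s)"
proof -
  define r where "r = s / sqrt 2"
  have r: "r > 0" "2 * r\<^sup>2 = s\<^sup>2" "s / 2 = r * (sqrt 2 / 2)"
    using s by (auto simp: r_def power_divide field_simps)
  have arc: "path_image (part_circlepath 0 r (pi / 4) (3 * pi / 4))
      = {z. \<bar>Re z\<bar> \<le> s / 2 \<and> (Re z)\<^sup>2 + (Im z)\<^sup>2 = r\<^sup>2 \<and> 0 \<le> Im z}" (is "?A = ?B")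
  proof -
    have A: "?A = {r * exp (\<i> * complex_of_real t) |t. pi / 4 \<le> t \<and> t \<le> 3 * pi / 4}"
      by (subst path_image_part_circlepath) auto
    have c34: "cos (3 * pi / 4) = - (sqrt 2 / 2)"
      using cos_pi_minus[of "pi / 4"] by (simp add: cos_45 field_simps)
    show ?thesis
    proof (intro set_eqI iffI)
      fix z assume "z \<in> ?A"
      then obtain t where t: "pi / 4 \<le> t" "t \<le> 3 * pi / 4" and z: "z = r * exp (\<i> * complex_of_real t)"
        unfolding A by auto
      have ReIm: "Re z = r * cos t" "Im z = r * sin t"
        unfolding z by (simp_all add: Re_exp Im_exp)
      have "cos t \<le> cos (pi / 4)" "cos (3 * pi / 4) \<le> cos t"
        using t pi_gt_zero by (auto intro!: cos_monotone_0_pi_le)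
      then have "\<bar>cos t\<bar> \<le> sqrt 2 / 2" unfolding c34 by (simp add: cos_45)
      then have "r * \<bar>cos t\<bar> \<le> r * (sqrt 2 / 2)" using r by (intro mult_left_mono) auto
      then have "\<bar>Re z\<bar> \<le> s / 2" unfolding ReIm using r by (simp add: abs_mult)
      moreover have "sin t \<ge> 0" using t pi_gt_zero by (intro sin_ge_zero) auto
      moreover have "(Re z)\<^sup>2 + (Im z)\<^sup>2 = r\<^sup>2"
        unfolding ReIm by (simp add: power_mult_distrib distrib_left[symmetric])
      ultimately show "z \<in> ?B" using r ReIm by auto
    next
      fix z assume z: "z \<in> ?B"
      define x where "x = Re z / r"
      have x: "\<bar>x\<bar> \<le> sqrt 2 / 2" using z r by (auto simp: x_def field_simps)
      have x1: "\<bar>x\<bar> \<le> 1" using x sqrt2_less_2 by linarith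
      define t where "t = arccos x"
      have ct: "cos t = x" using x1 by (simp add: t_def)
      have t0: "0 \<le> t" "t \<le> pi" using x1 by (auto simp: t_def arccos_lbound arccos_ubound)
      have "pi / 4 \<le> t"
      proof (rule ccontr)
        assume "\<not> ?thesis"
        then have "cos (pi / 4) < cos t" using t0 by (intro cos_monotone_0_pi) auto
        then show False using x ct by (auto simp: cos_45)
      qed
      moreover have "t \<le> 3 * pi / 4"
      proof (rule ccontr)
        assume "\<not> ?thesis"
        then have "cos t < cos (3 * pi / 4)" using t0 by (intro cos_monotone_0_pi) auto
        then show False using x ct unfolding c34 by auto
      qed
      moreover have "z = r * exp (\<i> * complex_of_real t)"
      proof -
        have re: "Re z = r * cos t" using r by (simp add: ct x_def)
        have "(Im z)\<^sup>2 = r\<^sup>2 - (r * cos t)\<^sup>2" using z re by auto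
        also have "\<dots> = (r * sin t)\<^sup>2"
          by (simp add: power_mult_distrib sin_squared_eq right_diff_distrib)
        finally have "Im z = r * sin t"
          using z r t0 by (intro power2_eq_imp_eq[of "Im z"]) (auto intro!: mult_nonneg_nonneg sin_ge_zero)
        with re show ?thesis by (simp add: complex_eq_iff Re_exp Im_exp)
      qed
      ultimately show "z \<in> ?A" unfolding A by auto
    qed
  qed
  have arc': "path_image (part_circlepath 0 r (5 * pi / 4) (7 * pi / 4))
      = {z. \<bar>Re z\<bar> \<le> s / 2 \<and> (Re z)\<^sup>2 + (Im z)\<^sup>2 = r\<^sup>2 \<and> Im z \<le> 0}"
  proof -
    have "part_circlepath 0 r (5 * pi / 4) (7 * pi / 4) =
        uminus \<circ> part_circlepath 0 r (pi / 4) (3 * pi / 4)"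
    proof
      fix u :: real
      have "linepath (5 * pi / 4) (7 * pi / 4) u = linepath (pi / 4) (3 * pi / 4) u + pi"
        by (simp add: linepath_def field_simps)
      then show "part_circlepath 0 r (5 * pi / 4) (7 * pi / 4) u =
          (uminus \<circ> part_circlepath 0 r (pi / 4) (3 * pi / 4)) u"
        by (simp add: part_circlepath_def exp_add distrib_left)
    qed
    then have "path_image (part_circlepath 0 r (5 * pi / 4) (7 * pi / 4)) =
        uminus ` path_image (part_circlepath 0 r (pi / 4) (3 * pi / 4))"
      by (simp add: path_image_compose)
    also have "\<dots> = {z. - z \<in> path_image (part_circlepath 0 r (pi / 4) (3 * pi / 4))}"
      by (auto intro: image_eqI[where x = "- z" for z])
    finally show ?thesis unfolding arc by simp
  qed
  have "(\<Union>g\<in>set (arcs_EF s). path_image g) = {z. \<bar>Re z\<bar> \<le> s / 2 \<and> (Re z)\<^sup>2 + (Im z)\<^sup>2 = r\<^sup>2}"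
    unfolding arcs_EF_def r_def[symmetric] using arc arc' by auto
  also have "\<dots> = closure (phase_E s) \<inter> closure (phase_F s)"
  proof -
    have "z \<in> closure (phase_E s) \<inter> closure (phase_F s) \<longleftrightarrow>
        \<bar>Re z\<bar> \<le> s / 2 \<and> (Re z)\<^sup>2 + (Im z)\<^sup>2 = r\<^sup>2" for z
      using half_square_bound[of "Re z" s "Im z"] r(2)[symmetric]
      unfolding closure_phase_E[OF s] closure_phase_F[OF s] by auto
    then show ?thesis by blast
  qed
  finally show ?thesis
    using frontier_Int_frontier[OF open_phases(3,2) phase_E_disjoint(1)] by simp
qed

end

theory Submission
 imports Defs "HOL-Real_Asymp.Real_Asymp"
begin

text \<open>
 By Green's formula, integrating a test function \<open>\<phi>\<close> against the zeros of \<open>Z\<^sub>n\<close> gives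
 \<open>1 / (2 \<pi>) \<integral> ln \<bar>Z\<^sub>n\<bar> \<Delta>\<phi>\<close>, so it suffices that the potentials \<open>ln \<bar>Z\<^sub>n\<bar> / n\<close> converge to \<open>p\<close> in mean,
 locally integrably in \<open>\<beta>\<close>, and that \<open>\<Delta>p = \<Xi>\<close>. The partition function is a cascade
 \<open>\<Sum>\<^sub>i exp (\<beta> c X\<^sub>i) W\<^sub>i\<close> with independent cascades \<open>W\<^sub>i\<close> of the remaining levels. Moments of order \<open>q \<le> 2\<close>
 (subadditivity for \<open>q \<le> 1\<close>, the von Bahr-Esseen inequality for \<open>q \<ge> 1\<close>) give the upper bound. For the lower
 bound, a level in the phase \<open>E\<close> concentrates about its mean, together with all later levels; in the other phases
 the sum is anticoncentrated, since the characteristic function of each term is bounded away from 1 by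
 the energies near a suitable level. Finally \<open>\<bar>Z\<^sub>n\<bar>\<close> has a bounded moment of order \<open>-1/2\<close>, so that
 the logarithmic singularities are uniformly integrable.
\<close>

section \<open>Green's formula for compactly supported functions\<close>

text \<open>The moment order of a level is \<open>min 2 (s / |Re b|)\<close>: the second entry
  minimises the growth rate of the L^q norm of the fluctuations, and 2 is the largest order covered
  by the von Bahr-Esseen inequality. Since the critical values increase, so do the orders; a bound
  for the subtrees at their own order yields one at the lower order of their parent. The same
  monotonicity makes phase E pass on to all later levels. The lower bound is built up from the last
  level: a step outside E uses weights lying between exp (n (P - eps)) and exp (n (P + eps)) with
  probability at least 1/2. Both coordinate axes are null sets and are left out. Near the imaginary
  axis the bound on the moment of order -1/2 degenerates, but the resulting logarithmic moment grows
  only like |Re b| powr (-1/2), which is integrable; near the real axis the half-period of the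
  oscillation tends to infinity. The vague topology is handled by countably many test functions,
  monomials times the cube of the positive part of R^2 - |z|^2. They are C^2 but in general not
  smooth, hence Green's formula is proved for C^2 functions.\<close>

lemmas square_simps = power2_eq_square algebra_simps

lemma measurable_Complex [measurable]:
 "(\<lambda>(x, y). Complex x y) \<in> borel_measurable (borel \<Otimes>\<^sub>M borel)"
 unfolding borel_prod
 by (intro borel_measurable_continuous_onI) (auto simp: case_prod_beta intro!: continuous_intros)

text \<open>Both measures give a box the product of its side lengths. Plane integrals become
  iterated one-dimensional ones through this identity.\<close>

lemma lborel_complex:
 "(lborel :: complex measure) = distr (lborel \<Otimes>\<^sub>M lborel) borel (\<lambda>(x, y). Complex x y)"
proof (rule lborel_eqI)
 have m: "(\<lambda>(x, y). Complex x y) \<in> borel_measurable (lborel \<Otimes>\<^sub>M lborel)"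
  by measurable
 fix l u :: complex
 assume lu: "\<And>b. b \<in> Basis ==> l \<bullet> b <= u \<bullet> b"
 have *: "Re l <= Re u" "Im l <= Im u"
  using lu[of 1] lu[of \<i>] by (auto simp: Basis_complex_def)
 have eq: "(\<lambda>(x, y). Complex x y) -` box l u = {Re l<..<Re u} \<times> {Im l<..<Im u}"
  by (auto simp: box_def Basis_complex_def)
 show "emeasure (distr (lborel \<Otimes>\<^sub>M lborel) borel (\<lambda>(x, y). Complex x y)) (box l u)
   = ennreal (\<Prod>b\<in>Basis. (u - l) \<bullet> b)"
  apply (subst emeasure_distr[OF m])
   apply simp
  apply (simp only: eq space_pair_measure space_lborel space_borel UNIV_Times_UNIV Int_UNIV_right)
  using * by (subst lborel.emeasure_pair_measure_Times)
   (auto simp: Basis_complex_def ennreal_mult'[symmetric])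
qed simp

lemma measurable_Complex' [measurable (raw)]:
 assumes "f \<in> borel_measurable M" "g \<in> borel_measurable M"
 shows "(\<lambda>x. Complex (f x) (g x)) \<in> borel_measurable M"
 using measurable_compose[OF measurable_Pair[OF assms] measurable_Complex] by simp

lemma nn_integral_complex:
 assumes [measurable]: "f \<in> borel_measurable borel"
 shows "(\<integral>\<^sup>+z. f z \<partial>lborel) = (\<integral>\<^sup>+x. \<integral>\<^sup>+y. f (Complex x y) \<partial>lborel \<partial>lborel)"
 by (subst lborel_complex, subst nn_integral_distr)
  (auto simp: lborel.nn_integral_fst[symmetric])

lemma
 fixes f :: "complex \<Rightarrow> real"
 assumes f: "integrable lborel f"
 shows integral_complex_xy: "(LBINT z. f z) = (LBINT x. \<integral>y. f (Complex x y) \<partial>lborel)"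
  and integral_complex_yx: "(LBINT z. f z) = (LBINT y. \<integral>x. f (Complex x y) \<partial>lborel)"
proof -
 have [measurable]: "f \<in> borel_measurable borel" using f by auto
 have eq: "(LBINT z. f z) = (\<integral>p. f (Complex (fst p) (snd p)) \<partial>(lborel \<Otimes>\<^sub>M lborel))"
  by (subst lborel_complex, subst integral_distr) (auto simp: case_prod_beta)
 have "integrable (distr (lborel \<Otimes>\<^sub>M lborel) borel (\<lambda>(x, y). Complex x y)) f"
  using f unfolding lborel_complex .
 then have i: "integrable (lborel \<Otimes>\<^sub>M lborel) (\<lambda>(x, y). f (Complex x y))"
  by (subst (asm) integrable_distr_eq) (auto simp: case_prod_beta')
 show "(LBINT z. f z) = (LBINT x. \<integral>y. f (Complex x y) \<partial>lborel)"
  using lborel_pair.integral_fst[OF i] by (simp add: eq case_prod_beta')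
 show "(LBINT z. f z) = (LBINT y. \<integral>x. f (Complex x y) \<partial>lborel)"
  using lborel_pair.integral_snd[OF i] by (simp add: eq case_prod_beta')
qed

lemma integrable_cont_compact_support:
 fixes f :: "'a::euclidean_space \<Rightarrow> real"
 assumes "continuous_on UNIV f" and "\<And>x. norm x > R ==> f x = 0"
 shows "integrable lborel f"
proof -
 have "integrable lborel (\<lambda>x. indicator (cball 0 R) x *\<^sub>R f x)"
  by (intro borel_integrable_compact) (auto intro: continuous_on_subset[OF assms(1)])
 also have "(\<lambda>x. indicator (cball 0 R) x *\<^sub>R f x) = f"
  using assms(2) by (auto simp: fun_eq_iff indicator_def)
 finally show ?thesis .
qed

text \<open>The derivatives are explicit arguments, taken along the two axes: Green's formula
  integrates by parts on horizontal and vertical lines, and explicit derivatives make sums, products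
  and compositions computable. The domain \<open>U\<close> matters because the logarithm of a
  zero-free factor is available on a disc only.\<close>

definition C2_on :: "complex set \<Rightarrow> (complex \<Rightarrow> real) \<Rightarrow> (complex \<Rightarrow> real) \<Rightarrow> (complex \<Rightarrow> real) \<Rightarrow>
  (complex \<Rightarrow> real) \<Rightarrow> (complex \<Rightarrow> real) \<Rightarrow> bool" where
 "C2_on U u ux uy uxx uyy \<longleftrightarrow>
  continuous_on U u \<and> continuous_on U ux \<and> continuous_on U uy \<and>
  continuous_on U uxx \<and> continuous_on U uyy \<and>
  (\<forall>z\<in>U. ((\<lambda>x. u (Complex x (Im z))) has_real_derivative ux z) (at (Re z)) \<and>
      ((\<lambda>y. u (Complex (Re z) y)) has_real_derivative uy z) (at (Im z)) \<and>
      ((\<lambda>x. ux (Complex x (Im z))) has_real_derivative uxx z) (at (Re z)) \<and>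
      ((\<lambda>y. uy (Complex (Re z) y)) has_real_derivative uyy z) (at (Im z)))"

lemma C2_onD:
 assumes "C2_on U u ux uy uxx uyy"
 shows "continuous_on U u" "continuous_on U ux" "continuous_on U uy"
  "continuous_on U uxx" "continuous_on U uyy"
  "\<And>x y. Complex x y \<in> U ==> ((\<lambda>x. u (Complex x y)) has_real_derivative ux (Complex x y)) (at x)"
  "\<And>x y. Complex x y \<in> U ==> ((\<lambda>y. u (Complex x y)) has_real_derivative uy (Complex x y)) (at y)"
  "\<And>x y. Complex x y \<in> U ==> ((\<lambda>x. ux (Complex x y)) has_real_derivative uxx (Complex x y)) (at x)"
  "\<And>x y. Complex x y \<in> U ==> ((\<lambda>y. uy (Complex x y)) has_real_derivative uyy (Complex x y)) (at y)"
 using assms unfolding C2_on_def by force+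

lemma C2_on_const: "C2_on U (\<lambda>_. c) (\<lambda>_. 0) (\<lambda>_. 0) (\<lambda>_. 0) (\<lambda>_. 0)"
 unfolding C2_on_def by auto

lemma C2_on_Re: "C2_on U Re (\<lambda>_. 1) (\<lambda>_. 0) (\<lambda>_. 0) (\<lambda>_. 0)"
 unfolding C2_on_def by (auto intro!: continuous_intros)

lemma C2_on_Im: "C2_on U Im (\<lambda>_. 0) (\<lambda>_. 1) (\<lambda>_. 0) (\<lambda>_. 0)"
 unfolding C2_on_def by (auto intro!: continuous_intros)

lemma C2_on_add:
 assumes "C2_on U u ux uy uxx uyy" "C2_on U v vx vy vxx vyy"
 shows "C2_on U (\<lambda>z. u z + v z) (\<lambda>z. ux z + vx z) (\<lambda>z. uy z + vy z)
  (\<lambda>z. uxx z + vxx z) (\<lambda>z. uyy z + vyy z)"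
 using assms unfolding C2_on_def by (auto intro!: continuous_intros derivative_intros)

lemma C2_on_mult:
 assumes "C2_on U u ux uy uxx uyy" "C2_on U v vx vy vxx vyy"
 shows "C2_on U (\<lambda>z. u z * v z) (\<lambda>z. ux z * v z + u z * vx z) (\<lambda>z. uy z * v z + u z * vy z)
  (\<lambda>z. uxx z * v z + 2 * (ux z * vx z) + u z * vxx z)
  (\<lambda>z. uyy z * v z + 2 * (uy z * vy z) + u z * vyy z)"
 using assms unfolding C2_on_def
 by (auto intro!: continuous_intros derivative_eq_intros simp: algebra_simps)

lemma C2_on_compose:
 assumes u: "C2_on U u ux uy uxx uyy"
  and g: "\<And>z. z \<in> U ==> (g has_real_derivative g' (u z)) (at (u z))"
  and g': "\<And>z. z \<in> U ==> (g' has_real_derivative g'' (u z)) (at (u z))"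
  and c: "continuous_on (u ` U) g''"
 shows "C2_on U (\<lambda>z. g (u z)) (\<lambda>z. g' (u z) * ux z) (\<lambda>z. g' (u z) * uy z)
  (\<lambda>z. g'' (u z) * (ux z)^2 + g' (u z) * uxx z) (\<lambda>z. g'' (u z) * (uy z)^2 + g' (u z) * uyy z)"
proof -
 have cg: "continuous_on (u ` U) g" "continuous_on (u ` U) g'"
  using g g' by (auto intro!: continuous_at_imp_continuous_on DERIV_isCont)
 have cc: "continuous_on U (\<lambda>z. g (u z))" "continuous_on U (\<lambda>z. g' (u z))" "continuous_on U (\<lambda>z. g'' (u z))"
  using cg c C2_onD(1)[OF u] by (auto intro: continuous_on_compose2)
 have d: "((\<lambda>x. g (u (Complex x (Im z)))) has_real_derivative g' (u z) * ux z) (at (Re z))"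
  "((\<lambda>x. g (u (Complex (Re z) x))) has_real_derivative g' (u z) * uy z) (at (Im z))"
  "((\<lambda>x. g' (u (Complex x (Im z)))) has_real_derivative g'' (u z) * ux z) (at (Re z))"
  "((\<lambda>x. g' (u (Complex (Re z) x))) has_real_derivative g'' (u z) * uy z) (at (Im z))" if "z \<in> U" for z
  using C2_onD(6,7)[OF u, of "Re z" "Im z"] g[OF that] g'[OF that] that
  by (auto intro!: DERIV_chain2[of _ _ "\<lambda>x. u (Complex x (Im z))"] DERIV_chain2[of _ _ "\<lambda>x. u (Complex (Re z) x)"])
 have d2: "((\<lambda>x. ux (Complex x (Im z))) has_real_derivative uxx z) (at (Re z))"
  "((\<lambda>y. uy (Complex (Re z) y)) has_real_derivative uyy z) (at (Im z))" if "z \<in> U" for z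
  using C2_onD(8,9)[OF u, of "Re z" "Im z"] that by auto
 show ?thesis
  unfolding C2_on_def
  apply (intro conjI ballI)
      apply (use cc C2_onD(2-5)[OF u] in \<open>auto intro!: continuous_intros\<close>)[5]
    apply (rule d d; assumption)
    apply (rule d d; assumption)
  using d2 by (auto intro!: derivative_eq_intros d simp: power2_eq_square)
qed

lemma integral_deriv_compact_support:
 fixes F f :: "real \<Rightarrow> real"
 assumes F: "\<And>x. (F has_real_derivative f x) (at x)" and f: "continuous_on UNIV f"
  and z: "\<And>x. \<bar>x\<bar> > R ==> F x = 0"
 shows "(LBINT x. f x) = 0"
proof -
 have f0: "f x = 0" if "\<bar>x\<bar> > R" for x
 proof -
  have "\<forall>\<^sub>F y in nhds x. y \<in> {y. \<bar>y\<bar> > R}"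
   using that by (intro eventually_nhds_in_open open_Collect_less continuous_intros) auto
  then have "(F has_real_derivative f x) (at x) = ((\<lambda>_. 0) has_real_derivative f x) (at x)"
   by (intro DERIV_cong_ev) (auto elim!: eventually_mono simp: z)
  then show ?thesis using F DERIV_unique[OF _ DERIV_const] by blast
 qed
 define r where "r = \<bar>R\<bar> + 1"
 have "has_bochner_integral lborel (\<lambda>x. f x * indicator {-r..r} x) (F r - F (-r))"
  using f by (intro has_bochner_integral_FTC_Icc_real F)
   (auto simp: r_def continuous_on_eq_continuous_at)
 moreover have "(\<lambda>x. f x * indicator {-r..r} x) = f"
 proof
  show "f x * indicator {-r..r} x = f x" for x
   by (cases "\<bar>x\<bar> > R") (auto simp: f0 r_def indicator_def)
 qed
 moreover have "F r = 0" "F (-r) = 0" by (auto intro!: z simp: r_def)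
 ultimately show ?thesis by (simp add: has_bochner_integral_iff)
qed

text \<open>Meant for the product of a function that is regular on \<open>U\<close> only with a test
  function supported in \<open>cball 0 R\<close>.\<close>

lemma continuous_on_extend_zero:
 fixes f :: "complex \<Rightarrow> real"
 assumes "open U" "cball 0 R \<subseteq> U" "continuous_on U f" "\<And>z. norm z > R ==> f z = 0"
 shows "continuous_on UNIV f"
proof -
 have "continuous_on (- cball 0 R) f"
  by (rule continuous_on_eq[of _ "\<lambda>_. 0"]) (auto simp: assms(4))
 then have "continuous_on (U \<union> - cball 0 R) f"
  using assms by (intro continuous_on_open_Un) auto
 moreover have "U \<union> - cball 0 R = UNIV" using assms(2) by auto
 ultimately show ?thesis by simp
qed

lemma C2_support:
 assumes \<phi>: "C2_on UNIV \<phi> \<phi>x \<phi>y \<phi>xx \<phi>yy" and 0: "\<And>z. norm z > R ==> \<phi> z = 0"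
  and z: "norm z > R"
 shows "\<phi>x z = 0" "\<phi>y z = 0" "\<phi>xx z = 0" "\<phi>yy z = 0"
proof -
 have x: "d = 0" if d: "((\<lambda>x. f (Complex x (Im z))) has_real_derivative d) (at (Re z))"
   and f: "\<And>z. norm z > R ==> f z = 0" and z: "norm z > R" for f d z
 proof -
  have "\<forall>\<^sub>F x in nhds (Re z). x \<in> {x. norm (Complex x (Im z)) > R}"
   using z by (intro eventually_nhds_in_open open_Collect_less continuous_intros) auto
  then have "((\<lambda>x. f (Complex x (Im z))) has_real_derivative d) (at (Re z)) =
    ((\<lambda>_. 0) has_real_derivative d) (at (Re z))"
   by (intro DERIV_cong_ev) (auto elim!: eventually_mono simp: f)
  then show ?thesis using d DERIV_unique[OF _ DERIV_const] by blast
 qed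
 have y: "d = 0" if d: "((\<lambda>x. f (Complex (Re z) x)) has_real_derivative d) (at (Im z))"
   and f: "\<And>z. norm z > R ==> f z = 0" and z: "norm z > R" for f d z
 proof -
  have "\<forall>\<^sub>F x in nhds (Im z). x \<in> {x. norm (Complex (Re z) x) > R}"
   using z by (intro eventually_nhds_in_open open_Collect_less continuous_intros) auto
  then have "((\<lambda>x. f (Complex (Re z) x)) has_real_derivative d) (at (Im z)) =
    ((\<lambda>_. 0) has_real_derivative d) (at (Im z))"
   by (intro DERIV_cong_ev) (auto elim!: eventually_mono simp: f)
  then show ?thesis using d DERIV_unique[OF _ DERIV_const] by blast
 qed
 have 1: "\<phi>x z = 0" "\<phi>y z = 0" if "norm z > R" for z
  using x[of \<phi> z] y[of \<phi> z] 0 that \<phi> unfolding C2_on_def by blast+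
 then show "\<phi>x z = 0" "\<phi>y z = 0" using z by auto
 show "\<phi>xx z = 0" "\<phi>yy z = 0"
  using x[of \<phi>x z] y[of \<phi>y z] 1 z \<phi> unfolding C2_on_def by blast+
qed

text \<open>On a horizontal line \<open>u * \<phi>xx - uxx * \<phi>\<close> is the derivative of
  \<open>u * \<phi>x - ux * \<phi>\<close>, which has compact support, so its integral vanishes;
  vertical lines behave alike. Fubini adds up the two identities.\<close>

lemma Green_compact_support:
 assumes U: "open U" "cball 0 R \<subseteq> U" and u: "C2_on U u ux uy uxx uyy"
  and \<phi>: "C2_on UNIV \<phi> \<phi>x \<phi>y \<phi>xx \<phi>yy" and 0: "\<And>z. norm z > R ==> \<phi> z = 0"
 shows "(LBINT z. u z * (\<phi>xx z + \<phi>yy z)) = (LBINT z. (uxx z + uyy z) * \<phi> z)"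
proof -
 have s: "\<phi>x z = 0" "\<phi>y z = 0" "\<phi>xx z = 0" "\<phi>yy z = 0" if "norm z > R" for z
  using C2_support[OF \<phi>, of R z] 0 that by auto
 note cu = C2_onD(1-5)[OF u]
 have c\<phi>: "continuous_on A \<phi>" "continuous_on A \<phi>x" "continuous_on A \<phi>y" "continuous_on A \<phi>xx" "continuous_on A \<phi>yy" for A
  using C2_onD(1-5)[OF \<phi>] by (auto intro: continuous_on_subset)
 note ext = continuous_on_extend_zero[OF U]
 have c1: "continuous_on UNIV (\<lambda>z. u z * \<phi>xx z - uxx z * \<phi> z)" "continuous_on UNIV (\<lambda>z. u z * \<phi>yy z - uyy z * \<phi> z)"
  "continuous_on UNIV (\<lambda>z. u z * (\<phi>xx z + \<phi>yy z))" "continuous_on UNIV (\<lambda>z. (uxx z + uyy z) * \<phi> z)"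
  by (rule ext; (intro continuous_intros cu c\<phi> | simp add: s 0))+
 have i1: "integrable lborel (\<lambda>z. u z * \<phi>xx z - uxx z * \<phi> z)" "integrable lborel (\<lambda>z. u z * \<phi>yy z - uyy z * \<phi> z)"
  "integrable lborel (\<lambda>z. u z * (\<phi>xx z + \<phi>yy z))" "integrable lborel (\<lambda>z. (uxx z + uyy z) * \<phi> z)"
  by (auto intro!: integrable_cont_compact_support[of _ R] c1 simp: s 0)
 have far: "\<phi> (Complex x y) = 0" "\<phi>x (Complex x y) = 0" "\<phi>y (Complex x y) = 0" if "R < \<bar>x\<bar> \<or> R < \<bar>y\<bar>" for x y
  using that abs_Re_le_cmod[of "Complex x y"] abs_Im_le_cmod[of "Complex x y"]
  by (auto intro!: 0 s)
 have "(LBINT x. u (Complex x y) * \<phi>xx (Complex x y) - uxx (Complex x y) * \<phi> (Complex x y)) = 0" for y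
 proof (rule integral_deriv_compact_support)
  let ?F = "\<lambda>x. u (Complex x y) * \<phi>x (Complex x y) - ux (Complex x y) * \<phi> (Complex x y)"
  show "(?F has_real_derivative (u (Complex x y) * \<phi>xx (Complex x y) - uxx (Complex x y) * \<phi> (Complex x y))) (at x)" for x
  proof (cases "Complex x y \<in> U")
   case True
   show ?thesis
    using C2_onD(6,8)[OF u True] C2_onD(6,8)[OF \<phi>, of x y]
    by (auto intro!: derivative_eq_intros simp: algebra_simps)
  next
   case False
   then have "Complex x y \<notin> cball 0 R" using U(2) by blast
   then have "norm (Complex x y) > R" by simp
   then have "\<forall>\<^sub>F x in nhds x. x \<in> {x. norm (Complex x y) > R}"
    by (intro eventually_nhds_in_open open_Collect_less continuous_intros) auto
   then have "(?F has_real_derivative 0) (at x) \<longleftrightarrow> ((\<lambda>_. 0) has_real_derivative 0) (at x)"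
    by (intro DERIV_cong_ev) (auto elim!: eventually_mono simp: s 0)
   then show ?thesis using \<open>norm (Complex x y) > R\<close> by (auto simp: s 0)
  qed
  show "continuous_on UNIV (\<lambda>x. u (Complex x y) * \<phi>xx (Complex x y) - uxx (Complex x y) * \<phi> (Complex x y))"
   by (rule continuous_on_compose2[OF c1(1)]) (auto intro!: continuous_intros)
  show "\<bar>x\<bar> > R ==> ?F x = 0" for x by (simp add: far)
 qed
 then have 1: "(LBINT z. u z * \<phi>xx z - uxx z * \<phi> z) = 0"
  by (subst integral_complex_yx[OF i1(1)]) simp
 have "(LBINT y. u (Complex x y) * \<phi>yy (Complex x y) - uyy (Complex x y) * \<phi> (Complex x y)) = 0" for x
 proof (rule integral_deriv_compact_support)
  let ?F = "\<lambda>y. u (Complex x y) * \<phi>y (Complex x y) - uy (Complex x y) * \<phi> (Complex x y)"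
  show "(?F has_real_derivative (u (Complex x y) * \<phi>yy (Complex x y) - uyy (Complex x y) * \<phi> (Complex x y))) (at y)" for y
  proof (cases "Complex x y \<in> U")
   case True
   show ?thesis
    using C2_onD(7,9)[OF u True] C2_onD(7,9)[OF \<phi>, of x y]
    by (auto intro!: derivative_eq_intros simp: algebra_simps)
  next
   case False
   then have "Complex x y \<notin> cball 0 R" using U(2) by blast
   then have "norm (Complex x y) > R" by simp
   then have "\<forall>\<^sub>F y in nhds y. y \<in> {y. norm (Complex x y) > R}"
    by (intro eventually_nhds_in_open open_Collect_less continuous_intros) auto
   then have "(?F has_real_derivative 0) (at y) \<longleftrightarrow> ((\<lambda>_. 0) has_real_derivative 0) (at y)"
    by (intro DERIV_cong_ev) (auto elim!: eventually_mono simp: s 0)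
   then show ?thesis using \<open>norm (Complex x y) > R\<close> by (auto simp: s 0)
  qed
  show "continuous_on UNIV (\<lambda>y. u (Complex x y) * \<phi>yy (Complex x y) - uyy (Complex x y) * \<phi> (Complex x y))"
   by (rule continuous_on_compose2[OF c1(2)]) (auto intro!: continuous_intros)
  show "\<bar>y\<bar> > R ==> ?F y = 0" for y by (simp add: far)
 qed
 then have 2: "(LBINT z. u z * \<phi>yy z - uyy z * \<phi> z) = 0"
  by (subst integral_complex_xy[OF i1(2)]) simp
 have "(LBINT z. u z * (\<phi>xx z + \<phi>yy z)) - (LBINT z. (uxx z + uyy z) * \<phi> z)
   = (LBINT z. (u z * \<phi>xx z - uxx z * \<phi> z) + (u z * \<phi>yy z - uyy z * \<phi> z))"
  by (subst Bochner_Integration.integral_diff[symmetric]) (use i1 in \<open>auto simp: algebra_simps\<close>)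
 also have "\<dots> = 0" using 1 2 i1 by (subst Bochner_Integration.integral_add) auto
 finally show ?thesis by simp
qed

section \<open>The Laplacian of the logarithm\<close>

lemma nn_integral_FTC_UNIV:
 fixes f F :: "real \<Rightarrow> real"
 assumes F: "\<And>x. (F has_real_derivative f x) (at x)" and c: "continuous_on UNIV f"
  and nn: "\<And>x. 0 <= f x" and A: "(F \<longlongrightarrow> A) at_bot" and B: "(F \<longlongrightarrow> B) at_top"
 shows "(\<integral>\<^sup>+x. f x \<partial>lborel) = ennreal (B - A)"
proof -
 have "set_integrable lborel (einterval (-\<infinity>) \<infinity>) f" "(LBINT x=-\<infinity>..\<infinity>. f x) = B - A"
  by (rule interval_integral_FTC_nonneg[of _ _ F];
   use assms in \<open>simp add: ereal_tendsto_simps continuous_on_eq_continuous_at\<close>)+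
 then have "integrable lborel f" "(LBINT x. f x) = B - A"
  by (simp_all add: set_integrable_def interval_lebesgue_integral_def set_lebesgue_integral_def)
 then show ?thesis using nn by (subst nn_integral_eq_integral) auto
qed

lemma AE_Re_neq: "AE z in lborel. Re z \<noteq> c"
proof -
 have "(\<integral>\<^sup>+z. indicator {z. Re z = c} z \<partial>lborel) = (\<integral>\<^sup>+x. \<infinity> * indicator {c} x \<partial>lborel)"
  by (subst nn_integral_complex) (auto intro!: nn_integral_cong simp: indicator_def)
 also have "\<dots> = 0" by (subst nn_integral_cmult_indicator) auto
 finally have "emeasure lborel {z. Re z = c} = 0"
  by (subst (asm) nn_integral_indicator) auto
 then show ?thesis by (intro AE_I[of _ _ "{z. Re z = c}"]) auto
qed

lemma AE_Im_neq: "AE z in lborel. Im z \<noteq> c"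
proof -
 have "(\<integral>\<^sup>+z. indicator {z. Im z = c} z \<partial>lborel) = (\<integral>\<^sup>+x. \<integral>\<^sup>+y. 1 * indicator {c} y \<partial>lborel \<partial>(lborel :: real measure))"
  by (subst nn_integral_complex) (auto intro!: nn_integral_cong simp: indicator_def)
 also have "\<dots> = 0" by (subst nn_integral_cmult_indicator) auto
 finally have "emeasure lborel {z. Im z = c} = 0"
  by (subst (asm) nn_integral_indicator) auto
 then show ?thesis by (intro AE_I[of _ _ "{z. Im z = c}"]) auto
qed

lemma integrable_indicator_cball: "integrable lborel (indicat_real (cball (0::'a::euclidean_space) R))"
 using emeasure_bounded_finite[OF bounded_cball, of 0 R] by (intro integrable_real_indicator) auto

text \<open>By Fubini, a singularity of order 1/2 along a whole line is still integrable. It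
  dominates the logarithmic singularities here and, at \<open>c = 0\<close>, the growth of the
  logarithmic moments near the imaginary axis.\<close>

lemma integrable_inverse_sqrt_Re:
 "integrable lborel (\<lambda>z. indicator (cball 0 R) z * \<bar>Re z - c\<bar> powr (- (1 / 2)))"
proof (rule integrableI_nonneg)
 define r where "r = \<bar>R\<bar> + \<bar>c\<bar>"
 define g where "g x = (if x \<in> {0..r} then x powr (- (1 / 2)) else 0)" for x :: real
 have [measurable]: "g \<in> borel_measurable borel" unfolding g_def by measurable
 have "((\<lambda>x. x powr (- (1 / 2))) has_integral (r powr (- (1 / 2) + 1) / (- (1 / 2) + 1))) {0..r}"
  by (intro has_integral_powr_from_0) (auto simp: r_def)
 then have "(g has_integral (r powr (- (1 / 2) + 1) / (- (1 / 2) + 1))) UNIV"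
  unfolding g_def by (subst has_integral_restrict_UNIV)
 then have g: "(\<integral>\<^sup>+x. g x \<partial>lborel) < \<infinity>"
  by (subst nn_integral_has_integral_lborel) (auto simp: g_def)
 have 1: "(\<integral>\<^sup>+x. g (x - c) \<partial>lborel) = (\<integral>\<^sup>+x. g x \<partial>lborel)" "(\<integral>\<^sup>+x. g (c - x) \<partial>lborel) = (\<integral>\<^sup>+x. g x \<partial>lborel)"
  using nn_integral_real_affine[of "\<lambda>x. ennreal (g x)" 1 "-c"] nn_integral_real_affine[of "\<lambda>x. ennreal (g x)" "-1" "c"] by simp_all
 have "(\<integral>\<^sup>+z. ennreal (indicator (cball 0 R) z * \<bar>Re z - c\<bar> powr (- (1 / 2))) \<partial>lborel)
   <= (\<integral>\<^sup>+z. (ennreal (g (Re z - c)) + ennreal (g (c - Re z))) * indicator {-\<bar>R\<bar>..\<bar>R\<bar>} (Im z) \<partial>lborel)"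
 proof (intro nn_integral_mono)
  fix z :: complex
  show "ennreal (indicator (cball 0 R) z * \<bar>Re z - c\<bar> powr (- (1 / 2)))
   <= (ennreal (g (Re z - c)) + ennreal (g (c - Re z))) * indicator {-\<bar>R\<bar>..\<bar>R\<bar>} (Im z)"
  proof (cases "norm z <= R")
   case True
   then have *: "\<bar>Re z - c\<bar> <= r" "Im z \<in> {-\<bar>R\<bar>..\<bar>R\<bar>}"
    using abs_Re_le_cmod[of z] abs_Im_le_cmod[of z] by (auto simp: r_def)
   have "ennreal (\<bar>Re z - c\<bar> powr (- (1 / 2))) <= ennreal (g (Re z - c)) + ennreal (g (c - Re z))"
   proof (cases "Re z >= c")
    case True
    then have "g (Re z - c) = \<bar>Re z - c\<bar> powr (- (1 / 2))" using * by (simp add: g_def)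
    then show ?thesis by simp
   next
    case False
    then have "g (c - Re z) = \<bar>Re z - c\<bar> powr (- (1 / 2))" using * by (simp add: g_def abs_minus_commute)
    then show ?thesis by simp
   qed
   then show ?thesis using True * by simp
  qed simp
 qed
 also have "\<dots> = (\<integral>\<^sup>+x. (ennreal (g (x - c)) + ennreal (g (c - x))) * ennreal (2 * \<bar>R\<bar>) \<partial>lborel)"
  by (subst nn_integral_complex) (auto intro!: nn_integral_cong simp: nn_integral_cmult)
 also have "\<dots> = (2 * (\<integral>\<^sup>+x. g x \<partial>lborel)) * ennreal (2 * \<bar>R\<bar>)"
 proof -
  have "(\<integral>\<^sup>+x. ennreal (g (x - c)) + ennreal (g (c - x)) \<partial>lborel) = (\<integral>\<^sup>+x. g (x - c) \<partial>lborel) + (\<integral>\<^sup>+x. g (c - x) \<partial>lborel)"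
   by (intro nn_integral_add) auto
  then show ?thesis unfolding 1 by (subst nn_integral_multc) (simp_all only: mult_2, measurable)
 qed
 also have "\<dots> < \<infinity>" using g by (simp add: ennreal_mult_less_top)
 finally show "(\<integral>\<^sup>+z. ennreal (indicator (cball 0 R) z * \<bar>Re z - c\<bar> powr (- (1 / 2))) \<partial>lborel) < \<infinity>" .
 have [measurable]: "cball 0 R \<in> sets borel" by auto
 show "(\<lambda>z. indicator (cball 0 R) z * \<bar>Re z - c\<bar> powr (- (1 / 2))) \<in> borel_measurable lborel" by measurable
qed auto

text \<open>The inequality \<open>ln x <= x\<close> is applied to \<open>t\<close> and to
  \<open>t powr (-1/2)\<close>. The lower estimate \<open>s\<close> will be
  \<open>|Re z - Re w|\<close>, which replaces the distance to a point by the distance to a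
  line.\<close>

lemma abs_ln_le:
 fixes t s :: real
 assumes "t > 0" "s > 0" "s <= t"
 shows "\<bar>ln t\<bar> <= 2 * s powr (- (1 / 2)) + t"
proof -
 have "ln t <= t" using ln_bound[OF assms(1)] .
 moreover have "- ln t = 2 * ln (t powr (- (1 / 2)))" using assms by (simp add: ln_powr)
 moreover have "ln (t powr (- (1 / 2))) <= t powr (- (1 / 2))" using assms by (intro ln_bound) auto
 moreover have "t powr (- (1 / 2)) <= s powr (- (1 / 2))" using assms by (intro powr_mono2') auto
 moreover have "s powr (- (1 / 2)) >= 0" by simp
 ultimately show ?thesis using assms by linarith
qed

lemma integrable_ln_dist:
 "integrable lborel (\<lambda>z::complex. indicator (cball 0 R) z * \<bar>ln (norm (z - w))\<bar>)"
proof (rule Bochner_Integration.integrable_bound)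
 let ?b = "\<lambda>z. 2 * (indicator (cball 0 R) z * \<bar>Re z - Re w\<bar> powr (- (1 / 2))) + indicator (cball 0 R) z * (R + norm w)"
 show "integrable lborel ?b"
  by (intro Bochner_Integration.integrable_add integrable_mult_right integrable_mult_left integrable_inverse_sqrt_Re integrable_indicator_cball)
 show "AE z in lborel. norm (indicator (cball 0 R) z * \<bar>ln (norm (z - w))\<bar>) <= norm (?b z)"
  using AE_Re_neq[of "Re w"]
 proof eventually_elim
  case (elim z)
  have 1: "\<bar>Re z - Re w\<bar> <= norm (z - w)" using abs_Re_le_cmod[of "z - w"] by simp
  have "\<bar>ln (norm (z - w))\<bar> <= 2 * \<bar>Re z - Re w\<bar> powr (- (1 / 2)) + norm (z - w)"
   using elim 1 by (intro abs_ln_le) auto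
  moreover have "norm (z - w) <= R + norm w" if "norm z <= R"
   using that norm_triangle_ineq4[of z w] by simp
  ultimately show ?case by (auto simp: indicator_def)
 qed
 have [measurable]: "cball 0 R \<in> sets borel" by auto
 show "(\<lambda>z. indicator (cball 0 R) z * \<bar>ln (norm (z - w))\<bar>) \<in> borel_measurable lborel" by measurable
qed

text \<open>The Laplacian of \<open>ln (|v|^2 + 1) / 2\<close>; its dilations form an approximate
  identity of mass \<open>2 * pi\<close>.\<close>

definition plane_kernel :: "complex \<Rightarrow> real" where
 "plane_kernel v = 2 / ((Re v)^2 + (Im v)^2 + 1)^2"

lemma integral_plane_kernel:
 "integrable lborel plane_kernel" "(LBINT v. plane_kernel v) = 2 * pi"
proof -
 have [measurable]: "plane_kernel \<in> borel_measurable borel" unfolding plane_kernel_def by measurable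
 have nn: "plane_kernel v >= 0" for v by (simp add: plane_kernel_def)
 have inner: "(\<integral>\<^sup>+y. plane_kernel (Complex x y) \<partial>lborel) = ennreal (pi / sqrt (1 + x^2) ^ 3)" for x
 proof -
  define A where "A = sqrt (1 + x^2)"
  have A: "A > 0" "A^2 = 1 + x^2" by (auto simp: A_def intro: add_pos_nonneg)
  have pos: "A^2 + y^2 > 0" for y using A(1) by (intro add_pos_nonneg) auto
  \<comment> \<open>The standard primitive of \<open>2 / (A^2 + y^2)^2\<close>, with
    \<open>A^2 = 1 + x^2\<close>. The rational term vanishes at both ends, so the inner integral is
    the increment \<open>pi / A^3\<close> of the arctangent term.\<close>
  have d: "((\<lambda>y. y / (A^2 * (A^2 + y^2)) + arctan (y / A) / A ^ 3) has_real_derivative 2 / (A^2 + y^2)^2) (at y)" for y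
  proof -
   define q P where "q = A^2" and "P = A^2 + y^2"
   have q: "q > 0" "P > 0" "q = A * A" "P = q + y^2"
    using A(1) pos[of y] by (auto simp: q_def P_def power2_eq_square)
   have e: "1 + (y / A)^2 = P / q" using A(1) by (simp add: power_divide add_divide_distrib P_def q_def)
   have "(q * P - y * (q * (2 * y))) / (q * P)^2 = (P - 2 * y^2) / (q * P^2)"
    using q(1,2) by (simp add: field_simps power2_eq_square)
   moreover have "(1 / (P / q) * (1 / A)) / A ^ 3 = 1 / (q * P)"
    using A(1) q(1,2) unfolding q(3) by (simp add: divide_simps power3_eq_cube)
   moreover have "(P - 2 * y^2) / (q * P^2) + 1 / (q * P) = (2 * P - 2 * y^2) / (q * P^2)"
    using q(1,2) by (simp add: divide_simps power2_eq_square)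
   moreover have "(2 * P - 2 * y^2) / (q * P^2) = 2 / P^2"
    using q(1,2) unfolding q(4) by simp
   ultimately have "((A^2 * (A^2 + y^2) - y * (A^2 * (2 * y))) / (A^2 * (A^2 + y^2))^2 + (1 / (1 + (y / A)^2) * (1 / A)) / A ^ 3) = 2 / (A^2 + y^2)^2"
    unfolding e q_def P_def by simp
   moreover have "((\<lambda>y. y / (A^2 * (A^2 + y^2)) + arctan (y / A) / A ^ 3) has_real_derivative
     ((A^2 * (A^2 + y^2) - y * (A^2 * (2 * y))) / (A^2 * (A^2 + y^2))^2 + (1 / (1 + (y / A)^2) * (1 / A)) / A ^ 3)) (at y)"
   proof (rule DERIV_add)
    show "((\<lambda>y. y / (A^2 * (A^2 + y^2))) has_real_derivative (A^2 * (A^2 + y^2) - y * (A^2 * (2 * y))) / (A^2 * (A^2 + y^2))^2) (at y)"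
     using A(1) pos[of y] by (auto intro!: derivative_eq_intros simp: power2_eq_square)
    have "((\<lambda>y. arctan (y / A)) has_real_derivative inverse (1 + (y / A)^2) * (1 / A)) (at y)"
     by (rule DERIV_chain2[OF DERIV_arctan]) (use A(1) in \<open>auto intro!: derivative_eq_intros\<close>)
    then show "((\<lambda>y. arctan (y / A) / A ^ 3) has_real_derivative 1 / (1 + (y / A)^2) * (1 / A) / A ^ 3) (at y)"
     unfolding inverse_eq_divide by (rule DERIV_cdivide)
   qed
   ultimately show ?thesis by simp
  qed
  have "(\<integral>\<^sup>+y. ennreal (2 / (A^2 + y^2)^2) \<partial>lborel) = ennreal (pi / 2 / A ^ 3 - (- (pi / 2) / A ^ 3))"
  proof (rule nn_integral_FTC_UNIV[OF d])
   show "continuous_on UNIV (\<lambda>y. 2 / (A^2 + y^2)^2)"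
    using pos by (intro continuous_intros) (auto simp: less_imp_neq[symmetric])
   show "((\<lambda>y. y / (A^2 * (A^2 + y^2)) + arctan (y / A) / A ^ 3) \<longlongrightarrow> - (pi / 2) / A ^ 3) at_bot"
    using A(1) by (real_asymp simp: field_simps)
   show "((\<lambda>y. y / (A^2 * (A^2 + y^2)) + arctan (y / A) / A ^ 3) \<longlongrightarrow> pi / 2 / A ^ 3) at_top"
    using A(1) by (real_asymp simp: field_simps)
  qed auto
  then show ?thesis by (simp add: plane_kernel_def A(2) A_def[symmetric] add_ac)
 qed
 have outer: "(\<integral>\<^sup>+x. ennreal (pi / sqrt (1 + x^2) ^ 3) \<partial>lborel) = ennreal (pi - (- pi))"
 proof (rule nn_integral_FTC_UNIV)
  have pos: "sqrt (1 + x^2) > 0" for x :: real by (auto intro: add_pos_nonneg)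
  show "((\<lambda>x. pi * (x / sqrt (1 + x^2))) has_real_derivative pi / sqrt (1 + x^2) ^ 3) (at x)" for x
  proof -
   define s where "s = sqrt (1 + x^2)"
   have s: "s > 0" "x^2 = s^2 - 1" using pos by (auto simp: s_def)
   have "1 + x^2 > 0" by (auto intro: add_pos_nonneg)
   then have "((\<lambda>x. pi * (x / sqrt (1 + x^2))) has_real_derivative pi * ((s - x * ((2 * x) / (2 * s))) / s^2)) (at x)"
    using s unfolding s_def
    by (auto intro!: derivative_eq_intros simp: power2_eq_square inverse_eq_divide right_diff_distrib mult.assoc)
   moreover have "pi * ((s - x * ((2 * x) / (2 * s))) / s^2) = pi / s ^ 3"
   proof -
    have "x * ((2 * x) / (2 * s)) = x^2 / s" by (simp add: power2_eq_square)
    also have "\<dots> = s - 1 / s" unfolding s(2) using s(1) by (simp add: diff_divide_distrib power2_eq_square)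
    finally have "s - x * ((2 * x) / (2 * s)) = 1 / s" by simp
    then show ?thesis using s(1) by (simp add: power2_eq_square power3_eq_cube)
   qed
   ultimately show ?thesis by (simp add: s_def)
  qed
  show "continuous_on UNIV (\<lambda>x::real. pi / sqrt (1 + x^2) ^ 3)"
   by (intro continuous_intros) (use pos in \<open>metis less_irrefl power_eq_0_iff\<close>)
  show "((\<lambda>x. pi * (x / sqrt (1 + x^2))) \<longlongrightarrow> - pi) at_bot" by real_asymp
  show "((\<lambda>x. pi * (x / sqrt (1 + x^2))) \<longlongrightarrow> pi) at_top" by real_asymp
 qed auto
 have "(\<integral>\<^sup>+v. plane_kernel v \<partial>lborel) = ennreal (2 * pi)"
  by (subst nn_integral_complex) (simp_all add: inner outer)
 then show "integrable lborel plane_kernel" "(LBINT v. plane_kernel v) = 2 * pi"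
  using nn by (auto intro!: integrableI_nonneg simp: integral_eq_nn_integral)
qed

lemma bounded_compact_support:
 fixes f :: "complex \<Rightarrow> real"
 assumes "continuous_on UNIV f" and "\<And>x. norm x > R ==> f x = 0"
 obtains B where "B >= 0" "\<And>x. \<bar>f x\<bar> <= B"
proof -
 have "compact (f ` cball 0 R)" using assms(1) by (intro compact_continuous_image) (auto intro: continuous_on_subset)
 then obtain B where B: "\<And>x. norm x <= R ==> \<bar>f x\<bar> <= B"
  by (metis bounded_iff compact_imp_bounded image_eqI mem_cball_0 real_norm_def)
 have "\<bar>f x\<bar> <= max B 0" for x using B[of x] assms(2)[of x] by (cases "norm x <= R") (auto simp: le_max_iff_disj)
 then show thesis using that[of "max B 0"] by auto
qed

text \<open>The logarithm is regularised to \<open>ln (|z - w|^2 + e^2) / 2\<close>, to which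
  Green's formula applies. Its Laplacian \<open>2 * e^2 / (|z - w|^2 + e^2)^2\<close> is a rescaled
  \<open>plane_kernel\<close>, so the right side tends to \<open>2 * pi * \<phi> w\<close> as
  \<open>e\<close> tends to 0, while the left side converges by domination.\<close>

lemma ln_dist_Laplacian:
 assumes \<phi>: "C2_on UNIV \<phi> \<phi>x \<phi>y \<phi>xx \<phi>yy" and 0: "\<And>z. norm z > R ==> \<phi> z = 0"
 shows "integrable lborel (\<lambda>z. ln (norm (z - w)) * (\<phi>xx z + \<phi>yy z))"
  and "(LBINT z. ln (norm (z - w)) * (\<phi>xx z + \<phi>yy z)) = 2 * pi * \<phi> w"
proof -
 define L where "L z = \<phi>xx z + \<phi>yy z" for z
 have cL: "continuous_on UNIV L" unfolding L_def using C2_onD(4,5)[OF \<phi>] by (intro continuous_intros)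
 have L0: "L z = 0" if "norm z > R" for z
  using C2_support[OF \<phi>, of R z] 0 that by (auto simp: L_def)
 have [measurable]: "L \<in> borel_measurable borel" "\<phi> \<in> borel_measurable borel"
  using cL C2_onD(1)[OF \<phi>] by (auto intro: borel_measurable_continuous_onI)
 obtain B where B: "B >= 0" "\<And>z. \<bar>L z\<bar> <= B" using bounded_compact_support[OF cL L0] by blast
 obtain B' where B': "B' >= 0" "\<And>z. \<bar>\<phi> z\<bar> <= B'" using bounded_compact_support[OF C2_onD(1)[OF \<phi>] 0] by blast
 have dom: "integrable lborel (\<lambda>z. B * (indicator (cball 0 R) z * \<bar>ln (norm (z - w))\<bar>) + B * (R + norm w)^2 * indicator (cball 0 R) z)"
  by (intro Bochner_Integration.integrable_add integrable_mult_right integrable_ln_dist integrable_indicator_cball)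
 define u where "u e z = ln ((Re z - Re w)^2 + (Im z - Im w)^2 + e^2) / 2" for e z
 have nrm: "(Re z - Re w)^2 + (Im z - Im w)^2 = (norm (z - w))^2" for z by (simp add: cmod_power2)
 have green: "(LBINT z. u e z * L z) = (LBINT v. plane_kernel v * \<phi> (w + e *\<^sub>R v))" if e: "e > 0" for e
 proof -
  define r where "r z = (Re z - Re w)^2 + (Im z - Im w)^2 + e^2" for z
  have rpos: "r z > 0" for z using e by (auto simp: r_def intro: add_nonneg_pos)
  have r: "C2_on UNIV r (\<lambda>z. 2 * (Re z - Re w)) (\<lambda>z. 2 * (Im z - Im w)) (\<lambda>_. 2) (\<lambda>_. 2)"
   unfolding C2_on_def r_def by (auto intro!: continuous_intros derivative_eq_intros)
  have "C2_on UNIV (\<lambda>z. ln (r z) / 2) (\<lambda>z. (1 / (2 * r z)) * (2 * (Re z - Re w))) (\<lambda>z. (1 / (2 * r z)) * (2 * (Im z - Im w)))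
    (\<lambda>z. (- (1 / (2 * (r z)^2))) * (2 * (Re z - Re w))^2 + (1 / (2 * r z)) * 2) (\<lambda>z. (- (1 / (2 * (r z)^2))) * (2 * (Im z - Im w))^2 + (1 / (2 * r z)) * 2)"
  proof (rule C2_on_compose[OF r, of "\<lambda>t. ln t / 2" "\<lambda>t. 1 / (2 * t)" "\<lambda>t. - (1 / (2 * t^2))"])
   fix z
   show "((\<lambda>t. ln t / 2) has_real_derivative 1 / (2 * r z)) (at (r z))"
    using rpos[of z] by (auto intro!: derivative_eq_intros simp: field_simps)
   show "((\<lambda>t. 1 / (2 * t)) has_real_derivative - (1 / (2 * (r z)^2))) (at (r z))"
    using rpos[of z] by (auto intro!: derivative_eq_intros simp: field_simps power2_eq_square)
  next
   show "continuous_on (range r) (\<lambda>t. - (1 / (2 * t^2)))"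
    using rpos by (intro continuous_intros) (auto simp: less_imp_neq[symmetric])
  qed
  from Green_compact_support[OF open_UNIV subset_UNIV this \<phi> 0]
  have "(LBINT z. u e z * L z) =
   (LBINT z. ((- (1 / (2 * (r z)^2))) * (2 * (Re z - Re w))^2 + (1 / (2 * r z)) * 2 + ((- (1 / (2 * (r z)^2))) * (2 * (Im z - Im w))^2 + (1 / (2 * r z)) * 2)) * \<phi> z)"
   by (simp add: u_def L_def r_def)
  also have "\<dots> = (LBINT z. 2 * e^2 / (r z)^2 * \<phi> z)"
  proof (intro Bochner_Integration.integral_cong refl arg_cong2[where f = "(*)"])
   fix z
   have "(2 * (Re z - Re w))^2 + (2 * (Im z - Im w))^2 = 4 * (r z - e^2)"
    by (simp add: r_def square_simps)
   moreover have "(- (1 / (2 * (r z)^2))) * (2 * (Re z - Re w))^2 + (1 / (2 * r z)) * 2 + ((- (1 / (2 * (r z)^2))) * (2 * (Im z - Im w))^2 + (1 / (2 * r z)) * 2)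
    = (- (1 / (2 * (r z)^2))) * ((2 * (Re z - Re w))^2 + (2 * (Im z - Im w))^2) + 2 / r z"
    using rpos[of z] by (simp add: distrib_left)
   moreover have "(- (1 / (2 * (r z)^2))) * (4 * (r z - e^2)) + 2 / r z = 2 * e^2 / (r z)^2"
    using rpos[of z] by (simp add: field_simps power2_eq_square)
   ultimately show "(- (1 / (2 * (r z)^2))) * (2 * (Re z - Re w))^2 + (1 / (2 * r z)) * 2 + ((- (1 / (2 * (r z)^2))) * (2 * (Im z - Im w))^2 + (1 / (2 * r z)) * 2) = 2 * e^2 / (r z)^2"
    by (simp only:)
  qed
  \<comment> \<open>Substitution \<open>z = w + e v\<close>; the Jacobian \<open>e^2\<close> of the
    real dimension two turns the Laplacian into \<open>plane_kernel\<close>.\<close>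
  also have "\<dots> = (\<integral>z. 2 * e^2 / (r z)^2 * \<phi> z \<partial>density (distr lborel borel (\<lambda>x. w + e *\<^sub>R x)) (\<lambda>_. ennreal (\<bar>e\<bar>^DIM(complex))))"
   using lborel_affine[of e w] e by simp
  also have "\<dots> = (LBINT v. e^2 * (2 * e^2 / (r (w + e *\<^sub>R v))^2 * \<phi> (w + e *\<^sub>R v)))"
   apply (subst integral_density)
   subgoal unfolding r_def by measurable
   subgoal by simp
   subgoal by simp
   apply (subst integral_distr)
   subgoal by simp
   subgoal unfolding r_def by measurable
   subgoal by simp
   done
  also have "\<dots> = (LBINT v. plane_kernel v * \<phi> (w + e *\<^sub>R v))"
  proof (intro Bochner_Integration.integral_cong refl)
   fix v
   have e4: "q * (2 * q / (q * D)^2) = 2 / D^2" if "q > 0" for q D :: real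
    using that by (simp add: power2_eq_square)
   have "r (w + e *\<^sub>R v) = e^2 * ((Re v)^2 + (Im v)^2 + 1)" by (simp add: r_def power_mult_distrib distrib_left)
   then have "e^2 * (2 * e^2 / (r (w + e *\<^sub>R v))^2) = plane_kernel v"
    using e4[of "e^2"] e by (simp add: plane_kernel_def)
   then show "e^2 * (2 * e^2 / (r (w + e *\<^sub>R v))^2 * \<phi> (w + e *\<^sub>R v)) = plane_kernel v * \<phi> (w + e *\<^sub>R v)"
    by (metis mult.assoc)
  qed
  finally show ?thesis .
 qed
 define e where "e n = 1 / real (Suc n)" for n
 have e: "e n > 0" "e n <= 1" for n by (auto simp: e_def)
 have elim: "e \<longlonglongrightarrow> 0" unfolding e_def using LIMSEQ_inverse_real_of_nat by (simp add: inverse_eq_divide)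
 have rhs: "(\<lambda>n. \<integral>v. plane_kernel v * \<phi> (w + e n *\<^sub>R v) \<partial>lborel) \<longlonglongrightarrow> (LBINT v. plane_kernel v * \<phi> w)"
 proof (rule integral_dominated_convergence[where w = "\<lambda>v. plane_kernel v * B'"])
  show "integrable lborel (\<lambda>v. plane_kernel v * B')" using integral_plane_kernel(1) by simp
  show "AE v in lborel. (\<lambda>n. plane_kernel v * \<phi> (w + e n *\<^sub>R v)) \<longlonglongrightarrow> plane_kernel v * \<phi> w"
  proof (intro AE_I2 tendsto_intros)
   fix v
   have "isCont \<phi> w" using C2_onD(1)[OF \<phi>] by (simp add: continuous_on_eq_continuous_at)
   moreover have "(\<lambda>n. w + e n *\<^sub>R v) \<longlonglongrightarrow> w + 0 *\<^sub>R v" by (intro tendsto_intros elim)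
   ultimately show "(\<lambda>n. \<phi> (w + e n *\<^sub>R v)) \<longlonglongrightarrow> \<phi> w"
    using isCont_tendsto_compose[of w \<phi>] by simp
  qed
  have "plane_kernel v >= 0" for v by (simp add: plane_kernel_def)
  then show "AE v in lborel. norm (plane_kernel v * \<phi> (w + e n *\<^sub>R v)) <= plane_kernel v * B'" for n
   using B' by (auto simp: abs_mult intro!: mult_left_mono)
 qed (use integral_plane_kernel(1) in auto)
 have pw: "AE z in lborel. z \<noteq> w" using AE_Re_neq[of "Re w"] by eventually_elim auto
 have lhs: "integrable lborel (\<lambda>z. ln (norm (z - w)) * L z) \<and> (\<lambda>n. \<integral>z. u (e n) z * L z \<partial>lborel) \<longlonglongrightarrow> (LBINT z. ln (norm (z - w)) * L z)"
 proof -
  have [measurable]: "(\<lambda>z. u (e n) z * L z) \<in> borel_measurable borel" for n unfolding u_def by measurable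
  have 1: "(\<lambda>z. u (e n) z * L z) \<in> borel_measurable lborel" "(\<lambda>z. ln (norm (z - w)) * L z) \<in> borel_measurable lborel" for n
   by simp_all
  have 2: "AE z in lborel. (\<lambda>n. u (e n) z * L z) \<longlonglongrightarrow> ln (norm (z - w)) * L z"
   using pw
  proof eventually_elim
   case (elim z)
   then have "(\<lambda>n. u (e n) z) \<longlonglongrightarrow> ln ((norm (z - w))^2 + 0^2) / 2"
    unfolding u_def nrm by (intro tendsto_intros \<open>e \<longlonglongrightarrow> 0\<close>) auto
   also have "ln ((norm (z - w))^2 + 0^2) / 2 = ln (norm (z - w))" using elim by (simp add: ln_realpow)
   finally show ?case by (intro tendsto_intros)
  qed
  \<comment> \<open>A dominating function uniform in \<open>n\<close>: since
    \<open>0 < e n <= 1\<close>, the regularised logarithm lies between \<open>ln t\<close> and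
    \<open>t^2\<close>, where \<open>t = |z - w|\<close>.\<close>
  have 3: "AE z in lborel. norm (u (e n) z * L z) <= B * (indicator (cball 0 R) z * \<bar>ln (norm (z - w))\<bar>) + B * (R + norm w)^2 * indicator (cball 0 R) z" for n
   using pw
  proof eventually_elim
   case (elim z)
   define t where "t = norm (z - w)"
   have t: "t > 0" using elim by (simp add: t_def)
   show ?case
   proof (cases "norm z <= R")
    case True
    have "ln (t^2) <= ln (t^2 + (e n)^2)" using t by (subst ln_le_cancel_iff) (auto intro: add_pos_nonneg)
    then have 1: "u (e n) z >= ln t" using t unfolding u_def nrm t_def[symmetric] by (simp add: ln_realpow)
    have "(e n)^2 <= 1" using e[of n] by (simp add: power_le_one)
    then have "ln (t^2 + (e n)^2) <= ln (1 + t^2)" using t by (subst ln_le_cancel_iff) (auto intro: add_pos_nonneg)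
    also have "\<dots> <= t^2" by (rule ln_add_one_self_le_self) simp
    also have "ln (t^2 + (e n)^2) = 2 * u (e n) z" by (simp add: u_def nrm t_def)
    finally have 2: "u (e n) z <= t^2" using zero_le_power2[of t] by linarith
    have 3: "t <= R + norm w" using True norm_triangle_ineq4[of z w] by (simp add: t_def)
    then have "t^2 <= (R + norm w)^2" using t by (intro power_mono) auto
    then have "\<bar>u (e n) z\<bar> <= \<bar>ln t\<bar> + (R + norm w)^2" using 1 2 zero_le_power2[of t] by linarith
    then have "\<bar>u (e n) z\<bar> * \<bar>L z\<bar> <= (\<bar>ln t\<bar> + (R + norm w)^2) * B"
     using B by (intro mult_mono) auto
    then show ?thesis using True by (simp add: abs_mult t_def[symmetric] algebra_simps)
   qed (use L0 B in auto)
  qed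
  show ?thesis
   using integrable_dominated_convergence[OF 1(2,1) dom 2 3] integral_dominated_convergence[OF 1(2,1) dom 2 3] by blast
 qed
 then show "integrable lborel (\<lambda>z. ln (norm (z - w)) * (\<phi>xx z + \<phi>yy z))" by (simp add: L_def)
 have "(LBINT z. ln (norm (z - w)) * L z) = (LBINT v. plane_kernel v * \<phi> w)"
  using lhs rhs green[OF e(1)] LIMSEQ_unique by auto
 then show "(LBINT z. ln (norm (z - w)) * (\<phi>xx z + \<phi>yy z)) = 2 * pi * \<phi> w"
  by (simp add: L_def integral_plane_kernel)
qed

section \<open>Zero counting measures\<close>

lemma has_field_derivative_along_axes:
 assumes "(k has_field_derivative D) (at z)"
 shows "((\<lambda>x. Re (k (Complex x (Im z)))) has_real_derivative Re D) (at (Re z))"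
  "((\<lambda>y. Re (k (Complex (Re z) y))) has_real_derivative - Im D) (at (Im z))"
  "((\<lambda>y. Im (k (Complex (Re z) y))) has_real_derivative Re D) (at (Im z))"
proof -
 have k: "(k has_derivative (\<lambda>h. D * h)) (at (Complex (Re z) (Im z)))"
  using assms by (simp add: has_field_derivative_def)
 have "((\<lambda>x. Complex x (Im z)) has_derivative of_real) (at (Re z))"
  unfolding Complex_eq by (auto intro!: derivative_eq_intros)
 from has_derivative_compose[OF this k]
 have "((\<lambda>x. Re (k (Complex x (Im z)))) has_derivative (\<lambda>t. Re (D * of_real t))) (at (Re z))"
  by (rule has_derivative_Re)
 then show "((\<lambda>x. Re (k (Complex x (Im z)))) has_real_derivative Re D) (at (Re z))"
  by (simp add: has_field_derivative_def)
 have "((\<lambda>y. Complex (Re z) y) has_derivative (\<lambda>t. \<i> * of_real t)) (at (Im z))"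
  unfolding Complex_eq by (auto intro!: derivative_eq_intros)
 from has_derivative_compose[OF this k]
 have *: "((\<lambda>y. k (Complex (Re z) y)) has_derivative (\<lambda>t. D * (\<i> * of_real t))) (at (Im z))" .
 have e: "(\<lambda>x. - (Im D * x)) = (*) (- Im D)" by (auto simp: fun_eq_iff)
 show "((\<lambda>y. Re (k (Complex (Re z) y))) has_real_derivative - Im D) (at (Im z))"
  "((\<lambda>y. Im (k (Complex (Re z) y))) has_real_derivative Re D) (at (Im z))"
  using has_derivative_Re[OF *] has_derivative_Im[OF *] by (simp_all add: has_field_derivative_def e)
qed

text \<open>By the Cauchy-Riemann equations. The last two components add up to 0, that is, the real
  part is harmonic.\<close>

lemma C2_on_Re_holomorphic:
 assumes U: "open U" and h: "h holomorphic_on U"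
 shows "C2_on U (\<lambda>z. Re (h z)) (\<lambda>z. Re (deriv h z)) (\<lambda>z. - Im (deriv h z))
  (\<lambda>z. Re (deriv (deriv h) z)) (\<lambda>z. - Re (deriv (deriv h) z))"
proof -
 have h': "deriv h holomorphic_on U" using h U by (intro holomorphic_deriv)
 have h'': "deriv (deriv h) holomorphic_on U" by (intro holomorphic_deriv h' U)
 have c: "continuous_on U h" "continuous_on U (deriv h)" "continuous_on U (deriv (deriv h))"
  using h h' h'' by (auto intro: holomorphic_on_imp_continuous_on)
 have d: "(h has_field_derivative deriv h z) (at z)" "(deriv h has_field_derivative deriv (deriv h) z) (at z)" if "z \<in> U" for z
  using holomorphic_derivI[OF h U that] holomorphic_derivI[OF h' U that] by auto
 show ?thesis
  unfolding C2_on_def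
  using c d has_field_derivative_along_axes[of h] has_field_derivative_along_axes[of "deriv h"]
  by (auto intro!: continuous_intros DERIV_minus)
qed

text \<open>Induction on \<open>Z\<close>: \<open>g\<close> is divided by the power of
  \<open>z - w\<close> given by its order at \<open>w\<close>, which is 0 if \<open>g\<close> does
  not vanish there. The quotient is holomorphic off \<open>w\<close> and agrees with
  \<open>zor_poly\<close> near \<open>w\<close>.\<close>

lemma entire_factor_zeros:
 assumes f: "f holomorphic_on UNIV" "f z0 \<noteq> 0" and Z: "finite Z"
 shows "\<exists>g m. g holomorphic_on UNIV \<and> (\<forall>z. f z = g z * (\<Prod>w\<in>Z. (z - w) ^ m w)) \<and> (\<forall>w\<in>Z. g w \<noteq> 0)"
 using Z
proof (induction Z)
 case empty
 show ?case using f by (auto intro!: exI[of _ f])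
next
 case (insert w Z)
 then obtain g m where g: "g holomorphic_on UNIV" "\<And>z. f z = g z * (\<Prod>w\<in>Z. (z - w) ^ m w)" "\<And>w. w \<in> Z ==> g w \<noteq> 0"
  by blast
 have "g z0 \<noteq> 0" using f(2) g(2)[of z0] by auto
 then have "\<exists>w\<in>UNIV. g w \<noteq> 0" by blast
 from zorder_exist_zero[OF g(1) open_UNIV connected_UNIV UNIV_I this, of w]
 obtain r where r: "r > 0" "zor_poly g w holomorphic_on cball w r"
  "\<And>z. z \<in> cball w r ==> g z = zor_poly g w z * (z - w) ^ nat (zorder g w) \<and> zor_poly g w z \<noteq> 0"
  by blast
 define n where "n = nat (zorder g w)"
 define k where "k z = (if z = w then zor_poly g w w else g z / (z - w) ^ n)" for z
 have kG: "k z = zor_poly g w z" if "z \<in> cball w r" for z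
  using r(3)[OF that] by (auto simp: k_def n_def)
 have "zor_poly g w holomorphic_on ball w r" using r(2) by (rule holomorphic_on_subset) auto
 then have "k holomorphic_on ball w r"
  by (rule holomorphic_transform) (simp add: kG)
 moreover have "k holomorphic_on - {w}"
 proof (rule holomorphic_transform)
  show "(\<lambda>z. g z / (z - w) ^ n) holomorphic_on - {w}"
   by (intro holomorphic_intros holomorphic_on_subset[OF g(1)]) auto
 qed (simp add: k_def)
 ultimately have "k holomorphic_on (ball w r \<union> - {w})"
  by (intro holomorphic_on_Un) auto
 moreover have "ball w r \<union> - {w} = UNIV" using r(1) by auto
 ultimately have k: "k holomorphic_on UNIV" by simp
 have gk: "g z = k z * (z - w) ^ n" for z
  using r(3)[of w] r(1) by (cases "z = w") (auto simp: k_def n_def)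
 have "(\<Prod>v\<in>insert w Z. (z - v) ^ (m(w := n)) v) = (z - w) ^ n * (\<Prod>v\<in>Z. (z - v) ^ m v)" for z
 proof -
  have "(\<Prod>v\<in>Z. (z - v) ^ (m(w := n)) v) = (\<Prod>v\<in>Z. (z - v) ^ m v)"
   using insert.hyps by (intro prod.cong) auto
  then show ?thesis using insert.hyps by simp
 qed
 then have "f z = k z * (\<Prod>v\<in>insert w Z. (z - v) ^ (m(w := n)) v)" for z
  by (simp add: g(2) gk mult_ac)
 moreover have "k v \<noteq> 0" if "v \<in> insert w Z" for v
  using that g(3)[of v] r(3)[of w] r(1) by (auto simp: k_def)
 ultimately show ?case using k by blast
qed

lemma zeros_finite:
 assumes "f holomorphic_on UNIV" "f z0 \<noteq> 0" "compact K"
 shows "finite {z \<in> K. f z = 0}"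
proof (cases "\<exists>c. \<forall>z. f z = c")
 case True
 then have "f z \<noteq> 0" for z using assms(2) by metis
 then show ?thesis by simp
next
 case False
 then show ?thesis
  using assms by (intro holomorphic_compact_finite_zeros[of f UNIV]) (auto simp: constant_on_def)
qed

lemma zorder_nonneg_entire:
 assumes "f holomorphic_on UNIV" "f z0 \<noteq> 0"
 shows "zorder f z >= 0"
proof -
 have "\<exists>w\<in>UNIV. f w \<noteq> 0" using assms(2) by blast
 from zorder_exist_zero[OF assms(1) open_UNIV connected_UNIV UNIV_I this, of z] show ?thesis
  by (auto split: if_splits)
qed

lemma sets_zeros_measure [simp, measurable_cong]: "sets (zeros_measure f) = sets borel"
 by (simp add: zeros_measure_def)

lemma zeros_measure_radon:
 assumes f: "f holomorphic_on UNIV" "f z0 \<noteq> 0"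
 shows "zeros_measure f \<in> radon_measures"
proof -
 have "emeasure (zeros_measure f) K < \<infinity>" if K: "compact K" for K
 proof -
  have fin: "finite ({z. f z = 0} \<inter> K)" using zeros_finite[OF f K] by (simp add: Int_def conj_commute)
  have "emeasure (zeros_measure f) K = (\<integral>\<^sup>+z. ennreal (of_int (zorder f z)) * indicator ({z. f z = 0} \<inter> K) z \<partial>count_space {z. f z = 0})"
   using K unfolding zeros_measure_def
   by (subst emeasure_distr, simp, simp add: borel_compact, subst emeasure_density) (auto simp: Int_commute)
  also have "\<dots> = (\<Sum>z\<in>{z. f z = 0} \<inter> K. ennreal (of_int (zorder f z)))"
   using fin by (subst nn_integral_count_space') (auto simp: indicator_def intro!: sum.cong)
  also have "\<dots> < \<infinity>" using zorder_nonneg_entire[OF f] by (subst sum_ennreal) auto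
  finally show ?thesis .
 qed
 then show ?thesis by (simp add: radon_measures_def)
qed

lemma integral_zeros_measure:
 fixes \<phi> :: "complex \<Rightarrow> real"
 assumes f: "f holomorphic_on UNIV" "f z0 \<noteq> 0"
  and [measurable]: "\<phi> \<in> borel_measurable borel" and 0: "\<And>z. z \<notin> K ==> \<phi> z = 0" and K: "compact K"
 shows "(\<integral>z. \<phi> z \<partial>zeros_measure f) = (\<Sum>z\<in>{z \<in> K. f z = 0}. of_int (zorder f z) * \<phi> z)"
proof -
 note fin = zeros_finite[OF f K]
 have "(\<integral>z. \<phi> z \<partial>zeros_measure f) = (\<integral>z. \<phi> z \<partial>density (count_space {z. f z = 0}) (\<lambda>z. ennreal (of_int (zorder f z))))"
  unfolding zeros_measure_def by (simp add: integral_distr)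
 also have "\<dots> = (\<integral>z. of_int (zorder f z) * \<phi> z \<partial>count_space {z. f z = 0})"
  using zorder_nonneg_entire[OF f] by (subst integral_density) auto
 also have "\<dots> = (\<Sum>z | z \<in> {z. f z = 0} \<and> of_int (zorder f z) * \<phi> z \<noteq> 0. of_int (zorder f z) * \<phi> z)"
  using 0 by (intro lebesgue_integral_count_space_finite_support finite_subset[OF _ fin]) auto
 also have "\<dots> = (\<Sum>z\<in>{z \<in> K. f z = 0}. of_int (zorder f z) * \<phi> z)"
  using 0 by (intro sum.mono_neutral_left fin) auto
 finally show ?thesis .
qed

text \<open>On a disc containing the support, \<open>f\<close> is a zero-free \<open>g\<close> times
  finitely many linear factors. There \<open>ln |g|\<close> is the real part of a holomorphic
  logarithm and contributes 0 by Green's formula; each linear factor contributes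
  \<open>2 * pi * \<phi> w\<close> with its multiplicity.\<close>

theorem Poincare_Lelong:
 assumes f: "f holomorphic_on UNIV" "f z0 \<noteq> 0"
  and \<phi>: "C2_on UNIV \<phi> \<phi>x \<phi>y \<phi>xx \<phi>yy" and 0: "\<And>z. norm z > R ==> \<phi> z = 0"
 shows "integrable lborel (\<lambda>z. ln (norm (f z)) * (\<phi>xx z + \<phi>yy z))"
  and "(LBINT z. ln (norm (f z)) * (\<phi>xx z + \<phi>yy z)) = 2 * pi * (\<integral>z. \<phi> z \<partial>zeros_measure f)"
proof -
 let ?L = "\<lambda>z. \<phi>xx z + \<phi>yy z"
 define Z where "Z = {z \<in> cball 0 (R + 1). f z = 0}"
 have finZ: "finite Z" unfolding Z_def by (rule zeros_finite[OF f]) simp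
 obtain g m where g: "g holomorphic_on UNIV" "\<And>z. f z = g z * (\<Prod>w\<in>Z. (z - w) ^ m w)" "\<And>w. w \<in> Z ==> g w \<noteq> 0"
  using entire_factor_zeros[OF f finZ] by blast
 have ord: "zorder f w = int (m w)" if w: "w \<in> Z" for w
 proof (rule zorder_eqI[of UNIV w "\<lambda>z. g z * (\<Prod>v\<in>Z - {w}. (z - v) ^ m v)"])
  show "(\<lambda>z. g z * (\<Prod>v\<in>Z - {w}. (z - v) ^ m v)) holomorphic_on UNIV"
   by (intro holomorphic_intros g)
  show "g w * (\<Prod>v\<in>Z - {w}. (w - v) ^ m v) \<noteq> 0" using g(3)[OF w] finZ by auto
  show "f z = g z * (\<Prod>v\<in>Z - {w}. (z - v) ^ m v) * (z - w) powi int (m w)" for z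
   unfolding g(2)[of z] using finZ w by (subst prod.remove[of Z w]) (auto simp: mult_ac)
 qed auto
 \<comment> \<open>\<open>Z\<close> collects the zeros in the closed disc of this radius, so that
   \<open>g\<close> has none in the open disc, which still contains the support.\<close>
 define U where "U = ball (0::complex) (R + 1)"
 have U: "open U" "convex U" "cball 0 R \<subseteq> U" by (auto simp: U_def)
 have gU: "g z \<noteq> 0" if "z \<in> U" for z
 proof
  assume "g z = 0"
  then have "f z = 0" by (simp add: g(2))
  then have "z \<in> Z" using that by (auto simp: Z_def U_def)
  then show False using g(3) \<open>g z = 0\<close> by auto
 qed
 have L0: "\<phi>xx z + \<phi>yy z = 0" if "norm z > R" for z using C2_support[OF \<phi>, of R z] 0 that by auto
 have eq: "(\<Sum>z\<in>Z. of_int (zorder f z) * \<phi> z) = (\<integral>z. \<phi> z \<partial>zeros_measure f)"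
 proof -
  have [measurable]: "\<phi> \<in> borel_measurable borel" using C2_onD(1)[OF \<phi>] by (rule borel_measurable_continuous_onI)
  show ?thesis unfolding Z_def by (rule integral_zeros_measure[OF f, symmetric]) (use 0 in auto)
 qed
 have 1: "integrable lborel (\<lambda>z. real (m w) * (ln (norm (z - w)) * ?L z))"
  "(LBINT z. real (m w) * (ln (norm (z - w)) * ?L z)) = real (m w) * (2 * pi * \<phi> w)" for w
  using ln_dist_Laplacian[OF \<phi>, of R w] 0 by auto
 obtain u where u: "integrable lborel (\<lambda>z. u z * ?L z)" "(LBINT z. u z * ?L z) = 0"
  "\<And>z. z \<in> U ==> ln (norm (g z)) = u z"
 proof (cases "U = {}")
  \<comment> \<open>\<open>R\<close> may be so negative that the disc is empty; then the test
    function vanishes identically, and there is no base point for the logarithm.\<close>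
  case True
  then have "\<phi>xx z + \<phi>yy z = 0" for z using L0[of z] True norm_ge_zero[of z] unfolding U_def ball_eq_empty by linarith
  then have "(\<lambda>z. 0 * ?L z) = (\<lambda>z. 0 :: real)" by auto
  then show thesis using that[of "\<lambda>_. 0"] True by simp
 next
  case False
  then obtain p where "p \<in> U" by auto
  obtain h where h: "h holomorphic_on U" "\<And>z. z \<in> U ==> exp (h z) = g z"
   by (rule holomorphic_logarithm_exists[OF U(2,1) holomorphic_on_subset[OF g(1)] gU \<open>p \<in> U\<close>]) auto
  note C = C2_on_Re_holomorphic[OF U(1) h(1)]
  have "continuous_on UNIV (\<lambda>z. Re (h z) * ?L z)"
   by (rule continuous_on_extend_zero[OF U(1,3)])
    (use C2_onD(1)[OF C] C2_onD(4,5)[OF \<phi>] L0 in \<open>auto intro!: continuous_intros intro: continuous_on_subset\<close>)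
  then have "integrable lborel (\<lambda>z. Re (h z) * ?L z)"
   by (rule integrable_cont_compact_support[of _ R]) (simp add: L0)
  moreover have "(LBINT z. Re (h z) * ?L z) = 0"
   using Green_compact_support[OF U(1,3) C \<phi> 0] by simp
  moreover have "ln (norm (g z)) = Re (h z)" if "z \<in> U" for z
   using h(2)[OF that, symmetric] by simp
  ultimately show thesis using that[of "\<lambda>z. Re (h z)"] by blast
 qed
 have "emeasure lborel Z = 0" using finZ by (intro emeasure_lborel_countable countable_finite)
 then have "AE z in lborel. z \<notin> Z" using finZ by (intro AE_I[of _ _ Z]) (auto intro: borel_closed finite_imp_closed)
 then have ae: "AE z in lborel. u z * ?L z + (\<Sum>w\<in>Z. real (m w) * (ln (norm (z - w)) * ?L z)) = ln (norm (f z)) * ?L z"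
 proof eventually_elim
  case (elim z)
  show ?case
  proof (cases "z \<in> U")
   case True
   have pos: "(\<Prod>w\<in>Z. norm (z - w) ^ m w) > 0" using elim by (intro prod_pos ballI zero_less_power) auto
   have "ln (norm (f z)) = ln (norm (g z)) + ln (\<Prod>w\<in>Z. norm (z - w) ^ m w)"
    unfolding g(2)[of z] using gU[OF True] pos by (simp add: norm_mult prod_norm[symmetric] norm_power ln_mult)
   also have "ln (\<Prod>w\<in>Z. norm (z - w) ^ m w) = (\<Sum>w\<in>Z. real (m w) * ln (norm (z - w)))"
    using elim finZ by (subst ln_prod) (auto simp: ln_realpow intro!: sum.cong)
   finally show ?thesis using u(3)[OF True] by (simp add: distrib_right sum_distrib_right mult.assoc)
  next
   case False
   then show ?thesis using L0[of z] by (auto simp: U_def)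
  qed
 qed
 have [measurable]: "f \<in> borel_measurable borel" "\<phi>xx \<in> borel_measurable borel" "\<phi>yy \<in> borel_measurable borel"
  using holomorphic_on_imp_continuous_on[OF f(1)] C2_onD(4,5)[OF \<phi>] by (auto intro: borel_measurable_continuous_onI)
 have i: "integrable lborel (\<lambda>z. u z * ?L z + (\<Sum>w\<in>Z. real (m w) * (ln (norm (z - w)) * ?L z)))"
  by (intro Bochner_Integration.integrable_add Bochner_Integration.integrable_sum u 1)
 show "integrable lborel (\<lambda>z. ln (norm (f z)) * ?L z)"
  by (rule integrable_cong_AE_imp[OF i _ ae]) measurable
 have "(LBINT z. ln (norm (f z)) * ?L z) =
   (LBINT z. u z * ?L z + (\<Sum>w\<in>Z. real (m w) * (ln (norm (z - w)) * ?L z)))"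
  using ae i by (intro integral_cong_AE) (auto elim!: eventually_mono)
 also have "\<dots> = (\<Sum>w\<in>Z. real (m w) * (2 * pi * \<phi> w))"
  by (subst Bochner_Integration.integral_add[OF u(1)], intro Bochner_Integration.integrable_sum 1, subst Bochner_Integration.integral_sum)
   (simp_all only: 1 u(2) add_0)
 also have "\<dots> = 2 * pi * (\<Sum>z\<in>Z. of_int (zorder f z) * \<phi> z)"
  by (simp add: sum_distrib_left ord mult_ac)
 finally show "(LBINT z. ln (norm (f z)) * ?L z) = 2 * pi * (\<integral>z. \<phi> z \<partial>zeros_measure f)"
  unfolding eq .
qed

section \<open>Vague convergence in distribution\<close>

text \<open>Pairs a compactly supported C^2 function with its Laplacian. The class contains both the
  smooth functions and the countable family \<open>test_fun\<close>, whose members are in general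
  not smooth.\<close>

definition C2c :: "(complex \<Rightarrow> real) \<Rightarrow> (complex \<Rightarrow> real) \<Rightarrow> bool" where
 "C2c \<phi> L \<longleftrightarrow> (\<exists>\<phi>x \<phi>y \<phi>xx \<phi>yy R. C2_on UNIV \<phi> \<phi>x \<phi>y \<phi>xx \<phi>yy \<and>
  (\<forall>z. norm z > R \<longrightarrow> \<phi> z = 0) \<and> L = (\<lambda>z. \<phi>xx z + \<phi>yy z))"

lemma C2cE:
 assumes "C2c \<phi> L"
 obtains R where "continuous_on UNIV \<phi>" "continuous_on UNIV L"
  "\<And>z. norm z > R ==> \<phi> z = 0" "\<And>z. norm z > R ==> L z = 0"
proof -
 obtain \<phi>x \<phi>y \<phi>xx \<phi>yy R where C: "C2_on UNIV \<phi> \<phi>x \<phi>y \<phi>xx \<phi>yy" and z: "\<forall>z. norm z > R \<longrightarrow> \<phi> z = 0"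
  and L: "L = (\<lambda>z. \<phi>xx z + \<phi>yy z)" using assms unfolding C2c_def by blast
 have "L z = 0" if "norm z > R" for z
  using C2_support[OF C, of R z] z that by (auto simp: L)
 moreover have "continuous_on UNIV L" unfolding L by (intro continuous_intros C2_onD[OF C])
 ultimately show thesis using that C2_onD(1)[OF C] z by blast
qed

section \<open>A countable family of test functions\<close>

lemma DERIV_pos_part_power:
 "((\<lambda>t::real. (max 0 t) ^ Suc (Suc n)) has_real_derivative real (Suc (Suc n)) * (max 0 t) ^ Suc n) (at t)"
proof -
 consider "t > 0" | "t < 0" | "t = 0" by linarith
 then show ?thesis
 proof cases
  case 1
  then have "\<forall>\<^sub>F x in nhds t. x > 0" by (intro order_tendstoD(1)[of "\<lambda>x. x"]) (auto simp: filterlim_ident)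
  then have "((\<lambda>t::real. (max 0 t) ^ Suc (Suc n)) has_real_derivative real (Suc (Suc n)) * t ^ Suc n) (at t) \<longleftrightarrow>
   ((\<lambda>t::real. t ^ Suc (Suc n)) has_real_derivative real (Suc (Suc n)) * t ^ Suc n) (at t)"
   by (intro DERIV_cong_ev) (auto elim!: eventually_mono)
  moreover have "((\<lambda>t::real. t ^ Suc (Suc n)) has_real_derivative real (Suc (Suc n)) * t ^ Suc n) (at t)"
   using DERIV_pow[of "Suc (Suc n)" t] by simp
  ultimately show ?thesis using 1 by simp
 next
  case 2
  then have "\<forall>\<^sub>F x in nhds t. x < 0" by (intro order_tendstoD(2)[of "\<lambda>x. x"]) (auto simp: filterlim_ident)
  then have "((\<lambda>t::real. (max 0 t) ^ Suc (Suc n)) has_real_derivative 0) (at t) \<longleftrightarrow>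
   ((\<lambda>t::real. 0) has_real_derivative 0) (at t)"
   by (intro DERIV_cong_ev) (auto elim!: eventually_mono)
  then show ?thesis using 2 by simp
 next
  case 3
  have "((\<lambda>h::real. (max 0 h) ^ Suc n) \<longlongrightarrow> (max 0 0) ^ Suc n) (at 0)"
   by (intro tendsto_intros)
  then have "((\<lambda>h::real. (max 0 h) ^ Suc n) \<longlongrightarrow> 0) (at 0)" by simp
  moreover have "(max 0 h) ^ Suc n = ((max 0 (0 + h)) ^ Suc (Suc n) - (max 0 0) ^ Suc (Suc n)) / h" if "h \<noteq> 0" for h :: real
   using that by (cases "h > 0") (auto simp: max_def)
  ultimately have "((\<lambda>h::real. ((max 0 (0 + h)) ^ Suc (Suc n) - (max 0 0) ^ Suc (Suc n)) / h) \<longlongrightarrow> 0) (at 0)"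
   by (subst (asm) tendsto_cong) (auto simp: eventually_at intro!: exI[of _ 1])
  then show ?thesis using 3 by (simp add: DERIV_def)
 qed
qed

text \<open>The cube is the smallest integer power of a positive part that is C^2.\<close>

definition bump :: "nat \<Rightarrow> complex \<Rightarrow> real" where
 "bump R z = (max 0 ((real R)^2 - ((Re z)^2 + (Im z)^2))) ^ 3"

definition test_fun :: "nat \<times> nat \<times> nat \<Rightarrow> complex \<Rightarrow> real" where
 "test_fun = (\<lambda>(i, j, R) z. Re z ^ i * Im z ^ j * bump R z)"

lemma bump_nonneg: "bump R z >= 0" by (simp add: bump_def)

lemma bump_pos: "norm z < real R ==> bump R z > 0"
 using power_strict_mono[of "norm z" "real R" 2] by (simp add: bump_def cmod_power2)

lemma bump_eq_0: "norm z >= real R ==> bump R z = 0"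
 using power_mono[of "real R" "norm z" 2] by (simp add: bump_def cmod_power2)

lemma continuous_bump: "continuous_on A (bump R)"
 unfolding bump_def by (intro continuous_intros)

lemma C2_on_power:
 assumes u: "C2_on U u ux uy uxx uyy"
 shows "\<exists>vx vy vxx vyy. C2_on U (\<lambda>z. u z ^ n) vx vy vxx vyy"
proof -
 have "C2_on U (\<lambda>z. u z ^ n) (\<lambda>z. (real n * u z ^ (n - 1)) * ux z) (\<lambda>z. (real n * u z ^ (n - 1)) * uy z)
  (\<lambda>z. (real n * (real (n - 1) * u z ^ (n - 1 - 1))) * (ux z)^2 + (real n * u z ^ (n - 1)) * uxx z)
  (\<lambda>z. (real n * (real (n - 1) * u z ^ (n - 1 - 1))) * (uy z)^2 + (real n * u z ^ (n - 1)) * uyy z)"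
  by (rule C2_on_compose[OF u, of "\<lambda>t. t ^ n" "\<lambda>t. real n * t ^ (n - 1)" "\<lambda>t. real n * (real (n - 1) * t ^ (n - 1 - 1))"])
   (auto intro!: derivative_eq_intros continuous_intros)
 then show ?thesis by blast
qed

lemma C2_on_bump: "\<exists>vx vy vxx vyy. C2_on UNIV (bump R) vx vy vxx vyy"
proof -
 have u: "C2_on UNIV (\<lambda>z. (real R)^2 - ((Re z)^2 + (Im z)^2)) (\<lambda>z. - 2 * Re z) (\<lambda>z. - 2 * Im z) (\<lambda>_. -2) (\<lambda>_. -2)"
  unfolding C2_on_def by (auto intro!: continuous_intros derivative_eq_intros)
 have g: "((\<lambda>t::real. (max 0 t) ^ 3) has_real_derivative 3 * (max 0 t)^2) (at t)"
  "((\<lambda>t::real. 3 * (max 0 t)^2) has_real_derivative 3 * (2 * max 0 t)) (at t)" for t :: real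
  using DERIV_pos_part_power[of 1 t] DERIV_cmult[OF DERIV_pos_part_power[of 0 t], of 3]
  by (simp_all add: numeral_3_eq_3 numeral_2_eq_2)
 show ?thesis
  unfolding bump_def
  by (intro exI) (rule C2_on_compose[OF u, of "\<lambda>t. (max 0 t) ^ 3" "\<lambda>t. 3 * (max 0 t)^2" "\<lambda>t. 3 * (2 * max 0 t)"];
   (rule g | intro continuous_intros))
qed

lemma C2c_test_fun: "\<exists>L. C2c (test_fun k) L"
proof -
 obtain i j R where k: "k = (i, j, R)" by (cases k)
 obtain ax ay axx ayy where a: "C2_on UNIV (\<lambda>z. Re z ^ i) ax ay axx ayy"
  using C2_on_power[OF C2_on_Re] by blast
 obtain bx by' bxx byy where b: "C2_on UNIV (\<lambda>z. Im z ^ j) bx by' bxx byy"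
  using C2_on_power[OF C2_on_Im] by blast
 obtain cx cy cxx cyy where c: "C2_on UNIV (bump R) cx cy cxx cyy"
  using C2_on_bump by blast
 from C2_on_mult[OF C2_on_mult[OF a b] c]
 obtain vx vy vxx vyy where v: "C2_on UNIV (test_fun k) vx vy vxx vyy"
  unfolding k test_fun_def prod.case by blast
 have "\<forall>z. norm z > real R \<longrightarrow> test_fun k z = 0" by (simp add: k test_fun_def bump_eq_0)
 then show ?thesis using v unfolding C2c_def by blast
qed

lemma continuous_test_fun: "continuous_on A (test_fun k)"
 by (cases k) (auto simp: test_fun_def intro!: continuous_intros continuous_bump)

inductive_set real_polys :: "(complex \<Rightarrow> real) set" where
 monomial: "(\<lambda>z. c * (Re z ^ i * Im z ^ j)) \<in> real_polys"
| add: "f \<in> real_polys ==> g \<in> real_polys ==> (\<lambda>z. f z + g z) \<in> real_polys"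

lemma real_polys_mult:
 assumes "f \<in> real_polys" "g \<in> real_polys"
 shows "(\<lambda>z. f z * g z) \<in> real_polys"
 using assms(1)
proof (induction)
 case f: (monomial c i j)
 show ?case using assms(2)
 proof induction
  case (monomial c' i' j')
  have "(\<lambda>z. c * (Re z ^ i * Im z ^ j) * (c' * (Re z ^ i' * Im z ^ j'))) = (\<lambda>z. (c * c') * (Re z ^ (i + i') * Im z ^ (j + j')))"
   by (simp add: power_add mult_ac)
  then show ?case using real_polys.monomial by simp
 next
  case (add f g)
  then show ?case using real_polys.add by (simp add: distrib_left)
 qed
next
 case (add f g)
 then show ?case using real_polys.add by (simp add: distrib_right)
qed

lemma continuous_real_polys: "f \<in> real_polys ==> continuous_on A f"
 by (induction rule: real_polys.induct) (auto intro!: continuous_intros)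

lemma function_ring_real_polys: "function_ring_on real_polys (cball 0 R)"
proof
 show "(\<lambda>_. c) \<in> real_polys" for c using real_polys.monomial[of c 0 0] by simp
 fix x y :: complex assume "x \<noteq> y"
 then consider "Re x \<noteq> Re y" | "Im x \<noteq> Im y" by (auto simp: complex_eq_iff)
 then show "\<exists>f\<in>real_polys. f x \<noteq> f y"
 proof cases
  case 1 then show ?thesis using real_polys.monomial[of 1 1 0] by (intro bexI[of _ Re]) auto
 next
  case 2 then show ?thesis using real_polys.monomial[of 1 0 1] by (intro bexI[of _ Im]) auto
 qed
qed (auto intro: continuous_real_polys real_polys.add real_polys_mult)

text \<open>Stone-Weierstrass is applied to the quotient \<open>f / bump R\<close> on a disc
  strictly larger than the support of \<open>f\<close>. Multiplying back gives an error of at most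
  \<open>e * bump R\<close>, which is integrable against every Radon measure and is itself measured
  by a test integral.\<close>

lemma test_fun_approx:
 assumes f: "continuous_on UNIV f" and 0: "\<And>z. norm z > r ==> f z = 0"
 obtains R where "\<And>e. e > 0 ==> \<exists>q\<in>real_polys. \<forall>z. \<bar>f z - q z * bump R z\<bar> <= e * bump R z"
proof -
 obtain R :: nat where R: "real R > r" using reals_Archimedean2 by blast
 define g where "g z = (if norm z < real R then f z / bump R z else 0)" for z
 have "continuous_on (ball 0 (real R)) (\<lambda>z. f z / bump R z)"
  using bump_pos[of _ R] by (intro continuous_intros continuous_bump continuous_on_subset[OF f]) (auto simp: less_imp_neq[symmetric])
 then have "continuous_on (ball 0 (real R)) g"
  by (rule continuous_on_eq) (auto simp: g_def)
 moreover have "continuous_on (- cball 0 r) g"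
  by (rule continuous_on_eq[of _ "\<lambda>_. 0"]) (auto simp: g_def 0)
 ultimately have "continuous_on (ball 0 (real R) \<union> - cball 0 r) g"
  by (intro continuous_on_open_Un) auto
 moreover have "ball 0 (real R) \<union> - cball 0 r = (UNIV :: complex set)" using R by auto
 ultimately have cg: "continuous_on (cball 0 (real R)) g" by (metis continuous_on_subset subset_UNIV)
 have "\<exists>q\<in>real_polys. \<forall>z. \<bar>f z - q z * bump R z\<bar> <= e * bump R z" if e: "e > 0" for e
 proof -
  interpret function_ring_on real_polys "cball 0 (real R)" by (rule function_ring_real_polys)
  obtain q where q: "q \<in> real_polys" "\<And>z. norm z <= real R ==> \<bar>g z - q z\<bar> < e"
   using Stone_Weierstrass_basic[OF cg e] by auto
  have "\<bar>f z - q z * bump R z\<bar> <= e * bump R z" for z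
  proof (cases "norm z < real R")
   case True
   then have "f z = g z * bump R z" using bump_pos[OF True] by (simp add: g_def)
   then have "\<bar>f z - q z * bump R z\<bar> = \<bar>g z - q z\<bar> * bump R z"
    using bump_nonneg[of R z] by (simp add: left_diff_distrib[symmetric] abs_mult)
   also have "\<dots> <= e * bump R z" using q(2)[of z] True bump_nonneg[of R z] by (intro mult_right_mono) auto
   finally show ?thesis .
  next
   case False
   then show ?thesis using bump_eq_0[of R z] 0[of z] R by auto
  qed
  then show ?thesis using q(1) by blast
 qed
 then show thesis using that by blast
qed

section \<open>The vague topology through countably many integrals\<close>

lemma radon_integrable:
 fixes f :: "complex \<Rightarrow> real"
 assumes \<mu>: "\<mu> \<in> radon_measures" and f: "continuous_on UNIV f" and 0: "\<And>z. norm z > R ==> f z = 0"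
 shows "integrable \<mu> f"
proof -
 have s[measurable_cong]: "sets \<mu> = sets borel" using \<mu> by (simp add: radon_measures_def)
 have [measurable]: "f \<in> borel_measurable borel" using f by (rule borel_measurable_continuous_onI)
 have [measurable]: "cball 0 R \<in> sets \<mu>" unfolding s by auto
 obtain B where B: "B >= 0" "\<And>x. \<bar>f x\<bar> <= B" using bounded_compact_support[OF f 0] by blast
 have "integrable \<mu> (\<lambda>z. B * indicat_real (cball 0 R) z)"
  using \<mu> by (intro integrable_mult_right integrable_real_indicator) (auto simp: radon_measures_def)
 then show ?thesis
  by (rule Bochner_Integration.integrable_bound) (use B 0 in \<open>auto simp: indicator_def not_le\<close>)
qed

lemma compactly_supportedE:
 assumes "compactly_supported f"
 obtains R where "\<And>z. norm z > R ==> f z = 0"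
proof -
 obtain R where "\<And>z. z \<in> closure {z. f z \<noteq> 0} ==> norm z <= R"
  using compact_imp_bounded[OF assms[unfolded compactly_supported_def]] by (auto simp: bounded_iff)
 then have "f z = 0" if "norm z > R" for z
  using that closure_subset[of "{z. f z \<noteq> 0}"] by force
 then show thesis using that by blast
qed

definition test_integrals :: "complex measure \<Rightarrow> nat \<times> nat \<times> nat \<Rightarrow> real" where
 "test_integrals \<mu> k = (\<integral>z. test_fun k z \<partial>\<mu>)"

lemma integrable_test_fun: "\<mu> \<in> radon_measures ==> integrable \<mu> (test_fun k)"
 using C2c_test_fun[of k] by (metis C2cE radon_integrable)

lemma integral_poly_bump:
 assumes "q \<in> real_polys"
 shows "\<exists>G. continuous_on UNIV G \<and> (\<forall>\<mu>\<in>radon_measures. integrable \<mu> (\<lambda>z. q z * bump R z) \<and>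
  (\<integral>z. q z * bump R z \<partial>\<mu>) = G (test_integrals \<mu>))"
 using assms
proof induction
 case (monomial c i j)
 have eq: "(\<lambda>z. c * (Re z ^ i * Im z ^ j) * bump R z) = (\<lambda>z. c * test_fun (i, j, R) z)"
  by (simp add: test_fun_def mult_ac)
 show ?case unfolding eq
  by (intro exI[of _ "\<lambda>x. c * x (i, j, R)"])
   (auto simp: test_integrals_def integrable_test_fun intro!: continuous_intros)
next
 case (add f g)
 then obtain F G where *: "continuous_on UNIV F" "continuous_on UNIV G"
  "\<And>\<mu>. \<mu>\<in>radon_measures ==> integrable \<mu> (\<lambda>z. f z * bump R z) \<and> (\<integral>z. f z * bump R z \<partial>\<mu>) = F (test_integrals \<mu>)"
  "\<And>\<mu>. \<mu>\<in>radon_measures ==> integrable \<mu> (\<lambda>z. g z * bump R z) \<and> (\<integral>z. g z * bump R z \<partial>\<mu>) = G (test_integrals \<mu>)"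
  by blast
 show ?case
  using * by (intro exI[of _ "\<lambda>x. F x + G x"]) (auto simp: distrib_right intro!: continuous_intros)
qed

lemma topspace_vague: "topspace vague_topology = radon_measures"
proof -
 have "radon_measures \<in> {{\<mu> \<in> radon_measures. integral\<^sup>L \<mu> f \<in> U} | f U.
    continuous_on UNIV f \<and> compactly_supported f \<and> open U}"
  by (intro CollectI exI[of _ "\<lambda>_. 0"] exI[of _ UNIV]) (auto simp: compactly_supported_def)
 then show ?thesis unfolding vague_topology_def topology_generated_by_topspace by blast
qed

text \<open>Induction over the generation of the topology. For a subbasic set given by
  \<open>f\<close>, the integral of \<open>bump R\<close> serves as a further coordinate: a bound on
  it bounds the error of replacing \<open>f\<close> by a polynomial times \<open>bump R\<close>,
  uniformly over the neighbourhood. So the vague topology is no finer than the one pulled back along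
  \<open>test_integrals\<close> from a countable product of lines.\<close>

lemma vague_nhd_test_integrals:
 assumes "openin vague_topology U" "\<mu> \<in> U"
 shows "\<exists>W. open W \<and> test_integrals \<mu> \<in> W \<and> (\<forall>\<nu>\<in>radon_measures. test_integrals \<nu> \<in> W \<longrightarrow> \<nu> \<in> U)"
proof -
 have "generate_topology_on {{\<mu> \<in> radon_measures. integral\<^sup>L \<mu> f \<in> U} | f U.
    continuous_on UNIV f \<and> compactly_supported f \<and> open U} U"
  using assms(1) unfolding vague_topology_def by (rule openin_topology_generated_by)
 then show ?thesis using assms(2)
 proof induction
  case (Int A B)
  have "\<mu> \<in> A" "\<mu> \<in> B" using Int.prems by auto
  from Int.IH(1)[OF this(1)] Int.IH(2)[OF this(2)]
  obtain V W where "open V" "test_integrals \<mu> \<in> V" "\<forall>\<nu>\<in>radon_measures. test_integrals \<nu> \<in> V \<longrightarrow> \<nu> \<in> A"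
   "open W" "test_integrals \<mu> \<in> W" "\<forall>\<nu>\<in>radon_measures. test_integrals \<nu> \<in> W \<longrightarrow> \<nu> \<in> B"
   by (elim exE conjE)
  then show ?case by (intro exI[of _ "V \<inter> W"]) (simp add: open_Int)
 next
  case (UN K)
  then obtain A where A: "A \<in> K" "\<mu> \<in> A" by (elim UnionE)
  from UN.IH[OF this] show ?case
   by (elim exE conjE, intro exI conjI) (assumption, assumption, use A(1) in blast)
 next
  case (Basis s)
  then obtain f V where s: "s = {\<mu> \<in> radon_measures. integral\<^sup>L \<mu> f \<in> V}"
   and f: "continuous_on UNIV f" "compactly_supported f" and V: "open V" by blast
  obtain r where r: "\<And>z. norm z > r ==> f z = 0" using compactly_supportedE[OF f(2)] by blast
  have \<mu>: "\<mu> \<in> radon_measures" "integral\<^sup>L \<mu> f \<in> V" using Basis(2) s by auto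
  then obtain e where e: "e > 0" "\<And>x. \<bar>x - integral\<^sup>L \<mu> f\<bar> < e ==> x \<in> V"
   using V unfolding open_real by blast
  obtain R where R: "\<And>e. e > 0 ==> \<exists>q\<in>real_polys. \<forall>z. \<bar>f z - q z * bump R z\<bar> <= e * bump R z"
   using test_fun_approx[OF f(1) r] by blast
  have b0: "bump R = test_fun (0, 0, R)" by (auto simp: test_fun_def)
  define M where "M \<nu> = test_integrals \<nu> (0, 0, R)" for \<nu>
  have Mnn: "M \<nu> >= 0" for \<nu> using bump_nonneg[of R] unfolding M_def test_integrals_def b0[symmetric] by simp
  \<comment> \<open>The denominator is \<open>4 * (M \<mu> + 1)\<close>. The errors at
    \<open>\<nu>\<close>, at \<open>\<mu>\<close> and from \<open>G\<close> are at most
    \<open>\<delta> * (M \<mu> + 1)\<close>, \<open>\<delta> * M \<mu>\<close> and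
    \<open>\<delta>\<close>, together \<open>e / 2\<close>.\<close>
  define \<delta> where "\<delta> = e / (2 * (2 * M \<mu> + 1) + 2)"
  have \<delta>: "\<delta> > 0" "\<delta> * (2 * (2 * M \<mu> + 1) + 2) = e" using e Mnn[of \<mu>] by (auto simp: \<delta>_def add_nonneg_pos)
  obtain q where q: "q \<in> real_polys" "\<And>z. \<bar>f z - q z * bump R z\<bar> <= \<delta> * bump R z" using R[OF \<delta>(1)] by blast
  obtain G where G: "continuous_on UNIV G" "\<And>\<nu>. \<nu> \<in> radon_measures ==> integrable \<nu> (\<lambda>z. q z * bump R z)"
   "\<And>\<nu>. \<nu> \<in> radon_measures ==> (\<integral>z. q z * bump R z \<partial>\<nu>) = G (test_integrals \<nu>)"
   using integral_poly_bump[OF q(1)] by blast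
  have close: "\<bar>integral\<^sup>L \<nu> f - G (test_integrals \<nu>)\<bar> <= \<delta> * M \<nu>" if \<nu>: "\<nu> \<in> radon_measures" for \<nu>
  proof -
   have i: "integrable \<nu> f" "integrable \<nu> (bump R)"
    using radon_integrable[OF \<nu> f(1) r] integrable_test_fun[OF \<nu>, of "(0, 0, R)"] by (auto simp: b0)
   have "\<bar>integral\<^sup>L \<nu> f - G (test_integrals \<nu>)\<bar> = \<bar>\<integral>z. f z - q z * bump R z \<partial>\<nu>\<bar>"
    using i G(2)[OF \<nu>] by (simp add: G(3)[OF \<nu>, symmetric])
   also have "\<dots> <= (\<integral>z. \<bar>f z - q z * bump R z\<bar> \<partial>\<nu>)" by (rule integral_abs_bound)
   also have "\<dots> <= (\<integral>z. \<delta> * bump R z \<partial>\<nu>)"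
    using i G(2)[OF \<nu>] q(2) by (intro integral_mono) auto
   finally show ?thesis using i by (simp add: M_def test_integrals_def b0)
  qed
  define W where "W = {x. x (0, 0, R) < M \<mu> + 1 \<and> \<bar>G x - G (test_integrals \<mu>)\<bar> < \<delta>}"
  have "open W" unfolding W_def
   by (intro open_Collect_conj open_Collect_less continuous_intros continuous_on_product_coordinates G(1))
  moreover have "test_integrals \<mu> \<in> W" using \<delta>(1) by (simp add: W_def M_def)
  moreover have "\<nu> \<in> s" if "\<nu> \<in> radon_measures" "test_integrals \<nu> \<in> W" for \<nu>
  proof -
   have "\<delta> * M \<nu> <= \<delta> * (M \<mu> + 1)" using that(2) \<delta>(1) by (intro mult_left_mono) (auto simp: W_def M_def)
   then have "\<bar>integral\<^sup>L \<nu> f - integral\<^sup>L \<mu> f\<bar> < \<delta> * (M \<mu> + 1) + \<delta> * M \<mu> + \<delta>"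
    using close[OF that(1)] close[OF \<mu>(1)] that(2) by (auto simp: W_def)
   also have "\<dots> = 2 * (\<delta> * M \<mu>) + 2 * \<delta>" by (simp add: algebra_simps)
   also have "\<dots> <= e"
   proof -
    have "e = 4 * (\<delta> * M \<mu>) + 4 * \<delta>" using \<delta>(2) by (simp add: algebra_simps)
    moreover have "0 <= \<delta> * M \<mu>" using \<delta>(1) Mnn[of \<mu>] by (intro mult_nonneg_nonneg) auto
    ultimately show ?thesis using \<delta>(1) by linarith
   qed
   finally show ?thesis using e(2) that(1) s by auto
  qed
  ultimately show ?case by blast
 qed simp
qed

lemma measurable_vague:
 assumes r: "\<And>w. w \<in> space P ==> X w \<in> radon_measures"
  and m: "\<And>k. (\<lambda>w. \<integral>z. test_fun k z \<partial>X w) \<in> borel_measurable P"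
 shows "X \<in> P \<rightarrow>\<^sub>M borel_of vague_topology"
 unfolding borel_of_def
proof (rule measurable_measure_of)
 show "{U. openin vague_topology U} \<subseteq> Pow (topspace vague_topology)" by (auto dest: openin_subset)
 show "X \<in> space P \<rightarrow> topspace vague_topology" using r by (auto simp: topspace_vague)
 fix U assume "U \<in> {U. openin vague_topology U}"
 then have U: "openin vague_topology U" by simp
 \<comment> \<open>The union of all admissible open sets is open, and \<open>U\<close> is exactly
   its preimage. The product has countably many coordinates, so coordinatewise measurability makes
   the preimage measurable.\<close>
 define W where "W = \<Union>{W. open W \<and> (\<forall>\<nu>\<in>radon_measures. test_integrals \<nu> \<in> W \<longrightarrow> \<nu> \<in> U)}"
 have "open W" unfolding W_def by auto
 have W: "\<nu> \<in> U \<longleftrightarrow> test_integrals \<nu> \<in> W" if "\<nu> \<in> radon_measures" for \<nu>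
  using vague_nhd_test_integrals[OF U] that unfolding W_def by blast
 have mt: "(\<lambda>w. test_integrals (X w)) \<in> borel_measurable P"
  using m by (intro measurable_coordinatewise_then_product) (simp add: test_integrals_def)
 have "X -` U \<inter> space P = (\<lambda>w. test_integrals (X w)) -` W \<inter> space P"
  using W r by auto
 also have "\<dots> \<in> sets P" using \<open>open W\<close> by (intro measurable_sets[OF mt] borel_open)
 finally show "X -` U \<inter> space P \<in> sets P" .
qed

text \<open>The limit is deterministic. A bounded continuous \<open>\<Phi>\<close> is within
  \<open>e / 2\<close> of \<open>\<Phi> \<mu>\<close> on a neighbourhood described by finitely many
  test integrals, and the event that one of them is off has vanishing probability; on that event the
  bound \<open>2 * B\<close> is used.\<close>

theorem converges_in_distribution_vagueI:
 assumes P: "prob_space P" and \<mu>: "\<mu> \<in> radon_measures"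
  and r: "\<forall>\<^sub>F n in sequentially. \<forall>\<omega>\<in>space P. X n \<omega> \<in> radon_measures"
  and m: "\<forall>\<^sub>F n in sequentially. \<forall>k. (\<lambda>\<omega>. \<integral>z. test_fun k z \<partial>X n \<omega>) \<in> borel_measurable P"
  and c: "\<And>k e. e > 0 ==> (\<lambda>n. measure P {\<omega>\<in>space P. \<bar>(\<integral>z. test_fun k z \<partial>X n \<omega>) - (\<integral>z. test_fun k z \<partial>\<mu>)\<bar> >= e}) \<longlonglongrightarrow> 0"
 shows "converges_in_distribution P vague_topology X (\<lambda>_. \<mu>)"
proof -
 interpret prob_space P by fact
 have meas: "\<forall>\<^sub>F n in sequentially. X n \<in> P \<rightarrow>\<^sub>M borel_of vague_topology"
  using r m by eventually_elim (rule measurable_vague, auto)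
 have space_borel_of: "space (borel_of vague_topology) = radon_measures"
  unfolding borel_of_def topspace_vague[symmetric] by (intro space_measure_of) (auto dest: openin_subset)
 have limits: "(\<lambda>n. \<integral>\<omega>. \<Phi> (X n \<omega>) \<partial>P) \<longlonglongrightarrow> (\<integral>\<omega>. \<Phi> \<mu> \<partial>P)"
  if \<Phi>: "continuous_map vague_topology euclideanreal \<Phi>" "bounded (\<Phi> ` topspace vague_topology)" for \<Phi>
 proof -
  obtain B where B: "\<And>\<nu>. \<nu> \<in> radon_measures ==> \<bar>\<Phi> \<nu>\<bar> <= B"
   using \<Phi>(2) unfolding bounded_iff topspace_vague by auto
  have B0: "B >= 0" using B[OF \<mu>] by linarith
  have \<Phi>m: "\<Phi> \<in> borel_measurable (borel_of vague_topology)"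
  proof (rule borel_measurableI)
   fix S :: "real set" assume "open S"
   then have "openin vague_topology {\<nu> \<in> topspace vague_topology. \<Phi> \<nu> \<in> S}"
    using \<Phi>(1) by (intro openin_continuous_map_preimage[of _ euclideanreal]) auto
   moreover have "\<Phi> -` S \<inter> space (borel_of vague_topology) = {\<nu> \<in> topspace vague_topology. \<Phi> \<nu> \<in> S}"
    unfolding space_borel_of topspace_vague by auto
   ultimately show "\<Phi> -` S \<inter> space (borel_of vague_topology) \<in> sets (borel_of vague_topology)"
    unfolding borel_of_def by (subst sets_measure_of) (auto dest: openin_subset intro: sigma_sets.Basic)
  qed
  show ?thesis
  proof (rule LIMSEQ_I)
   fix e :: real assume e: "e > 0"
   have "openin vague_topology {\<nu> \<in> topspace vague_topology. \<Phi> \<nu> \<in> ball (\<Phi> \<mu>) (e / 2)}"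
    using \<Phi>(1) by (intro openin_continuous_map_preimage[of _ euclideanreal]) auto
   from vague_nhd_test_integrals[OF this, of \<mu>]
   obtain W where W: "open W" "test_integrals \<mu> \<in> W"
    "\<And>\<nu>. \<nu> \<in> radon_measures ==> test_integrals \<nu> \<in> W ==> \<bar>\<Phi> \<nu> - \<Phi> \<mu>\<bar> < e / 2"
    using \<mu> e by (auto simp: topspace_vague dist_real_def abs_minus_commute)
   have "openin (product_topology (\<lambda>_. euclidean) UNIV) W" using W(1) by (simp add: open_fun_def)
   from product_topology_open_contains_basis[OF this W(2)]
   obtain Y where Y0: "test_integrals \<mu> \<in> (\<Pi>\<^sub>E k\<in>UNIV. Y k)" "\<forall>k. open (Y k)"
    "finite {k. Y k \<noteq> UNIV}" "(\<Pi>\<^sub>E k\<in>UNIV. Y k) \<subseteq> W"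
    unfolding open_openin[symmetric] topspace_euclidean by blast
   then have Y: "test_integrals \<mu> k \<in> Y k" "open (Y k)" "finite {k. Y k \<noteq> UNIV}" for k
    by (auto simp del: split_paired_All)
   have YW: "x \<in> W" if "\<And>k. x k \<in> Y k" for x
    using Y0(4) that by (auto simp del: split_paired_All)
   define K where "K = {k. Y k \<noteq> UNIV}"
   have "\<exists>d>0. \<forall>x. \<bar>x - test_integrals \<mu> k\<bar> < d \<longrightarrow> x \<in> Y k" for k
    using Y(1,2)[of k] unfolding open_real by blast
   then obtain d where d: "\<And>k. d k > 0" "\<And>k x. \<bar>x - test_integrals \<mu> k\<bar> < d k ==> x \<in> Y k" by metis
   define A where "A n k = {\<omega>\<in>space P. \<bar>(\<integral>z. test_fun k z \<partial>X n \<omega>) - (\<integral>z. test_fun k z \<partial>\<mu>)\<bar> >= d k}" for n k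
   have "(\<lambda>n. (2 * B) * (\<Sum>k\<in>K. measure P (A n k))) \<longlonglongrightarrow> (2 * B) * (\<Sum>k\<in>K. 0)"
    unfolding A_def by (intro tendsto_intros c d)
   then have "\<forall>\<^sub>F n in sequentially. (2 * B) * (\<Sum>k\<in>K. measure P (A n k)) < e / 2"
    using e by (intro order_tendstoD) auto
   then have "\<forall>\<^sub>F n in sequentially. norm ((\<integral>\<omega>. \<Phi> (X n \<omega>) \<partial>P) - (\<integral>\<omega>. \<Phi> \<mu> \<partial>P)) < e"
    using meas r m
   proof eventually_elim
    case (elim n)
    note [measurable] = measurable_compose[OF elim(2) \<Phi>m]
    have [measurable]: "(\<lambda>\<omega>. \<integral>z. test_fun k z \<partial>X n \<omega>) \<in> borel_measurable P" for k using elim(4) by blast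
    have Am[measurable]: "A n k \<in> sets P" for k unfolding A_def by measurable
    have i: "integrable P (\<lambda>\<omega>. \<Phi> (X n \<omega>))"
     using elim(3) B by (intro integrable_const_bound[of _ B]) auto
    have iK: "integrable P (indicat_real (A n k))" for k
     by (intro integrable_real_indicator) (auto simp: less_top[symmetric])
    then have iA: "integrable P (\<lambda>\<omega>. e / 2 + (2 * B) * (\<Sum>k\<in>K. indicat_real (A n k) \<omega>))"
     by (intro Bochner_Integration.integrable_add integrable_mult_right Bochner_Integration.integrable_sum) auto
    have bound: "\<bar>\<Phi> (X n \<omega>) - \<Phi> \<mu>\<bar> <= e / 2 + (2 * B) * (\<Sum>k\<in>K. indicat_real (A n k) \<omega>)" if \<omega>: "\<omega> \<in> space P" for \<omega>
    proof (cases "\<exists>k\<in>K. \<omega> \<in> A n k")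
     case True
     then obtain k where "k \<in> K" "\<omega> \<in> A n k" by blast
     then have "indicat_real (A n k) \<omega> <= (\<Sum>k\<in>K. indicat_real (A n k) \<omega>)"
      using Y(3) by (intro member_le_sum) (auto simp: K_def)
     then have "2 * B * 1 <= (2 * B) * (\<Sum>k\<in>K. indicat_real (A n k) \<omega>)"
      using B0 \<open>\<omega> \<in> A n k\<close> by (intro mult_left_mono) auto
     moreover have "\<bar>\<Phi> (X n \<omega>) - \<Phi> \<mu>\<bar> <= 2 * B" using B[OF \<mu>] B[of "X n \<omega>"] elim(3) \<omega> by fastforce
     ultimately show ?thesis using e by linarith
    next
     case False
     have "test_integrals (X n \<omega>) k \<in> Y k" for k
     proof (cases "k \<in> K")
      case True
      then show ?thesis using False \<omega> by (intro d) (auto simp: A_def test_integrals_def not_le)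
     qed (simp add: K_def)
     then have "test_integrals (X n \<omega>) \<in> W" by (rule YW)
     moreover have "X n \<omega> \<in> radon_measures" using elim(3) \<omega> by (rule bspec)
     ultimately have "\<bar>\<Phi> (X n \<omega>) - \<Phi> \<mu>\<bar> < e / 2" by (intro W(3))
     moreover have "(2 * B) * (\<Sum>k\<in>K. indicat_real (A n k) \<omega>) >= 0"
      using B0 by (intro mult_nonneg_nonneg sum_nonneg) auto
     ultimately show ?thesis by linarith
    qed
    have "\<bar>(\<integral>\<omega>. \<Phi> (X n \<omega>) \<partial>P) - (\<integral>\<omega>. \<Phi> \<mu> \<partial>P)\<bar> = \<bar>\<integral>\<omega>. \<Phi> (X n \<omega>) - \<Phi> \<mu> \<partial>P\<bar>"
     using i by (simp add: prob_space)
    also have "\<dots> <= (\<integral>\<omega>. \<bar>\<Phi> (X n \<omega>) - \<Phi> \<mu>\<bar> \<partial>P)" by (rule integral_abs_bound)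
    also have "\<dots> <= (\<integral>\<omega>. e / 2 + (2 * B) * (\<Sum>k\<in>K. indicat_real (A n k) \<omega>) \<partial>P)"
     using i bound iA by (intro integral_mono) auto
    also have "\<dots> = e / 2 + (2 * B) * (\<Sum>k\<in>K. measure P (A n k))"
     using iK by (simp add: prob_space Bochner_Integration.integral_sum Int_absorb1 sets.sets_into_space)
    also have "\<dots> < e" using elim(1) by simp
    finally show ?case by simp
   qed
   then show "\<exists>N. \<forall>n\<ge>N. norm ((\<integral>\<omega>. \<Phi> (X n \<omega>) \<partial>P) - (\<integral>\<omega>. \<Phi> \<mu> \<partial>P)) < e"
    by (simp add: eventually_sequentially)
  qed
 qed
 show ?thesis
  unfolding converges_in_distribution_def
  using meas limits \<mu> by (auto simp: space_borel_of)
qed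

section \<open>The Laplacian of the limiting potential of one level\<close>

definition mirror :: "real \<Rightarrow> real \<Rightarrow> complex \<Rightarrow> complex" where
 "mirror c d z = Complex (c * Re z) (d * Im z)"

definition quadrant :: "complex set" where "quadrant = {z. Re z > 0 \<and> Im z > 0}"

text \<open>\<open>level_p\<close> and the phases are invariant under both reflections, so all
  integrals fold onto the open quadrant with the test function replaced by this sum. The sum is even
  in both coordinates, which kills the boundary terms on the axes.\<close>

definition symm :: "(complex \<Rightarrow> real) \<Rightarrow> complex \<Rightarrow> real" where
 "symm f z = f (mirror 1 1 z) + f (mirror 1 (-1) z) + f (mirror (-1) 1 z) + f (mirror (-1) (-1) z)"

lemma measurable_mirror [measurable]: "mirror c d \<in> borel_measurable borel"
 unfolding mirror_def by measurable

lemma measurable_quadrant [measurable]: "quadrant \<in> sets borel"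
proof -
 have "open quadrant" unfolding quadrant_def by (intro open_Collect_conj open_Collect_less continuous_intros)
 then show ?thesis by auto
qed

lemma lborel_mirror:
 assumes "c = 1 \<or> c = -1" "d = 1 \<or> d = -1"
 shows "distr lborel borel (mirror c d) = lborel"
proof -
 have "(lborel :: complex measure) = density (distr lborel borel (\<lambda>x. 0 + (\<Sum>j\<in>Basis. ((if j = 1 then c else d) * (x \<bullet> j)) *\<^sub>R j)))
   (\<lambda>_. ennreal (\<Prod>j\<in>(Basis :: complex set). \<bar>if j = 1 then c else d\<bar>))"
  by (rule lborel_affine_euclidean) (use assms in auto)
 also have "(\<lambda>x. 0 + (\<Sum>j\<in>Basis. ((if j = 1 then c else d) * (x \<bullet> j)) *\<^sub>R j)) = mirror c d"
  by (auto simp: fun_eq_iff mirror_def Basis_complex_def complex_eq_iff)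
 also have "(\<Prod>j\<in>(Basis :: complex set). \<bar>if j = 1 then c else d\<bar>) = 1"
  using assms by (auto simp: Basis_complex_def)
 finally show ?thesis by (simp add: density_1)
qed

lemma integral_mirror:
 fixes f :: "complex \<Rightarrow> real"
 assumes "c = 1 \<or> c = -1" "d = 1 \<or> d = -1" and f: "integrable lborel f"
 shows "integrable lborel (\<lambda>z. f (mirror c d z))" "(LBINT z. f (mirror c d z)) = (LBINT z. f z)"
proof -
 have [measurable]: "f \<in> borel_measurable borel" using f by auto
 have "integrable (distr lborel borel (mirror c d)) f" using f by (simp add: lborel_mirror assms)
 then show "integrable lborel (\<lambda>z. f (mirror c d z))" by (subst (asm) integrable_distr_eq) auto
 have "(LBINT z. f z) = (\<integral>z. f z \<partial>distr lborel borel (mirror c d))" by (simp add: lborel_mirror assms)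
 also have "\<dots> = (LBINT z. f (mirror c d z))" by (subst integral_distr) auto
 finally show "(LBINT z. f (mirror c d z)) = (LBINT z. f z)" ..
qed

lemma integral_quadrant:
 assumes f: "integrable lborel f"
 shows "integrable lborel (\<lambda>z. indicator quadrant z * symm f z)"
  and "(LBINT z. f z) = (LBINT z. indicator quadrant z * symm f z)"
proof -
 have i: "integrable lborel (\<lambda>z. indicator quadrant (mirror c d z) * f z)" for c d
 proof -
  have "integrable lborel (\<lambda>z. indicator {z. mirror c d z \<in> quadrant} z *\<^sub>R f z)"
   by (intro integrable_mult_indicator f) (simp add: pred_def)
  then show ?thesis by (simp add: indicator_def)
 qed
 have e: "integrable lborel (\<lambda>z. indicator quadrant z * f (mirror c d z))"
  "(LBINT z. indicator quadrant (mirror c d z) * f z) = (LBINT z. indicator quadrant z * f (mirror c d z))"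
  if "c = 1 \<or> c = -1" "d = 1 \<or> d = -1" for c d
 proof -
  have "mirror c d (mirror c d z) = z" for z using that by (auto simp: mirror_def complex_eq_iff)
  then show "integrable lborel (\<lambda>z. indicator quadrant z * f (mirror c d z))"
   "(LBINT z. indicator quadrant (mirror c d z) * f z) = (LBINT z. indicator quadrant z * f (mirror c d z))"
   using integral_mirror[OF that i[of c d]] by simp_all
 qed
 have s: "(\<lambda>z. indicator quadrant z * symm f z) = (\<lambda>z. indicator quadrant z * f (mirror 1 1 z) + indicator quadrant z * f (mirror 1 (-1) z)
   + indicator quadrant z * f (mirror (-1) 1 z) + indicator quadrant z * f (mirror (-1) (-1) z))"
  by (simp add: symm_def algebra_simps)
 show "integrable lborel (\<lambda>z. indicator quadrant z * symm f z)"
  unfolding s by (intro Bochner_Integration.integrable_add e) auto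
 have "(LBINT z. f z) = (LBINT z. indicator quadrant (mirror 1 1 z) * f z + indicator quadrant (mirror 1 (-1) z) * f z
   + indicator quadrant (mirror (-1) 1 z) * f z + indicator quadrant (mirror (-1) (-1) z) * f z)"
 proof (rule integral_cong_AE)
  show "AE z in lborel. f z = indicator quadrant (mirror 1 1 z) * f z + indicator quadrant (mirror 1 (-1) z) * f z
   + indicator quadrant (mirror (-1) 1 z) * f z + indicator quadrant (mirror (-1) (-1) z) * f z"
   using AE_Re_neq[of 0] AE_Im_neq[of 0]
   by eventually_elim (auto simp: quadrant_def mirror_def indicator_def)
 qed (use f in measurable)
 also have "\<dots> = (LBINT z. indicator quadrant (mirror 1 1 z) * f z) + (LBINT z. indicator quadrant (mirror 1 (-1) z) * f z)
   + (LBINT z. indicator quadrant (mirror (-1) 1 z) * f z) + (LBINT z. indicator quadrant (mirror (-1) (-1) z) * f z)"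
  using i by simp
 also have "\<dots> = (LBINT z. indicator quadrant z * symm f z)"
  unfolding s by (simp add: e)
 finally show "(LBINT z. f z) = (LBINT z. indicator quadrant z * symm f z)" .
qed

lemma C2_on_mirror:
 assumes \<phi>: "C2_on UNIV \<phi> \<phi>x \<phi>y \<phi>xx \<phi>yy" and cd: "c = 1 \<or> c = -1" "d = 1 \<or> d = -1"
 shows "C2_on UNIV (\<lambda>z. \<phi> (mirror c d z)) (\<lambda>z. c * \<phi>x (mirror c d z)) (\<lambda>z. d * \<phi>y (mirror c d z))
  (\<lambda>z. \<phi>xx (mirror c d z)) (\<lambda>z. \<phi>yy (mirror c d z))"
proof -
 have c: "continuous_on UNIV (\<lambda>z. f (mirror c d z))" if "continuous_on UNIV f" for f :: "complex \<Rightarrow> real"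
  unfolding mirror_def by (rule continuous_on_compose2[OF that]) (auto intro!: continuous_intros)
 have m: "((\<lambda>x. f (e * x)) has_real_derivative e * D) (at x)" if "(f has_real_derivative D) (at (e * x))" for f D e and x :: real
  using DERIV_chain2[OF that DERIV_cmult_Id] by (simp add: mult_ac)
 have cc: "c * c = 1" "d * d = 1" using cd by auto
 have d1: "((\<lambda>x. \<phi> (mirror c d (Complex x (Im z)))) has_real_derivative c * \<phi>x (mirror c d z)) (at (Re z))"
  "((\<lambda>y. \<phi> (mirror c d (Complex (Re z) y))) has_real_derivative d * \<phi>y (mirror c d z)) (at (Im z))"
  "((\<lambda>x. \<phi>x (mirror c d (Complex x (Im z)))) has_real_derivative c * \<phi>xx (mirror c d z)) (at (Re z))"
  "((\<lambda>y. \<phi>y (mirror c d (Complex (Re z) y))) has_real_derivative d * \<phi>yy (mirror c d z)) (at (Im z))" for z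
  using C2_onD(6-9)[OF \<phi>, of "c * Re z" "d * Im z"] unfolding mirror_def by (auto intro!: m)
 have d2: "((\<lambda>x. c * \<phi>x (mirror c d (Complex x (Im z)))) has_real_derivative \<phi>xx (mirror c d z)) (at (Re z))"
  "((\<lambda>y. d * \<phi>y (mirror c d (Complex (Re z) y))) has_real_derivative \<phi>yy (mirror c d z)) (at (Im z))" for z
  using DERIV_cmult[OF d1(3)[of z], of c] DERIV_cmult[OF d1(4)[of z], of d] by (simp_all add: mult.assoc[symmetric] cc)
 show ?thesis
  unfolding C2_on_def using d1 d2 by (auto intro!: continuous_intros c C2_onD(1-5)[OF \<phi>])
qed

text \<open>Two integrations by parts on each of \<open>[0, S]\<close>, \<open>[S, S2]\<close> and
  \<open>[S2, M]\<close>, where \<open>q\<close> is a quadratic \<open>A\<close>, a quadratic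
  \<open>B\<close> and an affine \<open>D\<close>. The matching conditions leave only the jumps of
  the first derivative at \<open>S\<close> and \<open>S2\<close>; the terms at 0 vanish because
  \<open>f1 0 = 0\<close> and \<open>A1 0 = 0\<close>, those at \<open>M\<close> by support.
  Intervals may degenerate, which covers lines that miss a phase.\<close>

lemma kink_integral:
 fixes f f1 f2 q A A1 B B1 D D1 :: "real \<Rightarrow> real"
 assumes qm[measurable]: "q \<in> borel_measurable borel"
  and f: "\<And>x. (f has_real_derivative f1 x) (at x)" "\<And>x. (f1 has_real_derivative f2 x) (at x)"
  and c: "continuous_on UNIV f2" and f0: "f1 0 = 0" and S: "0 <= S" "S <= S2" "S2 <= M"
  and M: "\<And>x. x >= M ==> f x = 0" "\<And>x. x >= M ==> f1 x = 0" "\<And>x. x >= M ==> f2 x = 0"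
  and A: "\<And>x. (A has_real_derivative A1 x) (at x)" "\<And>x. (A1 has_real_derivative kA) (at x)"
  and B: "\<And>x. (B has_real_derivative B1 x) (at x)" "\<And>x. (B1 has_real_derivative kB) (at x)"
  and D: "\<And>x. (D has_real_derivative D1 x) (at x)" "\<And>x. (D1 has_real_derivative 0) (at x)"
  and A0: "A1 0 = 0" and AB: "A S = B S" and BD: "B S2 = D S2"
  and q: "\<And>x. 0 < x ==> x < S ==> q x = A x" "\<And>x. S < x ==> x < S2 ==> q x = B x" "\<And>x. S2 < x ==> q x = D x"
 shows "(LBINT x. indicator {0<..} x * (q x * f2 x)) = (B1 S - A1 S) * f S + (D1 S2 - B1 S2) * f S2
  + kA * (LBINT x. indicator {0<..<S} x * f x) + kB * (LBINT x. indicator {S<..<S2} x * f x)"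
proof -
 have cf: "continuous_on X f" "continuous_on X f2" for X
  using continuous_at_imp_continuous_on[of X f] DERIV_isCont[OF f(1)] continuous_on_subset[OF c] by auto
 have piece: "has_bochner_integral lborel (\<lambda>x. (H x * f2 x - k * f x) * indicator {u..v} x)
   ((H v * f1 v - H1 v * f v) - (H u * f1 u - H1 u * f u))" "integrable lborel (\<lambda>x. (H x * f2 x) * indicator {u..v} x)"
  "integrable lborel (\<lambda>x. f x * indicator {u..v} x)"
  if H: "\<And>x. (H has_real_derivative H1 x) (at x)" "\<And>x. (H1 has_real_derivative k) (at x)" and "u <= v" for H H1 k u v
 proof -
  have cH: "continuous_on X H" for X
   using H(1) by (auto intro!: continuous_at_imp_continuous_on DERIV_isCont)
  show "has_bochner_integral lborel (\<lambda>x. (H x * f2 x - k * f x) * indicator {u..v} x)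
   ((H v * f1 v - H1 v * f v) - (H u * f1 u - H1 u * f u))"
  proof (rule has_bochner_integral_FTC_Icc_real[OF \<open>u <= v\<close>])
   show "((\<lambda>x. H x * f1 x - H1 x * f x) has_real_derivative H x * f2 x - k * f x) (at x)" for x
    using H f by (auto intro!: derivative_eq_intros simp: algebra_simps)
   show "isCont (\<lambda>x. H x * f2 x - k * f x) x" for x
    using cH[of UNIV] cf[of UNIV] by (auto simp: continuous_on_eq_continuous_at intro!: continuous_intros)
  qed
  show "integrable lborel (\<lambda>x. (H x * f2 x) * indicator {u..v} x)" "integrable lborel (\<lambda>x. f x * indicator {u..v} x)"
   using borel_integrable_compact[of "{u..v}" "\<lambda>x. H x * f2 x"] borel_integrable_compact[of "{u..v}" f] cH cf
   by (auto simp: mult.commute intro!: continuous_intros)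
 qed
 have split: "(LBINT x. H x * f2 x * indicator {u..v} x) = (H v * f1 v - H1 v * f v) - (H u * f1 u - H1 u * f u) + k * (LBINT x. f x * indicator {u..v} x)"
  if H: "\<And>x. (H has_real_derivative H1 x) (at x)" "\<And>x. (H1 has_real_derivative k) (at x)" and "u <= v" for H H1 k u v
 proof -
  have "(LBINT x. H x * f2 x * indicator {u..v} x - k * (f x * indicator {u..v} x)) = (H v * f1 v - H1 v * f v) - (H u * f1 u - H1 u * f u)"
   using piece(1)[OF that] by (simp add: has_bochner_integral_iff left_diff_distrib mult.assoc)
  then show ?thesis using piece(2,3)[OF that] by simp
 qed
 have ind: "(LBINT x. indicator {u<..<v} x * f x) = (LBINT x. f x * indicator {u..v} x)" for u v :: real
 proof (rule integral_cong_AE)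
  have "f \<in> borel_measurable borel" using cf(1)[of UNIV] by (rule borel_measurable_continuous_onI)
  then show "(\<lambda>x. indicator {u<..<v} x * f x) \<in> borel_measurable lborel" "(\<lambda>x. f x * indicator {u..v} x) \<in> borel_measurable lborel"
   by measurable
  show "AE x in lborel. indicator {u<..<v} x * f x = f x * indicator {u..v} x"
   using AE_lborel_singleton[of u] AE_lborel_singleton[of v] by eventually_elim (auto simp: indicator_def)
 qed
 note iA = piece(2)[OF A S(1)] and iB = piece(2)[OF B S(2)] and iD = piece(2)[OF D S(3)]
 have "(LBINT x. indicator {0<..} x * (q x * f2 x))
   = (LBINT x. A x * f2 x * indicator {0..S} x + B x * f2 x * indicator {S..S2} x + D x * f2 x * indicator {S2..M} x)"
 proof -
  have ae: "AE x in lborel. A x * f2 x * indicator {0..S} x + B x * f2 x * indicator {S..S2} x + D x * f2 x * indicator {S2..M} x = indicator {0<..} x * (q x * f2 x)"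
   using AE_lborel_singleton[of 0] AE_lborel_singleton[of S] AE_lborel_singleton[of S2] AE_lborel_singleton[of M]
  proof eventually_elim
   case (elim x)
   consider "x < 0" | "0 < x" "x < S" | "S < x" "x < S2" | "S2 < x" "x < M" | "M < x" using elim S by linarith
   then show ?case using S q[of x] M(3)[of x] by cases (auto simp: indicator_def)
  qed
  have [measurable]: "f2 \<in> borel_measurable borel" using c by (rule borel_measurable_continuous_onI)
  show ?thesis
  proof (rule integral_cong_AE[OF _ _ AE_symmetric[OF ae]])
   show "(\<lambda>x. indicator {0<..} x * (q x * f2 x)) \<in> borel_measurable lborel" by measurable
  qed (intro borel_measurable_integrable Bochner_Integration.integrable_add iA iB iD)
 qed
 also have "\<dots> = (LBINT x. A x * f2 x * indicator {0..S} x) + (LBINT x. B x * f2 x * indicator {S..S2} x) + (LBINT x. D x * f2 x * indicator {S2..M} x)"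
  using iA iB iD by simp
 also have "\<dots> = (B1 S - A1 S) * f S + (D1 S2 - B1 S2) * f S2
  + kA * (LBINT x. indicator {0<..<S} x * f x) + kB * (LBINT x. indicator {S<..<S2} x * f x)"
  unfolding split[OF A S(1)] split[OF B S(2)] split[OF D S(3)] ind using M[of M] f0 A0 AB BD by (simp add: algebra_simps)
 finally show ?thesis .
qed

section \<open>Geometry of the phases of one level\<close>

locale level =
 fixes a \<alpha> :: real
 assumes a: "a > 0" and \<alpha>: "\<alpha> > 1"
begin

definition s :: real where "s = crit a \<alpha>"

lemma s_pos: "s > 0" using crit_pos[OF a \<alpha>] by (simp add: s_def)

lemma ln_\<alpha>: "ln \<alpha> = a * s^2 / 2" using a \<alpha> by (simp add: s_def crit_def)

lemma sqrt_aln: "sqrt (2 * a * ln \<alpha>) = a * s"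
proof -
 have "2 * a * ln \<alpha> = (a * s)^2" by (simp add: ln_\<alpha> power2_eq_square)
 then show ?thesis using a s_pos by simp
qed

lemma level_p_E: "b \<in> phase_E s ==> level_p a \<alpha> b = a * s^2 / 2 + a / 2 * ((Re b)^2 - (Im b)^2)"
 using level_p_closures(3)[OF a \<alpha>, of b] closure_subset[of "phase_E s"] by (auto simp: s_def[symmetric] ln_\<alpha>)

lemma level_p_F: "2 * \<bar>Re b\<bar> <= s ==> 2 * ((Re b)^2 + (Im b)^2) >= s^2 ==> level_p a \<alpha> b = a * s^2 / 4 + a * (Re b)^2"
 using level_p_closures(2)[OF a \<alpha>, of b] closure_phase_F[OF s_pos] by (simp add: s_def[symmetric] ln_\<alpha>)

lemma level_p_G: "2 * \<bar>Re b\<bar> >= s ==> \<bar>Re b\<bar> + \<bar>Im b\<bar> >= s ==> level_p a \<alpha> b = a * s * \<bar>Re b\<bar>"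
 using level_p_closures(1)[OF a \<alpha>, of b] closure_phase_G[OF s_pos] by (simp add: s_def[symmetric] sqrt_aln)

lemma continuous_level_p: "continuous_on UNIV (level_p a \<alpha>)"
proof -
 note cl = level_p_closures[OF a \<alpha>]
 have "continuous_on (closure (phase_G s)) (level_p a \<alpha>)"
  by (rule continuous_on_eq[of _ "\<lambda>b. \<bar>Re b\<bar> * sqrt (2 * a * ln \<alpha>)"]) (auto simp: cl s_def intro!: continuous_intros)
 moreover have "continuous_on (closure (phase_F s)) (level_p a \<alpha>)"
  by (rule continuous_on_eq[of _ "\<lambda>b. ln \<alpha> / 2 + a * (Re b)^2"]) (auto simp: cl s_def intro!: continuous_intros)
 moreover have "continuous_on (closure (phase_E s)) (level_p a \<alpha>)"
  by (rule continuous_on_eq[of _ "\<lambda>b. ln \<alpha> + a / 2 * ((Re b)^2 - (Im b)^2)"]) (auto simp: cl s_def intro!: continuous_intros)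
 ultimately have "continuous_on (closure (phase_G s) \<union> closure (phase_F s) \<union> closure (phase_E s)) (level_p a \<alpha>)"
  by (intro continuous_on_closed_Un) auto
 moreover have "closure (phase_G s) \<union> closure (phase_F s) \<union> closure (phase_E s) = UNIV"
  using closure_subset[of "phase_E s"] unfolding phase_E_def closure_Un by auto
 ultimately show ?thesis by simp
qed

text \<open>The right boundary of phase E in the quadrant as a graph over the imaginary part: a
  segment up to height \<open>s / 2\<close>, then the arc, then 0 on lines that pass above the arc.
  \<open>T_bd\<close> describes the same curve as a graph over the real part.\<close>

definition S_bd :: "real \<Rightarrow> real" where
 "S_bd y = (if y <= s / 2 then s - y else sqrt (max 0 (s^2 / 2 - y^2)))"

definition T_bd :: "real \<Rightarrow> real" where
 "T_bd x = (if x < s / 2 then sqrt (s^2 / 2 - x^2) else max 0 (s - x))"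

lemma S_bd_nonneg: "S_bd y >= 0" using s_pos by (auto simp: S_bd_def)

lemma S_bd_upper: "y > s / 2 ==> S_bd y <= s / 2"
proof -
 assume y: "y > s / 2"
 then have "(s / 2)^2 <= y^2" using s_pos by (intro power_mono) auto
 then have "max 0 (s^2 / 2 - y^2) <= (s / 2)^2" by (auto simp: power_divide max_def)
 then have "sqrt (max 0 (s^2 / 2 - y^2)) <= s / 2" using s_pos by (intro real_le_lsqrt) auto
 then show ?thesis using y by (simp add: S_bd_def)
qed

lemma phase_E_quadrant: "0 < x ==> 0 < y ==> Complex x y \<in> phase_E s \<longleftrightarrow> (2 * x < s \<or> x + y < s) \<and> (2 * x > s \<or> x\<^sup>2 + y^2 < s^2 / 2)"
 by (auto simp: phase_E_iff[OF s_pos])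

text \<open>Add \<open>2 * x^2 <= x * s\<close> and \<open>2 * y^2 <= y * s\<close>, and use
  \<open>(x + y) * s <= s^2\<close>. Hence the square of side \<open>s / 2\<close> lies in the disc
  bounded by the arc, which settles the phase of points of the strip below height
  \<open>s / 2\<close>.\<close>

lemma half_circle:
 assumes "0 < x" "0 < y" "2 * x <= s"
 shows "2 * y <= s ==> x + y < s ==> x\<^sup>2 + y^2 < s^2 / 2"
  and "2 * y <= s ==> x\<^sup>2 + y^2 <= s^2 / 2"
proof -
 assume y: "2 * y <= s"
 have *: "x * (2 * x) <= x * s" "y * (2 * y) <= y * s" using assms y by (intro mult_left_mono; simp)+
 have "(x + y) * s <= s * s" using assms y s_pos by (intro mult_right_mono) auto
 with * show "x^2 + y^2 <= s^2 / 2" by (simp add: square_simps)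
 assume "x + y < s"
 then have "(x + y) * s < s * s" using s_pos by (intro mult_strict_right_mono) auto
 with * show "x^2 + y^2 < s^2 / 2" by (simp add: square_simps)
qed

lemma sq_lt: "0 <= x ==> 0 <= y ==> x\<^sup>2 < y^2 \<longleftrightarrow> x < (y::real)"
 by (metis power2_less_imp_less power_strict_mono zero_less_numeral)

lemma less_sqrt_iff: "0 <= x ==> x < sqrt t \<longleftrightarrow> x\<^sup>2 < t"
 using real_sqrt_less_iff[of "x^2" t] by simp

lemma sqrt_less_iff: "0 <= x ==> sqrt t < x \<longleftrightarrow> t < x^2"
 using real_sqrt_less_iff[of t "x^2"] by simp

lemma S_bd_E: "0 < x ==> 0 < y ==> x < S_bd y \<longleftrightarrow> Complex x y \<in> phase_E s"
proof -
 assume p: "0 < x" "0 < y"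
 show ?thesis
 proof (cases "y <= s / 2")
  case True
  then show ?thesis unfolding phase_E_quadrant[OF p] S_bd_def using half_circle(1)[of x y] p
   by (cases "2 * x <= s") auto
 next
  case False
  have y2: "(s / 2)^2 < y^2" using False s_pos by (intro power_strict_mono) auto
  have "x < S_bd y \<longleftrightarrow> x\<^sup>2 < max 0 (s^2 / 2 - y^2)"
   using False p by (simp add: S_bd_def less_sqrt_iff)
  also have "\<dots> \<longleftrightarrow> x\<^sup>2 + y^2 < s^2 / 2" using p by (auto simp: less_max_iff_disj)
  also have "\<dots> \<longleftrightarrow> Complex x y \<in> phase_E s"
  proof
   assume *: "x^2 + y^2 < s^2 / 2"
   then have "x^2 < (s / 2)^2" using y2 by (simp add: power_divide)
   then have "x < s / 2" using p s_pos by (subst (asm) sq_lt) auto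
   then show "Complex x y \<in> phase_E s" unfolding phase_E_quadrant[OF p] using * by auto
  next
   assume "Complex x y \<in> phase_E s"
   then show "x^2 + y^2 < s^2 / 2" using False unfolding phase_E_quadrant[OF p] by auto
  qed
  finally show ?thesis .
 qed
qed

lemma S_bd_F: "0 < x ==> 0 < y ==> S_bd y < x \<and> x < s / 2 \<longleftrightarrow> Complex x y \<in> phase_F s"
proof -
 assume p: "0 < x" "0 < y"
 have F: "Complex x y \<in> phase_F s \<longleftrightarrow> x < s / 2 \<and> x\<^sup>2 + y^2 > s\<^sup>2 / 2" using p by (auto simp: phase_F_def)
 show ?thesis
 proof (cases "y <= s / 2")
  case True
  then show ?thesis unfolding F S_bd_def using half_circle(2)[of x y] p by force
 next
  case False
  have "S_bd y < x \<longleftrightarrow> max 0 (s^2 / 2 - y^2) < x^2"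
   using False p by (simp add: S_bd_def sqrt_less_iff del: max_less_iff_conj)
  also have "\<dots> \<longleftrightarrow> x\<^sup>2 + y^2 > s\<^sup>2 / 2" using p by auto
  finally show ?thesis unfolding F by auto
 qed
qed

lemma T_bd_nonneg: "x > 0 ==> T_bd x >= 0"
proof -
 assume x: "x > 0"
 have "0 <= s^2 / 2 - x^2" if "x < s / 2"
 proof -
  have "x^2 <= (s / 2)^2" using x that by (intro power_mono) auto
  then have "x^2 <= s^2 / 4" by (simp add: power_divide)
  then show ?thesis using zero_le_power2[of s] by linarith
 qed
 then show ?thesis by (auto simp: T_bd_def)
qed

lemma T_bd_E: "0 < x ==> 0 < y ==> y < T_bd x \<longleftrightarrow> Complex x y \<in> phase_E s"
proof -
 assume p: "0 < x" "0 < y"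
 consider "x < s / 2" | "x = s / 2" | "x > s / 2" by linarith
 then show ?thesis
 proof cases
  case 1
  then have "y < T_bd x \<longleftrightarrow> y\<^sup>2 < s^2 / 2 - x^2"
   using p by (simp add: T_bd_def less_sqrt_iff)
  then show ?thesis unfolding phase_E_quadrant[OF p] using 1 by auto
 next
  case 2
  have "x^2 + y^2 < s^2 / 2 \<longleftrightarrow> y\<^sup>2 < (s / 2)^2" by (auto simp: 2 power_divide)
  also have "\<dots> \<longleftrightarrow> y < s / 2" using p s_pos by (intro sq_lt) auto
  finally have k: "x^2 + y^2 < s^2 / 2 \<longleftrightarrow> y < s / 2" .
  have T: "T_bd x = s / 2" using 2 s_pos by (simp add: T_bd_def)
  show ?thesis unfolding phase_E_quadrant[OF p] T k using 2 by auto
 next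
  case 3
  then show ?thesis unfolding phase_E_quadrant[OF p] using p s_pos by (auto simp: T_bd_def)
 qed
qed

lemma level_p_above_T: "0 < x ==> 0 < y ==> T_bd x < y ==>
  level_p a \<alpha> (Complex x y) = (if x < s / 2 then a * s^2 / 4 + a * x^2 else a * s * x)"
proof -
 assume p: "0 < x" "0 < y" "T_bd x < y"
 show ?thesis
 proof (cases "x < s / 2")
  case True
  have "sqrt (s^2 / 2 - x^2) < y" using p True by (simp add: T_bd_def)
  then have "s^2 / 2 - x^2 < y^2" using p by (simp add: sqrt_less_iff)
  then show ?thesis using True p by (subst level_p_F) auto
 next
  case False
  then show ?thesis using p by (subst level_p_G) (auto simp: T_bd_def)
 qed
qed

lemma level_p_beyond_S: "0 < x ==> 0 < y ==> S_bd y < x ==> s / 2 < x ==> level_p a \<alpha> (Complex x y) = a * s * x"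
proof (cases "y <= s / 2")
 assume p: "0 < x" "0 < y" "S_bd y < x" "s / 2 < x"
 case True
 then show ?thesis using p by (subst level_p_G) (auto simp: S_bd_def)
next
 assume p: "0 < x" "0 < y" "S_bd y < x" "s / 2 < x"
 case False
 then show ?thesis using p by (subst level_p_G) auto
qed

definition rad :: real where "rad = s / sqrt 2"

end

lemma integrable_complex_slices:
 fixes f :: "complex \<Rightarrow> real"
 assumes f: "integrable lborel f"
 shows "integrable lborel (\<lambda>x. \<integral>y. f (Complex x y) \<partial>lborel)"
  and "integrable lborel (\<lambda>y. \<integral>x. f (Complex x y) \<partial>lborel)"
proof -
 have "integrable (distr (lborel \<Otimes>\<^sub>M lborel) borel (\<lambda>(x, y). Complex x y)) f"
  using f unfolding lborel_complex .
 then have i: "integrable (lborel \<Otimes>\<^sub>M lborel) (\<lambda>(x, y). f (Complex x y))"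
  using f by (subst (asm) integrable_distr_eq) (auto simp: case_prod_beta')
 show "integrable lborel (\<lambda>x. \<integral>y. f (Complex x y) \<partial>lborel)"
  using lborel_pair.integrable_fst'[OF i] by simp
 show "integrable lborel (\<lambda>y. \<integral>x. f (Complex x y) \<partial>lborel)"
  using lborel_pair.integrable_snd[OF i] by simp
qed

context level
begin

text \<open>Fubini reduces both statements to \<open>kink_integral\<close>. Along horizontal lines
  the derivative of \<open>level_p\<close> jumps by \<open>a * y\<close> from E to G, by
  \<open>a * S_bd y\<close> from E to F, and not at all from F to G. Along vertical lines
  \<open>level_p\<close> is constant beyond \<open>T_bd x\<close>, and its derivative jumps there by
  \<open>a * T_bd x\<close>. The second derivatives are \<open>a\<close> and \<open>2 * a\<close>
  horizontally in E and F, and \<open>- a\<close> vertically in E, so that E cancels in the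
  sum.\<close>

lemma \<psi>_facts:
 assumes \<psi>: "C2_on UNIV \<psi> \<psi>x \<psi>y \<psi>xx \<psi>yy" and R: "\<And>z. norm z > R ==> \<psi> z = 0"
  and even: "\<And>y. \<psi>x (Complex 0 y) = 0" "\<And>x. \<psi>y (Complex x 0) = 0"
 shows level_p_dxx: "(LBINT z. indicator quadrant z * (level_p a \<alpha> z * \<psi>xx z)) =
   (LBINT y. indicator {0<..} y * ((if y <= s / 2 then a * y else a * S_bd y) * \<psi> (Complex (S_bd y) y)))
   + a * (LBINT z. indicator (quadrant \<inter> phase_E s) z * \<psi> z) + 2 * a * (LBINT z. indicator (quadrant \<inter> phase_F s) z * \<psi> z)"
  and level_p_dyy: "(LBINT z. indicator quadrant z * (level_p a \<alpha> z * \<psi>yy z)) =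
   (LBINT x. indicator {0<..} x * (a * T_bd x * \<psi> (Complex x (T_bd x))))
   - a * (LBINT z. indicator (quadrant \<inter> phase_E s) z * \<psi> z)"
proof -
 let ?p = "level_p a \<alpha>"
 note s_pos[simp]
 define M where "M = \<bar>R\<bar> + s + 1"
 have M: "M > s" "M > R" using s_pos abs_ge_self[of R] unfolding M_def by linarith+
 have big: "norm (Complex x y) > R" if "x >= M \<or> y >= M" for x y
  using that M abs_Re_le_cmod[of "Complex x y"] abs_Im_le_cmod[of "Complex x y"] s_pos by auto
 have zero: "\<psi> (Complex x y) = 0" "\<psi>x (Complex x y) = 0" "\<psi>y (Complex x y) = 0" "\<psi>xx (Complex x y) = 0" "\<psi>yy (Complex x y) = 0"
  if "x >= M \<or> y >= M" for x y
  using C2_support[OF \<psi>, of R "Complex x y"] R R[of "Complex x y"] big[OF that] by auto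
 have supp: "\<psi>xx z = 0" "\<psi>yy z = 0" if "norm z > R" for z
  using C2_support[OF \<psi>, of R z] R that by auto
 note d = C2_onD(6-9)[OF \<psi>, simplified]
 have cc: "continuous_on UNIV (\<lambda>x. f (Complex x y))" "continuous_on UNIV (\<lambda>x. f (Complex y x))"
  if "continuous_on UNIV f" for f :: "complex \<Rightarrow> real" and y
  by (rule continuous_on_compose2[OF that]; auto intro!: continuous_intros)+
 have pm: "(\<lambda>x. ?p (Complex x y)) \<in> borel_measurable borel" "(\<lambda>x. ?p (Complex y x)) \<in> borel_measurable borel" for y
  using cc[OF continuous_level_p] by (auto intro: borel_measurable_continuous_onI)
 have i\<psi>: "integrable lborel \<psi>" using C2_onD(1)[OF \<psi>] R by (rule integrable_cont_compact_support)
 have [measurable]: "phase_E s \<in> sets borel" "phase_F s \<in> sets borel" using open_phases by auto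
 have iE: "integrable lborel (\<lambda>z. indicator (quadrant \<inter> phase_E s) z * \<psi> z)"
  using integrable_mult_indicator[OF _ i\<psi>, of "quadrant \<inter> phase_E s"] by simp
 have iF: "integrable lborel (\<lambda>z. indicator (quadrant \<inter> phase_F s) z * \<psi> z)"
  using integrable_mult_indicator[OF _ i\<psi>, of "quadrant \<inter> phase_F s"] by simp
 have ixx: "integrable lborel (\<lambda>z. indicator quadrant z * (?p z * \<psi>xx z))"
 proof -
  have "integrable lborel (\<lambda>z. ?p z * \<psi>xx z)"
   by (rule integrable_cont_compact_support[of _ R]) (auto simp: supp intro!: continuous_intros continuous_level_p C2_onD[OF \<psi>])
  from integrable_mult_indicator[OF _ this, of quadrant] show ?thesis by simp
 qed
 have iyy: "integrable lborel (\<lambda>z. indicator quadrant z * (?p z * \<psi>yy z))"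
 proof -
  have "integrable lborel (\<lambda>z. ?p z * \<psi>yy z)"
   by (rule integrable_cont_compact_support[of _ R]) (auto simp: supp intro!: continuous_intros continuous_level_p C2_onD[OF \<psi>])
  from integrable_mult_indicator[OF _ this, of quadrant] show ?thesis by simp
 qed
 have linear: "((\<lambda>x. c * x^2 + e) has_real_derivative 2 * c * x) (at x)" "((\<lambda>x. c * x) has_real_derivative c) (at x)"
  "((\<lambda>x. c) has_real_derivative 0) (at x)" for c e x :: real
  by (auto intro!: derivative_eq_intros)
 have sliceE: "(LBINT x. indicator {0<..<S_bd y} x * \<psi> (Complex x y)) = (LBINT x. indicator (quadrant \<inter> phase_E s) (Complex x y) * \<psi> (Complex x y))" if "y > 0" for y
  by (intro Bochner_Integration.integral_cong refl) (use that S_bd_E[of _ y] in \<open>auto simp: indicator_def quadrant_def\<close>)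
 have sliceF: "(LBINT x. indicator {S_bd y<..<s / 2} x * \<psi> (Complex x y)) = (LBINT x. indicator (quadrant \<inter> phase_F s) (Complex x y) * \<psi> (Complex x y))" if "y > 0" for y
 proof (intro Bochner_Integration.integral_cong refl)
  fix x
  show "indicator {S_bd y<..<s / 2} x * \<psi> (Complex x y) = indicator (quadrant \<inter> phase_F s) (Complex x y) * \<psi> (Complex x y)"
  proof (cases "0 < x")
   case True
   then show ?thesis using S_bd_F[OF True that] that by (auto simp: indicator_def quadrant_def)
  next
   case False
   then show ?thesis using S_bd_nonneg[of y] by (auto simp: indicator_def quadrant_def)
  qed
 qed
 have sliceE': "(LBINT y. indicator {0<..<T_bd x} y * \<psi> (Complex x y)) = (LBINT y. indicator (quadrant \<inter> phase_E s) (Complex x y) * \<psi> (Complex x y))" if "x > 0" for x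
  by (intro Bochner_Integration.integral_cong refl) (use that T_bd_E[of x] in \<open>auto simp: indicator_def quadrant_def\<close>)
 have pE: "?p (Complex x y) = a / 2 * x^2 + (a * s^2 / 2 - a / 2 * y^2)" "?p (Complex x y) = (- a / 2) * y^2 + (a * s^2 / 2 + a / 2 * x^2)"
  if "Complex x y \<in> phase_E s" for x y
  using level_p_E[OF that] by (auto simp: algebra_simps)
 have pF: "?p (Complex x y) = a * x^2 + a * s^2 / 4" if "Complex x y \<in> phase_F s" for x y
  using that by (subst level_p_F) (auto simp: phase_F_def)
 have x1: "(LBINT x. indicator {0<..} x * (?p (Complex x y) * \<psi>xx (Complex x y))) =
   (if y <= s / 2 then a * y else a * S_bd y) * \<psi> (Complex (S_bd y) y)
   + a * (LBINT x. indicator {0<..<S_bd y} x * \<psi> (Complex x y)) + 2 * a * (LBINT x. indicator {S_bd y<..<s / 2} x * \<psi> (Complex x y))"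
  if y: "y > 0" for y
 proof -
  let ?A = "\<lambda>x. a / 2 * x^2 + (a * s^2 / 2 - a / 2 * y^2)" and ?A1 = "\<lambda>x. 2 * (a / 2) * x"
  let ?B = "\<lambda>x. a * x^2 + a * s^2 / 4" and ?B1 = "\<lambda>x. 2 * a * x"
  let ?D = "\<lambda>x. (a * s) * x" and ?D1 = "\<lambda>x::real. a * s"
  let ?f = "\<lambda>x. \<psi> (Complex x y)" and ?f1 = "\<lambda>x. \<psi>x (Complex x y)" and ?f2 = "\<lambda>x. \<psi>xx (Complex x y)"
  note kink = kink_integral[of "\<lambda>x. ?p (Complex x y)" ?f ?f1 ?f2 _ _ M, OF pm(1) d(1) d(3) cc(1)[OF C2_onD(4)[OF \<psi>]] even(1)]
  have E: "?p (Complex x y) = ?A x" if "0 < x" "x < S_bd y" for x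
   using that y S_bd_E[of x y] pE(1) by blast
  have G: "?p (Complex x y) = ?D x" if "S_bd y < x" "s / 2 < x" for x
   using that y level_p_beyond_S[of x y] s_pos by auto
  have F: "?p (Complex x y) = ?B x" if "S_bd y < x" "x < s / 2" for x
   using that y S_bd_F[of x y] S_bd_nonneg[of y] pF by fastforce
  have "S_bd y <= s"
  proof (cases "y <= s / 2")
   case True
   then show ?thesis using y by (simp add: S_bd_def)
  next
   case False
   then show ?thesis using S_bd_upper[of y] s_pos by linarith
  qed
  then have sM: "s / 2 <= M" "S_bd y <= M" using M(1) s_pos by linarith+
  \<comment> \<open>The line meets E and G; or E, F and G; or, above the arc, F and G only. A
    missing phase is entered as a degenerate interval.\<close>
  consider "y <= s / 2" | "y > s / 2" "y^2 < s^2 / 2" | "y > s / 2" "y^2 >= s^2 / 2" by linarith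
  then show ?thesis
  proof cases
   case 1
   then have S: "S_bd y = s - y" by (simp add: S_bd_def)
   have e: "{S_bd y<..<s / 2} = {}" "{S_bd y<..<S_bd y} = {}" using 1 S by auto
   have AD: "?A (S_bd y) = ?D (S_bd y)" unfolding S by (simp add: square_simps)
   have "(LBINT x. indicator {0<..} x * (?p (Complex x y) * ?f2 x)) = (?A1 (S_bd y) - ?A1 (S_bd y)) * ?f (S_bd y) + (?D1 (S_bd y) - ?A1 (S_bd y)) * ?f (S_bd y)
     + 2 * (a / 2) * (LBINT x. indicator {0<..<S_bd y} x * ?f x) + 2 * (a / 2) * (LBINT x. indicator {S_bd y<..<S_bd y} x * ?f x)"
    by (rule kink[where A = "?A" and ?A1.0 = "?A1" and B = "?A" and ?B1.0 = "?A1" and D = "?D" and ?D1.0 = "?D1" and S = "S_bd y" and ?S2.0 = "S_bd y" and kA = "2 * (a / 2)" and kB = "2 * (a / 2)"]; (rule linear refl AD S_bd_nonneg order_refl sM)?) (use E G 1 S zero in auto)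
   then show ?thesis unfolding e using 1 by (simp add: S algebra_simps)
  next
   case 2
   then have S: "(S_bd y)^2 = s^2 / 2 - y^2" by (simp add: S_bd_def)
   have AB: "?A (S_bd y) = ?B (S_bd y)" unfolding S by (simp add: algebra_simps)
   have BD: "?B (s / 2) = ?D (s / 2)" by (simp add: square_simps)
   have "(LBINT x. indicator {0<..} x * (?p (Complex x y) * ?f2 x)) = (?B1 (S_bd y) - ?A1 (S_bd y)) * ?f (S_bd y) + (?D1 (s / 2) - ?B1 (s / 2)) * ?f (s / 2)
     + 2 * (a / 2) * (LBINT x. indicator {0<..<S_bd y} x * ?f x) + 2 * a * (LBINT x. indicator {S_bd y<..<s / 2} x * ?f x)"
    by (rule kink[where A = "?A" and ?A1.0 = "?A1" and B = "?B" and ?B1.0 = "?B1" and D = "?D" and ?D1.0 = "?D1" and S = "S_bd y" and ?S2.0 = "s / 2" and kA = "2 * (a / 2)" and kB = "2 * a"]; (rule linear refl AB BD S_bd_nonneg sM S_bd_upper[OF 2(1)])?) (use E F G S_bd_upper[OF 2(1)] zero in auto)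
   then show ?thesis using 2 by (simp add: algebra_simps)
  next
   case 3
   then have S: "S_bd y = 0" by (simp add: S_bd_def)
   have BD: "?B (s / 2) = ?D (s / 2)" by (simp add: square_simps)
   have "(LBINT x. indicator {0<..} x * (?p (Complex x y) * ?f2 x)) = (?B1 (S_bd y) - ?B1 (S_bd y)) * ?f (S_bd y) + (?D1 (s / 2) - ?B1 (s / 2)) * ?f (s / 2)
     + 2 * a * (LBINT x. indicator {0<..<S_bd y} x * ?f x) + 2 * a * (LBINT x. indicator {S_bd y<..<s / 2} x * ?f x)"
    by (rule kink[where A = "?B" and ?A1.0 = "?B1" and B = "?B" and ?B1.0 = "?B1" and D = "?D" and ?D1.0 = "?D1" and S = "S_bd y" and ?S2.0 = "s / 2" and kA = "2 * a" and kB = "2 * a"]; (rule linear refl BD S_bd_nonneg sM S_bd_upper[OF 3(1)])?) (use F G S S_bd_upper[OF 3(1)] zero in auto)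
   then show ?thesis using 3 S by (simp add: algebra_simps)
  qed
 qed
 have y1: "(LBINT y. indicator {0<..} y * (?p (Complex x y) * \<psi>yy (Complex x y))) =
   a * T_bd x * \<psi> (Complex x (T_bd x)) + (- a) * (LBINT y. indicator {0<..<T_bd x} y * \<psi> (Complex x y))"
  if x: "x > 0" for x
 proof -
  define c where "c = (if x < s / 2 then a * s^2 / 4 + a * x^2 else a * s * x)"
  let ?A = "\<lambda>y. (- a / 2) * y^2 + (a * s^2 / 2 + a / 2 * x^2)" and ?A1 = "\<lambda>x. 2 * (- a / 2) * x"
  let ?B = "\<lambda>x::real. c" and ?B1 = "\<lambda>x::real. 0::real"
  let ?f = "\<lambda>y. \<psi> (Complex x y)" and ?f1 = "\<lambda>y. \<psi>y (Complex x y)" and ?f2 = "\<lambda>y. \<psi>yy (Complex x y)"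
  note kink = kink_integral[of "\<lambda>y. ?p (Complex x y)" ?f ?f1 ?f2 _ _ M, OF pm(2) d(2) d(4) cc(2)[OF C2_onD(5)[OF \<psi>]] even(2)]
  have E: "?p (Complex x y) = ?A y" if "0 < y" "y < T_bd x" for y
   using that x T_bd_E[of x y] pE(2) by blast
  have B: "?p (Complex x y) = c" if "T_bd x < y" for y
   using that x level_p_above_T[of x y] T_bd_nonneg[OF x] by (auto simp: c_def)
  have TM: "T_bd x <= M"
  proof (cases "x < s / 2")
   case True
   have "s^2 / 2 - x^2 <= s^2" using zero_le_power2[of x] zero_le_power2[of s] by linarith
   then have "sqrt (s^2 / 2 - x^2) <= s" by (intro real_le_lsqrt less_imp_le[OF s_pos])
   then show ?thesis using True M by (simp add: T_bd_def)
  next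
   case False
   have "0 <= M" "s - x <= M" using x M(1) s_pos by linarith+
   then show ?thesis using False by (simp add: T_bd_def)
  qed
  have e: "{T_bd x<..<T_bd x} = {}" by auto
  show ?thesis
  proof (cases "x < s")
   case True
   have AB: "?A (T_bd x) = c"
   proof (cases "x < s / 2")
    case True
    then have "x^2 <= (s / 2)^2" using x by (intro power_mono) auto
    then have "x^2 <= s^2 / 4" by (simp add: power_divide)
    then have "0 <= s^2 / 2 - x^2" using zero_le_power2[of s] by linarith
    then have T2: "(T_bd x)^2 = s^2 / 2 - x^2" using True by (simp add: T_bd_def)
    show ?thesis unfolding T2 using True by (simp add: c_def algebra_simps)
   next
    case False
    then have T: "T_bd x = s - x" using \<open>x < s\<close> by (simp add: T_bd_def)
    show ?thesis unfolding T using False by (simp add: c_def square_simps)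
   qed
   have "(LBINT y. indicator {0<..} y * (?p (Complex x y) * ?f2 y)) = (?B1 (T_bd x) - ?A1 (T_bd x)) * ?f (T_bd x) + (?B1 (T_bd x) - ?B1 (T_bd x)) * ?f (T_bd x)
     + 2 * (- a / 2) * (LBINT y. indicator {0<..<T_bd x} y * ?f y) + 0 * (LBINT y. indicator {T_bd x<..<T_bd x} y * ?f y)"
    by (rule kink[where A = "?A" and ?A1.0 = "?A1" and B = "?B" and ?B1.0 = "?B1" and D = "?B" and ?D1.0 = "?B1" and S = "T_bd x" and ?S2.0 = "T_bd x" and kA = "2 * (- a / 2)" and kB = "0"]; (rule linear refl AB T_bd_nonneg[OF x] order_refl TM)?) (use E B zero in auto)
   then show ?thesis by (simp add: algebra_simps)
  next
   case False
   then have "\<not> x < s / 2" using s_pos by linarith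
   then have T: "T_bd x = 0" using False by (simp add: T_bd_def)
   have "(LBINT y. indicator {0<..} y * (?p (Complex x y) * ?f2 y)) = (?B1 (T_bd x) - ?B1 (T_bd x)) * ?f (T_bd x) + (?B1 (T_bd x) - ?B1 (T_bd x)) * ?f (T_bd x)
     + 0 * (LBINT y. indicator {0<..<T_bd x} y * ?f y) + 0 * (LBINT y. indicator {T_bd x<..<T_bd x} y * ?f y)"
    by (rule kink[where A = "?B" and ?A1.0 = "?B1" and B = "?B" and ?B1.0 = "?B1" and D = "?B" and ?D1.0 = "?B1" and S = "T_bd x" and ?S2.0 = "T_bd x" and kA = "0" and kB = "0"]; (rule linear refl T_bd_nonneg[OF x] order_refl TM)?) (use B T zero in auto)
   then show ?thesis by (simp add: T)
  qed
 qed
 have qx: "indicator quadrant (Complex x y) = (indicator {0<..} x * indicator {0<..} y :: real)" for x y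
  by (auto simp: quadrant_def indicator_def)
 define J where "J y = (if y <= s / 2 then a * y else a * S_bd y) * \<psi> (Complex (S_bd y) y)" for y
 define ex where "ex y = (LBINT x. indicator (quadrant \<inter> phase_E s) (Complex x y) * \<psi> (Complex x y))" for y
 define fx where "fx y = (LBINT x. indicator (quadrant \<inter> phase_F s) (Complex x y) * \<psi> (Complex x y))" for y
 define px where "px y = (LBINT x. indicator quadrant (Complex x y) * (?p (Complex x y) * \<psi>xx (Complex x y)))" for y
 have pos: "ex y = indicator {0<..} y * ex y" "fx y = indicator {0<..} y * fx y" for y
  by (auto simp: indicator_def ex_def fx_def quadrant_def)
 have px: "px y = indicator {0<..} y * J y + a * ex y + 2 * a * fx y" for y
 proof (cases "y > 0")
  case True
  then have "px y = (LBINT x. indicator {0<..} x * (?p (Complex x y) * \<psi>xx (Complex x y)))"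
   unfolding px_def qx by simp
  then show ?thesis using x1[OF True] True sliceE[OF True] sliceF[OF True] by (simp add: J_def ex_def fx_def)
 next
  case False
  then show ?thesis using pos[of y] by (simp add: px_def qx)
 qed
 have i: "integrable lborel px" "integrable lborel ex" "integrable lborel fx"
  using integrable_complex_slices(2)[OF ixx] integrable_complex_slices(2)[OF iE] integrable_complex_slices(2)[OF iF]
  unfolding px_def[abs_def] ex_def[abs_def] fx_def[abs_def] by auto
 have "(LBINT y. indicator {0<..} y * J y) = (LBINT y. px y - a * ex y - 2 * a * fx y)"
  by (simp add: px)
 also have "\<dots> = (LBINT y. px y) - a * (LBINT y. ex y) - 2 * a * (LBINT y. fx y)"
  using i by simp
 finally show "(LBINT z. indicator quadrant z * (?p z * \<psi>xx z)) =
   (LBINT y. indicator {0<..} y * ((if y <= s / 2 then a * y else a * S_bd y) * \<psi> (Complex (S_bd y) y)))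
   + a * (LBINT z. indicator (quadrant \<inter> phase_E s) z * \<psi> z) + 2 * a * (LBINT z. indicator (quadrant \<inter> phase_F s) z * \<psi> z)"
  unfolding integral_complex_yx[OF ixx] integral_complex_yx[OF iE] integral_complex_yx[OF iF] px_def ex_def fx_def J_def by simp
 define ey where "ey x = (LBINT y. indicator (quadrant \<inter> phase_E s) (Complex x y) * \<psi> (Complex x y))" for x
 define py where "py x = (LBINT y. indicator quadrant (Complex x y) * (?p (Complex x y) * \<psi>yy (Complex x y)))" for x
 have py: "py x = indicator {0<..} x * (a * T_bd x * \<psi> (Complex x (T_bd x))) - a * ey x" for x
 proof (cases "x > 0")
  case True
  then have "py x = (LBINT y. indicator {0<..} y * (?p (Complex x y) * \<psi>yy (Complex x y)))"
   unfolding py_def qx by simp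
  then show ?thesis using y1[OF True] True sliceE'[OF True] by (simp add: ey_def)
 next
  case False
  then show ?thesis by (simp add: py_def ey_def qx quadrant_def)
 qed
 have i: "integrable lborel py" "integrable lborel ey"
  using integrable_complex_slices(1)[OF iyy] integrable_complex_slices(1)[OF iE]
  unfolding py_def[abs_def] ey_def[abs_def] by auto
 have "(LBINT x. indicator {0<..} x * (a * T_bd x * \<psi> (Complex x (T_bd x)))) = (LBINT x. py x + a * ey x)"
  by (simp add: py)
 also have "\<dots> = (LBINT x. py x) + a * (LBINT x. ey x)"
  using i by simp
 finally show "(LBINT z. indicator quadrant z * (?p z * \<psi>yy z)) =
   (LBINT x. indicator {0<..} x * (a * T_bd x * \<psi> (Complex x (T_bd x))))
   - a * (LBINT z. indicator (quadrant \<inter> phase_E s) z * \<psi> z)"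
  unfolding integral_complex_xy[OF iyy] integral_complex_xy[OF iE] py_def ey_def by simp
qed

text \<open>On the segment both families of jumps give \<open>a * y\<close>, hence
  \<open>2 * a * y\<close>. On the arc at polar angle \<open>t\<close> they are
  \<open>a * rad * cos t\<close> against \<open>rad * cos t dt\<close> and
  \<open>a * rad * sin t\<close> against \<open>rad * sin t dt\<close>, and
  \<open>cos^2 + sin^2 = 1\<close> leaves \<open>a * rad^2 dt\<close>. These are the densities of
  \<open>level_Xi_EG\<close> and \<open>level_Xi_EF\<close> in the parameters \<open>y\<close> and
  \<open>t\<close>.\<close>

lemma boundary_integrals:
 assumes \<psi>: "continuous_on UNIV \<psi>"
 shows "(LBINT y. indicator {0<..} y * ((if y <= s / 2 then a * y else a * S_bd y) * \<psi> (Complex (S_bd y) y)))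
   + (LBINT x. indicator {0<..} x * (a * T_bd x * \<psi> (Complex x (T_bd x))))
  = 2 * a * (LBINT y. indicator {0..s / 2} y * (y * \<psi> (Complex (s - y) y)))
   + a * rad^2 * (LBINT t. indicator {pi / 4..pi / 2} t * \<psi> (Complex (rad * cos t) (rad * sin t)))"
proof -
 have r: "rad > 0" "rad^2 = s^2 / 2" "rad * sin (pi / 4) = s / 2" "rad * cos (pi / 4) = s / 2"
  using s_pos by (auto simp: rad_def power_divide sin_45 cos_45)
 have sr: "s / 2 <= rad" using mult_left_mono[OF sin_le_one, of rad "pi / 4"] r by simp
 have c\<psi>: "continuous_on X (\<lambda>t. \<psi> (Complex (f t) (g t)))" if "continuous_on X f" "continuous_on X g" for X :: "real set" and f g
  by (rule continuous_on_compose2[OF \<psi>]) (use that in \<open>auto intro!: continuous_intros\<close>)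
 have sI: "set_integrable lborel {u..v} f" if "continuous_on {u..v} f" for u v and f :: "real \<Rightarrow> real"
  unfolding set_integrable_def using that by (intro borel_integrable_compact) auto
 have I: "integrable lborel (\<lambda>t. indicator {u..v} t * f t)" if "continuous_on {u..v} f" for u v and f :: "real \<Rightarrow> real"
  using sI[OF that] by (simp add: set_integrable_def)
 let ?q = "\<lambda>y. sqrt (rad^2 - y^2)"
 define L where "L = (LBINT y. indicator {0..s / 2} y * (y * \<psi> (Complex (s - y) y)))"
 have q: "?q (rad * sin t) = rad * cos t" if "t \<in> {0..pi / 2}" for t
 proof -
  have "rad^2 - (rad * sin t)^2 = (rad * cos t)^2"
   by (simp add: cos_squared_eq power_mult_distrib right_diff_distrib)
  moreover have "rad * cos t >= 0" using r(1) that by (intro mult_nonneg_nonneg cos_ge_zero) auto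
  ultimately show ?thesis by simp
 qed
 have subst: "(LBINT y. indicator {rad * sin u..rad * sin v} y * f y) = (LBINT t. indicator {u..v} t * (f (rad * sin t) * (rad * cos t)))"
  if "continuous_on {rad * sin u..rad * sin v} f" "0 <= u" "u <= v" "v <= pi / 2" for f :: "real \<Rightarrow> real" and u v
 proof -
  have "(LBINT y. f y * indicator {rad * sin u..rad * sin v} y) = (LBINT t. f (rad * sin t) * (rad * cos t) * indicator {u..v} t)"
  proof (rule integral_substitution(2)[where g = "\<lambda>t. rad * sin t"])
   show "((\<lambda>t. rad * sin t) has_real_derivative rad * cos t) (at t)" for t
    by (auto intro!: derivative_eq_intros)
   show "0 <= rad * cos t" if "t \<in> {u..v}" for t
    using r(1) \<open>0 <= u\<close> \<open>v <= pi / 2\<close> that by (intro mult_nonneg_nonneg cos_ge_zero) auto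
  qed (use that in \<open>auto intro!: sI continuous_intros\<close>)
  then show ?thesis by (simp add: mult.commute)
 qed
 define \<Psi> where "\<Psi> t = \<psi> (Complex (rad * cos t) (rad * sin t))" for t
 let ?C = "LBINT t. indicator {pi / 4..pi / 2} t * (a * rad^2 * (cos t)^2 * \<Psi> t)"
 let ?D = "LBINT t. indicator {pi / 4..pi / 2} t * (a * rad^2 * (sin t)^2 * \<Psi> t)"
 have c\<Psi>: "continuous_on X \<Psi>" for X unfolding \<Psi>_def by (intro c\<psi> continuous_intros)
 have arc1: "(LBINT y. indicator {s / 2..rad} y * (a * ?q y * \<psi> (Complex (?q y) y))) =
   ?C"
 proof -
  have "(LBINT y. indicator {rad * sin (pi / 4)..rad * sin (pi / 2)} y * (a * ?q y * \<psi> (Complex (?q y) y))) =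
   (LBINT t. indicator {pi / 4..pi / 2} t * (a * ?q (rad * sin t) * \<psi> (Complex (?q (rad * sin t)) (rad * sin t)) * (rad * cos t)))"
   by (rule subst) (use pi_gt_zero in \<open>auto intro!: continuous_intros c\<psi>\<close>)
  also have "\<dots> = ?C"
  proof (intro Bochner_Integration.integral_cong refl)
   fix t :: real
   show "indicator {pi / 4..pi / 2} t * (a * ?q (rad * sin t) * \<psi> (Complex (?q (rad * sin t)) (rad * sin t)) * (rad * cos t))
    = indicator {pi / 4..pi / 2} t * (a * rad^2 * (cos t)^2 * \<Psi> t)"
   proof (cases "t \<in> {pi / 4..pi / 2}")
    case True
    have e: "?q (rad * sin t) = rad * cos t" by (rule q) (use True pi_gt_zero in auto)
    show ?thesis unfolding e \<Psi>_def by (simp add: power2_eq_square)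
   qed simp
  qed
  finally show ?thesis by (simp add: r(3))
 qed
 have arc2: "(LBINT x. indicator {0..s / 2} x * (a * ?q x * \<psi> (Complex x (?q x)))) =
   ?D"
 proof -
  have "(LBINT x. indicator {rad * sin 0..rad * sin (pi / 4)} x * (a * ?q x * \<psi> (Complex x (?q x)))) =
   (LBINT t. indicator {0..pi / 4} t * (a * ?q (rad * sin t) * \<psi> (Complex (rad * sin t) (?q (rad * sin t))) * (rad * cos t)))"
   by (rule subst) (use pi_gt_zero in \<open>auto intro!: continuous_intros c\<psi>\<close>)
  \<comment> \<open>The substitution \<open>x = rad * sin t\<close> measures the angle from the
    imaginary axis; the reflection to \<open>pi / 2 - t\<close> gives the polar angle used for the
    other family.\<close>
  also have "\<dots> = (LBINT t. indicator {0..pi / 4} (pi / 2 + (-1) * t) * (a * ?q (rad * sin (pi / 2 + (-1) * t)) * \<psi> (Complex (rad * sin (pi / 2 + (-1) * t)) (?q (rad * sin (pi / 2 + (-1) * t)))) * (rad * cos (pi / 2 + (-1) * t))))"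
   by (subst lborel_integral_real_affine[of "-1" _ "pi / 2"]) simp_all
  also have "\<dots> = ?D"
  proof (intro Bochner_Integration.integral_cong refl)
   fix t :: real
   have i: "(indicator {0..pi / 4} (pi / 2 + (-1) * t) :: real) = indicator {pi / 4..pi / 2} t"
    by (auto simp: indicator_def)
   have sc: "sin (pi / 2 + (-1) * t) = cos t" "cos (pi / 2 + (-1) * t) = sin t"
    using cos_sin_eq[of t] sin_cos_eq[of t] by simp_all
   have "?q (rad * cos t) = rad * sin t" if "t \<in> {pi / 4..pi / 2}"
    using q[of "pi / 2 - t"] that pi_gt_zero sc by auto
   then show "indicator {0..pi / 4} (pi / 2 + (-1) * t) * (a * ?q (rad * sin (pi / 2 + (-1) * t)) * \<psi> (Complex (rad * sin (pi / 2 + (-1) * t)) (?q (rad * sin (pi / 2 + (-1) * t)))) * (rad * cos (pi / 2 + (-1) * t)))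
    = indicator {pi / 4..pi / 2} t * (a * rad^2 * (sin t)^2 * \<Psi> t)"
    unfolding i sc by (auto simp: indicator_def \<Psi>_def power2_eq_square)
  qed
  finally show ?thesis by (simp add: r(3))
 qed
 have seg: "(LBINT x. indicator {s / 2..s} x * (a * (s - x) * \<psi> (Complex x (s - x)))) = a * L"
 proof -
  have "(LBINT x. indicator {s / 2..s} x * (a * (s - x) * \<psi> (Complex x (s - x)))) =
    (LBINT x. indicator {s / 2..s} (s + (-1) * x) * (a * (s - (s + (-1) * x)) * \<psi> (Complex (s + (-1) * x) (s - (s + (-1) * x)))))"
   by (subst lborel_integral_real_affine[of "-1" _ s]) simp_all
  also have "\<dots> = (LBINT y. a * (indicator {0..s / 2} y * (y * \<psi> (Complex (s - y) y))))"
   by (intro Bochner_Integration.integral_cong refl) (auto simp: indicator_def)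
  finally show ?thesis by (simp add: L_def)
 qed
 have 1: "(LBINT y. indicator {0<..} y * ((if y <= s / 2 then a * y else a * S_bd y) * \<psi> (Complex (S_bd y) y))) =
   (LBINT y. a * (indicator {0..s / 2} y * (y * \<psi> (Complex (s - y) y))) + indicator {s / 2..rad} y * (a * ?q y * \<psi> (Complex (?q y) y)))"
 proof (rule integral_cong_AE)
  have m: "continuous_on UNIV (\<lambda>y. sqrt (max 0 (s^2 / 2 - y^2)))" by (intro continuous_intros)
  have [measurable]: "\<psi> \<in> borel_measurable borel" using \<psi> by (rule borel_measurable_continuous_onI)
  show "(\<lambda>y. indicator {0<..} y * ((if y <= s / 2 then a * y else a * S_bd y) * \<psi> (Complex (S_bd y) y))) \<in> borel_measurable lborel"
   unfolding S_bd_def by measurable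
  show "(\<lambda>y. a * (indicator {0..s / 2} y * (y * \<psi> (Complex (s - y) y))) + indicator {s / 2..rad} y * (a * ?q y * \<psi> (Complex (?q y) y))) \<in> borel_measurable lborel"
   by measurable
  show "AE y in lborel. indicator {0<..} y * ((if y <= s / 2 then a * y else a * S_bd y) * \<psi> (Complex (S_bd y) y)) =
   a * (indicator {0..s / 2} y * (y * \<psi> (Complex (s - y) y))) + indicator {s / 2..rad} y * (a * ?q y * \<psi> (Complex (?q y) y))"
   using AE_lborel_singleton[of 0] AE_lborel_singleton[of "s / 2"] AE_lborel_singleton[of rad]
  proof eventually_elim
   case (elim y)
   consider "y < 0" | "0 < y" "y < s / 2" | "s / 2 < y" "y < rad" | "rad < y" using elim by linarith
   then show ?case
   proof cases
    case 3
    have "y^2 <= rad^2" using 3 s_pos by (intro power_mono) auto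
    then have "S_bd y = ?q y" using 3 by (simp add: S_bd_def r(2))
    then show ?thesis using 3 s_pos by (simp add: indicator_def)
   next
    case 4
    have "rad^2 <= y^2" using 4 r(1) by (intro power_mono) auto
    then have "S_bd y = 0" using 4 sr by (simp add: S_bd_def r(2))
    then show ?thesis using 4 sr by (simp add: indicator_def)
   qed (use s_pos sr in \<open>auto simp: indicator_def S_bd_def\<close>)
  qed
 qed
 have 2: "(LBINT x. indicator {0<..} x * (a * T_bd x * \<psi> (Complex x (T_bd x)))) =
   (LBINT x. indicator {0..s / 2} x * (a * ?q x * \<psi> (Complex x (?q x))) + indicator {s / 2..s} x * (a * (s - x) * \<psi> (Complex x (s - x))))"
 proof (rule integral_cong_AE)
  have [measurable]: "\<psi> \<in> borel_measurable borel" using \<psi> by (rule borel_measurable_continuous_onI)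
  show "(\<lambda>x. indicator {0<..} x * (a * T_bd x * \<psi> (Complex x (T_bd x)))) \<in> borel_measurable lborel"
   unfolding T_bd_def by measurable
  show "(\<lambda>x. indicator {0..s / 2} x * (a * ?q x * \<psi> (Complex x (?q x))) + indicator {s / 2..s} x * (a * (s - x) * \<psi> (Complex x (s - x)))) \<in> borel_measurable lborel"
   by measurable
  show "AE x in lborel. indicator {0<..} x * (a * T_bd x * \<psi> (Complex x (T_bd x))) =
   indicator {0..s / 2} x * (a * ?q x * \<psi> (Complex x (?q x))) + indicator {s / 2..s} x * (a * (s - x) * \<psi> (Complex x (s - x)))"
   using AE_lborel_singleton[of 0] AE_lborel_singleton[of "s / 2"] AE_lborel_singleton[of s]
   by eventually_elim (use s_pos in \<open>auto simp: indicator_def T_bd_def r(2)\<close>)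
 qed
 have A: "(LBINT y. indicator {0<..} y * ((if y <= s / 2 then a * y else a * S_bd y) * \<psi> (Complex (S_bd y) y))) =
   a * L + ?C"
  unfolding 1 by (subst Bochner_Integration.integral_add)
   (auto intro!: integrable_mult_right I continuous_intros c\<psi> simp: L_def arc1)
 have B: "(LBINT x. indicator {0<..} x * (a * T_bd x * \<psi> (Complex x (T_bd x)))) =
   ?D + a * L"
  unfolding 2 by (subst Bochner_Integration.integral_add) (auto intro!: I continuous_intros c\<psi> simp: arc2 seg)
 have C: "?C
   + ?D
   = (LBINT t. a * rad^2 * (indicator {pi / 4..pi / 2} t * \<Psi> t))"
 proof (subst Bochner_Integration.integral_add[symmetric])
  have "a * rad^2 * (cos t)^2 * \<Psi> t + a * rad^2 * (sin t)^2 * \<Psi> t = a * rad^2 * \<Psi> t" for t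
  proof -
   have "a * rad^2 * (cos t)^2 * \<Psi> t + a * rad^2 * (sin t)^2 * \<Psi> t = a * rad^2 * \<Psi> t * ((sin t)^2 + (cos t)^2)"
    by (simp only: distrib_left) (simp add: mult_ac)
   then show ?thesis by simp
  qed
  then show "(LBINT t. indicator {pi / 4..pi / 2} t * (a * rad^2 * (cos t)^2 * \<Psi> t) + indicator {pi / 4..pi / 2} t * (a * rad^2 * (sin t)^2 * \<Psi> t))
   = (LBINT t. a * rad^2 * (indicator {pi / 4..pi / 2} t * \<Psi> t))"
   by (intro Bochner_Integration.integral_cong refl) (auto simp: indicator_def)
 qed (auto intro!: I continuous_intros c\<Psi>)
 show ?thesis unfolding A B using C by (simp add: L_def \<Psi>_def)
qed

end

section \<open>Integration against finite sums of measures and against length measures\<close>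

lemma nn_integral_borel_sum:
 assumes Ms: "\<And>M. M \<in> set Ms ==> sets M = sets borel" and f: "f \<in> borel_measurable borel"
 shows "(\<integral>\<^sup>+x. f x \<partial>borel_sum Ms) = (\<Sum>M\<leftarrow>Ms. \<integral>\<^sup>+x. f x \<partial>M)"
 using f
proof induction
 case (cong f g)
 have sp: "space M = UNIV" if "M \<in> set Ms" for M
  using sets_eq_imp_space_eq[OF Ms[OF that]] by simp
 show ?case
  using cong by (simp add: sp cong: map_cong nn_integral_cong)
next
 case (set A)
 then have m: "map (\<lambda>M. \<integral>\<^sup>+x. indicator A x \<partial>M) Ms = map (\<lambda>M. emeasure M A) Ms"
  using Ms by (intro map_cong refl nn_integral_indicator) auto
 have "(\<integral>\<^sup>+x. indicator A x \<partial>borel_sum Ms) = emeasure (borel_sum Ms) A"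
  using set by (intro nn_integral_indicator) simp
 then show ?case using set Ms by (simp only: m emeasure_borel_sum)
next
 case (mult u c)
 have m: "map (\<lambda>M. \<integral>\<^sup>+x. c * u x \<partial>M) Ms = map (\<lambda>M. c * \<integral>\<^sup>+x. u x \<partial>M) Ms"
  using mult Ms by (intro map_cong refl nn_integral_cmult) (auto cong: measurable_cong_sets)
 have "(\<integral>\<^sup>+x. c * u x \<partial>borel_sum Ms) = c * (\<integral>\<^sup>+x. u x \<partial>borel_sum Ms)"
  using mult by (intro nn_integral_cmult) (simp cong: measurable_cong_sets)
 then show ?case by (simp only: m mult(4) sum_list_const_mult)
next
 case (add u v)
 have m: "map (\<lambda>M. \<integral>\<^sup>+x. v x + u x \<partial>M) Ms = map (\<lambda>M. (\<integral>\<^sup>+x. v x \<partial>M) + (\<integral>\<^sup>+x. u x \<partial>M)) Ms"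
  using add Ms by (intro map_cong refl nn_integral_add) (auto cong: measurable_cong_sets)
 have "(\<integral>\<^sup>+x. v x + u x \<partial>borel_sum Ms) = (\<integral>\<^sup>+x. v x \<partial>borel_sum Ms) + (\<integral>\<^sup>+x. u x \<partial>borel_sum Ms)"
  using add by (intro nn_integral_add) (simp_all cong: measurable_cong_sets)
 then show ?case by (simp only: m add.IH sum_list_addf)
next
 case (seq U)
 have mono: "(\<integral>\<^sup>+x. (SUP i. U i) x \<partial>M) = (SUP i. \<integral>\<^sup>+x. U i x \<partial>M)" if "sets M = sets borel" for M
  using seq(1,3) that unfolding SUP_apply
  by (intro nn_integral_monotone_convergence_SUP) (auto cong: measurable_cong_sets)
 have inc: "incseq (\<lambda>i. \<integral>\<^sup>+x. U i x \<partial>M)" for M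
  using seq(3) by (auto simp: incseq_def le_fun_def intro!: nn_integral_mono)
 have "(SUP i. \<Sum>M\<leftarrow>Ms. \<integral>\<^sup>+x. U i x \<partial>M) = (\<Sum>M\<leftarrow>Ms. SUP i. \<integral>\<^sup>+x. U i x \<partial>M) \<and> incseq (\<lambda>i. \<Sum>M\<leftarrow>Ms. \<integral>\<^sup>+x. U i x \<partial>M)"
 proof (induction Ms)
  case Nil
  then show ?case by (simp add: incseq_def)
 next
  case (Cons M Ms)
  have "(SUP i. (\<integral>\<^sup>+x. U i x \<partial>M) + (\<Sum>M\<leftarrow>Ms. \<integral>\<^sup>+x. U i x \<partial>M)) = (SUP i. \<integral>\<^sup>+x. U i x \<partial>M) + (SUP i. \<Sum>M\<leftarrow>Ms. \<integral>\<^sup>+x. U i x \<partial>M)"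
   using Cons inc by (intro ennreal_SUP_add) auto
  moreover have "incseq (\<lambda>i. (\<integral>\<^sup>+x. U i x \<partial>M) + (\<Sum>M\<leftarrow>Ms. \<integral>\<^sup>+x. U i x \<partial>M))"
   using Cons inc[of M] unfolding incseq_def by (auto intro: add_mono)
  ultimately show ?case using Cons by simp
 qed
 moreover have "map (\<lambda>M. SUP i. \<integral>\<^sup>+x. U i x \<partial>M) Ms = map (\<lambda>M. \<integral>\<^sup>+x. (SUP i. U i) x \<partial>M) Ms"
  using mono Ms by (intro map_cong refl) auto
 ultimately show ?case using mono[of "borel_sum Ms"] seq.IH by simp
qed

lemma integral_borel_sum:
 fixes f :: "'a::topological_space \<Rightarrow> real"
 assumes Ms: "\<And>M. M \<in> set Ms ==> sets M = sets borel" and i: "\<And>M. M \<in> set Ms ==> integrable M f"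
  and f: "f \<in> borel_measurable borel"
 shows "integrable (borel_sum Ms) f" "(\<integral>x. f x \<partial>borel_sum Ms) = (\<Sum>M\<leftarrow>Ms. \<integral>x. f x \<partial>M)"
proof -
 have fin: "(\<Sum>M\<leftarrow>Ms'. \<integral>\<^sup>+x. ennreal (f x) \<partial>M) \<noteq> \<infinity>" "(\<Sum>M\<leftarrow>Ms'. \<integral>\<^sup>+x. ennreal (- f x) \<partial>M) \<noteq> \<infinity>"
  if "\<And>M. M \<in> set Ms' ==> integrable M f" for Ms'
  using that by (induction Ms') (auto simp: real_integrable_def)
 show "integrable (borel_sum Ms) f"
  unfolding real_integrable_def using fin[OF i] f Ms by (auto simp: nn_integral_borel_sum)
 then have "(\<integral>x. f x \<partial>borel_sum Ms) = enn2real (\<Sum>M\<leftarrow>Ms. \<integral>\<^sup>+x. ennreal (f x) \<partial>M) - enn2real (\<Sum>M\<leftarrow>Ms. \<integral>\<^sup>+x. ennreal (- f x) \<partial>M)"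
  using f Ms by (subst real_lebesgue_integral_def) (auto simp: nn_integral_borel_sum)
 also have "\<dots> = (\<Sum>M\<leftarrow>Ms. \<integral>x. f x \<partial>M)"
  using i
 proof (induction Ms)
  case (Cons M Ms)
  have 1: "(\<integral>\<^sup>+x. ennreal (f x) \<partial>M) < top" "(\<integral>\<^sup>+x. ennreal (- f x) \<partial>M) < top"
   "(\<Sum>M\<leftarrow>Ms. \<integral>\<^sup>+x. ennreal (f x) \<partial>M) < top" "(\<Sum>M\<leftarrow>Ms. \<integral>\<^sup>+x. ennreal (- f x) \<partial>M) < top"
   using fin[of Ms] Cons.prems[of M] Cons.prems by (auto simp: real_integrable_def less_top)
  then show ?case
   using Cons by (simp add: enn2real_plus real_lebesgue_integral_def)
 qed simp
 finally show "(\<integral>x. f x \<partial>borel_sum Ms) = (\<Sum>M\<leftarrow>Ms. \<integral>x. f x \<partial>M)" .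
qed

lemma radon_borel_sum:
 assumes "\<And>M. M \<in> set Ms ==> M \<in> radon_measures"
 shows "borel_sum Ms \<in> radon_measures"
proof -
 have "(\<Sum>M\<leftarrow>Ms. emeasure M K) < \<infinity>" if K: "compact K" for K
  using assms
 proof (induction Ms)
  case (Cons M Ms)
  then have "emeasure M K < \<infinity>" "(\<Sum>M\<leftarrow>Ms. emeasure M K) < \<infinity>" using K by (auto simp: radon_measures_def)
  then show ?case by simp
 qed simp
 moreover have "emeasure (borel_sum Ms) K = (\<Sum>M\<leftarrow>Ms. emeasure M K)" if "compact K" for K
  using assms that by (intro emeasure_borel_sum) (auto simp: radon_measures_def borel_compact)
 ultimately show ?thesis by (simp add: radon_measures_def)
qed

lemma scale_measure_eq_density: "scale_measure r M = density M (\<lambda>_. r)"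
 by (rule measure_eqI) (auto simp: emeasure_density_const)

lemma radon_scale:
 assumes "M \<in> radon_measures"
 shows "scale_measure (ennreal c) M \<in> radon_measures"
 using assms by (auto simp: radon_measures_def ennreal_mult_less_top)

lemma integral_scale_measure:
 fixes f :: "'a \<Rightarrow> real"
 assumes "f \<in> borel_measurable M" "c >= 0"
 shows "(\<integral>x. f x \<partial>scale_measure (ennreal c) M) = c * (\<integral>x. f x \<partial>M)"
 using assms unfolding scale_measure_eq_density by (subst integral_density) auto

lemma sets_length_measure [simp, measurable_cong]: "sets (length_measure g) = sets borel"
 by (simp add: length_measure_def)

text \<open>Arcs parametrised by angle and segments have constant speed \<open>c\<close>, so the
  length measure is the image of \<open>c dt\<close> and every integral becomes one over the unit
  interval.\<close>

lemma
 fixes g :: "real \<Rightarrow> complex"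
 assumes g: "continuous_on UNIV g" and c: "c >= 0"
  and d: "\<And>t. t \<in> {0..1} ==> norm (vector_derivative g (at t within {0..1})) = c"
 shows length_measure_finite: "emeasure (length_measure g) UNIV < \<infinity>"
  and integral_length_measure: "\<phi> \<in> borel_measurable borel ==>
   (\<integral>z. \<phi> z \<partial>length_measure g) = c * (LBINT t. indicator {0..1} t * \<phi> (g t))"
proof -
 let ?L = "restrict_space lborel {0..1::real}"
 have gm[measurable]: "g \<in> borel_measurable borel" using g by (rule borel_measurable_continuous_onI)
 have gm'[measurable]: "g \<in> borel_measurable ?L" by (rule measurable_restrict_space1) simp
 have "(\<lambda>t. ennreal (norm (vector_derivative g (at t within {0..1})))) \<in> borel_measurable ?L"
  by (subst measurable_cong[where g = "\<lambda>_. ennreal c"]) (auto simp: space_restrict_space d)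
 then have eq: "length_measure g = distr (density ?L (\<lambda>_. ennreal c)) borel g"
  unfolding length_measure_def
  by (intro arg_cong3[where f = distr] refl density_cong) (auto simp: space_restrict_space d)
 show "emeasure (length_measure g) UNIV < \<infinity>"
 proof -
  have "emeasure (density ?L (\<lambda>_. ennreal c)) {0..1} = ennreal c * emeasure ?L {0..1}"
   by (intro emeasure_density_const) (auto simp: sets_restrict_space)
  then show ?thesis
   unfolding eq by (subst emeasure_distr) (auto simp: space_restrict_space emeasure_restrict_space ennreal_mult_less_top)
 qed
 assume [measurable]: "\<phi> \<in> borel_measurable borel"
 have "(\<integral>z. \<phi> z \<partial>length_measure g) = (\<integral>t. \<phi> (g t) \<partial>density ?L (\<lambda>_. ennreal c))"
  unfolding eq by (subst integral_distr) auto
 also have "\<dots> = (\<integral>t. c * \<phi> (g t) \<partial>?L)"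
  using c measurable_compose[OF gm' \<open>\<phi> \<in> borel_measurable borel\<close>] by (subst integral_density) auto
 also have "\<dots> = c * (LBINT t. indicator {0..1} t * \<phi> (g t))"
  by (subst integral_restrict_space) (auto simp: mult.left_commute)
 finally show "(\<integral>z. \<phi> z \<partial>length_measure g) = c * (LBINT t. indicator {0..1} t * \<phi> (g t))" .
qed

lemma radon_length_measure:
 assumes "continuous_on UNIV g" "c >= 0" "\<And>t. t \<in> {0..1} ==> norm (vector_derivative g (at t within {0..1})) = c"
 shows "length_measure g \<in> radon_measures"
proof -
 have "emeasure (length_measure g) K <= emeasure (length_measure g) UNIV" for K
  using emeasure_space[of "length_measure g" K] by (simp add: length_measure_def)
 then show ?thesis using length_measure_finite[OF assms] by (auto simp: radon_measures_def intro: le_less_trans)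
qed

lemma integral_affine_Icc:
 fixes F :: "real \<Rightarrow> real"
 assumes "u < v"
 shows "(v - u) * (LBINT t. indicator {0..1} t * F (u + (v - u) * t)) = (LBINT t. indicator {u..v} t * F t)"
proof -
 have i: "(indicator {u..v} (u + (v - u) * t) :: real) = indicator {0..1} t" for t
 proof -
  have k: "v - u > 0" using assms by simp
  have "u <= u + (v - u) * t \<longleftrightarrow> 0 <= t" using k by (simp add: zero_le_mult_iff)
  moreover have "u + (v - u) * t <= v \<longleftrightarrow> (v - u) * t <= (v - u) * 1" by auto
  moreover have "\<dots> \<longleftrightarrow> t <= 1" using k by (rule mult_le_cancel_left_pos)
  ultimately show ?thesis by (simp add: indicator_def)
 qed
 show ?thesis using assms
  by (subst lborel_integral_real_affine[of "v - u" _ u]) (simp_all add: i)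
qed

lemma integral_reflect_Icc:
 fixes F :: "real \<Rightarrow> real"
 shows "(LBINT t. indicator {u..v} t * F t) = (LBINT t. indicator {m - v..m - u} t * F (m - t))"
proof -
 have i: "(indicator {u..v} (m + (-1) * t) :: real) = indicator {m - v..m - u} t" for t
  by (auto simp: indicator_def)
 show ?thesis by (subst lborel_integral_real_affine[of "-1" _ m]) (simp_all only: i, simp_all)
qed

lemma integrable_Icc:
 fixes F :: "real \<Rightarrow> real"
 assumes "continuous_on {u..v} F"
 shows "integrable lborel (\<lambda>t. indicator {u..v} t * F t)"
 using borel_integrable_compact[OF compact_Icc assms] by simp

section \<open>The measures of one level in coordinates\<close>

context level
begin

lemma rad: "rad > 0" "sqrt (a * ln \<alpha>) = a * rad"
proof -
 show r: "rad > 0" using s_pos by (simp add: rad_def)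
 have "a * ln \<alpha> = (a * rad)^2" unfolding ln_\<alpha> by (simp add: rad_def power2_eq_square)
 then show "sqrt (a * ln \<alpha>) = a * rad" using a r by simp
qed

lemma arcs_speed:
 assumes "g \<in> set (arcs_EF s)"
 shows "continuous_on UNIV g" "t \<in> {0..1} ==> norm (vector_derivative g (at t within {0..1})) = rad * (pi / 2)"
proof -
 show "continuous_on UNIV g" using assms unfolding arcs_EF_def part_circlepath_def linepath_def
  by (auto intro!: continuous_intros)
 assume "t \<in> {0..1}"
 moreover have "norm (vector_derivative (part_circlepath 0 rad u (u + pi / 2)) (at t within {0..1})) = rad * (pi / 2)" if "t \<in> {0..1}" for u
  using that rad(1) by (subst vector_derivative_part_circlepath01) (auto simp: norm_mult)
 from this[of "pi / 4"] this[of "5 * pi / 4"]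
 show "t \<in> {0..1} ==> norm (vector_derivative g (at t within {0..1})) = rad * (pi / 2)"
  using assms by (auto simp: arcs_EF_def rad_def field_simps)
qed

lemma segments_speed:
 assumes "g \<in> set (segments_EG s)"
 shows "continuous_on UNIV g" "t \<in> {0..1} ==> norm (vector_derivative g (at t within {0..1})) = s / sqrt 2"
proof -
 show "continuous_on UNIV g" using assms unfolding segments_EG_def linepath_def
  by (auto intro!: continuous_intros)
 have "(s / 2)^2 + (s / 2)^2 = (s / sqrt 2)^2" by (simp add: power_divide)
 then have "sqrt ((s / 2)^2 + (s / 2)^2) = s / sqrt 2" using s_pos by simp
 then show "t \<in> {0..1} ==> norm (vector_derivative g (at t within {0..1})) = s / sqrt 2"
  using assms by (auto simp: segments_EG_def vector_derivative_linepath_within cmod_def)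
qed

lemma radon_level_Xi: "level_Xi_F a \<alpha> \<in> radon_measures" "level_Xi_EF a \<alpha> \<in> radon_measures" "level_Xi_EG a \<alpha> \<in> radon_measures"
 "level_Xi a \<alpha> \<in> radon_measures"
proof -
 have [measurable]: "phase_F (crit a \<alpha>) \<in> sets borel" using open_phases(2) by auto
 have "emeasure (level_Xi_F a \<alpha>) K < \<infinity>" if K: "compact K" for K
 proof -
  have "emeasure (level_Xi_F a \<alpha>) K = (\<integral>\<^sup>+z. ennreal (2 * a * indicator (phase_F (crit a \<alpha>)) z) * indicator K z \<partial>lborel)"
   using K unfolding level_Xi_F_def by (subst emeasure_density) (auto simp: borel_compact)
  also have "\<dots> <= (\<integral>\<^sup>+z. ennreal (2 * a) * indicator K z \<partial>lborel)"
   using a by (intro nn_integral_mono) (auto simp: indicator_def)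
  also have "\<dots> = ennreal (2 * a) * emeasure lborel K"
   using K by (intro nn_integral_cmult_indicator) (auto simp: borel_compact)
  also have "\<dots> < \<infinity>" using emeasure_compact_finite[OF K] by (simp add: ennreal_mult_less_top)
  finally show ?thesis .
 qed
 then show 1: "level_Xi_F a \<alpha> \<in> radon_measures" by (simp add: radon_measures_def level_Xi_F_def)
 have "M \<in> radon_measures" if "M \<in> set (map length_measure (arcs_EF s))" for M
  using that arcs_speed radon_length_measure[where c = "rad * (pi / 2)"] rad(1) by auto
 then show 2: "level_Xi_EF a \<alpha> \<in> radon_measures"
  unfolding level_Xi_EF_def s_def[symmetric] by (intro radon_scale radon_borel_sum) auto
 have r: "borel_sum (map length_measure (segments_EG s)) \<in> radon_measures" (is "?M \<in> _")
  using segments_speed radon_length_measure[where c = "s / sqrt 2"] s_pos by (intro radon_borel_sum) auto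
 have "emeasure (level_Xi_EG a \<alpha>) K < \<infinity>" if K: "compact K" for K
 proof -
  obtain B where B: "\<And>z. z \<in> K ==> norm z <= B" using compact_imp_bounded[OF K] by (auto simp: bounded_iff)
  have "emeasure (level_Xi_EG a \<alpha>) K = (\<integral>\<^sup>+z. ennreal (sqrt 2 * a * \<bar>Im z\<bar>) * indicator K z \<partial>?M)"
   using K unfolding level_Xi_EG_def s_def[symmetric] by (subst emeasure_density) (auto simp: borel_compact)
  also have "\<dots> <= (\<integral>\<^sup>+z. ennreal (sqrt 2 * a * B) * indicator K z \<partial>?M)"
  proof (intro nn_integral_mono)
   fix z
   have "sqrt 2 * a * \<bar>Im z\<bar> <= sqrt 2 * a * B" if "z \<in> K"
    using abs_Im_le_cmod[of z] B[OF that] a by (intro mult_left_mono) auto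
   then show "ennreal (sqrt 2 * a * \<bar>Im z\<bar>) * indicator K z <= ennreal (sqrt 2 * a * B) * indicator K z"
    by (auto simp: indicator_def intro: ennreal_leI)
  qed
  also have "\<dots> = ennreal (sqrt 2 * a * B) * emeasure ?M K"
   using K by (intro nn_integral_cmult_indicator) (auto simp: borel_compact)
  also have "\<dots> < \<infinity>" using r K by (auto simp: ennreal_mult_less_top radon_measures_def)
  finally show ?thesis .
 qed
 then show 3: "level_Xi_EG a \<alpha> \<in> radon_measures" by (simp add: radon_measures_def level_Xi_EG_def)
 show "level_Xi a \<alpha> \<in> radon_measures" unfolding level_Xi_def using 1 2 3 by (intro radon_borel_sum) auto
qed

text \<open>The mirror images of each piece are folded onto the quadrant. For a segment, the speed
  \<open>s / sqrt 2\<close> and the density \<open>sqrt 2 * a * |Im z|\<close> combine to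
  \<open>2 * a * y dy\<close> with \<open>y = s * t / 2\<close>; for an arc, \<open>a * rad\<close>
  times the arc length \<open>rad dt\<close> gives \<open>a * rad^2 dt\<close>. This is the form in
  which integration by parts produces the Laplacian of \<open>level_p\<close>.\<close>

lemma integral_level_Xi:
 assumes \<phi>: "continuous_on UNIV \<phi>" and 0: "\<And>z. norm z > R ==> \<phi> z = 0"
 shows "(\<integral>z. \<phi> z \<partial>level_Xi a \<alpha>) = 2 * a * (LBINT z. indicator (quadrant \<inter> phase_F s) z * symm \<phi> z)
   + 2 * a * (LBINT y. indicator {0..s / 2} y * (y * symm \<phi> (Complex (s - y) y)))
   + a * rad^2 * (LBINT t. indicator {pi / 4..pi / 2} t * symm \<phi> (Complex (rad * cos t) (rad * sin t)))"
proof -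
 have [measurable]: "\<phi> \<in> borel_measurable borel" using \<phi> by (rule borel_measurable_continuous_onI)
 have [measurable]: "phase_F s \<in> sets borel" using open_phases by auto
 have c\<phi>: "continuous_on X (\<lambda>t. \<phi> (Complex (f t) (g t)))" if "continuous_on X f" "continuous_on X g" for X :: "real set" and f g
  by (rule continuous_on_compose2[OF \<phi>]) (use that in \<open>auto intro!: continuous_intros\<close>)
 have ri: "integrable M \<phi>" if "M \<in> radon_measures" for M using radon_integrable[OF that \<phi> 0] .
 have F: "(\<integral>z. \<phi> z \<partial>level_Xi_F a \<alpha>) = 2 * a * (LBINT z. indicator (quadrant \<inter> phase_F s) z * symm \<phi> z)"
 proof -
  have inv: "mirror c d z \<in> phase_F s \<longleftrightarrow> z \<in> phase_F s" if "c = 1 \<or> c = -1" "d = 1 \<or> d = -1" for c d z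
   using that by (auto simp: phase_F_def mirror_def)
  have "integrable lborel \<phi>" using \<phi> 0 by (rule integrable_cont_compact_support)
  then have i: "integrable lborel (\<lambda>z. indicator (phase_F s) z * \<phi> z)"
   using integrable_mult_indicator[of "phase_F s" lborel \<phi>] by simp
  have "(\<integral>z. \<phi> z \<partial>level_Xi_F a \<alpha>) = (LBINT z. 2 * a * (indicator (phase_F s) z * \<phi> z))"
   unfolding level_Xi_F_def s_def[symmetric] using a by (subst integral_density) (auto simp: mult.assoc)
  also have "\<dots> = 2 * a * (LBINT z. indicator quadrant z * symm (\<lambda>z. indicator (phase_F s) z * \<phi> z) z)"
   using integral_quadrant(2)[OF i] by simp
  also have "(\<lambda>z. indicator quadrant z * symm (\<lambda>z. indicator (phase_F s) z * \<phi> z) z) = (\<lambda>z. indicator (quadrant \<inter> phase_F s) z * symm \<phi> z)"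
   by (auto simp: fun_eq_iff symm_def indicator_def inv)
  finally show ?thesis .
 qed
 have EF: "(\<integral>z. \<phi> z \<partial>level_Xi_EF a \<alpha>) = a * rad^2 * (LBINT t. indicator {pi / 4..pi / 2} t * symm \<phi> (Complex (rad * cos t) (rad * sin t)))"
 proof -
  let ?C = "\<lambda>t. Complex (rad * cos t) (rad * sin t)"
  have rC: "of_real rad * exp (\<i> * of_real t) = ?C t" for t
   by (simp add: complex_eq_iff Re_exp Im_exp)
  have half: "(\<integral>z. \<phi> z \<partial>length_measure (part_circlepath 0 rad u (u + pi / 2))) = rad * (LBINT t. indicator {u..u + pi / 2} t * \<phi> (?C t))" for u
  proof -
   have cont: "continuous_on UNIV (part_circlepath 0 rad u (u + pi / 2))"
    unfolding part_circlepath_def linepath_def by (auto intro!: continuous_intros)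
   have "(\<integral>z. \<phi> z \<partial>length_measure (part_circlepath 0 rad u (u + pi / 2))) = rad * (pi / 2) * (LBINT t. indicator {0..1} t * \<phi> (part_circlepath 0 rad u (u + pi / 2) t))"
    by (rule integral_length_measure[OF cont]) (use rad(1) in \<open>auto simp: vector_derivative_part_circlepath01 norm_mult\<close>)
   also have "(\<lambda>t. \<phi> (part_circlepath 0 rad u (u + pi / 2) t)) = (\<lambda>t. \<phi> (?C (u + (u + pi / 2 - u) * t)))"
    unfolding part_circlepath_def add_0 rC linepath_def by (auto simp: fun_eq_iff algebra_simps)
   finally show ?thesis
    using integral_affine_Icc[of u "u + pi / 2" "\<lambda>t. \<phi> (?C t)"] pi_gt_zero by (simp add: mult.assoc)
  qed
  \<comment> \<open>The angles of an arc are folded at \<open>pi / 2\<close>, that is, at the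
    imaginary axis, so that only polar angles of the quadrant remain.\<close>
  have split: "(LBINT t. indicator {pi / 4..3 * pi / 4} t * f t) = (LBINT t. indicator {pi / 4..pi / 2} t * (f t + f (pi - t)))"
   if cf: "continuous_on UNIV f" for f :: "real \<Rightarrow> real"
  proof -
   have [measurable]: "f \<in> borel_measurable borel" using cf by (rule borel_measurable_continuous_onI)
   have I: "integrable lborel (\<lambda>t. indicator {u..v} t * f t)" "integrable lborel (\<lambda>t. indicator {u..v} t * f (pi - t))" for u v
    by (intro integrable_Icc continuous_on_compose2[OF cf] continuous_intros subset_UNIV)+
   have "(LBINT t. indicator {pi / 4..3 * pi / 4} t * f t) = (LBINT t. indicator {pi / 4..pi / 2} t * f t + indicator {pi / 2..3 * pi / 4} t * f t)"
    using AE_lborel_singleton[of "pi / 2"] pi_gt_zero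
    by (intro integral_cong_AE) (measurable, auto simp: indicator_def elim!: eventually_mono)
   also have "\<dots> = (LBINT t. indicator {pi / 4..pi / 2} t * f t) + (LBINT t. indicator {pi / 2..3 * pi / 4} t * f t)"
    by (intro Bochner_Integration.integral_add I)
   also have "(LBINT t. indicator {pi / 2..3 * pi / 4} t * f t) = (LBINT t. indicator {pi / 4..pi / 2} t * f (pi - t))"
    by (subst integral_reflect_Icc[of _ _ _ pi]) (simp add: field_simps)
   also have "(LBINT t. indicator {pi / 4..pi / 2} t * f t) + \<dots> = (LBINT t. indicator {pi / 4..pi / 2} t * (f t + f (pi - t)))"
    by (subst Bochner_Integration.integral_add[symmetric, OF I]) (simp add: distrib_left)
   finally show ?thesis .
  qed
  have 1: "(\<integral>z. \<phi> z \<partial>length_measure (part_circlepath 0 rad (pi / 4) (3 * pi / 4))) = rad * (LBINT t. indicator {pi / 4..pi / 2} t * (\<phi> (?C t) + \<phi> (?C (pi - t))))"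
  proof -
   have e: "pi / 4 + pi / 2 = 3 * pi / 4" by simp
   have "continuous_on UNIV (\<lambda>t. \<phi> (?C t))" by (intro c\<phi> continuous_intros)
   from half[of "pi / 4", unfolded e split[OF this]] show ?thesis .
  qed
  have 2: "(\<integral>z. \<phi> z \<partial>length_measure (part_circlepath 0 rad (5 * pi / 4) (7 * pi / 4))) = rad * (LBINT t. indicator {pi / 4..pi / 2} t * (\<phi> (?C (pi + t)) + \<phi> (?C (pi + (pi - t)))))"
  proof -
   have "(LBINT t. indicator {5 * pi / 4..7 * pi / 4} t * \<phi> (?C t)) = (LBINT t. indicator {pi / 4..3 * pi / 4} t * \<phi> (?C (pi + t)))"
   proof -
    have "(LBINT t. indicator {5 * pi / 4..7 * pi / 4} t * \<phi> (?C t)) = (LBINT t. indicator {5 * pi / 4..7 * pi / 4} (pi + 1 * t) * \<phi> (?C (pi + 1 * t)))"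
     by (subst lborel_integral_real_affine[of 1 _ pi]) simp_all
    also have "\<dots> = (LBINT t. indicator {pi / 4..3 * pi / 4} t * \<phi> (?C (pi + t)))"
     by (intro Bochner_Integration.integral_cong refl) (auto simp: indicator_def field_simps)
    finally show ?thesis .
   qed
   also have "\<dots> = (LBINT t. indicator {pi / 4..pi / 2} t * (\<phi> (?C (pi + t)) + \<phi> (?C (pi + (pi - t)))))"
    by (rule split) (intro c\<phi> continuous_intros)
   finally have 3: "(LBINT t. indicator {5 * pi / 4..7 * pi / 4} t * \<phi> (?C t)) = \<dots>" .
   have e: "5 * pi / 4 + pi / 2 = 7 * pi / 4" by simp
   from half[of "5 * pi / 4", unfolded e 3] show ?thesis .
  qed
  have I: "integrable lborel (\<lambda>t. indicator {pi / 4..pi / 2} t * (\<phi> (?C t) + \<phi> (?C (pi - t))))"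
   "integrable lborel (\<lambda>t. indicator {pi / 4..pi / 2} t * (\<phi> (?C (pi + t)) + \<phi> (?C (pi + (pi - t)))))"
   by (intro integrable_Icc continuous_intros c\<phi>)+
  have li: "integrable (length_measure g) \<phi>" if "g \<in> set (arcs_EF s)" for g
   using that arcs_speed radon_length_measure[where c = "rad * (pi / 2)"] rad(1) by (intro ri) auto
  have "(\<integral>z. \<phi> z \<partial>level_Xi_EF a \<alpha>) = a * rad * (\<integral>z. \<phi> z \<partial>borel_sum (map length_measure (arcs_EF s)))"
   unfolding level_Xi_EF_def s_def[symmetric] rad(2) using a rad(1) by (intro integral_scale_measure) auto
  also have "(\<integral>z. \<phi> z \<partial>borel_sum (map length_measure (arcs_EF s))) = (\<Sum>M\<leftarrow>map length_measure (arcs_EF s). \<integral>z. \<phi> z \<partial>M)"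
   by (intro integral_borel_sum) (auto intro: li)
  also have "\<dots> = rad * (LBINT t. indicator {pi / 4..pi / 2} t * (\<phi> (?C t) + \<phi> (?C (pi - t)))) + rad * (LBINT t. indicator {pi / 4..pi / 2} t * (\<phi> (?C (pi + t)) + \<phi> (?C (pi + (pi - t)))))"
   using 1 2 by (simp add: arcs_EF_def rad_def)
  also have "\<dots> = rad * (LBINT t. indicator {pi / 4..pi / 2} t * (\<phi> (?C t) + \<phi> (?C (pi - t))) + indicator {pi / 4..pi / 2} t * (\<phi> (?C (pi + t)) + \<phi> (?C (pi + (pi - t)))))"
   using I by (simp add: distrib_left)
  also have "(\<lambda>t. indicator {pi / 4..pi / 2} t * (\<phi> (?C t) + \<phi> (?C (pi - t))) + indicator {pi / 4..pi / 2} t * (\<phi> (?C (pi + t)) + \<phi> (?C (pi + (pi - t)))))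
    = (\<lambda>t. indicator {pi / 4..pi / 2} t * symm \<phi> (?C t))"
  proof
   fix t
   have "?C (pi - t) = mirror (-1) 1 (?C t)" "?C (pi + t) = mirror (-1) (-1) (?C t)" "?C (pi + (pi - t)) = mirror 1 (-1) (?C t)" "?C t = mirror 1 1 (?C t)"
    by (simp_all add: mirror_def cos_add sin_add cos_diff sin_diff)
   then show "indicator {pi / 4..pi / 2} t * (\<phi> (?C t) + \<phi> (?C (pi - t))) + indicator {pi / 4..pi / 2} t * (\<phi> (?C (pi + t)) + \<phi> (?C (pi + (pi - t))))
    = indicator {pi / 4..pi / 2} t * symm \<phi> (?C t)"
    unfolding symm_def by (simp only: distrib_left add_ac)
  qed
  finally show ?thesis by (simp add: power2_eq_square)
 qed
 have EG: "(\<integral>z. \<phi> z \<partial>level_Xi_EG a \<alpha>) = 2 * a * (LBINT y. indicator {0..s / 2} y * (y * symm \<phi> (Complex (s - y) y)))"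
 proof -
  let ?h = "\<lambda>z. sqrt 2 * a * \<bar>Im z\<bar> * \<phi> z"
  have ch: "continuous_on UNIV ?h" by (intro continuous_intros \<phi>)
  have [measurable]: "?h \<in> borel_measurable borel" by measurable
  have h0: "?h z = 0" if "norm z > R" for z using 0[OF that] by simp
  have seg: "(\<integral>z. ?h z \<partial>length_measure (linepath (Complex (c * s) 0) (Complex (c * s / 2) (d * s / 2)))) = 2 * a * (LBINT y. indicator {0..s / 2} y * (y * \<phi> (mirror c d (Complex (s - y) y))))"
   if cd: "c = 1 \<or> c = -1" "d = 1 \<or> d = -1" for c d
  proof -
   let ?g = "linepath (Complex (c * s) 0) (Complex (c * s / 2) (d * s / 2))"
   have "?g \<in> set (segments_EG s)" using cd by (auto simp: segments_EG_def)
   note sp = segments_speed[OF this]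
   have g: "?g t = mirror c d (Complex (s - s / 2 * t) (s / 2 * t))" for t
    by (simp add: linepath_def mirror_def complex_eq_iff algebra_simps)
   have "(\<integral>z. ?h z \<partial>length_measure ?g) = s / sqrt 2 * (LBINT t. indicator {0..1} t * ?h (?g t))"
    by (rule integral_length_measure[OF sp(1)]) (use s_pos sp(2) in auto)
   also have "\<dots> = s / sqrt 2 * (LBINT t. sqrt 2 * a * (indicator {0..1} t * ((s / 2 * t) * \<phi> (mirror c d (Complex (s - s / 2 * t) (s / 2 * t))))))"
   proof (rule arg_cong[where f = "\<lambda>x. s / sqrt 2 * x"], rule Bochner_Integration.integral_cong[OF refl])
    fix t :: real
    have "\<bar>Im (?g t)\<bar> = s / 2 * t" if "t \<in> {0..1}"
     using that cd s_pos unfolding g by (auto simp: mirror_def abs_mult)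
    then show "indicator {0..1} t * ?h (?g t) = sqrt 2 * a * (indicator {0..1} t * ((s / 2 * t) * \<phi> (mirror c d (Complex (s - s / 2 * t) (s / 2 * t)))))"
     by (cases "t \<in> {0..1}") (simp_all add: g)
   qed
   also have "\<dots> = 2 * a * ((s / 2 - 0) * (LBINT t. indicator {0..1} t * ((0 + (s / 2 - 0) * t) * \<phi> (mirror c d (Complex (s - (0 + (s / 2 - 0) * t)) (0 + (s / 2 - 0) * t))))))"
    by (subst integral_mult_right_zero) simp
   also have "(s / 2 - 0) * (LBINT t. indicator {0..1} t * ((0 + (s / 2 - 0) * t) * \<phi> (mirror c d (Complex (s - (0 + (s / 2 - 0) * t)) (0 + (s / 2 - 0) * t)))))
     = (LBINT y. indicator {0..s / 2} y * (y * \<phi> (mirror c d (Complex (s - y) y))))"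
    by (rule integral_affine_Icc) (use s_pos in simp)
   finally show ?thesis .
  qed
  have li: "integrable (length_measure g) ?h" if "g \<in> set (segments_EG s)" for g
   using that segments_speed radon_length_measure[where c = "s / sqrt 2"] s_pos
   by (intro radon_integrable[OF _ ch h0]) auto
  have I: "integrable lborel (\<lambda>y. indicator {0..s / 2} y * (y * \<phi> (mirror c d (Complex (s - y) y))))" for c d
   unfolding mirror_def by (intro integrable_Icc continuous_intros c\<phi>)
  have "(\<integral>z. \<phi> z \<partial>level_Xi_EG a \<alpha>) = (\<integral>z. ?h z \<partial>borel_sum (map length_measure (segments_EG s)))"
   unfolding level_Xi_EG_def s_def[symmetric] using a by (subst integral_density) auto
  also have "\<dots> = (\<Sum>M\<leftarrow>map length_measure (segments_EG s). \<integral>z. ?h z \<partial>M)"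
   by (intro integral_borel_sum) (auto intro: li)
  also have "\<dots> = 2 * a * ((LBINT y. indicator {0..s / 2} y * (y * \<phi> (mirror 1 1 (Complex (s - y) y))))
    + (LBINT y. indicator {0..s / 2} y * (y * \<phi> (mirror 1 (-1) (Complex (s - y) y))))
    + (LBINT y. indicator {0..s / 2} y * (y * \<phi> (mirror (-1) 1 (Complex (s - y) y))))
    + (LBINT y. indicator {0..s / 2} y * (y * \<phi> (mirror (-1) (-1) (Complex (s - y) y)))))"
   using seg[of 1 1] seg[of 1 "-1"] seg[of "-1" 1] seg[of "-1" "-1"] by (simp add: segments_EG_def distrib_left)
  also have "\<dots> = 2 * a * (LBINT y. indicator {0..s / 2} y * (y * symm \<phi> (Complex (s - y) y)))"
   unfolding symm_def distrib_left using I by (simp add: distrib_left)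
  finally show ?thesis .
 qed
 have "(\<integral>z. \<phi> z \<partial>level_Xi a \<alpha>) = (\<Sum>M\<leftarrow>[level_Xi_F a \<alpha>, level_Xi_EF a \<alpha>, level_Xi_EG a \<alpha>]. \<integral>z. \<phi> z \<partial>M)"
  unfolding level_Xi_def using radon_level_Xi by (intro integral_borel_sum) (auto intro: ri simp: radon_measures_def)
 then show ?thesis by (simp add: F EF EG)
qed

end

context level
begin

lemma level_p_mirror: "c = 1 \<or> c = -1 ==> d = 1 \<or> d = -1 ==> level_p a \<alpha> (mirror c d z) = level_p a \<alpha> z"
 unfolding level_p_def closure_phase_G[OF crit_pos[OF a \<alpha>]] closure_phase_F[OF crit_pos[OF a \<alpha>]]
 by (auto simp: mirror_def)

text \<open>The test function is symmetrised and both second derivatives are integrated by parts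
  over the quadrant. The terms of phase E cancel because \<open>level_p\<close> is harmonic there;
  the rest matches \<open>integral_level_Xi\<close> term by term.\<close>

theorem level_p_Laplacian:
 assumes "C2c \<phi> L"
 shows "(LBINT z. level_p a \<alpha> z * L z) = (\<integral>z. \<phi> z \<partial>level_Xi a \<alpha>)"
proof -
 obtain \<phi>x \<phi>y \<phi>xx \<phi>yy R where \<phi>: "C2_on UNIV \<phi> \<phi>x \<phi>y \<phi>xx \<phi>yy" and z: "\<And>z. norm z > R ==> \<phi> z = 0"
  and L: "L = (\<lambda>z. \<phi>xx z + \<phi>yy z)" using assms unfolding C2c_def by blast
 \<comment> \<open>The signs come from the chain rule for the reflections; they make
   \<open>\<psi>x\<close> vanish on the imaginary axis and \<open>\<psi>y\<close> on the real
   axis.\<close>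
 define \<psi>x where "\<psi>x z = 1 * \<phi>x (mirror 1 1 z) + 1 * \<phi>x (mirror 1 (-1) z) + (-1) * \<phi>x (mirror (-1) 1 z) + (-1) * \<phi>x (mirror (-1) (-1) z)" for z
 define \<psi>y where "\<psi>y z = 1 * \<phi>y (mirror 1 1 z) + (-1) * \<phi>y (mirror 1 (-1) z) + 1 * \<phi>y (mirror (-1) 1 z) + (-1) * \<phi>y (mirror (-1) (-1) z)" for z
 have \<psi>: "C2_on UNIV (symm \<phi>) \<psi>x \<psi>y (symm \<phi>xx) (symm \<phi>yy)"
  unfolding symm_def[abs_def] \<psi>x_def[abs_def] \<psi>y_def[abs_def]
  by (intro C2_on_add C2_on_mirror[OF \<phi>]) auto
 have \<psi>0: "symm \<phi> z = 0" if "norm z > R" for z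
 proof -
  have "norm (mirror c d z) = norm z" if "c = 1 \<or> c = -1" "d = 1 \<or> d = -1" for c d
   using that by (auto simp: mirror_def cmod_def)
  then show ?thesis using that by (simp add: symm_def z)
 qed
 have e: "\<psi>x (Complex 0 y) = 0" "\<psi>y (Complex x 0) = 0" for x y
  by (simp_all add: \<psi>x_def \<psi>y_def mirror_def)
 have ip: "integrable lborel (\<lambda>z. level_p a \<alpha> z * f z)" if "continuous_on UNIV f" "\<And>z. norm z > R ==> f z = 0" for f
  by (rule integrable_cont_compact_support[of _ R]) (auto simp: that intro!: continuous_intros continuous_level_p)
 have iq: "integrable lborel (\<lambda>z. indicator quadrant z * (level_p a \<alpha> z * f z))" if "continuous_on UNIV f" "\<And>z. norm z > R ==> f z = 0" for f
  using integrable_mult_indicator[OF _ ip[OF that], of quadrant] by simp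
 have s0: "symm \<phi>xx z = 0" "symm \<phi>yy z = 0" if "norm z > R" for z
  using C2_support[OF \<psi>, of R z] \<psi>0 that by auto
 have L0: "L z = 0" if "norm z > R" for z
  using C2_support[OF \<phi>, of R z] z that by (auto simp: L)
 have "continuous_on UNIV L" unfolding L by (intro continuous_intros C2_onD[OF \<phi>])
 then have "(LBINT z. level_p a \<alpha> z * L z) = (LBINT z. indicator quadrant z * symm (\<lambda>z. level_p a \<alpha> z * L z) z)"
  by (intro integral_quadrant ip L0)
 also have "(\<lambda>z. indicator quadrant z * symm (\<lambda>z. level_p a \<alpha> z * L z) z) =
   (\<lambda>z. indicator quadrant z * (level_p a \<alpha> z * symm \<phi>xx z) + indicator quadrant z * (level_p a \<alpha> z * symm \<phi>yy z))"
  by (simp add: fun_eq_iff symm_def level_p_mirror L algebra_simps)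
 also have "(LBINT z. indicator quadrant z * (level_p a \<alpha> z * symm \<phi>xx z) + indicator quadrant z * (level_p a \<alpha> z * symm \<phi>yy z))
  = (LBINT z. indicator quadrant z * (level_p a \<alpha> z * symm \<phi>xx z)) + (LBINT z. indicator quadrant z * (level_p a \<alpha> z * symm \<phi>yy z))"
  by (intro Bochner_Integration.integral_add iq C2_onD[OF \<psi>] s0)
 also have "\<dots> = (\<integral>z. \<phi> z \<partial>level_Xi a \<alpha>)"
 proof -
  note dx = level_p_dxx[where R = R, OF \<psi> \<psi>0 e, simplified] and dy = level_p_dyy[where R = R, OF \<psi> \<psi>0 e, simplified]
  note dX = integral_level_Xi[where R = R, OF C2_onD(1)[OF \<phi>] z, simplified]
  show ?thesis
   using boundary_integrals[OF C2_onD(1)[OF \<psi>]] dx dy dX by simp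
 qed
 finally show ?thesis .
qed

end

text \<open>A value of the Frechet derivative in direction 1 or \<i> is a derivative along an axis,
  and differentiability of the iterated derivatives gives their continuity.\<close>

lemma smooth_C2c:
 assumes "smooth \<phi>" "compactly_supported \<phi>"
 shows "C2c \<phi> (laplacian \<phi>)"
proof -
 have D: "((\<lambda>x. f (Complex x (Im z))) has_real_derivative partial_deriv 1 f z) (at (Re z)) \<and>
   ((\<lambda>y. f (Complex (Re z) y)) has_real_derivative partial_deriv \<i> f z) (at (Im z))"
  if "\<And>z. f differentiable at z" for f z
 proof -
  let ?D = "frechet_derivative f (at z)"
  have f: "(f has_derivative ?D) (at (Complex (Re z) (Im z)))"
   using that[of z] by (simp add: frechet_derivative_works[symmetric])
  interpret linear ?D using f by (rule has_derivative_linear)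
  have sc: "?D (of_real t * w) = t * ?D w" for t w using scaleR[of t w] by (simp add: scaleR_conv_of_real)
  have "((\<lambda>x. Complex x (Im z)) has_derivative of_real) (at (Re z))"
   unfolding Complex_eq by (auto intro!: derivative_eq_intros)
  from has_derivative_compose[OF this f]
  have 1: "((\<lambda>x. f (Complex x (Im z))) has_derivative (\<lambda>t. ?D (of_real t))) (at (Re z))" .
  have "((\<lambda>y. Complex (Re z) y) has_derivative (\<lambda>t. of_real t * \<i>)) (at (Im z))"
   unfolding Complex_eq by (auto intro!: derivative_eq_intros)
  from has_derivative_compose[OF this f]
  have 2: "((\<lambda>y. f (Complex (Re z) y)) has_derivative (\<lambda>t. ?D (of_real t * \<i>))) (at (Im z))" .
  have "(\<lambda>t. ?D (of_real t)) = (*) (partial_deriv 1 f z)" "(\<lambda>t. ?D (of_real t * \<i>)) = (*) (partial_deriv \<i> f z)"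
   using sc[of _ 1] sc[of _ \<i>] by (simp_all add: fun_eq_iff partial_deriv_def mult.commute)
  then show ?thesis using 1 2 by (simp add: has_field_derivative_def)
 qed
 have d: "fold partial_deriv vs \<phi> differentiable at z" if "vs \<in> lists {1, \<i>}" for vs z
  using assms(1) that unfolding smooth_def by blast
 have c: "continuous_on UNIV (fold partial_deriv vs \<phi>)" if "vs \<in> lists {1, \<i>}" for vs
  using d[OF that] by (auto intro!: continuous_at_imp_continuous_on differentiable_imp_continuous_within)
 have "C2_on UNIV \<phi> (partial_deriv 1 \<phi>) (partial_deriv \<i> \<phi>) (partial_deriv 1 (partial_deriv 1 \<phi>)) (partial_deriv \<i> (partial_deriv \<i> \<phi>))"
  unfolding C2_on_def
  using c[of "[]"] c[of "[1]"] c[of "[\<i>]"] c[of "[1, 1]"] c[of "[\<i>, \<i>]"]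
   D[of \<phi>] D[of "partial_deriv 1 \<phi>"] D[of "partial_deriv \<i> \<phi>"] d[of "[]"] d[of "[1]"] d[of "[\<i>]"]
  by simp
 moreover obtain R where "\<And>z. norm z > R ==> \<phi> z = 0" using compactly_supportedE[OF assms(2)] by blast
 ultimately show ?thesis unfolding C2c_def laplacian_def[abs_def] by blast
qed

lemma
 assumes pos: "\<And>k. k \<in> {1..d} ==> a k > 0" "\<And>k. k \<in> {1..d} ==> \<alpha> k > 1"
 shows radon_grem_Xi: "grem_Xi d a \<alpha> \<in> radon_measures"
  and continuous_grem_p: "continuous_on UNIV (grem_p d a \<alpha>)"
  and grem_p_Laplacian: "C2c \<phi> L ==> (LBINT z. grem_p d a \<alpha> z * L z) = (\<integral>z. \<phi> z \<partial>grem_Xi d a \<alpha>)"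
  and grem_p_distributional_Laplacian: "has_distributional_laplacian (grem_p d a \<alpha>) (grem_Xi d a \<alpha>)"
proof -
 have l: "level (a k) (\<alpha> k)" if "k \<in> {1..d}" for k using pos[OF that] by unfold_locales
 have r: "level_Xi (a k) (\<alpha> k) \<in> radon_measures" if "k \<in> {1..d}" for k using level.radon_level_Xi(4)[OF l[OF that]] .
 have set: "set [1..<Suc d] = {1..d}" by auto
 show X: "grem_Xi d a \<alpha> \<in> radon_measures"
  unfolding grem_Xi_def by (intro radon_borel_sum) (use r set in auto)
 show c: "continuous_on UNIV (grem_p d a \<alpha>)"
  unfolding grem_p_def[abs_def] by (intro continuous_on_sum level.continuous_level_p l)
 show *: "(LBINT z. grem_p d a \<alpha> z * L z) = (\<integral>z. \<phi> z \<partial>grem_Xi d a \<alpha>)" if C: "C2c \<phi> L" for \<phi> L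
 proof -
  obtain R where R: "continuous_on UNIV \<phi>" "continuous_on UNIV L" "\<And>z. norm z > R ==> \<phi> z = 0" "\<And>z. norm z > R ==> L z = 0"
   using C2cE[OF C] by blast
  have i: "integrable lborel (\<lambda>z. level_p (a k) (\<alpha> k) z * L z)" if "k \<in> {1..d}" for k
   by (rule integrable_cont_compact_support[of _ R]) (auto simp: R intro!: continuous_intros level.continuous_level_p l that)
  have "(LBINT z. grem_p d a \<alpha> z * L z) = (\<Sum>k=1..d. \<integral>z. level_p (a k) (\<alpha> k) z * L z \<partial>lborel)"
   unfolding grem_p_def sum_distrib_right by (intro Bochner_Integration.integral_sum i)
  also have "\<dots> = (\<Sum>k=1..d. \<integral>z. \<phi> z \<partial>level_Xi (a k) (\<alpha> k))"
   by (intro sum.cong refl level.level_p_Laplacian[OF l C])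
  also have "\<dots> = (\<Sum>M\<leftarrow>map (\<lambda>k. level_Xi (a k) (\<alpha> k)) [1..<Suc d]. \<integral>z. \<phi> z \<partial>M)"
   by (simp add: sum_list_distinct_conv_sum_set atLeastLessThanSuc_atLeastAtMost comp_def del: upt_Suc)
  also have "\<dots> = (\<integral>z. \<phi> z \<partial>grem_Xi d a \<alpha>)"
   unfolding grem_Xi_def
  proof (intro integral_borel_sum(2)[symmetric])
   fix M assume "M \<in> set (map (\<lambda>k. level_Xi (a k) (\<alpha> k)) [1..<Suc d])"
   then have M: "M \<in> radon_measures" using r set by auto
   then show "sets M = sets borel" by (simp add: radon_measures_def)
   show "integrable M \<phi>" by (rule radon_integrable[OF M R(1,3)])
  qed (use R(1) in \<open>rule borel_measurable_continuous_onI\<close>)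
  finally show ?thesis .
 qed
 show "has_distributional_laplacian (grem_p d a \<alpha>) (grem_Xi d a \<alpha>)"
  unfolding has_distributional_laplacian_def
  by (intro conjI c X allI impI *[OF smooth_C2c]) auto
qed

section \<open>Moment inequalities and characteristic functions\<close>

text \<open>Bernoulli's inequality for exponents at most 1, read off from the convexity of
  \<open>exp\<close> between 0 and \<open>ln u\<close>.\<close>

lemma powr_le_affine:
 fixes u r :: real
 assumes "0 <= u" "0 < r" "r <= 1"
 shows "u powr r <= 1 + r * (u - 1)"
proof (cases "u = 0")
 case False
 then have "u > 0" using assms by simp
 have "exp ((1 - r) *\<^sub>R 0 + r *\<^sub>R ln u) <= (1 - r) * exp 0 + r * exp (ln u)"
  using exp_convex assms by (intro convex_onD) auto
 then show ?thesis using \<open>u > 0\<close> by (simp add: powr_def algebra_simps)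
qed (use assms in auto)

lemma powr_add_le_4:
 fixes x y q :: real
 assumes "0 <= x" "0 <= y" "0 < q" "q <= 2"
 shows "(x + y) powr q <= 4 * (x powr q + y powr q)"
proof -
 have "(x + y) powr q <= (2 * max x y) powr q" using assms by (intro powr_mono2) auto
 also have "\<dots> = 2 powr q * max x y powr q" using assms by (subst powr_mult) auto
 also have "\<dots> <= 4 * max x y powr q"
  using powr_mono[of q 2 2] assms by (intro mult_right_mono) auto
 also have "max x y powr q <= x powr q + y powr q" by (auto simp: max_def)
 finally show ?thesis by simp
qed

text \<open>An expansion around \<open>x\<close> whose linear term will integrate to 0 for a centred
  independent \<open>y\<close>. If \<open>|y| <= |x|\<close>, then \<open>|x + y|^q\<close> is the
  power \<open>q / 2 <= 1\<close> of \<open>|x|^2 + B\<close>, bounded by its tangent at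
  \<open>|x|^2\<close>. Otherwise each term is comparable with \<open>|y|^q\<close>: the left side
  is at most 4 times it and the linear term at most 2 times it, whence the 6.\<close>

lemma vBE_pointwise:
 fixes x y :: complex
 assumes q: "1 <= q" "q <= 2"
 shows "norm (x + y) powr q <= norm x powr q + q * norm x powr (q - 2) * Re (cnj x * y) + 6 * norm y powr q"
proof (cases "x = 0 \<or> y = 0")
 case True
 then show ?thesis by auto
next
 case False
 then have x: "norm x > 0" and y: "norm y > 0" by auto
 have nR: "\<bar>Re (cnj x * y)\<bar> <= norm x * norm y"
  using abs_Re_le_cmod[of "cnj x * y"] by (simp add: norm_mult)
 show ?thesis
 proof (cases "norm y <= norm x")
  case True
  define A where "A = (norm x)^2"
  define B where "B = 2 * Re (cnj x * y) + (norm y)^2"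
  have A: "A > 0" using x by (simp add: A_def)
  have AB: "(norm (x + y))^2 = A + B"
   unfolding A_def B_def cmod_power2 by (simp add: square_simps)
  then have nn: "0 <= A + B" by (metis zero_le_power2)
  have pw: "t powr q = (t^2) powr (q / 2)" if "t >= 0" for t :: real
   using that by (cases "t = 0") (auto simp: powr_def ln_realpow)
  have Ap: "A powr (q / 2) = norm x powr q" unfolding A_def by (rule pw[symmetric, OF norm_ge_zero])
  have Aq: "A powr (q / 2) / A = norm x powr (q - 2)"
   unfolding Ap unfolding A_def using x by (simp add: powr_diff)
  have "norm (x + y) powr q = (A + B) powr (q / 2)" using pw[of "norm (x + y)"] AB by simp
  also have "\<dots> = A powr (q / 2) * ((A + B) / A) powr (q / 2)"
   using A nn by (simp add: powr_divide)
  also have "\<dots> <= A powr (q / 2) * (1 + q / 2 * ((A + B) / A - 1))"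
   using A nn q by (intro mult_left_mono powr_le_affine) auto
  also have "\<dots> = A powr (q / 2) + q / 2 * (A powr (q / 2) / A) * B"
   using A by (simp add: field_simps)
  also have "\<dots> = norm x powr q + q * norm x powr (q - 2) * Re (cnj x * y) + q / 2 * (norm x powr (q - 2) * (norm y)^2)"
   unfolding Aq unfolding Ap B_def by (simp add: algebra_simps)
  also have "norm x powr (q - 2) * (norm y)^2 <= norm y powr (q - 2) * (norm y)^2"
   using True y q by (intro mult_right_mono powr_mono2') auto
  also have "norm y powr (q - 2) * (norm y)^2 = norm y powr q"
   using y by (simp add: powr_diff)
  also have "q / 2 * norm y powr q <= 6 * norm y powr q" using q by (intro mult_right_mono) auto
  finally show ?thesis using q by simp
 next
  case False
  have "norm (x + y) powr q <= (2 * norm y) powr q"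
   using norm_triangle_ineq[of x y] False q by (intro powr_mono2) auto
  also have "\<dots> = 2 powr q * norm y powr q" by (subst powr_mult) auto
  also have "\<dots> <= 4 * norm y powr q"
   using powr_mono[of q 2 2] q by (intro mult_right_mono) auto
  finally have 1: "norm (x + y) powr q <= 4 * norm y powr q" .
  have "q * norm x powr (q - 2) * (- Re (cnj x * y)) <= q * norm x powr (q - 2) * \<bar>Re (cnj x * y)\<bar>"
   using q by (intro mult_left_mono mult_nonneg_nonneg powr_ge_zero) linarith+
  also have "\<dots> <= 2 * norm x powr (q - 2) * (norm x * norm y)"
   using nR q by (intro mult_mono mult_right_mono) auto
  also have "\<dots> = 2 * (norm x powr (q - 1) * norm y)"
   using x by (simp add: powr_diff power2_eq_square field_simps)
  also have "norm x powr (q - 1) * norm y <= norm y powr (q - 1) * norm y"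
   using False q by (intro mult_right_mono powr_mono2) auto
  also have "norm y powr (q - 1) * norm y = norm y powr q" using y by (simp add: powr_diff)
  finally have "- (q * norm x powr (q - 2) * Re (cnj x * y)) <= 2 * norm y powr q" by (simp only: mult_minus_right mult.assoc)
  moreover have "norm x powr q >= 0" by simp
  ultimately show ?thesis using 1 by linarith
 qed
qed

section \<open>Gaussian exponential moments\<close>

abbreviation gauss :: "real measure" where "gauss \<equiv> std_normal_distribution"

text \<open>The square is completed for \<open>Re z\<close> only: translating by \<open>Re z\<close>
  turns the integrand into a constant times \<open>iexp (Im z * u)\<close>, and the characteristic
  function of the normal law does the rest.\<close>

lemma gauss_exp:
 fixes z :: complex
 shows "integrable gauss (\<lambda>x. exp (z * of_real x))"
  and "(\<integral>x. exp (z * of_real x) \<partial>gauss) = exp (z^2 / 2)"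
proof -
 interpret N: real_distribution gauss by (rule real_dist_normal_dist)
 define s t where "s = Re z" and "t = Im z"
 have z: "z = of_real s + \<i> * of_real t" by (simp add: s_def t_def complex_eq)
 define K where "K = exp (of_real (s^2 / 2) + \<i> * of_real (s * t))"
 have shift: "std_normal_density (s + 1 * u) *\<^sub>R exp (z * of_real (s + 1 * u)) = K * (std_normal_density u *\<^sub>R iexp (t * u))" for u
 proof -
  have 1: "std_normal_density (s + u) = exp (- s\<^sup>2 / 2 - s * u) * std_normal_density u"
   by (simp add: std_normal_density_def exp_add[symmetric] power2_eq_square field_simps)
  have 2: "of_real (exp (- s\<^sup>2 / 2 - s * u)) * exp (z * of_real (s + u)) = K * iexp (t * u)"
   unfolding K_def exp_of_real[symmetric] exp_add[symmetric] z
   by (rule arg_cong[of _ _ exp]) (simp add: complex_eq_iff power2_eq_square field_simps)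
  have "std_normal_density (s + u) *\<^sub>R exp (z * of_real (s + u)) = of_real (std_normal_density u) * (of_real (exp (- s\<^sup>2 / 2 - s * u)) * exp (z * of_real (s + u)))"
   by (simp add: 1 scaleR_conv_of_real)
  then show ?thesis unfolding 2 by (simp add: scaleR_conv_of_real)
 qed
 have "integrable gauss (\<lambda>u. iexp (t * u))"
  by (intro N.integrable_const_bound[of _ 1]) auto
 then have "integrable lborel (\<lambda>u. std_normal_density u *\<^sub>R iexp (t * u))"
  by (subst (asm) integrable_density) auto
 then have i: "integrable lborel (\<lambda>u. K * (std_normal_density u *\<^sub>R iexp (t * u)))"
  by (rule integrable_mult_right)
 then have i2: "integrable lborel (\<lambda>x. std_normal_density x *\<^sub>R exp (z * of_real x))"
  using lborel_integrable_real_affine_iff[of 1 "\<lambda>x. std_normal_density x *\<^sub>R exp (z * of_real x)" s] by (simp only: shift)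
 then show "integrable gauss (\<lambda>x. exp (z * of_real x))"
  by (subst integrable_density) auto
 have "(\<integral>x. exp (z * of_real x) \<partial>gauss) = (LBINT x. std_normal_density x *\<^sub>R exp (z * of_real x))"
  by (subst integral_density) auto
 also have "\<dots> = (LBINT u. K * (std_normal_density u *\<^sub>R iexp (t * u)))"
  by (subst lborel_integral_real_affine[of 1 _ s]) (simp_all only: shift, simp_all)
 also have "\<dots> = K * (LBINT u. std_normal_density u *\<^sub>R iexp (t * u))"
  by (rule integral_mult_right_zero)
 also have "(LBINT u. std_normal_density u *\<^sub>R iexp (t * u)) = (\<integral>u. iexp (t * u) \<partial>gauss)"
  by (subst integral_density) auto
 also have "(\<integral>u. iexp (t * u) \<partial>gauss) = of_real (exp (- (t^2) / 2))"
  using char_std_normal_distribution unfolding char_def by meson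
 also have "K * of_real (exp (- (t^2) / 2)) = exp (z^2 / 2)"
  unfolding K_def exp_of_real[symmetric] exp_add[symmetric] z
  by (rule arg_cong[of _ _ exp]) (simp add: complex_eq_iff power2_eq_square field_simps)
 finally show "(\<integral>x. exp (z * of_real x) \<partial>gauss) = exp (z^2 / 2)" .
qed

lemma gauss_exp_real:
 fixes s :: real
 shows "integrable gauss (\<lambda>x. exp (s * x))"
  and "(\<integral>x. exp (s * x) \<partial>gauss) = exp (s^2 / 2)"
proof -
 have e: "(\<lambda>x. Re (exp (of_real s * of_real x))) = (\<lambda>x. exp (s * x))"
  by (simp add: Re_exp)
 show "integrable gauss (\<lambda>x. exp (s * x))"
  using integrable_Re[OF gauss_exp(1)[of "of_real s"]] unfolding e .
 have "(\<integral>x. exp (s * x) \<partial>gauss) = Re (exp ((of_real s)^2 / 2))"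
  using integral_Re[OF gauss_exp(1)[of "of_real s"]] unfolding e gauss_exp(2) by simp
 also have "\<dots> = exp (s^2 / 2)" by (simp add: Re_exp power2_eq_square)
 finally show "(\<integral>x. exp (s * x) \<partial>gauss) = exp (s^2 / 2)" .
qed

section \<open>Independence, moments of fractional order and anticoncentration\<close>

context prob_space
begin

text \<open>The library's \<open>indep_var\<close> requires both variables to have the same type.\<close>

definition indep_pair :: "'b measure \<Rightarrow> ('a \<Rightarrow> 'b) \<Rightarrow> 'c measure \<Rightarrow> ('a \<Rightarrow> 'c) \<Rightarrow> bool" where
 "indep_pair N1 X N2 Y \<longleftrightarrow> random_variable N1 X \<and> random_variable N2 Y \<and>
  distr M (N1 \<Otimes>\<^sub>M N2) (\<lambda>w. (X w, Y w)) = distr M N1 X \<Otimes>\<^sub>M distr M N2 Y"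

lemma indep_pairD:
 assumes "indep_pair N1 X N2 Y"
 shows "random_variable N1 X" "random_variable N2 Y"
  and "distr M (N1 \<Otimes>\<^sub>M N2) (\<lambda>w. (X w, Y w)) = distr M N1 X \<Otimes>\<^sub>M distr M N2 Y"
 using assms by (auto simp: indep_pair_def)

lemma indep_pair_iff_indep_var: "indep_pair N1 X N2 Y \<longleftrightarrow> indep_var N1 X N2 Y"
 by (auto simp: indep_pair_def indep_var_distribution_eq)

lemma indep_pair_compose:
 assumes "indep_pair N1 X N2 Y" and f[measurable]: "f \<in> measurable N1 L1" and g[measurable]: "g \<in> measurable N2 L2"
 shows "indep_pair L1 (\<lambda>w. f (X w)) L2 (\<lambda>w. g (Y w))"
proof -
 note [measurable] = indep_pairD(1,2)[OF assms(1)]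
 have gY: "random_variable L2 (\<lambda>w. g (Y w))" by measurable
 then interpret Y: prob_space "distr M L2 (\<lambda>w. g (Y w))" by (rule prob_space_distr)
 have "distr M (L1 \<Otimes>\<^sub>M L2) (\<lambda>w. (f (X w), g (Y w))) = distr (distr M (N1 \<Otimes>\<^sub>M N2) (\<lambda>w. (X w, Y w))) (L1 \<Otimes>\<^sub>M L2) (\<lambda>(x, y). (f x, g y))"
  by (subst distr_distr) (auto simp: o_def)
 also have "\<dots> = distr (distr M N1 X \<Otimes>\<^sub>M distr M N2 Y) (L1 \<Otimes>\<^sub>M L2) (\<lambda>(x, y). (f x, g y))"
  unfolding indep_pairD(3)[OF assms(1)] ..
 also have "\<dots> = distr (distr M N1 X) L1 f \<Otimes>\<^sub>M distr (distr M N2 Y) L2 g"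
 proof (rule pair_measure_distr[symmetric])
  show "sigma_finite_measure (distr (distr M N2 Y) L2 g)"
   using Y.sigma_finite_measure_axioms by (subst distr_distr) (auto simp: o_def)
 qed measurable
 also have "\<dots> = distr M L1 (\<lambda>w. f (X w)) \<Otimes>\<^sub>M distr M L2 (\<lambda>w. g (Y w))"
  by (simp add: distr_distr o_def)
 finally show ?thesis unfolding indep_pair_def by simp
qed

lemma indep_pair_of_disjoint:
 assumes "indep_vars M' X I" "K \<inter> L = {}" "K \<subseteq> I" "L \<subseteq> I"
  and "F \<in> measurable (PiM K M') N1" "G \<in> measurable (PiM L M') N2"
 shows "indep_pair N1 (\<lambda>w. F (\<lambda>i\<in>K. X i w)) N2 (\<lambda>w. G (\<lambda>i\<in>L. X i w))"
 using indep_var_restrict[OF assms(1-4)] assms(5,6)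
 unfolding indep_pair_iff_indep_var[symmetric] by (rule indep_pair_compose)

lemma indep_vars_of_disjoint:
 assumes "indep_vars M' X I" "\<And>j. j \<in> L ==> K j \<subseteq> I" "disjoint_family_on K L"
  and "\<And>j. j \<in> L ==> F j \<in> measurable (PiM (K j) M') (N j)"
 shows "indep_vars N (\<lambda>j w. F j (\<lambda>i\<in>K j. X i w)) L"
 by (rule indep_vars_compose2[OF indep_vars_restrict[OF assms(1-3)] assms(4)])

lemma nn_integral_indep_pair:
 assumes ind: "indep_pair N1 X N2 Y" and f: "f \<in> borel_measurable (N1 \<Otimes>\<^sub>M N2)"
 shows "(\<integral>\<^sup>+w. f (X w, Y w) \<partial>M) = (\<integral>\<^sup>+w. (\<integral>\<^sup>+x. f (x, Y w) \<partial>distr M N1 X) \<partial>M)"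
proof -
 have rv[measurable]: "random_variable N1 X" "random_variable N2 Y" using indep_pairD[OF ind] by auto
 interpret X: prob_space "distr M N1 X" by (rule prob_space_distr) fact
 interpret Y: prob_space "distr M N2 Y" by (rule prob_space_distr) fact
 interpret XY: pair_prob_space "distr M N1 X" "distr M N2 Y" ..
 have f': "f \<in> borel_measurable (distr M N1 X \<Otimes>\<^sub>M distr M N2 Y)" using f by simp
 have "(\<integral>\<^sup>+w. f (X w, Y w) \<partial>M) = (\<integral>\<^sup>+p. f p \<partial>distr M (N1 \<Otimes>\<^sub>M N2) (\<lambda>w. (X w, Y w)))"
  using f by (subst nn_integral_distr) auto
 also have "\<dots> = (\<integral>\<^sup>+p. f p \<partial>(distr M N1 X \<Otimes>\<^sub>M distr M N2 Y))"
  using indep_pairD(3)[OF ind] by simp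
 also have "\<dots> = (\<integral>\<^sup>+y. (\<integral>\<^sup>+x. f (x, y) \<partial>distr M N1 X) \<partial>distr M N2 Y)"
  by (rule XY.nn_integral_snd[OF f', symmetric])
 also have "\<dots> = (\<integral>\<^sup>+w. (\<integral>\<^sup>+x. f (x, Y w) \<partial>distr M N1 X) \<partial>M)"
 proof -
  have "(\<lambda>(y, x). f (x, y)) \<in> borel_measurable (N2 \<Otimes>\<^sub>M distr M N1 X)" using f by measurable
  then have "(\<lambda>y. \<integral>\<^sup>+x. f (x, y) \<partial>distr M N1 X) \<in> borel_measurable N2"
   by (rule X.borel_measurable_nn_integral)
  then show ?thesis using rv(2) by (simp add: nn_integral_distr)
 qed
 finally show ?thesis .
qed

lemma integral_indep_pair:
 fixes f :: "_ \<Rightarrow> complex"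
 assumes ind: "indep_pair N1 X N2 Y" and f: "f \<in> borel_measurable (N1 \<Otimes>\<^sub>M N2)" and bd: "\<And>p. norm (f p) <= B"
 shows "(\<integral>w. f (X w, Y w) \<partial>M) = (\<integral>w. (\<integral>x. f (x, Y w) \<partial>distr M N1 X) \<partial>M)"
  and "(\<lambda>w. \<integral>x. f (x, Y w) \<partial>distr M N1 X) \<in> borel_measurable M"
proof -
 have rv[measurable]: "random_variable N1 X" "random_variable N2 Y" using indep_pairD[OF ind] by auto
 interpret X: prob_space "distr M N1 X" by (rule prob_space_distr) fact
 interpret Y: prob_space "distr M N2 Y" by (rule prob_space_distr) fact
 interpret XY: pair_prob_space "distr M N1 X" "distr M N2 Y" ..
 have f': "f \<in> borel_measurable (distr M N1 X \<Otimes>\<^sub>M distr M N2 Y)" using f by simp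
 have i: "integrable (distr M N1 X \<Otimes>\<^sub>M distr M N2 Y) (case_prod (\<lambda>x y. f (x, y)))"
  using f' bd by (intro finite_measure.integrable_const_bound[OF prob_space.axioms(1)[OF XY.prob_space_axioms], of _ B]) auto
 have m: "(\<lambda>y. \<integral>x. f (x, y) \<partial>distr M N1 X) \<in> borel_measurable N2"
 proof -
  have "(\<lambda>(y, x). f (x, y)) \<in> borel_measurable (N2 \<Otimes>\<^sub>M distr M N1 X)" using f by measurable
  then show ?thesis by (rule X.borel_measurable_lebesgue_integral)
 qed
 then show "(\<lambda>w. \<integral>x. f (x, Y w) \<partial>distr M N1 X) \<in> borel_measurable M"
  using rv(2) by (rule measurable_compose[rotated])
 have "(\<integral>w. f (X w, Y w) \<partial>M) = (\<integral>p. f p \<partial>distr M (N1 \<Otimes>\<^sub>M N2) (\<lambda>w. (X w, Y w)))"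
  using f by (subst integral_distr) auto
 also have "\<dots> = (\<integral>p. f p \<partial>(distr M N1 X \<Otimes>\<^sub>M distr M N2 Y))"
  using indep_pairD(3)[OF ind] by simp
 also have "\<dots> = (\<integral>y. (\<integral>x. f (x, y) \<partial>distr M N1 X) \<partial>distr M N2 Y)"
  using XY.integral_snd[OF i] by simp
 also have "\<dots> = (\<integral>w. (\<integral>x. f (x, Y w) \<partial>distr M N1 X) \<partial>M)"
  using m by (subst integral_distr) auto
 finally show "(\<integral>w. f (X w, Y w) \<partial>M) = (\<integral>w. (\<integral>x. f (x, Y w) \<partial>distr M N1 X) \<partial>M)" .
qed

text \<open>\<open>C\<close> bounds the L^q norm, or for \<open>q < 1\<close> the corresponding
  quasi-norm. Because of the power on the right, the same \<open>C\<close> stays valid when the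
  order is lowered.\<close>

definition Lq_bound :: "real \<Rightarrow> ('a \<Rightarrow> complex) \<Rightarrow> real \<Rightarrow> bool" where
 "Lq_bound q Y C \<longleftrightarrow> random_variable borel Y \<and> integrable M (\<lambda>w. norm (Y w) powr q) \<and>
  expectation (\<lambda>w. norm (Y w) powr q) <= C powr q"

text \<open>Lyapunov's inequality: \<open>powr_le_affine\<close> with exponent \<open>r / q\<close>,
  applied to \<open>(|Y| / C) powr q\<close>, whose expectation is at most 1.\<close>

lemma Lq_bound_mono:
 assumes "Lq_bound q Y C" "0 < r" "r <= q" "C > 0"
 shows "Lq_bound r Y C"
proof -
 have [measurable]: "random_variable borel Y" and i: "integrable M (\<lambda>w. norm (Y w) powr q)"
  and b: "expectation (\<lambda>w. norm (Y w) powr q) <= C powr q" using assms by (auto simp: Lq_bound_def)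
 have pw: "norm (Y w) powr r <= C powr r * (1 + r / q * (norm (Y w) powr q / C powr q - 1))" for w
 proof -
  have "norm (Y w) powr r = C powr r * ((norm (Y w) / C) powr q) powr (r / q)"
   using assms by (simp add: powr_powr powr_divide)
  also have "\<dots> <= C powr r * (1 + r / q * ((norm (Y w) / C) powr q - 1))"
   using assms by (intro mult_left_mono powr_le_affine) auto
  finally show ?thesis using assms by (simp add: powr_divide)
 qed
 have i2: "integrable M (\<lambda>w. C powr r * (1 + r / q * (norm (Y w) powr q / C powr q - 1)))" using i by simp
 have i3: "integrable M (\<lambda>w. norm (Y w) powr r)"
 proof (rule Bochner_Integration.integrable_bound[OF i2 _ AE_I2])
  fix w
  show "norm (norm (Y w) powr r) <= norm (C powr r * (1 + r / q * (norm (Y w) powr q / C powr q - 1)))"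
   using order_trans[OF pw abs_ge_self] by (simp only: real_norm_def abs_of_nonneg[OF powr_ge_zero])
 qed measurable
 have "expectation (\<lambda>w. norm (Y w) powr r) <= expectation (\<lambda>w. C powr r * (1 + r / q * (norm (Y w) powr q / C powr q - 1)))"
  by (intro integral_mono i2 i3 pw)
 also have "\<dots> = C powr r * (1 + r / q * (expectation (\<lambda>w. norm (Y w) powr q) / C powr q - 1))"
  using i by (simp add: prob_space)
 also have "\<dots> <= C powr r * 1"
 proof -
  have "r / q * (expectation (\<lambda>w. norm (Y w) powr q) / C powr q - 1) <= 0"
   using assms b by (intro mult_nonneg_nonpos) (auto simp: divide_le_eq)
  then show ?thesis by (intro mult_left_mono) auto
 qed
 finally show ?thesis using i3 by (simp add: Lq_bound_def)
qed

lemma Lq_bound_integrable: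
 assumes "Lq_bound q Y C" "1 <= q"
 shows "integrable M Y"
proof -
 have [measurable]: "random_variable borel Y" and i: "integrable M (\<lambda>w. norm (Y w) powr q)"
  using assms by (auto simp: Lq_bound_def)
 have i2: "integrable M (\<lambda>w. 1 + norm (Y w) powr q)" using i by simp
 show ?thesis
 proof (rule Bochner_Integration.integrable_bound[OF i2 _ AE_I2])
  fix w
  show "norm (Y w) <= norm (1 + norm (Y w) powr q)"
  proof (cases "norm (Y w) <= 1")
   case False
   then have "norm (Y w) powr 1 <= norm (Y w) powr q" using assms(2) by (intro powr_mono) auto
   then show ?thesis using False by simp
  qed (simp add: add_nonneg_nonneg order_trans[of _ 1])
 qed auto
qed

lemma norm_expectation_le:
 assumes "Lq_bound q Y C" "1 <= q" "C > 0"
 shows "norm (expectation Y) <= C"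
proof -
 have 1: "Lq_bound 1 Y C" using Lq_bound_mono[OF assms(1) _ assms(2,3)] by simp
 have "norm (expectation Y) <= expectation (\<lambda>w. norm (Y w))" by (rule integral_norm_bound)
 also have "\<dots> <= C" using 1 assms(3) by (simp add: Lq_bound_def)
 finally show ?thesis .
qed

lemma Markov_Lq:
 assumes "Lq_bound q Y C" "0 < q" "t > 0" "C > 0"
 shows "prob {w \<in> space M. norm (Y w) >= t} <= (C / t) powr q"
proof -
 have [measurable]: "random_variable borel Y" and i: "integrable M (\<lambda>w. norm (Y w) powr q)"
  and b: "expectation (\<lambda>w. norm (Y w) powr q) <= C powr q" using assms by (auto simp: Lq_bound_def)
 have "prob {w \<in> space M. norm (Y w) >= t} <= prob {w \<in> space M. norm (Y w) powr q >= t powr q}"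
  using assms by (intro finite_measure_mono) (auto intro: powr_mono2)
 also have "\<dots> <= expectation (\<lambda>w. norm (Y w) powr q) / t powr q"
  using assms by (intro integral_Markov_inequality_measure[OF i, of "{}"]) auto
 also have "\<dots> <= C powr q / t powr q" using b by (intro divide_right_mono) auto
 also have "\<dots> = (C / t) powr q"
  using assms by (simp add: powr_divide)
 finally show ?thesis .
qed

text \<open>Induction on the index set with \<open>vBE_pointwise\<close>: the linear term is the
  real part of a function of the partial sum times the new centred variable, so independence makes
  its expectation 0.\<close>

lemma von_Bahr_Esseen:
 fixes Y :: "'i \<Rightarrow> 'a \<Rightarrow> complex"
 assumes A: "finite A" and ind: "indep_vars (\<lambda>_. borel) Y A" and q: "1 <= q" "q <= 2"
  and i: "\<And>j. j \<in> A ==> integrable M (\<lambda>w. norm (Y j w) powr q)"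
  and 0: "\<And>j. j \<in> A ==> expectation (Y j) = 0"
 shows "integrable M (\<lambda>w. norm (\<Sum>j\<in>A. Y j w) powr q) \<and>
  expectation (\<lambda>w. norm (\<Sum>j\<in>A. Y j w) powr q) <= 6 * (\<Sum>j\<in>A. expectation (\<lambda>w. norm (Y j w) powr q))"
 using A ind i 0
proof (induction A)
 case empty
 then show ?case by simp
next
 case (insert k A)
 define S where "S w = (\<Sum>j\<in>A. Y j w)" for w
 have indA: "indep_vars (\<lambda>_. borel) Y A" using insert.prems(1) by (rule indep_vars_subset) auto
 have IH: "integrable M (\<lambda>w. norm (S w) powr q)" "expectation (\<lambda>w. norm (S w) powr q) <= 6 * (\<Sum>j\<in>A. expectation (\<lambda>w. norm (Y j w) powr q))"
  using insert.IH[OF indA] insert.prems by (auto simp: S_def)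
 have rvj: "random_variable borel (Y j)" if "j \<in> insert k A" for j
  using insert.prems(1) that by (auto simp: indep_vars_def)
 then have [measurable]: "random_variable borel (Y k)" by simp
 have [measurable]: "random_variable borel S" unfolding S_def using rvj by (intro borel_measurable_sum) auto
 have ik: "integrable M (\<lambda>w. norm (Y k w) powr q)" using insert.prems by auto
 have Lk: "Lq_bound q (Y k) (expectation (\<lambda>w. norm (Y k w) powr q) powr (1 / q))"
  using ik q by (simp add: Lq_bound_def powr_powr Bochner_Integration.integral_nonneg)
 have iY: "integrable M (Y k)" by (rule Lq_bound_integrable[OF Lk q(1)])
 \<comment> \<open>The gradient of \<open>|s|^q\<close> up to conjugation. Its norm is at most
   \<open>2 * (1 + |s|^q)\<close>, so it is integrable along the partial sum.\<close>
 define u where "u = (\<lambda>s. of_real (q * norm s powr (q - 2)) * cnj s :: complex)"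
 have [measurable]: "u \<in> borel_measurable borel" 
 proof -
  have [measurable]: "cnj \<in> borel_measurable borel" by (intro borel_measurable_continuous_onI continuous_intros)
  show ?thesis unfolding u_def by measurable
 qed
 have nu: "norm (u s) <= 2 * (1 + norm s powr q)" for s
 proof (cases "s = 0")
  case False
  have "norm (u s) = q * (norm s powr (q - 2) * norm s)" using q by (simp add: u_def norm_mult)
  also have "norm s powr (q - 2) * norm s = norm s powr (q - 1)"
   using False by (simp add: powr_diff power2_eq_square)
  also have "\<dots> <= 1 + norm s powr q"
  proof (cases "norm s <= 1")
   case True
   then have "norm s powr (q - 1) <= 1 powr (q - 1)" using q by (intro powr_mono2) auto
   then show ?thesis by (simp add: add_increasing2)
  next
   case False
   then have "norm s powr (q - 1) <= norm s powr q" by (intro powr_mono) auto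
   then show ?thesis by simp
  qed
  finally have "norm (u s) <= q * (1 + norm s powr q)" using q by simp
  also have "\<dots> <= 2 * (1 + norm s powr q)" using q by (intro mult_right_mono) (auto intro: add_nonneg_nonneg)
  finally show ?thesis .
 qed (simp add: u_def)
 have iu: "integrable M (\<lambda>w. u (S w))"
  by (rule Bochner_Integration.integrable_bound[of _ "\<lambda>w. 2 * (1 + norm (S w) powr q)"])
   (use IH(1) nu in \<open>auto intro: order_trans\<close>)
 have "indep_var borel (\<lambda>w. u (\<Sum>j\<in>A. (\<lambda>j\<in>A. Y j w) j)) borel (\<lambda>w. (\<lambda>j\<in>{k}. Y j w) k)"
  unfolding indep_pair_iff_indep_var[symmetric]
  using insert.hyps by (intro indep_pair_of_disjoint[OF insert.prems(1)]) auto
 moreover have "(\<lambda>w. u (\<Sum>j\<in>A. (\<lambda>j\<in>A. Y j w) j)) = (\<lambda>w. u (S w))" by (simp add: S_def)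
 ultimately have ind2: "indep_var borel (\<lambda>w. u (S w)) borel (Y k)" by simp
 have iuY: "integrable M (\<lambda>w. u (S w) * Y k w)" by (rule indep_var_integrable[OF ind2 iu iY])
 have EuY: "expectation (\<lambda>w. u (S w) * Y k w) = 0"
  using indep_var_lebesgue_integral[OF ind2 iu iY] insert.prems(3) by simp
 define r where "r w = Re (u (S w) * Y k w)" for w
 have r: "integrable M r" "expectation r = 0"
  using integrable_Re[OF iuY] integral_Re[OF iuY] EuY by (simp_all add: r_def[abs_def])
 have pw: "norm (S w + Y k w) powr q <= norm (S w) powr q + r w + 6 * norm (Y k w) powr q" for w
  using vBE_pointwise[OF q, of "S w" "Y k w"] by (simp add: u_def r_def mult.assoc)
 have isum: "integrable M (\<lambda>w. norm (S w + Y k w) powr q)"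
 proof (rule Bochner_Integration.integrable_bound[of _ "\<lambda>w. 4 * (norm (S w) powr q + norm (Y k w) powr q)"])
  show "AE w in M. norm (norm (S w + Y k w) powr q) <= norm (4 * (norm (S w) powr q + norm (Y k w) powr q))"
  proof (rule AE_I2)
   fix w
   have "norm (S w + Y k w) powr q <= (norm (S w) + norm (Y k w)) powr q"
    using q by (intro powr_mono2 norm_triangle_ineq) auto
   also have "\<dots> <= 4 * (norm (S w) powr q + norm (Y k w) powr q)" using q by (intro powr_add_le_4) auto
   finally show "norm (norm (S w + Y k w) powr q) <= norm (4 * (norm (S w) powr q + norm (Y k w) powr q))" by simp
  qed
 qed (use IH(1) ik in auto)
 have "expectation (\<lambda>w. norm (S w + Y k w) powr q) <= expectation (\<lambda>w. norm (S w) powr q + r w + 6 * norm (Y k w) powr q)"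
  using IH(1) ik r isum pw by (intro integral_mono) auto
 also have "\<dots> = expectation (\<lambda>w. norm (S w) powr q) + 6 * expectation (\<lambda>w. norm (Y k w) powr q)"
  using IH(1) ik r by simp
 also have "\<dots> <= 6 * (\<Sum>j\<in>insert k A. expectation (\<lambda>w. norm (Y j w) powr q))"
  using IH(2) insert.hyps by simp
 finally show ?case using isum insert.hyps by (simp add: S_def add.commute)
qed

text \<open>Centring costs a factor 8 in the moment of order \<open>q\<close>, namely 4 from
  \<open>powr_add_le_4\<close> for each of the two terms; with the 6 of
  \<open>von_Bahr_Esseen\<close> this makes 48.\<close>

lemma centered_Lq:
 fixes Y :: "'i \<Rightarrow> 'a \<Rightarrow> complex"
 assumes A: "finite A" and ind: "indep_vars (\<lambda>_. borel) Y A" and q: "1 <= q" "q <= 2"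
  and Y: "\<And>j. j \<in> A ==> Lq_bound q (Y j) C" and C: "C > 0"
 shows "Lq_bound q (\<lambda>w. (\<Sum>j\<in>A. Y j w) - (\<Sum>j\<in>A. expectation (Y j))) ((48 * real (card A)) powr (1 / q) * C)"
proof -
 define Z where "Z j w = Y j w - expectation (Y j)" for j w
 have rv: "random_variable borel (Y j)" if "j \<in> A" for j using Y[OF that] by (simp add: Lq_bound_def)
 have iY: "integrable M (Y j)" if "j \<in> A" for j by (rule Lq_bound_integrable[OF Y[OF that] q(1)])
 have "indep_vars (\<lambda>_. borel) (\<lambda>j w. (\<lambda>y. y - expectation (Y j)) (Y j w)) A"
  by (rule indep_vars_compose2[OF ind]) measurable
 then have indZ: "indep_vars (\<lambda>_. borel) Z A" unfolding Z_def[abs_def] .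
 have EZ: "expectation (Z j) = 0" if "j \<in> A" for j using iY[OF that] by (simp add: Z_def[abs_def] prob_space)
 have Zb: "integrable M (\<lambda>w. norm (Z j w) powr q) \<and> expectation (\<lambda>w. norm (Z j w) powr q) <= 8 * C powr q" if j: "j \<in> A" for j
 proof -
  note [measurable] = rv[OF j]
  have i: "integrable M (\<lambda>w. norm (Y j w) powr q)" and b: "expectation (\<lambda>w. norm (Y j w) powr q) <= C powr q"
   using Y[OF j] by (auto simp: Lq_bound_def)
  have "norm (expectation (Y j)) <= C" by (rule norm_expectation_le[OF Y[OF j] q(1) C])
  then have m: "norm (expectation (Y j)) powr q <= C powr q" using q by (intro powr_mono2) auto
  have pw: "norm (Z j w) powr q <= 4 * (norm (Y j w) powr q + C powr q)" for w
  proof -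
   have "norm (Z j w) powr q <= (norm (Y j w) + norm (expectation (Y j))) powr q"
    unfolding Z_def using q by (intro powr_mono2 norm_triangle_ineq4) auto
   also have "\<dots> <= 4 * (norm (Y j w) powr q + norm (expectation (Y j)) powr q)" using q by (intro powr_add_le_4) auto
   finally show ?thesis using m by simp
  qed
  have i2: "integrable M (\<lambda>w. 4 * (norm (Y j w) powr q + C powr q))" using i by simp
  have [measurable]: "random_variable borel (Z j)" unfolding Z_def by measurable
  have i3: "integrable M (\<lambda>w. norm (Z j w) powr q)"
   by (rule Bochner_Integration.integrable_bound[OF i2]) (use pw in \<open>auto intro: order_trans\<close>)
  have "expectation (\<lambda>w. norm (Z j w) powr q) <= expectation (\<lambda>w. 4 * (norm (Y j w) powr q + C powr q))"
   by (intro integral_mono i2 i3 pw)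
  also have "\<dots> <= 8 * C powr q" using i b by (simp add: prob_space)
  finally show ?thesis using i3 by simp
 qed
 have V: "integrable M (\<lambda>w. norm (\<Sum>j\<in>A. Z j w) powr q)"
  "expectation (\<lambda>w. norm (\<Sum>j\<in>A. Z j w) powr q) <= 6 * (\<Sum>j\<in>A. expectation (\<lambda>w. norm (Z j w) powr q))"
  using von_Bahr_Esseen[OF A indZ q] Zb EZ by auto
 have "6 * (\<Sum>j\<in>A. expectation (\<lambda>w. norm (Z j w) powr q)) <= 6 * (\<Sum>j\<in>A. 8 * C powr q)"
  using Zb by (intro mult_left_mono sum_mono) auto
 also have "\<dots> = ((48 * real (card A)) powr (1 / q) * C) powr q"
  using q C by (simp add: powr_mult powr_powr)
 finally have "expectation (\<lambda>w. norm (\<Sum>j\<in>A. Z j w) powr q) <= ((48 * real (card A)) powr (1 / q) * C) powr q" using V(2) by linarith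
 moreover have eq: "(\<Sum>j\<in>A. Z j w) = (\<Sum>j\<in>A. Y j w) - (\<Sum>j\<in>A. expectation (Y j))" for w
  by (simp add: Z_def sum_subtractf)
 moreover have "random_variable borel (\<lambda>w. (\<Sum>j\<in>A. Y j w) - (\<Sum>j\<in>A. expectation (Y j)))"
  using rv by (intro borel_measurable_diff borel_measurable_sum) auto
 ultimately show ?thesis using V(1) unfolding Lq_bound_def eq by blast
qed

text \<open>On \<open>|S| <= t\<close> the function \<open>exp (- (S / t)^2 / 2)\<close> is at least
  \<open>exp (- 1 / 2)\<close>. It is itself the characteristic function of a normal variable at
  \<open>S / t\<close>; exchanging the integrals turns its expectation into an average of the
  characteristic function of \<open>S\<close>.\<close>

lemma char_anticoncentration:
 assumes [measurable]: "random_variable borel S" and t: "t > 0"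
 shows "prob {w \<in> space M. \<bar>S w\<bar> <= t} <= exp (1 / 2) * (\<integral>g. norm (char (distr M borel S) (g / t)) \<partial>gauss)"
proof -
 interpret N: real_distribution gauss by (rule real_dist_normal_dist)
 interpret S: prob_space "distr M borel S" by (rule prob_space_distr) measurable
 interpret SN: pair_prob_space "distr M borel S" gauss ..
 define e where "e s = exp (- (s / t)\<^sup>2 / 2)" for s :: real
 have [measurable]: "e \<in> borel_measurable borel" unfolding e_def by measurable
 have e01: "0 <= e s" "e s <= 1" for s by (auto simp: e_def)
 have ie: "integrable M (\<lambda>w. e (S w))" by (intro integrable_const_bound[of _ 1]) (auto simp: e01)
 have "prob {w \<in> space M. \<bar>S w\<bar> <= t} <= prob {w \<in> space M. e (S w) >= exp (- (1 / 2))}"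
 proof (intro finite_measure_mono subsetI)
  fix w assume "w \<in> {w \<in> space M. \<bar>S w\<bar> <= t}"
  then have "w \<in> space M" "\<bar>S w / t\<bar> <= 1" using t by auto
  then show "w \<in> {w \<in> space M. e (S w) >= exp (- (1 / 2))}"
   using abs_square_le_1[of "S w / t"] by (simp add: e_def)
 qed measurable
 also have "\<dots> <= expectation (\<lambda>w. e (S w)) / exp (- (1 / 2))"
  by (intro integral_Markov_inequality_measure[OF ie, of "{}"]) (auto simp: e01)
 also have "\<dots> = exp (1 / 2) * expectation (\<lambda>w. e (S w))" by (simp add: exp_minus field_simps)
 also have "expectation (\<lambda>w. e (S w)) <= (\<integral>g. norm (char (distr M borel S) (g / t)) \<partial>gauss)"
 proof -
  have i: "integrable (distr M borel S \<Otimes>\<^sub>M gauss) (\<lambda>(s, g). iexp (s / t * g))"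
   by (intro finite_measure.integrable_const_bound[OF prob_space.axioms(1)[OF SN.prob_space_axioms], of _ 1]) auto
  have cs: "(\<integral>g. iexp (u * g) \<partial>gauss) = of_real (exp (- u\<^sup>2 / 2))" for u
   using fun_cong[OF char_std_normal_distribution, of u] unfolding char_def by simp
  have "of_real (expectation (\<lambda>w. e (S w))) = (\<integral>s. complex_of_real (e s) \<partial>distr M borel S)"
   by (subst integral_distr) auto
  also have "\<dots> = (\<integral>s. (\<integral>g. iexp (s / t * g) \<partial>gauss) \<partial>distr M borel S)"
   unfolding e_def cs by simp
  also have "\<dots> = (\<integral>g. (\<integral>s. iexp (s / t * g) \<partial>distr M borel S) \<partial>gauss)"
   using SN.Fubini_integral[of "\<lambda>s g. iexp (s / t * g)"] i by simp
  also have "\<dots> = (\<integral>g. char (distr M borel S) (g / t) \<partial>gauss)"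
   unfolding char_def by (simp add: mult.commute)
  finally have "\<bar>expectation (\<lambda>w. e (S w))\<bar> = norm (\<integral>g. char (distr M borel S) (g / t) \<partial>gauss)"
   by (metis norm_of_real)
  also have "\<dots> <= (\<integral>g. norm (char (distr M borel S) (g / t)) \<partial>gauss)" by (rule integral_norm_bound)
  finally show ?thesis by simp
 qed
 finally show ?thesis by simp
qed

end

text \<open>Two integrations starting from \<open>cos >= 1 / 2\<close> on \<open>[0, 1]\<close>:
  first \<open>sin t >= t / 2\<close>, then the claim.\<close>

lemma abs_cos_upper:
 fixes u :: real
 assumes "\<bar>u\<bar> <= 1"
 shows "\<bar>cos u\<bar> <= 1 - u^2 / 4"
proof -
 define v where "v = \<bar>u\<bar>"
 have v: "0 <= v" "v <= 1" using assms by (auto simp: v_def)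
 have pi3: "1 <= pi / 3" using pi_gt3 by simp
 have c: "cos t >= 1 / 2" if "0 <= t" "t <= 1" for t :: real
  using cos_monotone_0_pi_le[of t "pi / 3"] that pi3 by (simp add: cos_60)
 have s: "0 <= sin t - t / 2" if t: "0 <= t" "t <= 1" for t :: real
 proof -
  have "(\<lambda>t. sin t - t / 2) 0 <= (\<lambda>t. sin t - t / 2) t"
   using t(1)
  proof (rule DERIV_nonneg_imp_nondecreasing)
   fix x assume "0 <= x" "x <= t"
   then show "\<exists>y. ((\<lambda>t. sin t - t / 2) has_real_derivative y) (at x) \<and> 0 <= y"
    using c[of x] t by (intro exI[of _ "cos x - 1 / 2"]) (auto intro!: derivative_eq_intros)
  qed
  then show ?thesis by simp
 qed
 have "(\<lambda>t. 1 - t^2 / 4 - cos t) 0 <= (\<lambda>t. 1 - t^2 / 4 - cos t) v"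
  using v(1)
 proof (rule DERIV_nonneg_imp_nondecreasing)
  fix x assume "0 <= x" "x <= v"
  then show "\<exists>y. ((\<lambda>t. 1 - t^2 / 4 - cos t) has_real_derivative y) (at x) \<and> 0 <= y"
   using s[of x] v by (intro exI[of _ "sin x - x / 2"]) (auto intro!: derivative_eq_intros)
 qed
 then have "cos v <= 1 - v^2 / 4" by simp
 moreover have "cos v = cos u" "v^2 = u^2" by (auto simp: v_def abs_if)
 moreover have "cos v >= 1 / 2" using c v by auto
 ultimately show ?thesis by simp
qed

lemma norm_iexp_add:
 fixes a b :: real
 shows "norm (iexp a + iexp b) = 2 * \<bar>cos ((a - b) / 2)\<bar>"
proof -
 have "iexp a + iexp b = iexp ((a + b) / 2) * (iexp ((a - b) / 2) + iexp (- ((a - b) / 2)))"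
  unfolding distrib_left exp_add[symmetric]
  by (intro arg_cong2[where f = "(+)"] arg_cong[of _ _ exp]) (simp_all add: field_simps)
 also have "iexp ((a - b) / 2) + iexp (- ((a - b) / 2)) = of_real (2 * cos ((a - b) / 2))"
  by (simp add: complex_eq_iff Re_exp Im_exp)
 finally show ?thesis by (simp add: norm_mult)
qed

text \<open>The mean of a squared cosine over a half-period is 1/2 whatever the phase; this removes
  the argument of the weight in \<open>char_window\<close>.\<close>

lemma integral_cos_squared_half_period:
 fixes x0 \<psi> p :: real
 assumes "p \<noteq> 0"
 shows "(LBINT x. (cos (p * x + \<psi>))^2 * indicator {x0..x0 + pi / \<bar>p\<bar>} x) = pi / \<bar>p\<bar> / 2"
proof -
 let ?F = "\<lambda>x. x / 2 + sin (2 * (p * x + \<psi>)) / (4 * p)"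
 have "has_bochner_integral lborel (\<lambda>x. (cos (p * x + \<psi>))^2 * indicator {x0..x0 + pi / \<bar>p\<bar>} x) (?F (x0 + pi / \<bar>p\<bar>) - ?F x0)"
 proof (rule has_bochner_integral_FTC_Icc_real)
  show "x0 <= x0 + pi / \<bar>p\<bar>" by simp
  fix x
  have "(?F has_real_derivative 1 / 2 + cos (2 * (p * x + \<psi>)) * (2 * p) / (4 * p)) (at x)"
   by (auto intro!: derivative_eq_intros)
  moreover have "1 / 2 + cos (2 * (p * x + \<psi>)) * (2 * p) / (4 * p) = (cos (p * x + \<psi>))^2"
   unfolding cos_double_cos[of "p * x + \<psi>"] using assms by (simp add: field_simps)
  ultimately show "(?F has_real_derivative (cos (p * x + \<psi>))\<^sup>2) (at x)" by simp
  show "isCont (\<lambda>x. (cos (p * x + \<psi>))^2) x" by (intro continuous_intros)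
 qed
 moreover have "sin (2 * (p * (x0 + pi / \<bar>p\<bar>) + \<psi>)) = sin (2 * (p * x0 + \<psi>))"
 proof (cases "p > 0")
  case True
  then have "2 * (p * (x0 + pi / \<bar>p\<bar>) + \<psi>) = 2 * (p * x0 + \<psi>) + 2 * pi" by (simp add: field_simps)
  then show ?thesis by (simp only: sin_periodic)
 next
  case False
  then have "2 * (p * (x0 + pi / \<bar>p\<bar>) + \<psi>) = 2 * (p * x0 + \<psi>) - 2 * pi" using assms by (simp add: field_simps)
  then show ?thesis using sin_periodic[of "2 * (p * x0 + \<psi>) - 2 * pi"] by (simp only: diff_add_cancel)
 qed
 ultimately show ?thesis by (simp add: has_bochner_integral_iff add_divide_distrib)
qed

text \<open>The shift changes the phase by \<open>pi\<close> and multiplies the modulus by a fixed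
  factor. The resulting change of sign drives \<open>char_window\<close>.\<close>

lemma exp_half_period:
 fixes b :: complex and c x :: real
 assumes "Im b \<noteq> 0" "c > 0"
 shows "exp (b * of_real (c * (x + pi / (\<bar>Im b\<bar> * c)))) = - of_real (exp (Re b * pi / \<bar>Im b\<bar>)) * exp (b * of_real (c * x))"
proof -
 have "b * of_real (c * (x + pi / (\<bar>Im b\<bar> * c))) = b * of_real (c * x) + (of_real (Re b * pi / \<bar>Im b\<bar>) + \<i> * of_real (sgn (Im b) * pi))"
  using assms by (simp add: complex_eq_iff sgn_if field_simps)
 moreover have "exp (\<i> * of_real (sgn (Im b) * pi)) = -1"
  using assms by (simp add: sgn_if exp_eq_polar cis.ctr complex_eq_iff Re_exp Im_exp)
 moreover have "exp (complex_of_real (Re b * pi / \<bar>Im b\<bar>)) = of_real (exp (Re b * pi / \<bar>Im b\<bar>))"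
  by (rule exp_of_real)
 ultimately show ?thesis by (simp only: exp_add) simp
qed

text \<open>On the window \<open>[x0, x0 + 2 * h]\<close>, two half-periods of the oscillation, the
  normal density is at least a positive constant. There \<open>x\<close> is paired with
  \<open>x + h\<close>: the two exponents have opposite signs, so the unit vectors cannot align, and
  their sum has norm at most 2 minus a multiple of the squared amplitude. \<open>V\<close> is the
  modulus of the exponential at \<open>x0\<close> and \<open>exp b\<close> bounds its variation, so
  that \<open>small\<close> keeps the angles in the range of \<open>abs_cos_upper\<close>.\<close>

lemma char_window:
 fixes \<beta> w :: complex and c \<theta> x0 :: real
 assumes \<tau>: "Im \<beta> \<noteq> 0" and c: "c > 0"
 defines "h \<equiv> pi / (\<bar>Im \<beta>\<bar> * c)" and "b \<equiv> 2 * pi * \<bar>Re \<beta>\<bar> / \<bar>Im \<beta>\<bar>" and "V \<equiv> exp (Re \<beta> * c * x0)"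
 assumes small: "\<bar>\<theta>\<bar> * norm w * V * exp b <= 1"
 shows "norm (\<integral>x. iexp (\<theta> * Re (w * exp (\<beta> * of_real (c * x)))) \<partial>gauss)
  <= 1 - exp (- (\<bar>x0\<bar> + 2 * h)\<^sup>2 / 2) / sqrt (2 * pi) * (h / 16 * (\<theta> * norm w * V * exp (- b))^2)"
proof -
 interpret N: real_distribution gauss by (rule real_dist_normal_dist)
 define Y where "Y x = \<theta> * Re (w * exp (\<beta> * of_real (c * x)))" for x
 define f where "f = std_normal_density"
 define m where "m = exp (- (\<bar>x0\<bar> + 2 * h)\<^sup>2 / 2) / sqrt (2 * pi)"
 define D where "D = {x0..x0 + 2 * h}"
 have h: "h > 0" using \<tau> c by (simp add: h_def)
 have b: "b >= 0" by (simp add: b_def)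
 have V: "V > 0" by (simp add: V_def)
 have Ym[measurable]: "Y \<in> borel_measurable borel" unfolding Y_def
  by (intro borel_measurable_continuous_onI continuous_intros)
 have cY: "continuous_on A (\<lambda>x. iexp (Y x))" for A unfolding Y_def by (intro continuous_intros)
 have fm[measurable]: "f \<in> borel_measurable borel" unfolding f_def by measurable
 have m0: "m >= 0" by (simp add: m_def)
 have mf: "m * indicator D x <= f x" for x
 proof (cases "x \<in> D")
  case True
  then have "\<bar>x\<bar> <= \<bar>x0\<bar> + 2 * h" using h by (auto simp: D_def)
  then have "x^2 <= (\<bar>x0\<bar> + 2 * h)^2" using power_mono[of "\<bar>x\<bar>" "\<bar>x0\<bar> + 2 * h" 2] by simp
  then show ?thesis using True by (simp add: m_def f_def std_normal_density_def divide_right_mono)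
 qed (simp add: f_def)
 have if1: "integrable lborel f" "(LBINT x. f x) = 1"
  unfolding f_def using integrable_normal_density[of 1 0] integral_normal_density[of 1 0] by auto
 have ifY: "integrable lborel (\<lambda>x. f x *\<^sub>R iexp (Y x))"
  by (rule Bochner_Integration.integrable_bound[OF if1(1)]) auto
 have iDr: "integrable lborel (indicat_real D)" unfolding D_def using h by (intro integrable_real_indicator) auto
 have iD: "integrable lborel (\<lambda>x. indicat_real D x *\<^sub>R iexp (Y x))"
  by (rule Bochner_Integration.integrable_bound[OF iDr]) (auto simp: D_def)
 define A where "A = (LBINT x. indicat_real D x *\<^sub>R iexp (Y x))"
 have mD: "(LBINT x. indicat_real D x) = 2 * h" using h by (simp add: D_def)
 have i3: "integrable lborel (\<lambda>x. (f x - m * indicator D x) *\<^sub>R iexp (Y x))"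
  using Bochner_Integration.integrable_diff[OF ifY integrable_scaleR_right[OF iD, of m]] by (simp add: scaleR_diff_left)
 have "(\<integral>x. iexp (Y x) \<partial>gauss) = (LBINT x. f x *\<^sub>R iexp (Y x))"
  unfolding f_def by (subst integral_density) auto
 \<comment> \<open>A multiple \<open>m\<close> of the indicator of the window is split off the
   density; the remainder is nonnegative of mass \<open>1 - 2 * h * m\<close> and is bounded
   trivially.\<close>
 also have "\<dots> = (LBINT x. (f x - m * indicator D x) *\<^sub>R iexp (Y x) + m *\<^sub>R (indicat_real D x *\<^sub>R iexp (Y x)))"
  by (simp add: scaleR_diff_left)
 also have "\<dots> = (LBINT x. (f x - m * indicator D x) *\<^sub>R iexp (Y x)) + m *\<^sub>R A"
  unfolding A_def integral_scaleR_right[symmetric]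
  by (rule Bochner_Integration.integral_add[OF i3 integrable_scaleR_right[OF iD]])
 also have "norm \<dots> <= norm (LBINT x. (f x - m * indicator D x) *\<^sub>R iexp (Y x)) + m * norm A"
  using m0 by (intro order_trans[OF norm_triangle_ineq]) simp
 also have "norm (LBINT x. (f x - m * indicator D x) *\<^sub>R iexp (Y x)) <= (LBINT x. norm ((f x - m * indicator D x) *\<^sub>R iexp (Y x)))"
  by (rule integral_norm_bound)
 also have "\<dots> = (LBINT x. f x - m * indicator D x)"
  using mf by (intro Bochner_Integration.integral_cong refl) simp
 also have "\<dots> = 1 - m * (2 * h)" using if1 iDr mD by simp
 finally have 1: "norm (\<integral>x. iexp (Y x) \<partial>gauss) <= 1 - m * (2 * h - norm A)"
  by (simp add: algebra_simps)
 define E where "E = {x0..x0 + h}"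
 have iE: "integrable lborel (\<lambda>x. indicat_real E x *\<^sub>R iexp (Y x))" "integrable lborel (\<lambda>x. indicat_real E x *\<^sub>R iexp (Y (x + h)))"
  unfolding E_def Y_def by (intro borel_integrable_compact continuous_intros compact_Icc)+
 have A: "A = (LBINT x. indicat_real E x *\<^sub>R (iexp (Y x) + iexp (Y (x + h))))"
 proof -
  have iE2: "integrable lborel (\<lambda>x. indicat_real {x0 + h..x0 + 2 * h} x *\<^sub>R iexp (Y x))"
   unfolding Y_def by (intro borel_integrable_compact continuous_intros compact_Icc)
  have "A = (LBINT x. indicat_real E x *\<^sub>R iexp (Y x) + indicat_real {x0 + h..x0 + 2 * h} x *\<^sub>R iexp (Y x))"
   unfolding A_def
  proof (rule integral_cong_AE)
   show "AE x in lborel. indicat_real D x *\<^sub>R iexp (Y x) = indicat_real E x *\<^sub>R iexp (Y x) + indicat_real {x0 + h..x0 + 2 * h} x *\<^sub>R iexp (Y x)"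
    using AE_lborel_singleton[of "x0 + h"] by eventually_elim (use h in \<open>auto simp: D_def E_def indicator_def\<close>)
  qed (use iD iE iE2 in auto)
  also have "\<dots> = (LBINT x. indicat_real E x *\<^sub>R iexp (Y x)) + (LBINT x. indicat_real {x0 + h..x0 + 2 * h} x *\<^sub>R iexp (Y x))"
   using iE iE2 by simp
  also have "(LBINT x. indicat_real {x0 + h..x0 + 2 * h} x *\<^sub>R iexp (Y x)) = (LBINT x. indicat_real {x0 + h..x0 + 2 * h} (h + 1 * x) *\<^sub>R iexp (Y (h + 1 * x)))"
   by (subst lborel_integral_real_affine[of 1 _ h]) simp_all
  also have "\<dots> = (LBINT x. indicat_real E x *\<^sub>R iexp (Y (x + h)))"
   by (intro Bochner_Integration.integral_cong refl) (auto simp: E_def indicator_def add.commute)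
  also have "(LBINT x. indicat_real E x *\<^sub>R iexp (Y x)) + \<dots> = (LBINT x. indicat_real E x *\<^sub>R (iexp (Y x) + iexp (Y (x + h))))"
   by (subst Bochner_Integration.integral_add[symmetric, OF iE]) (simp add: scaleR_add_right)
  finally show ?thesis .
 qed
 define q where "q = (\<theta> * norm w * V * exp (- b))^2"
 define \<psi> where "\<psi> = Arg w"
 let ?c = "\<lambda>x. Im \<beta> * c * x + \<psi>"
 have pw: "norm (indicat_real E x *\<^sub>R (iexp (Y x) + iexp (Y (x + h)))) <= 2 * indicator E x - q / 8 * ((cos (?c x))^2 * indicator {x0..x0 + pi / \<bar>Im \<beta> * c\<bar>} x)" for x
 proof (cases "x \<in> E")
  case x: True
  define u where "u = Re (w * exp (\<beta> * of_real (c * x)))"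
  define e1 where "e1 = exp (Re \<beta> * pi / \<bar>Im \<beta>\<bar>)"
  have Yh: "Y (x + h) = - e1 * Y x"
   unfolding Y_def h_def exp_half_period[OF \<tau> c] e1_def by (simp add: algebra_simps)
  have "w = of_real (norm w) * exp (\<i> * of_real \<psi>)"
   unfolding cis_conv_exp[symmetric] \<psi>_def by (metis rcis_cmod_Arg rcis_def)
  then have "w * exp (\<beta> * of_real (c * x)) = of_real (norm w) * exp (\<beta> * of_real (c * x) + \<i> * of_real \<psi>)"
   by (metis (no_types, lifting) exp_add mult.assoc mult.commute)
  then have u: "u = norm w * (exp (Re \<beta> * c * x) * cos (?c x))"
   by (simp add: u_def Re_exp mult_ac)
  have rng: "\<bar>Re \<beta> * c * x - Re \<beta> * c * x0\<bar> <= b / 2" "\<bar>Re \<beta> * pi / \<bar>Im \<beta>\<bar>\<bar> <= b / 2"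
  proof -
   have "Re \<beta> * c * x - Re \<beta> * c * x0 = Re \<beta> * c * (x - x0)" by (simp add: algebra_simps)
   then have "\<bar>Re \<beta> * c * x - Re \<beta> * c * x0\<bar> = \<bar>Re \<beta>\<bar> * c * \<bar>x - x0\<bar>" using c by (simp add: abs_mult)
   also have "\<dots> <= \<bar>Re \<beta>\<bar> * c * h" using x c by (intro mult_left_mono) (auto simp: E_def)
   also have "\<dots> = b / 2" using c by (simp add: h_def b_def)
   finally show "\<bar>Re \<beta> * c * x - Re \<beta> * c * x0\<bar> <= b / 2" .
   show "\<bar>Re \<beta> * pi / \<bar>Im \<beta>\<bar>\<bar> <= b / 2" by (simp add: b_def abs_mult mult.commute)
  qed
  have ex: "exp (Re \<beta> * c * x) <= V * exp (b / 2)" "V * exp (- b) <= exp (Re \<beta> * c * x)"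
   unfolding V_def exp_add[symmetric] exp_le_cancel_iff using rng(1) b by linarith+
  have e1: "e1 <= exp (b / 2)" "e1 > 0" unfolding e1_def using abs_le_D1[OF rng(2)] by (simp_all only: exp_le_cancel_iff exp_gt_zero)
  have eb: "exp (b / 2) * exp (b / 2) = exp b" "1 <= exp (b / 2)" using b by (simp_all flip: exp_add)
  define \<Delta> where "\<Delta> = (1 + e1) * (\<theta> * u)"
  \<comment> \<open>Since \<open>Y (x + h) = - e1 * Y x\<close>, the angle between the two vectors
    is \<open>(1 + e1) * |Y x|\<close>: at least \<open>|Y x|\<close>, and at most 2 by
    \<open>small\<close>.\<close>
  have d: "Y x - Y (x + h) = \<Delta>" unfolding Yh by (simp add: \<Delta>_def Y_def u_def algebra_simps)
  have au: "\<bar>u\<bar> <= norm w * (V * exp (b / 2))"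
  proof -
   have "exp (Re \<beta> * c * x) * \<bar>cos (?c x)\<bar> <= (V * exp (b / 2)) * 1"
    using V by (intro mult_mono ex(1)) auto
   then show ?thesis unfolding u abs_mult abs_exp_cancel abs_norm_cancel mult_1_right by (rule mult_left_mono) simp
  qed
  have "\<bar>\<Delta>\<bar> = (1 + e1) * (\<bar>\<theta>\<bar> * \<bar>u\<bar>)" using e1 by (simp add: \<Delta>_def abs_mult)
  also have "\<dots> <= (2 * exp (b / 2)) * (\<bar>\<theta>\<bar> * (norm w * (V * exp (b / 2))))"
  proof (intro mult_mono mult_left_mono)
   show "1 + e1 <= 2 * exp (b / 2)" using e1(1) eb(2) by linarith
  qed (use au V in auto)
  also have "\<dots> = 2 * (\<bar>\<theta>\<bar> * norm w * V * exp b)" unfolding eb(1)[symmetric] by (simp add: mult_ac)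
  also have "\<dots> <= 2" using small by simp
  finally have \<Delta>2: "\<bar>\<Delta> / 2\<bar> <= 1" by simp
  have "norm (iexp (Y x) + iexp (Y (x + h))) <= 2 * (1 - (\<Delta> / 2)^2 / 4)"
   unfolding norm_iexp_add d using abs_cos_upper[OF \<Delta>2] by simp
  also have "\<dots> = 2 - \<Delta>^2 / 8" by (simp add: power_divide)
  also have "\<dots> <= 2 - q / 8 * (cos (?c x))^2"
  proof -
   have "q * (cos (?c x))^2 = (\<theta> * (norm w * ((V * exp (- b)) * cos (?c x))))^2"
    by (simp add: q_def power_mult_distrib mult_ac)
   also have "\<dots> <= (\<theta> * u)^2"
   proof (intro abs_le_square_iff[THEN iffD1])
    have "(V * exp (- b)) * \<bar>cos (?c x)\<bar> <= exp (Re \<beta> * c * x) * \<bar>cos (?c x)\<bar>"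
     by (intro mult_right_mono ex(2)) auto
    then have "\<bar>\<theta>\<bar> * (norm w * ((V * exp (- b)) * \<bar>cos (?c x)\<bar>)) <= \<bar>\<theta>\<bar> * (norm w * (exp (Re \<beta> * c * x) * \<bar>cos (?c x)\<bar>))"
     by (intro mult_left_mono) auto
    moreover have "\<bar>V\<bar> = V" using V by simp
    ultimately show "\<bar>\<theta> * (norm w * ((V * exp (- b)) * cos (?c x)))\<bar> <= \<bar>\<theta> * u\<bar>"
     unfolding u abs_mult abs_exp_cancel abs_norm_cancel by simp
   qed
   also have "\<dots> <= \<Delta>^2" unfolding \<Delta>_def
   proof (intro abs_le_square_iff[THEN iffD1])
    have "1 * \<bar>\<theta> * u\<bar> <= \<bar>1 + e1\<bar> * \<bar>\<theta> * u\<bar>" using e1(2) by (intro mult_right_mono) auto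
    then show "\<bar>\<theta> * u\<bar> <= \<bar>(1 + e1) * (\<theta> * u)\<bar>" by (simp only: abs_mult[of "1 + e1"] mult_1)
   qed
   finally show ?thesis by simp
  qed
  finally show ?thesis using x c by (simp add: E_def h_def abs_mult)
 next
  case False
  then show ?thesis using c by (auto simp: E_def h_def abs_mult)
 qed
 have icos: "integrable lborel (\<lambda>x. (cos (?c x))^2 * indicator {x0..x0 + pi / \<bar>Im \<beta> * c\<bar>} x)"
 proof -
  have "continuous_on {x0..x0 + pi / \<bar>Im \<beta> * c\<bar>} (\<lambda>x. (cos (?c x))^2)" by (intro continuous_intros)
  from borel_integrable_compact[OF compact_Icc this] show ?thesis
   by (simp only: real_scaleR_def mult.commute[of "indicator _ _"])
 qed
 have iEr: "integrable lborel (indicat_real E)" "(LBINT x. indicat_real E x) = h" using h by (simp_all add: E_def)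
 have "norm A <= (LBINT x. norm (indicat_real E x *\<^sub>R (iexp (Y x) + iexp (Y (x + h)))))"
  unfolding A by (rule integral_norm_bound)
 also have "\<dots> <= (LBINT x. 2 * indicator E x - q / 8 * ((cos (?c x))^2 * indicator {x0..x0 + pi / \<bar>Im \<beta> * c\<bar>} x))"
 proof (rule integral_mono)
  have "integrable lborel (\<lambda>x. indicat_real E x *\<^sub>R (iexp (Y x) + iexp (Y (x + h))))"
   using Bochner_Integration.integrable_add[OF iE] by (simp add: scaleR_add_right)
  then show "integrable lborel (\<lambda>x. norm (indicat_real E x *\<^sub>R (iexp (Y x) + iexp (Y (x + h)))))" by (rule integrable_norm)
 qed (use pw icos iEr in auto)
 also have "\<dots> = 2 * h - q / 8 * (h / 2)"
  using icos iEr integral_cos_squared_half_period[of "Im \<beta> * c" \<psi> x0] \<tau> c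
  by (simp add: h_def abs_mult)
 finally have "h / 16 * q <= 2 * h - norm A" by (simp add: field_simps)
 then have "m * (h / 16 * q) <= m * (2 * h - norm A)" using m0 by (rule mult_left_mono)
 then show ?thesis using 1 unfolding Y_def q_def m_def by linarith
qed

lemma nn_integral_inverse_sqrt_Icc:
 "(\<integral>\<^sup>+x. indicator {c - 1..c + 1} x * ennreal (\<bar>x - c\<bar> powr (- (1 / 2))) \<partial>lborel) <= 4"
proof -
 define g where "g x = (if x \<in> {0..1} then x powr (- (1 / 2)) else 0)" for x :: real
 have [measurable]: "g \<in> borel_measurable borel" unfolding g_def by measurable
 have "((\<lambda>x. x powr (- (1 / 2))) has_integral (1 powr (- (1 / 2) + 1) / (- (1 / 2) + 1))) {0..1::real}"
  by (intro has_integral_powr_from_0) auto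
 then have "(g has_integral 2) UNIV"
  unfolding g_def by (subst has_integral_restrict_UNIV) simp
 then have g: "(\<integral>\<^sup>+x. g x \<partial>lborel) = ennreal 2"
  by (subst nn_integral_has_integral_lborel) (auto simp: g_def)
 have 1: "(\<integral>\<^sup>+x. g (x - c) \<partial>lborel) = ennreal 2" "(\<integral>\<^sup>+x. g (c - x) \<partial>lborel) = ennreal 2"
  using nn_integral_real_affine[of "\<lambda>x. ennreal (g x)" 1 "-c"] nn_integral_real_affine[of "\<lambda>x. ennreal (g x)" "-1" "c"] g by simp_all
 have "(\<integral>\<^sup>+x. indicator {c - 1..c + 1} x * ennreal (\<bar>x - c\<bar> powr (- (1 / 2))) \<partial>lborel) <= (\<integral>\<^sup>+x. ennreal (g (x - c)) + ennreal (g (c - x)) \<partial>lborel)"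
 proof (intro nn_integral_mono)
  fix x
  consider "x \<notin> {c - 1..c + 1}" | "x \<in> {c..c + 1}" | "x \<in> {c - 1..<c}" by fastforce
  then show "indicator {c - 1..c + 1} x * ennreal (\<bar>x - c\<bar> powr (- (1 / 2))) <= ennreal (g (x - c)) + ennreal (g (c - x))"
  proof cases
   case 2
   then have "g (x - c) = \<bar>x - c\<bar> powr (- (1 / 2))" by (simp add: g_def)
   then show ?thesis using 2 by (simp add: indicator_def)
  next
   case 3
   then have "g (c - x) = \<bar>x - c\<bar> powr (- (1 / 2))" by (simp add: g_def)
   then show ?thesis using 3 by (simp add: indicator_def)
  qed simp
 qed
 also have "\<dots> = (\<integral>\<^sup>+x. g (x - c) \<partial>lborel) + (\<integral>\<^sup>+x. g (c - x) \<partial>lborel)"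
  by (intro nn_integral_add) auto
 also have "\<dots> = 4" unfolding 1 by (simp flip: ennreal_plus)
 finally show ?thesis .
qed

lemma abs_exp_diff_ge:
 fixes x y :: real
 shows "exp x * min 1 \<bar>x - y\<bar> / 2 <= \<bar>exp x - exp y\<bar>"
proof (cases "x <= y")
 case True
 have "exp x * (1 + (y - x)) <= exp x * exp (y - x)" by (intro mult_left_mono) auto
 then have "exp x * (y - x) <= exp y - exp x" by (simp add: exp_add[symmetric] algebra_simps)
 moreover have "exp x * (min 1 (y - x) / 2) <= exp x * (y - x)" using True
  by (intro mult_left_mono) auto
 moreover have "\<bar>x - y\<bar> = y - x" "\<bar>exp x - exp y\<bar> = exp y - exp x" using True by auto
 ultimately show ?thesis by (simp only: times_divide_eq_right)
next
 case False
 define d where "d = x - y"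
 have d: "d > 0" using False by (simp add: d_def)
 have "1 / exp d <= 1 / (1 + d)" using d by (intro divide_left_mono) (auto simp: add_pos_pos)
 moreover have "1 / (1 + d) <= 1 - min 1 d / 2" using d by (auto simp: min_def field_simps)
 ultimately have "min 1 d / 2 <= 1 - exp (- d)" by (simp add: exp_minus inverse_eq_divide)
 then have "exp x * (min 1 d / 2) <= exp x * (1 - exp (- d))" by (intro mult_left_mono) auto
 also have "\<dots> = exp x - exp y" by (simp add: right_diff_distrib d_def flip: exp_add)
 finally show ?thesis using False by (simp add: d_def)
qed

text \<open>By the triangle inequality the modulus is at least \<open>|B|\<close> times the distance
  of \<open>exp (s * x)\<close> to \<open>|A| / |B|\<close>, which vanishes at one point at most,
  and there linearly; the exponent -1/2 makes this integrable. The factor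
  \<open>exp (- s * x / 2)\<close> is absorbed by completing the square, which gives
  \<open>exp (s^2 / 8)\<close>. The bound is uniform in \<open>A\<close>.\<close>

lemma nn_integral_negative_moment:
 fixes A B b :: complex and c :: real
 assumes \<sigma>: "Re b \<noteq> 0" and c: "c > 0" and B: "B \<noteq> 0"
 shows "(\<integral>\<^sup>+x. ennreal (norm (A + B * exp (b * of_real (c * x))) powr (- (1 / 2))) \<partial>gauss)
  <= ennreal (norm B powr (- (1 / 2)) * (2 * exp ((Re b * c)^2 / 8) * (1 + 5 * (\<bar>Re b\<bar> * c) powr (- (1 / 2)))))"
proof -
 interpret N: real_distribution gauss by (rule real_dist_normal_dist)
 define s where "s = Re b * c"
 have s: "s \<noteq> 0" using \<sigma> c by (simp add: s_def)
 have as: "\<bar>s\<bar> = \<bar>Re b\<bar> * c" using c by (simp add: s_def abs_mult)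
 define r where "r = norm A / norm B"
 \<comment> \<open>The point where the two moduli agree. For \<open>A = 0\<close> there is none;
   that case is treated separately below, and \<open>x1\<close> is then a dummy.\<close>
 define x1 where "x1 = ln r / s"
 let ?R = "\<lambda>x. 1 + \<bar>s\<bar> powr (- (1 / 2)) * \<bar>x - x1\<bar> powr (- (1 / 2))"
 let ?Z = "\<lambda>x. A + B * exp (b * of_real (c * x))"
 define f where "f = std_normal_density"
 have [measurable]: "f \<in> borel_measurable borel" unfolding f_def by measurable
 have f1: "f x <= 1" for x
 proof -
  have "sqrt 1 <= sqrt (2 * pi)" using pi_gt3 by (intro real_sqrt_le_mono) auto
  moreover have "exp (- x\<^sup>2 / 2) <= 1" by simp
  ultimately show ?thesis unfolding f_def std_normal_density_def by (intro mult_le_one) auto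
 qed
 have f0: "f x >= 0" for x by (simp add: f_def)
 define k where "k x = norm B powr (- (1 / 2)) * (2 * exp (- (s * x) / 2) * ?R x)" for x
 have k0: "k x >= 0" for x by (simp add: k_def add_nonneg_nonneg)
 have pw: "norm (?Z x) powr (- (1 / 2)) <= k x" if x: "x \<noteq> x1" for x
 proof -
  have nB: "norm (B * exp (b * of_real (c * x))) = norm B * exp (s * x)" by (simp add: norm_mult s_def)
  have "\<bar>norm B * exp (s * x) - norm A\<bar> <= norm (?Z x)"
   unfolding nB[symmetric] using norm_triangle_ineq3[of "B * exp (b * of_real (c * x))" "- A"]
   by (simp only: norm_minus_cancel diff_minus_eq_add add.commute)
  moreover have "norm B * exp (s * x) - norm A = norm B * (exp (s * x) - r)" using B by (simp add: r_def right_diff_distrib)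
  ultimately have 1: "norm B * \<bar>exp (s * x) - r\<bar> <= norm (?Z x)"
   by (simp add: abs_mult)
  have 2: "exp (s * x) * min 1 (\<bar>s\<bar> * \<bar>x - x1\<bar>) / 2 <= \<bar>exp (s * x) - r\<bar>"
  proof (cases "r = 0")
   case True
   have "exp (s * x) * min 1 (\<bar>s\<bar> * \<bar>x - x1\<bar>) <= exp (s * x) * 1" by (intro mult_left_mono) auto
   then have "exp (s * x) * min 1 (\<bar>s\<bar> * \<bar>x - x1\<bar>) <= 2 * exp (s * x)" using exp_gt_zero[of "s * x"] by linarith
   then show ?thesis using True by simp
  next
   case False
   then have "r > 0" by (simp add: r_def)
   then have "exp (s * x1) = r" using s by (simp add: x1_def)
   then show ?thesis using abs_exp_diff_ge[of "s * x" "s * x1"] by (simp add: right_diff_distrib[symmetric] abs_mult)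
  qed
  define \<mu> where "\<mu> = min 1 (\<bar>s\<bar> * \<bar>x - x1\<bar>)"
  have \<mu>: "\<mu> > 0" using s x by (simp add: \<mu>_def)
  have low: "norm B * (exp (s * x) * \<mu> / 2) <= norm (?Z x)"
   using order_trans[OF mult_left_mono[OF 2, of "norm B"] 1] by (simp add: \<mu>_def)
  have "norm (?Z x) powr (- (1 / 2)) <= (norm B * (exp (s * x) * \<mu> / 2)) powr (- (1 / 2))"
   using low \<mu> B by (intro powr_mono2') auto
  also have "\<dots> = norm B powr (- (1 / 2)) * (exp (s * x) powr (- (1 / 2)) * \<mu> powr (- (1 / 2)) * 2 powr (1 / 2))"
   using \<mu> B by (simp add: powr_mult powr_divide powr_minus field_simps)
  also have "\<dots> <= norm B powr (- (1 / 2)) * (exp (- (s * x) / 2) * ?R x * 2)"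
  proof (intro mult_left_mono mult_mono)
   show "exp (s * x) powr (- (1 / 2)) <= exp (- (s * x) / 2)" by (simp add: powr_def)
   have "\<bar>s\<bar> powr (- (1 / 2)) * \<bar>x - x1\<bar> powr (- (1 / 2)) = (\<bar>s\<bar> * \<bar>x - x1\<bar>) powr (- (1 / 2))" by (simp add: powr_mult)
   then show "\<mu> powr (- (1 / 2)) <= 1 + \<bar>s\<bar> powr (- (1 / 2)) * \<bar>x - x1\<bar> powr (- (1 / 2))"
    by (auto simp: \<mu>_def min_def)
   have "2 powr (1 / 2) <= (2::real) powr 1" by (intro powr_mono) auto
   then show "(2::real) powr (1 / 2) <= 2" by simp
  qed (auto intro: add_nonneg_nonneg)
  finally show ?thesis by (simp add: k_def mult_ac)
 qed
 let ?K = "norm B powr (- (1 / 2)) * (2 * exp (s^2 / 8))"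
 have km: "k \<in> borel_measurable borel" unfolding k_def by measurable
 have fk: "f x * k x = ?K * (f (x + s / 2) * ?R x)" for x
 proof -
  have "f x * exp (- (s * x) / 2) = exp (s^2 / 8) * f (x + s / 2)"
   unfolding f_def std_normal_density_def by (simp add: exp_add[symmetric] power2_eq_square field_simps)
  then show ?thesis by (simp add: k_def mult_ac)
 qed
 have "(\<integral>\<^sup>+x. ennreal (norm (?Z x) powr (- (1 / 2))) \<partial>gauss)
   = (\<integral>\<^sup>+x. ennreal (f x) * ennreal (norm (?Z x) powr (- (1 / 2))) \<partial>lborel)"
  unfolding f_def by (subst nn_integral_density) auto
 also have "\<dots> <= (\<integral>\<^sup>+x. ennreal (f x) * ennreal (k x) \<partial>lborel)"
  by (intro nn_integral_mono_AE eventually_mono[OF AE_lborel_singleton[of x1]] mult_left_mono ennreal_leI pw) auto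
 also have "\<dots> = (\<integral>\<^sup>+x. ennreal ?K * ennreal (f (x + s / 2) * ?R x) \<partial>lborel)"
  by (intro nn_integral_cong) (simp add: ennreal_mult'[symmetric] f0 k0 fk)
 also have "\<dots> = ennreal ?K * (\<integral>\<^sup>+x. ennreal (f (x + s / 2) * ?R x) \<partial>lborel)"
  by (intro nn_integral_cmult) measurable
 also have "(\<integral>\<^sup>+x. ennreal (f (x + s / 2) * ?R x) \<partial>lborel)
   <= ennreal (1 + 5 * \<bar>s\<bar> powr (- (1 / 2)))"
 proof -
  define p where "p = \<bar>s\<bar> powr (- (1 / 2))"
  have p: "p >= 0" by (simp add: p_def)
  have if1: "(\<integral>\<^sup>+x. ennreal (f (x + s / 2)) \<partial>lborel) = 1"
  proof -
   have "(\<integral>\<^sup>+x. ennreal (f x) \<partial>lborel) = 1"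
    unfolding f_def by (subst nn_integral_eq_integral) (auto simp: integrable_normal_density integral_normal_density)
   then show ?thesis using nn_integral_real_affine[of "\<lambda>x. ennreal (f x)" 1 "s / 2"] by (simp add: add.commute)
  qed
  have "(\<integral>\<^sup>+x. ennreal (f (x + s / 2) * (1 + p * \<bar>x - x1\<bar> powr (- (1 / 2)))) \<partial>lborel)
   <= (\<integral>\<^sup>+x. ennreal (1 + p) * ennreal (f (x + s / 2)) + ennreal p * (indicator {x1 - 1..x1 + 1} x * ennreal (\<bar>x - x1\<bar> powr (- (1 / 2)))) \<partial>lborel)"
  proof (intro nn_integral_mono)
   fix x
   define t where "t = \<bar>x - x1\<bar> powr (- (1 / 2))"
   have t: "t >= 0" "x \<notin> {x1 - 1..x1 + 1} ==> t <= 1"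
   proof -
    show "t >= 0" by (simp add: t_def)
    assume "x \<notin> {x1 - 1..x1 + 1}"
    then have "1 <= \<bar>x - x1\<bar>" by auto
    then have "t <= 1 powr (- (1 / 2))" unfolding t_def by (intro powr_mono2') auto
    then show "t <= 1" by simp
   qed
   define F where "F = f (x + s / 2)"
   have F: "0 <= F" "F <= 1" by (auto simp: F_def f0 f1)
   have "F * (1 + p * t) <= (1 + p) * F + p * (indicator {x1 - 1..x1 + 1} x * t)"
   proof (cases "x \<in> {x1 - 1..x1 + 1}")
    case True
    have "F * (p * t) <= 1 * (p * t)" using F p t by (intro mult_right_mono) auto
    moreover have "0 <= p * F" using p F by simp
    ultimately show ?thesis using True by (simp add: algebra_simps)
   next
    case False
    have "F * (p * t) <= F * (p * 1)" using F p t False by (intro mult_left_mono) auto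
    then show ?thesis using False by (simp add: algebra_simps)
   qed
   then have "ennreal (F * (1 + p * t)) <= ennreal ((1 + p) * F + p * (indicator {x1 - 1..x1 + 1} x * t))" by (rule ennreal_leI)
   also have "\<dots> = ennreal (1 + p) * ennreal F + ennreal p * (indicator {x1 - 1..x1 + 1} x * ennreal t)"
    using F p t by (auto simp: ennreal_plus ennreal_mult' indicator_def)
   finally show "ennreal (f (x + s / 2) * (1 + p * \<bar>x - x1\<bar> powr (- (1 / 2)))) <= ennreal (1 + p) * ennreal (f (x + s / 2)) + ennreal p * (indicator {x1 - 1..x1 + 1} x * ennreal (\<bar>x - x1\<bar> powr (- (1 / 2))))"
    by (simp add: F_def t_def)
  qed
  also have "\<dots> = ennreal (1 + p) * (\<integral>\<^sup>+x. ennreal (f (x + s / 2)) \<partial>lborel) + ennreal p * (\<integral>\<^sup>+x. indicator {x1 - 1..x1 + 1} x * ennreal (\<bar>x - x1\<bar> powr (- (1 / 2))) \<partial>lborel)"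
   by (subst nn_integral_add) (auto simp: nn_integral_cmult)
  also have "\<dots> <= ennreal (1 + p) * 1 + ennreal p * 4"
   unfolding if1 using nn_integral_inverse_sqrt_Icc[of x1] by (intro add_mono mult_left_mono) auto
  also have "\<dots> = ennreal (1 + 5 * p)"
  proof -
   have "ennreal p * 4 = ennreal (p * 4)" using p by (subst ennreal_mult) auto
   then show ?thesis using p by (simp flip: ennreal_plus)
  qed
  finally show ?thesis by (simp add: p_def)
 qed
 also have "ennreal ?K * ennreal (1 + 5 * \<bar>s\<bar> powr (- (1 / 2))) = ennreal (?K * (1 + 5 * \<bar>s\<bar> powr (- (1 / 2))))"
  by (rule ennreal_mult[symmetric]) (auto intro: add_nonneg_nonneg)
 finally show ?thesis by (simp add: mult_left_mono as[symmetric] s_def[symmetric] mult.assoc)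
qed

section \<open>Comparison of moments with the limiting potential\<close>

context level
begin

lemma phase_E_iff:
 "b \<in> phase_E s \<longleftrightarrow> \<not> (s <= 2 * \<bar>Re b\<bar> \<and> s <= \<bar>Re b\<bar> + \<bar>Im b\<bar>) \<and>
  \<not> (2 * \<bar>Re b\<bar> <= s \<and> s\<^sup>2 <= 2 * ((Re b)^2 + (Im b)^2))"
 unfolding phase_E_def closure_Un closure_phase_G[OF s_pos] closure_phase_F[OF s_pos] by auto

text \<open>Without the cap, the minimiser of
  \<open>(ln \<alpha> + q^2 * (Re b)^2 * a / 2) / q\<close>, the growth rate of the L^q norm of the
  fluctuations of about \<open>\<alpha>^n\<close> independent terms. The cap is the limit of the von
  Bahr-Esseen inequality.\<close>

definition q :: "complex \<Rightarrow> real" where "q b = min 2 (s / \<bar>Re b\<bar>)"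

lemma q_bounds: "Re b \<noteq> 0 ==> 0 < q b" "q b <= 2"
 using s_pos by (auto simp: q_def)

lemma q_gt_1_iff: "Re b \<noteq> 0 ==> 1 < q b \<longleftrightarrow> \<bar>Re b\<bar> < s"
 by (auto simp: q_def less_divide_eq)

lemma q_E: "Re b \<noteq> 0 ==> b \<in> phase_E s ==> 1 < q b"
 unfolding q_gt_1_iff phase_E_iff using s_pos by auto

lemma q_cases:
 assumes "Re b \<noteq> 0"
 obtains "2 * \<bar>Re b\<bar> <= s" "q b = 2" | "s <= 2 * \<bar>Re b\<bar>" "q b * \<bar>Re b\<bar> = s"
 using assms by (cases "2 * \<bar>Re b\<bar> <= s") (auto simp: q_def min_def field_simps)

text \<open>Divided by \<open>q b\<close>, the left side is the growth rate of the fluctuations of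
  one level. It equals \<open>level_p\<close> in the closures of F, where \<open>q b = 2\<close>,
  and of G, where \<open>q b * |Re b| = s\<close>; in E the mean is exponentially larger, hence the
  strict inequality.\<close>

lemma moment_le_level_p:
 assumes \<sigma>: "Re b \<noteq> 0"
 shows "ln \<alpha> + (q b)^2 * (Re b)^2 * a / 2 <= q b * level_p a \<alpha> b"
  and "b \<in> phase_E s ==> ln \<alpha> + (q b)^2 * (Re b)^2 * a / 2 < q b * level_p a \<alpha> b"
proof -
 define x where "x = \<bar>Re b\<bar>"
 define y where "y = \<bar>Im b\<bar>"
 have x: "x > 0" and y: "y >= 0" using \<sigma> by (auto simp: x_def y_def)
 have sq: "(Re b)^2 = x^2" "(Im b)^2 = y^2" by (simp_all add: x_def y_def)
 have E: "ln \<alpha> + (q b)^2 * (Re b)^2 * a / 2 < q b * level_p a \<alpha> b" if bE: "b \<in> phase_E s"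
  unfolding level_p_E[OF bE] sq ln_\<alpha>
 proof (cases rule: q_cases[OF \<sigma>])
  case 1
  then have "2 * (x^2 + y^2) < s^2" using bE unfolding phase_E_iff sq by auto
  then have "a * (2 * (x^2 + y^2)) < a * s^2" using a by (rule mult_strict_left_mono)
  then show "a * s^2 / 2 + (q b)^2 * x^2 * a / 2 < q b * (a * s^2 / 2 + a / 2 * (x^2 - y^2))"
   unfolding 1(2) by (simp add: algebra_simps)
 next
  case 2
  then have "x + y < s" using bE unfolding phase_E_iff x_def y_def by auto
  then have "y^2 < (s - x)^2" using y by (intro power_strict_mono) auto
  then have "2 * s * x < s^2 + x^2 - y^2" by (simp add: power2_diff)
  then have "(q b * a / 2) * (2 * s * x) < (q b * a / 2) * (s^2 + x^2 - y^2)"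
   using a q_bounds(1)[OF \<sigma>] by (intro mult_strict_left_mono) auto
  moreover have "a * s^2 / 2 + (q b)^2 * x^2 * a / 2 = (q b * a / 2) * (2 * s * x)"
  proof -
   have "(q b)^2 * x^2 = s^2" using 2(2) by (simp only: x_def power_mult_distrib[symmetric])
   moreover have "(q b * a / 2) * (2 * s * x) = a * s * (q b * x)" by simp
   moreover have "q b * x = s" using 2(2) by (simp only: x_def)
   ultimately show ?thesis by (simp add: power2_eq_square[of s])
  qed
  moreover have "(q b * a / 2) * (s^2 + x^2 - y^2) = q b * (a * s^2 / 2 + a / 2 * (x^2 - y^2))"
   by (simp add: algebra_simps)
  ultimately show "a * s^2 / 2 + (q b)^2 * x^2 * a / 2 < q b * (a * s^2 / 2 + a / 2 * (x^2 - y^2))"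
   by linarith
 qed
 then show "b \<in> phase_E s ==> ln \<alpha> + (q b)^2 * (Re b)^2 * a / 2 < q b * level_p a \<alpha> b" .
 show "ln \<alpha> + (q b)^2 * (Re b)^2 * a / 2 <= q b * level_p a \<alpha> b"
 proof (cases "b \<in> phase_E s")
  case False
  then consider "s <= 2 * x" "s <= x + y" | "2 * x <= s" "s^2 <= 2 * (x^2 + y^2)"
   unfolding phase_E_iff sq x_def y_def by auto
  then show ?thesis
  proof cases
   case 1
   then have p: "level_p a \<alpha> b = a * s * x" by (subst level_p_G) (auto simp: x_def y_def)
   have qx: "q b * x = s" using 1(1) x by (auto simp: q_def x_def[symmetric] min_def field_simps)
   then have "(q b)^2 * x^2 = s^2" by (simp flip: power_mult_distrib)
   then have "(q b)^2 * x^2 * a / 2 = a * s^2 / 2" by (simp only: mult.commute)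
   moreover have "q b * (a * s * x) = a * s^2"
    using arg_cong[OF qx, of "\<lambda>t. a * s * t"] by (simp only: mult_ac power2_eq_square)
   ultimately show ?thesis unfolding p sq ln_\<alpha> by linarith
  next
   case 2
   then have p: "level_p a \<alpha> b = a * s^2 / 4 + a * x^2" by (subst level_p_F) (auto simp: x_def y_def)
   have "2 <= s / x" using 2(1) x by (simp add: field_simps)
   then have "q b = 2" by (simp add: q_def x_def[symmetric])
   then show ?thesis unfolding p sq ln_\<alpha> by (simp add: algebra_simps)
  qed
 qed (use E in auto)
qed

text \<open>The left side is the growth rate of the mean, and in E both sides agree. The difference
  is \<open>a / 2 * ((Im b)^2 - (s - |Re b|)^2)\<close> in G and
  \<open>a / 2 * (|b|^2 - s^2 / 2)\<close> in F; its sign in G rests on \<open>|Re b| < s\<close>,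
  which is what \<open>1 < q b\<close> says.\<close>

lemma mean_le_level_p:
 assumes \<sigma>: "Re b \<noteq> 0" and q: "1 < q b"
 shows "ln \<alpha> + a / 2 * ((Re b)^2 - (Im b)^2) <= level_p a \<alpha> b"
proof (cases "b \<in> phase_E s")
 case True
 then show ?thesis unfolding level_p_E[OF True] ln_\<alpha> by simp
next
 case False
 define x where "x = \<bar>Re b\<bar>"
 define y where "y = \<bar>Im b\<bar>"
 have sq: "(Re b)^2 = x^2" "(Im b)^2 = y^2" by (simp_all add: x_def y_def)
 have xs: "x < s" using q \<sigma> by (simp add: q_gt_1_iff x_def)
 from False consider "s <= 2 * x" "s <= x + y" | "2 * x <= s" "s^2 <= 2 * (x^2 + y^2)"
  unfolding phase_E_iff sq x_def y_def by auto
 then show ?thesis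
 proof cases
  case 1
  then have p: "level_p a \<alpha> b = a * s * x" by (subst level_p_G) (auto simp: x_def y_def)
  have "(s - x)^2 <= y^2" using 1 xs by (intro power_mono) auto
  then have "a * (s - x)^2 <= a * y^2" using a by (intro mult_left_mono) auto
  then show ?thesis unfolding p sq ln_\<alpha> by (simp add: square_simps)
 next
  case 2
  then have p: "level_p a \<alpha> b = a * s^2 / 4 + a * x^2" by (subst level_p_F) (auto simp: x_def y_def)
  have "a * s^2 <= a * (2 * (x^2 + y^2))" using a 2 by (intro mult_left_mono) auto
  then show ?thesis unfolding p sq ln_\<alpha> by (simp add: algebra_simps)
 qed
qed

text \<open>
 With \<open>v\<close> the level (in units of \<open>n \<surd>a\<close>) at which the energies are sampled, the first inequality says
 that the variance contributed by the sampled terms beats \<open>exp (2 n (p - \<epsilon>'))\<close>, the second that no single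
 sampled term exceeds \<open>exp (n (p - \<epsilon>'))\<close>. In the phase \<open>G\<close> one samples just below the edge \<open>v = s\<close>.
\<close>
lemma window_exists:
 assumes \<sigma>: "Re b \<noteq> 0" and bE: "b \<notin> phase_E s" and e0: "\<epsilon>0 > 0"
 obtains v \<epsilon> \<epsilon>' where "0 <= v" "0 < \<epsilon>" "\<epsilon>' <= \<epsilon>0"
  "0 < ln \<alpha> - a * v^2 / 2 + 2 * a * \<bar>Re b\<bar> * v - 2 * level_p a \<alpha> b + 2 * (\<epsilon>' - \<epsilon>)"
  "0 < level_p a \<alpha> b - \<epsilon>' - \<epsilon> - a * \<bar>Re b\<bar> * v"
proof -
 define x where "x = \<bar>Re b\<bar>"
 define y where "y = \<bar>Im b\<bar>"
 have x: "x > 0" using \<sigma> by (auto simp: x_def)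
 have sq: "(Re b)^2 = x^2" "(Im b)^2 = y^2" by (simp_all add: x_def y_def)
 \<comment> \<open>On the common line \<open>2 * x = s\<close> the condition of F implies that of G,
   so these points are counted to G below.\<close>
 have eq: "s <= x + y" if h: "2 * x = s" "s^2 <= 2 * (x^2 + y^2)"
 proof -
  have "x^2 <= y^2" using h(2) unfolding h(1)[symmetric] by (simp add: power_mult_distrib)
  then have "x <= y" by (rule power2_le_imp_le) (simp add: y_def)
  then show ?thesis using h(1) by simp
 qed
 from bE have "(s <= 2 * x \<and> s <= x + y) \<or> (2 * x <= s \<and> s\<^sup>2 <= 2 * (x^2 + y^2))"
  unfolding phase_E_iff sq x_def y_def by blast
 then consider "s <= 2 * x" "s <= x + y" | "2 * x < s" "s^2 <= 2 * (x^2 + y^2)"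
  using eq by (cases "2 * x = s") auto
 then show ?thesis
 proof cases
  case 1
  then have p: "level_p a \<alpha> b = a * s * x" by (subst level_p_G) (auto simp: x_def y_def)
  \<comment> \<open>The distance to the edge. The cap \<open>s / 2\<close> keeps the quadratic loss
    \<open>a * \<delta>^2\<close> below half of the linear gain \<open>a * \<delta> * s\<close>, and
    the second cap makes \<open>\<epsilon>'\<close> at most \<open>\<epsilon>0\<close>.\<close>
  define \<delta> where "\<delta> = min (s / 2) (\<epsilon>0 / (a * x))"
  have d: "0 < \<delta>" "\<delta> <= s / 2" "\<delta> <= \<epsilon>0 / (a * x)" using a x e0 s_pos unfolding \<delta>_def by (auto simp del: le_divide_eq_numeral1)
  have d3: "a * (x * \<delta>) <= \<epsilon>0" using d(3) a x by (simp add: field_simps)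
  have P: "0 < a * (\<delta> * s)" using a d s_pos by simp
  have "a * (\<delta> * \<delta>) <= a * (\<delta> * (s / 2))" using a d by (intro mult_left_mono) auto
  then have Q: "2 * (a * (\<delta> * \<delta>)) <= a * (\<delta> * s)" by simp
  show ?thesis
  proof (rule that[of "s - \<delta>" "a * \<delta> * s / 16" "a * (x * \<delta> - \<delta> * s / 8)"])
   show "0 <= s - \<delta>" using d s_pos by simp
   show "0 < a * \<delta> * s / 16" using P by simp
   show "a * (x * \<delta> - \<delta> * s / 8) <= \<epsilon>0" using d3 P by (simp add: algebra_simps)
   have "ln \<alpha> - a * (s - \<delta>)^2 / 2 + 2 * a * \<bar>Re b\<bar> * (s - \<delta>) - 2 * level_p a \<alpha> b + 2 * (a * (x * \<delta> - \<delta> * s / 8) - a * \<delta> * s / 16)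
    = 5 / 8 * (a * (\<delta> * s)) - a * (\<delta> * \<delta>) / 2"
    unfolding p ln_\<alpha> x_def[symmetric] by (simp add: power2_eq_square field_simps)
   also have "\<dots> > 0" using P Q by linarith
   finally show "0 < ln \<alpha> - a * (s - \<delta>)^2 / 2 + 2 * a * \<bar>Re b\<bar> * (s - \<delta>) - 2 * level_p a \<alpha> b + 2 * (a * (x * \<delta> - \<delta> * s / 8) - a * \<delta> * s / 16)" .
   have "level_p a \<alpha> b - a * (x * \<delta> - \<delta> * s / 8) - a * \<delta> * s / 16 - a * \<bar>Re b\<bar> * (s - \<delta>) = a * (\<delta> * s) / 16"
    unfolding p x_def[symmetric] by (simp add: algebra_simps)
   also have "\<dots> > 0" using P by simp
   finally show "0 < level_p a \<alpha> b - a * (x * \<delta> - \<delta> * s / 8) - a * \<delta> * s / 16 - a * \<bar>Re b\<bar> * (s - \<delta>)" .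
  qed
 next
  case 2
  then have p: "level_p a \<alpha> b = a * s^2 / 4 + a * x^2" by (subst level_p_F) (auto simp: x_def y_def)
  have "(2 * x)^2 < s^2" using 2(1) x by (intro power_strict_mono) auto
  then have g: "0 < a * s^2 / 4 - a * x^2" using a by (simp add: power_mult_distrib)
  define \<epsilon>' where "\<epsilon>' = min \<epsilon>0 ((a * s^2 / 4 - a * x^2) / 2)"
  have e: "0 < \<epsilon>'" unfolding \<epsilon>'_def min_less_iff_conj by (rule conjI[OF e0 half_gt_zero[OF g]])
  have e': "\<epsilon>' <= \<epsilon>0" "\<epsilon>' <= (a * s^2 / 4 - a * x^2) / 2"
   unfolding \<epsilon>'_def by (rule min.cobounded1 min.cobounded2)+
  show ?thesis
  \<comment> \<open>\<open>v = 2 * |Re b|\<close> maximises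
    \<open>ln \<alpha> - a * v^2 / 2 + 2 * a * |Re b| * v\<close>, the rate of the second moment
    carried by energies near \<open>v\<close>. The maximum is exactly \<open>2 * level_p\<close>, so
    the slack \<open>2 * (\<epsilon>' - \<epsilon>) = \<epsilon>'\<close> remains.\<close>
  proof (rule that[of "2 * x" "\<epsilon>' / 2" \<epsilon>'])
   show "0 < ln \<alpha> - a * (2 * x)^2 / 2 + 2 * a * \<bar>Re b\<bar> * (2 * x) - 2 * level_p a \<alpha> b + 2 * (\<epsilon>' - \<epsilon>' / 2)"
    unfolding p ln_\<alpha> x_def[symmetric] using e by (simp add: square_simps)
   show "0 < level_p a \<alpha> b - \<epsilon>' - \<epsilon>' / 2 - a * \<bar>Re b\<bar> * (2 * x)"
    unfolding p x_def[symmetric] using e e' g by (simp add: square_simps)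
  qed (use e e' x in auto)
 qed
qed

end

text \<open>The case with content is \<open>s < 2 * x <= s'\<close>: there \<open>y < s - x\<close>
  gives \<open>2 * (x^2 + y^2) < (2 * x - s)^2 + s^2 <= s'^2\<close>. Consequently a level in phase
  E has all later levels in phase E.\<close>

lemma phase_E_mono:
 assumes "0 < s" "s <= s'" "b \<in> phase_E s"
 shows "b \<in> phase_E s'"
proof -
 define x where "x = \<bar>Re b\<bar>"
 define y where "y = \<bar>Im b\<bar>"
 have xy: "x >= 0" "y >= 0" by (auto simp: x_def y_def)
 have sq: "(Re b)^2 = x^2" "(Im b)^2 = y^2" by (simp_all add: x_def y_def)
 have iff: "b \<in> phase_E t \<longleftrightarrow> \<not> (t <= 2 * x \<and> t <= x + y) \<and> \<not> (2 * x <= t \<and> t\<^sup>2 <= 2 * (x^2 + y^2))" if "t > 0" for t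
  unfolding phase_E_def closure_Un closure_phase_G[OF that] closure_phase_F[OF that] by (auto simp: x_def y_def)
 have s2: "s^2 <= s'^2" using assms by (intro power_mono) auto
 have E: "\<not> (s <= 2 * x \<and> s <= x + y)" "\<not> (2 * x <= s \<and> s\<^sup>2 <= 2 * (x^2 + y^2))" using assms iff by auto
 have "2 * (x^2 + y^2) < s'^2" if "2 * x <= s'"
 proof (cases "2 * x <= s")
  case True
  then show ?thesis using E s2 by auto
 next
  case False
  then have "y < s - x" using E by auto
  then have "y^2 < (s - x)^2" using xy by (intro power_strict_mono) auto
  then have "2 * (x^2 + y^2) < (2 * x - s)^2 + s^2" by (simp add: square_simps)
  also have "(2 * x - s)^2 <= (s' - s)^2" using False that by (intro power_mono) auto
  also have "(s' - s)^2 + s^2 <= s'^2"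
   using mult_left_mono[OF assms(2), of s] assms(1) by (simp add: square_simps)
  finally show ?thesis by simp
 qed
 then show ?thesis using E assms iff[of s'] by fastforce
qed

section \<open>One branching step\<close>

lemma char_eq_exp_integral: "char M t = (\<integral>x. iexp (t * x) \<partial>M)"
 by (simp add: char_def)

text \<open>Unlike \<open>0 powr (- (1 / 2)) = 0\<close>, the value at \<open>0\<close> is infinite.\<close>

definition reciprocal_sqrt :: "complex \<Rightarrow> ennreal" where
 "reciprocal_sqrt z = (if z = 0 then \<top> else ennreal (norm z powr (- (1 / 2))))"

lemma measurable_reciprocal_sqrt [measurable]: "reciprocal_sqrt \<in> borel_measurable borel"
 unfolding reciprocal_sqrt_def by measurable

lemma AE_affine_exp_neq_0:
 assumes \<sigma>: "Re b \<noteq> 0" and c: "c > 0" and B: "B \<noteq> 0"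
 shows "AE x in gauss. A + B * exp (b * of_real (c * x)) \<noteq> 0"
proof -
 define x1 where "x1 = ln (norm A / norm B) / (Re b * c)"
 have "A + B * exp (b * of_real (c * x)) \<noteq> 0" if "x \<noteq> x1" for x
 proof
  assume "A + B * exp (b * of_real (c * x)) = 0"
  then have "A = - (B * exp (b * of_real (c * x)))" by (simp add: eq_neg_iff_add_eq_0)
  then have "norm A = norm B * exp (Re b * (c * x))" by (simp add: norm_mult)
  then have "norm A / norm B = exp (Re b * (c * x))" using B by simp
  then have "x1 = x" using \<sigma> c by (simp add: x1_def)
  then show False using that by simp
 qed
 then have "AE x in lborel. A + B * exp (b * of_real (c * x)) \<noteq> 0"
  using AE_lborel_singleton[of x1] by (auto elim: eventually_mono)
 then show ?thesis by (subst AE_density) auto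
qed

text \<open>One generation: \<open>X i\<close> is the Gaussian of child \<open>i\<close> and
  \<open>W i\<close> the partition function of the subtree below it. Independence of the pairs
  together with independence inside each pair makes all these variables independent, although their
  types differ.\<close>

locale branching = prob_space +
 fixes A :: "'i set" and X :: "'i \<Rightarrow> 'a \<Rightarrow> real" and W :: "'i \<Rightarrow> 'a \<Rightarrow> complex"
 assumes finite_A: "finite A"
  and indep_pairs: "indep_vars (\<lambda>_. borel \<Otimes>\<^sub>M borel) (\<lambda>i \<omega>. (X i \<omega>, W i \<omega>)) A"
  and indep_XW: "i \<in> A ==> indep_pair borel (X i) borel (W i)"
  and normal: "i \<in> A ==> distr M borel (X i) = gauss"
begin

lemma XW_rv: "i \<in> A ==> random_variable borel (X i)" "i \<in> A ==> random_variable borel (W i)"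
 using indep_pairD[OF indep_XW] by auto

lemma indep_vars_fun:
 assumes "f \<in> borel_measurable (borel \<Otimes>\<^sub>M borel)"
 shows "indep_vars (\<lambda>_. borel) (\<lambda>i w. f (X i w, W i w)) A"
 by (rule indep_vars_compose2[OF indep_pairs]) (use assms in auto)

lemma nn_integral_XW:
 assumes i: "i \<in> A" and f: "f \<in> borel_measurable (borel \<Otimes>\<^sub>M borel)"
 shows "(\<integral>\<^sup>+w. f (X i w, W i w) \<partial>M) = (\<integral>\<^sup>+w. (\<integral>\<^sup>+x. f (x, W i w) \<partial>gauss) \<partial>M)"
 using nn_integral_indep_pair[OF indep_XW[OF i] f] unfolding normal[OF i] .

lemma expectation_mult:
 assumes i: "i \<in> A" and W: "integrable M (W i)"
 shows "integrable M (\<lambda>v. exp (b * of_real (c * X i v)) * W i v)"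
  and "expectation (\<lambda>v. exp (b * of_real (c * X i v)) * W i v) = exp (b^2 * of_real (c^2) / 2) * expectation (W i)"
proof -
 note [measurable] = XW_rv[OF i]
 have e: "exp (b * of_real (c * x)) = exp ((b * of_real c) * of_real x)" for x by (simp add: mult.assoc)
 have ind: "indep_var borel (\<lambda>v. exp (b * of_real (c * X i v))) borel (W i)"
  unfolding indep_pair_iff_indep_var[symmetric]
  by (rule indep_pair_compose[OF indep_XW[OF i], of "\<lambda>x. exp (b * of_real (c * x))" borel "\<lambda>w. w" borel]) measurable
 have "integrable (distr M borel (X i)) (\<lambda>x. exp (b * of_real (c * x)))"
  unfolding normal[OF i] e by (rule gauss_exp(1))
 then have iX: "integrable M (\<lambda>v. exp (b * of_real (c * X i v)))" by (subst (asm) integrable_distr_eq) auto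
 have "expectation (\<lambda>v. exp (b * of_real (c * X i v))) = (\<integral>x. exp (b * of_real (c * x)) \<partial>distr M borel (X i))"
  by (subst integral_distr) auto
 also have "\<dots> = exp (b^2 * of_real (c^2) / 2)"
  unfolding normal[OF i] e gauss_exp(2) by (simp add: power_mult_distrib)
 finally have EX: "expectation (\<lambda>v. exp (b * of_real (c * X i v))) = exp (b^2 * of_real (c^2) / 2)" .
 show "integrable M (\<lambda>v. exp (b * of_real (c * X i v)) * W i v)" by (rule indep_var_integrable[OF ind iX W])
 show "expectation (\<lambda>v. exp (b * of_real (c * X i v)) * W i v) = exp (b^2 * of_real (c^2) / 2) * expectation (W i)"
  using indep_var_lebesgue_integral[OF ind iX W] EX by simp
qed

text \<open>The moment of order \<open>q\<close> of the exponential is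
  \<open>exp (q^2 * (Re b)^2 * c^2 / 2)\<close>. By independence it multiplies that of
  \<open>W i\<close>; the bound is the root of order \<open>q\<close> of the product.\<close>

lemma Lq_bound_mult:
 assumes i: "i \<in> A" and W: "Lq_bound q (W i) C" and C: "C > 0" and q: "q > 0"
 shows "Lq_bound q (\<lambda>v. exp (b * of_real (c * X i v)) * W i v) (exp (q * (Re b)^2 * c^2 / 2) * C)"
proof -
 note [measurable] = XW_rv[OF i]
 have iW: "integrable M (\<lambda>v. norm (W i v) powr q)" and bW: "expectation (\<lambda>v. norm (W i v) powr q) <= C powr q"
  using W by (auto simp: Lq_bound_def)
 define s where "s = q * Re b * c"
 have eq: "norm (exp (b * of_real (c * X i v)) * W i v) powr q = exp (s * X i v) * norm (W i v) powr q" for v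
 proof -
  have "exp (c * (Re b * X i v)) powr q = exp (s * X i v)" by (simp add: powr_def s_def mult_ac)
  then show ?thesis by (simp add: norm_mult powr_mult mult_ac)
 qed
 have ind: "indep_var borel (\<lambda>v. exp (s * X i v)) borel (\<lambda>v. norm (W i v) powr q)"
  unfolding indep_pair_iff_indep_var[symmetric]
  by (rule indep_pair_compose[OF indep_XW[OF i], of "\<lambda>x. exp (s * x)" borel "\<lambda>w. norm w powr q" borel]) measurable
 have "integrable (distr M borel (X i)) (\<lambda>x. exp (s * x))"
  unfolding normal[OF i] by (rule gauss_exp_real(1))
 then have iX: "integrable M (\<lambda>v. exp (s * X i v))" by (subst (asm) integrable_distr_eq) auto
 have "expectation (\<lambda>v. exp (s * X i v)) = (\<integral>x. exp (s * x) \<partial>distr M borel (X i))"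
  by (subst integral_distr) auto
 also have "\<dots> = exp (s^2 / 2)" unfolding normal[OF i] by (rule gauss_exp_real(2))
 finally have EX: "expectation (\<lambda>v. exp (s * X i v)) = exp (s^2 / 2)" .
 have "expectation (\<lambda>v. exp (s * X i v) * norm (W i v) powr q) = exp (s^2 / 2) * expectation (\<lambda>v. norm (W i v) powr q)"
  using indep_var_lebesgue_integral[OF ind iX iW] EX by simp
 also have "\<dots> <= exp (s^2 / 2) * C powr q" using bW by (intro mult_left_mono) auto
 also have "\<dots> = (exp (q * (Re b)^2 * c^2 / 2) * C) powr q"
 proof -
  have "exp (q * (Re b)^2 * c^2 / 2) powr q = exp (s^2 / 2)" by (simp add: powr_def s_def power2_eq_square)
  then show ?thesis using C by (simp add: powr_mult)
 qed
 finally have "expectation (\<lambda>v. exp (s * X i v) * norm (W i v) powr q) <= (exp (q * (Re b)^2 * c^2 / 2) * C) powr q" .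
 moreover have "random_variable borel (\<lambda>v. exp (b * of_real (c * X i v)) * W i v)" by measurable
 ultimately show ?thesis unfolding Lq_bound_def eq using indep_var_integrable[OF ind iX iW] by blast
qed

definition branch_sum :: "complex \<Rightarrow> real \<Rightarrow> 'a \<Rightarrow> complex" where
 "branch_sum b c w = (\<Sum>i\<in>A. exp (b * of_real (c * X i w)) * W i w)"

lemma branch_sum_rv: "random_variable borel (branch_sum b c)"
 unfolding branch_sum_def[abs_def] using XW_rv by (intro borel_measurable_sum) measurable

lemma branch_sum_expectation:
 assumes W: "\<And>i. i \<in> A ==> integrable M (W i)" "\<And>i. i \<in> A ==> expectation (W i) = m"
 shows "integrable M (branch_sum b c)"
  and "expectation (branch_sum b c) = of_nat (card A) * exp (b^2 * of_real (c^2) / 2) * m"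
 unfolding branch_sum_def[abs_def] using expectation_mult W by (auto simp: mult.assoc)

lemma powr_sum_le:
 fixes f :: "'b \<Rightarrow> real"
 assumes "finite B" "0 < q" "q <= 1" "\<And>i. i \<in> B ==> f i >= 0"
 shows "(\<Sum>i\<in>B. f i) powr q <= (\<Sum>i\<in>B. f i powr q)"
 using assms(1,4)
proof (induction B)
 case (insert i B)
 have two: "(x + y) powr q <= x powr q + y powr q" if "x >= 0" "y >= 0" for x y :: real
 proof (cases "x + y = 0")
  case False
  then have s: "x + y > 0" using that by simp
  have *: "u / (x + y) * (x + y) powr q <= u powr q" if u: "0 <= u" "u <= x + y" for u
  proof (cases "u = 0")
   case False
   have "u powr 1 * (x + y) powr (q - 1) <= u powr 1 * u powr (q - 1)"
    using u False assms by (intro mult_left_mono powr_mono2') auto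
   then show ?thesis using u False s by (simp add: powr_diff field_simps flip: powr_add)
  qed simp
  have "(x + y) powr q = x / (x + y) * (x + y) powr q + y / (x + y) * (x + y) powr q"
   using s by (simp flip: distrib_right add_divide_distrib)
  also have "\<dots> <= x powr q + y powr q" using that by (intro add_mono *) auto
  finally show ?thesis .
 qed (use that assms in auto)
 have "(\<Sum>i\<in>insert i B. f i) powr q = (f i + (\<Sum>i\<in>B. f i)) powr q" using insert by simp
 also have "\<dots> <= f i powr q + (\<Sum>i\<in>B. f i) powr q" using insert by (intro two sum_nonneg) auto
 also have "\<dots> <= f i powr q + (\<Sum>i\<in>B. f i powr q)" using insert by simp
 finally show ?case using insert by simp
qed (use assms in auto)

lemma Lq_bound_branch_sum_small:
 assumes W: "\<And>i. i \<in> A ==> Lq_bound q (W i) C" and C: "C > 0" and q: "0 < q" "q <= 1"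
 shows "Lq_bound q (branch_sum b c) (real (card A) powr (1 / q) * (exp (q * (Re b)^2 * c^2 / 2) * C))"
proof -
 let ?Y = "\<lambda>i w. exp (b * of_real (c * X i w)) * W i w"
 let ?D = "exp (q * (Re b)^2 * c^2 / 2) * C"
 have Y: "Lq_bound q (?Y i) ?D" if "i \<in> A" for i using Lq_bound_mult[OF that W[OF that] C q(1)] .
 have iY: "integrable M (\<lambda>w. \<Sum>i\<in>A. norm (?Y i w) powr q)"
  using Y by (intro Bochner_Integration.integrable_sum) (simp add: Lq_bound_def)
 have pw: "norm (branch_sum b c w) powr q <= (\<Sum>i\<in>A. norm (?Y i w) powr q)" for w
 proof -
  have "norm (branch_sum b c w) powr q <= (\<Sum>i\<in>A. norm (?Y i w)) powr q"
   unfolding branch_sum_def using q by (intro powr_mono2 norm_sum) auto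
  also have "\<dots> <= (\<Sum>i\<in>A. norm (?Y i w) powr q)" by (rule powr_sum_le[OF finite_A q]) simp
  finally show ?thesis .
 qed
 note [measurable] = branch_sum_rv
 have i: "integrable M (\<lambda>w. norm (branch_sum b c w) powr q)"
 proof (rule Bochner_Integration.integrable_bound[OF iY])
  show "AE w in M. norm (norm (branch_sum b c w) powr q) <= norm (\<Sum>i\<in>A. norm (?Y i w) powr q)"
   using order_trans[OF pw abs_ge_self] by (intro AE_I2) (simp only: real_norm_def abs_of_nonneg[OF powr_ge_zero])
 qed measurable
 have "expectation (\<lambda>w. norm (branch_sum b c w) powr q) <= expectation (\<lambda>w. \<Sum>i\<in>A. norm (?Y i w) powr q)"
  by (rule integral_mono[OF i iY pw])
 also have "\<dots> = (\<Sum>i\<in>A. expectation (\<lambda>w. norm (?Y i w) powr q))"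
  using Y by (intro Bochner_Integration.integral_sum) (simp add: Lq_bound_def)
 also have "\<dots> <= (\<Sum>i\<in>A. ?D powr q)" using Y by (intro sum_mono) (simp add: Lq_bound_def)
 also have "\<dots> = (real (card A) powr (1 / q) * ?D) powr q" using q C by (simp add: powr_mult powr_powr)
 finally show ?thesis using i branch_sum_rv unfolding Lq_bound_def by blast
qed

lemma Lq_bound_branch_sum_centered:
 assumes W: "\<And>i. i \<in> A ==> Lq_bound q (W i) C" and C: "C > 0" and q: "1 <= q" "q <= 2"
 shows "Lq_bound q (\<lambda>v. branch_sum b c v - expectation (branch_sum b c))
  ((48 * real (card A)) powr (1 / q) * (exp (q * (Re b)^2 * c^2 / 2) * C))"
proof -
 let ?Y = "\<lambda>i v. exp (b * of_real (c * X i v)) * W i v"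
 have Y: "Lq_bound q (?Y i) (exp (q * (Re b)^2 * c^2 / 2) * C)" if "i \<in> A" for i
  using Lq_bound_mult[OF that W[OF that] C, of b c] q by simp
 have ind: "indep_vars (\<lambda>_. borel) ?Y A"
  using indep_vars_fun[of "\<lambda>(x, w). exp (b * of_real (c * x)) * w"] by simp
 have "expectation (branch_sum b c) = (\<Sum>i\<in>A. expectation (?Y i))"
  unfolding branch_sum_def[abs_def] using Lq_bound_integrable[OF Y q(1)] by (intro Bochner_Integration.integral_sum) auto
 then show ?thesis using centered_Lq[OF finite_A ind q Y] C by (simp add: branch_sum_def)
qed

text \<open>Centred part plus mean, combined by \<open>powr_add_le_4\<close>, which gives a factor 4
  for each of the two; \<open>q >= 1\<close> then allows the factor 8 to move inside the power,
  since \<open>8 <= 8 powr q\<close>.\<close>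

lemma Lq_bound_branch_sum:
 assumes W: "\<And>i. i \<in> A ==> Lq_bound q (W i) C" and C: "C > 0" and q: "1 <= q" "q <= 2" and A: "A \<noteq> {}"
 shows "Lq_bound q (branch_sum b c)
  (8 * ((48 * real (card A)) powr (1 / q) * (exp (q * (Re b)^2 * c^2 / 2) * C) + real (card A) * (exp (Re (b^2) * c^2 / 2) * C)))"
proof -
 let ?Y = "\<lambda>i w. exp (b * of_real (c * X i w)) * W i w"
 define D where "D = (48 * real (card A)) powr (1 / q) * (exp (q * (Re b)^2 * c^2 / 2) * C)"
 define m where "m = real (card A) * (exp (Re (b^2) * c^2 / 2) * C)"
 define Z where "Z w = branch_sum b c w - expectation (branch_sum b c)" for w
 have cA: "card A > 0" using A finite_A by (simp add: card_gt_0_iff)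
 have D: "D > 0" and m: "m > 0" using C cA by (auto simp: D_def m_def)
 have Z: "Lq_bound q Z D" unfolding Z_def D_def by (rule Lq_bound_branch_sum_centered[OF W C q])
 then have iZ: "integrable M (\<lambda>w. norm (Z w) powr q)" and bZ: "expectation (\<lambda>w. norm (Z w) powr q) <= D powr q"
  by (auto simp: Lq_bound_def)
 have iW: "integrable M (W i)" if "i \<in> A" for i by (rule Lq_bound_integrable[OF W[OF that] q(1)])
 have mean: "norm (expectation (branch_sum b c)) <= m"
 proof -
  have "expectation (branch_sum b c) = (\<Sum>i\<in>A. expectation (?Y i))"
   unfolding branch_sum_def[abs_def] using expectation_mult(1)[OF _ iW] by (intro Bochner_Integration.integral_sum) auto
  also have "\<dots> = (\<Sum>i\<in>A. exp (b^2 * of_real (c^2) / 2) * expectation (W i))"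
   using expectation_mult(2)[OF _ iW] by (intro sum.cong) auto
  also have "norm \<dots> <= (\<Sum>i\<in>A. exp (Re (b^2) * c^2 / 2) * C)"
  proof (intro order_trans[OF norm_sum] sum_mono)
   fix i assume "i \<in> A"
   then have "norm (expectation (W i)) <= C" using norm_expectation_le[OF W q(1) C] by simp
   moreover have "norm (exp (b^2 * of_real (c^2) / 2)) = exp (Re (b^2) * c^2 / 2)"
    unfolding norm_exp_eq_Re by (simp flip: of_real_power)
   ultimately show "norm (exp (b^2 * of_real (c^2) / 2) * expectation (W i)) <= exp (Re (b^2) * c^2 / 2) * C"
    unfolding norm_mult by (intro mult_mono) auto
  qed
  finally show ?thesis by (simp add: m_def)
 qed
 have pw: "norm (branch_sum b c w) powr q <= 4 * (norm (Z w) powr q + m powr q)" for w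
 proof -
  have "norm (branch_sum b c w) <= norm (Z w) + m"
   using mean norm_triangle_ineq[of "Z w" "expectation (branch_sum b c)"] by (simp add: Z_def)
  then have "norm (branch_sum b c w) powr q <= (norm (Z w) + m) powr q" using q by (intro powr_mono2) auto
  also have "\<dots> <= 4 * (norm (Z w) powr q + m powr q)" using m q by (intro powr_add_le_4) auto
  finally show ?thesis .
 qed
 note [measurable] = branch_sum_rv
 have i2: "integrable M (\<lambda>w. 4 * (norm (Z w) powr q + m powr q))" using iZ by simp
 have i: "integrable M (\<lambda>w. norm (branch_sum b c w) powr q)"
  by (rule Bochner_Integration.integrable_bound[OF i2]) (use pw in \<open>auto intro: order_trans\<close>)
 have "expectation (\<lambda>w. norm (branch_sum b c w) powr q) <= expectation (\<lambda>w. 4 * (norm (Z w) powr q + m powr q))"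
  by (rule integral_mono[OF i i2 pw])
 also have "\<dots> = 4 * (expectation (\<lambda>w. norm (Z w) powr q) + m powr q)" using iZ by (simp add: prob_space)
 also have "\<dots> <= 4 * (D powr q + m powr q)" using bZ by simp
 also have "\<dots> <= 8 * (D + m) powr q"
 proof -
  have "D powr q <= (D + m) powr q" "m powr q <= (D + m) powr q" using D m q by (auto intro!: powr_mono2)
  then show ?thesis by simp
 qed
 also have "\<dots> <= 8 powr q * (D + m) powr q"
  using powr_mono[of 1 q 8] q by (intro mult_right_mono) auto
 also have "\<dots> = (8 * (D + m)) powr q" using D m by (subst powr_mult) auto
 finally show ?thesis using i branch_sum_rv unfolding Lq_bound_def D_def m_def by blast
qed

text \<open>Freezing \<open>W i\<close> reduces to \<open>char_window\<close>. On the event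
  \<open>w0 <= |W i| <= w1\<close>, of probability at least 1/2, the lower bound \<open>w0\<close>
  enters the gain and the upper bound \<open>w1\<close> the smallness condition; off this event the
  trivial bound 1 is used.\<close>

lemma char_branch:
 fixes x0 :: real
 assumes i: "i \<in> A" and \<tau>: "Im \<beta> \<noteq> 0" and c: "c > 0" and w: "0 < w0" "w0 <= w1"
  and W: "prob {v \<in> space M. w0 <= norm (W i v) \<and> norm (W i v) <= w1} >= 1 / 2"
 defines "h \<equiv> pi / (\<bar>Im \<beta>\<bar> * c)" and "b \<equiv> 2 * pi * \<bar>Re \<beta>\<bar> / \<bar>Im \<beta>\<bar>" and "V \<equiv> exp (Re \<beta> * c * x0)"
 assumes small: "\<bar>\<theta>\<bar> * w1 * V * exp b <= 1"
 shows "norm (char (distr M borel (\<lambda>v. Re (exp (\<beta> * of_real (c * X i v)) * W i v))) \<theta>)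
  <= 1 - exp (- (\<bar>x0\<bar> + 2 * h)\<^sup>2 / 2) / sqrt (2 * pi) * (h / 16 * (\<theta> * w0 * V * exp (- b))^2) / 2"
proof -
 note [measurable] = XW_rv[OF i]
 define f :: "real \<times> complex \<Rightarrow> complex" where "f p = iexp (\<theta> * Re (snd p * exp (\<beta> * of_real (c * fst p))))" for p
 let ?F = "\<lambda>v. \<integral>x. f (x, W i v) \<partial>gauss"
 have [measurable]: "f \<in> borel_measurable (borel \<Otimes>\<^sub>M borel)" unfolding f_def by measurable
 define K where "K = exp (- (\<bar>x0\<bar> + 2 * h)\<^sup>2 / 2) / sqrt (2 * pi) * (h / 16 * (\<theta> * w0 * V * exp (- b))^2)"
 define S where "S = {v \<in> space M. w0 <= norm (W i v) \<and> norm (W i v) <= w1}"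
 have Sm[measurable]: "S \<in> events" unfolding S_def by measurable
 have h: "h > 0" using \<tau> c by (simp add: h_def)
 have V: "V > 0" by (simp add: V_def)
 have K0: "K >= 0" using h by (simp add: K_def)
 have I: "(\<lambda>v. \<integral>x. f (x, W i v) \<partial>gauss) \<in> borel_measurable M"
  "expectation (\<lambda>v. f (X i v, W i v)) = expectation (\<lambda>v. \<integral>x. f (x, W i v) \<partial>gauss)"
  using integral_indep_pair[OF indep_XW[OF i], of f 1] unfolding normal[OF i] by (auto simp: f_def)
 have nf: "norm (\<integral>x. f (x, w) \<partial>gauss) <= 1" for w
 proof -
  interpret N: real_distribution gauss by (rule real_dist_normal_dist)
  have "norm (\<integral>x. f (x, w) \<partial>gauss) <= (\<integral>x. norm (f (x, w)) \<partial>gauss)" by (rule integral_norm_bound)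
  also have "\<dots> = 1" using N.prob_space by (simp add: f_def)
  finally show ?thesis .
 qed
 have pw: "norm (?F v) <= 1 - indicator S v * K" for v
 proof (cases "v \<in> S")
  case True
  then have wn: "w0 <= norm (W i v)" "norm (W i v) <= w1" by (auto simp: S_def)
  have "\<bar>\<theta>\<bar> * norm (W i v) * V * exp b <= \<bar>\<theta>\<bar> * w1 * V * exp b"
   using wn V by (intro mult_right_mono mult_left_mono) auto
  then have "\<bar>\<theta>\<bar> * norm (W i v) * V * exp b <= 1" using small by linarith
  from char_window[OF \<tau> c this[unfolded b_def V_def]]
  have "norm (?F v) <= 1 - exp (- (\<bar>x0\<bar> + 2 * h)\<^sup>2 / 2) / sqrt (2 * pi) * (h / 16 * (\<theta> * norm (W i v) * V * exp (- b))^2)"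
   by (simp only: f_def fst_conv snd_conv h_def b_def V_def)
  moreover have "K <= exp (- (\<bar>x0\<bar> + 2 * h)\<^sup>2 / 2) / sqrt (2 * pi) * (h / 16 * (\<theta> * norm (W i v) * V * exp (- b))^2)"
   unfolding K_def power_mult_distrib using wn w h
   by (intro mult_left_mono mult_right_mono power_mono) auto
  ultimately show ?thesis using True by simp
 qed (use nf in simp)
 have iS: "integrable M (\<lambda>v. indicator S v * K)"
  using Sm by (intro integrable_mult_left integrable_real_indicator) (auto simp: emeasure_eq_measure)
 have "char (distr M borel (\<lambda>v. Re (exp (\<beta> * of_real (c * X i v)) * W i v))) \<theta> = expectation (\<lambda>v. f (X i v, W i v))"
  unfolding char_eq_exp_integral by (subst integral_distr) (auto simp: f_def mult.commute)
 also have "norm \<dots> <= expectation (\<lambda>v. norm (?F v))"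
  unfolding I(2) by (rule integral_norm_bound)
 also have "expectation (\<lambda>v. norm (?F v)) <= expectation (\<lambda>v. 1 - indicator S v * K)"
 proof (rule integral_mono[OF _ _ pw])
  show "integrable M (\<lambda>v. norm (?F v))"
   using I(1) nf by (intro integrable_const_bound[of _ 1]) auto
  show "integrable M (\<lambda>v. 1 - indicator S v * K)" using iS by simp
 qed
 also have "\<dots> = 1 - prob S * K"
  using Bochner_Integration.integral_diff[OF integrable_const iS, of 1] Sm by (simp add: prob_space)
 also have "\<dots> <= 1 - K / 2" using mult_right_mono[OF W K0] by (simp add: S_def)
 finally show ?thesis by (simp add: K_def)
qed

text \<open>The characteristic function of the sum is a product over the branches, each factor being
  at most \<open>1 - k * g^2 <= exp (- k * g^2)\<close> by \<open>char_branch\<close>.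
  \<open>\<kappa>\<close> bounds the total gain from below, and \<open>G\<close> is a range of
  \<open>g\<close> on which the smallness condition of \<open>char_branch\<close> holds; beyond it
  the bound 1 is used.\<close>

lemma small_ball:
 fixes x0 :: real
 assumes \<tau>: "Im \<beta> \<noteq> 0" and c: "c > 0" and w: "0 < w0" "w0 <= w1"
  and W: "\<And>i. i \<in> A ==> prob {v \<in> space M. w0 <= norm (W i v) \<and> norm (W i v) <= w1} >= 1 / 2"
  and t: "t > 0"
 defines "h \<equiv> pi / (\<bar>Im \<beta>\<bar> * c)" and "b \<equiv> 2 * pi * \<bar>Re \<beta>\<bar> / \<bar>Im \<beta>\<bar>" and "V \<equiv> exp (Re \<beta> * c * x0)"
 assumes \<kappa>: "\<kappa> <= real (card A) * (exp (- (\<bar>x0\<bar> + 2 * h)\<^sup>2 / 2) / sqrt (2 * pi) * (h / 16 * (w0 * V * exp (- b) / t)^2) / 2)"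
  and G: "G <= t / (w1 * V * exp b)"
 shows "prob {v \<in> space M. norm (branch_sum \<beta> c v) < t} <=
  exp (1 / 2) * (\<integral>g. (if \<bar>g\<bar> <= G then exp (- \<kappa> * g^2) else 1) \<partial>gauss)"
proof -
 let ?S = "\<lambda>v. Re (branch_sum \<beta> c v)"
 interpret N: real_distribution gauss by (rule real_dist_normal_dist)
 let ?Y = "\<lambda>i v. Re (exp (\<beta> * of_real (c * X i v)) * W i v)"
 note [measurable] = branch_sum_rv
 have ind: "indep_vars (\<lambda>_. borel) ?Y A"
  using indep_vars_fun[of "\<lambda>(x, w). Re (exp (\<beta> * of_real (c * x)) * w)"] by simp
 have rS: "?S = (\<lambda>v. \<Sum>i\<in>A. ?Y i v)" by (simp add: branch_sum_def fun_eq_iff)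
 have V: "V > 0" by (simp add: V_def)
 define k where "k = exp (- (\<bar>x0\<bar> + 2 * h)\<^sup>2 / 2) / sqrt (2 * pi) * (h / 16 * (w0 * V * exp (- b) / t)^2) / 2"
 have bd: "norm (char (distr M borel ?S) (g / t)) <= (if \<bar>g\<bar> <= G then exp (- \<kappa> * g^2) else 1)" for g
 proof (cases "\<bar>g\<bar> <= G")
  case True
  have "\<bar>g\<bar> <= t / (w1 * V * exp b)" using True G by simp
  then have sm: "\<bar>g / t\<bar> * w1 * V * exp b <= 1" using t w V by (simp add: field_simps)
  have "char (distr M borel ?S) (g / t) = (\<Prod>i\<in>A. char (distr M borel (?Y i)) (g / t))"
   unfolding rS by (rule char_distr_sum[OF ind])
  also have "norm \<dots> = (\<Prod>i\<in>A. norm (char (distr M borel (?Y i)) (g / t)))" by (rule prod_norm[symmetric])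
  also have "\<dots> <= (\<Prod>i\<in>A. exp (- (k * g^2)))"
  proof (rule prod_mono, intro conjI)
   fix i assume i: "i \<in> A"
   have "norm (char (distr M borel (?Y i)) (g / t)) <= 1 - exp (- (\<bar>x0\<bar> + 2 * h)\<^sup>2 / 2) / sqrt (2 * pi) * (h / 16 * (g / t * w0 * V * exp (- b))^2) / 2"
    using char_branch[OF i \<tau> c w W[OF i], of "g / t" x0] sm by (simp add: h_def b_def V_def)
   also have "exp (- (\<bar>x0\<bar> + 2 * h)\<^sup>2 / 2) / sqrt (2 * pi) * (h / 16 * (g / t * w0 * V * exp (- b))^2) / 2 = k * g^2"
    by (simp add: k_def power_mult_distrib power_divide)
   also have "1 - k * g^2 <= exp (- (k * g^2))" using exp_ge_add_one_self[of "- (k * g^2)"] by simp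
   finally show "norm (char (distr M borel (?Y i)) (g / t)) <= exp (- (k * g^2))" .
  qed simp
  also have "\<dots> = exp (- (real (card A) * k * g^2))" by (simp flip: exp_of_nat_mult)
  also have "\<dots> <= exp (- \<kappa> * g^2)"
   using mult_right_mono[OF \<kappa>, of "g^2"] by (simp add: k_def)
  finally show ?thesis using True by simp
 next
  case False
  interpret D: real_distribution "distr M borel ?S" by (intro real_distribution_distr) measurable
  show ?thesis using D.cmod_char_le_1[of "g / t"] False by simp
 qed
 interpret D: real_distribution "distr M borel ?S" by (intro real_distribution_distr) measurable
 have [measurable]: "(\<lambda>g. char (distr M borel ?S) (g / t)) \<in> borel_measurable borel"
  using measurable_compose[of "\<lambda>g. g / t" borel borel "char (distr M borel ?S)" borel] D.char_measurable by simp
 have "prob {v \<in> space M. norm (branch_sum \<beta> c v) < t} <= prob {v \<in> space M. \<bar>Re (branch_sum \<beta> c v)\<bar> <= t}"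
  by (intro finite_measure_mono) (auto intro: order_trans[OF abs_Re_le_cmod])
 also have "\<dots> <= exp (1 / 2) * (\<integral>g. norm (char (distr M borel ?S) (g / t)) \<partial>gauss)"
  by (rule char_anticoncentration[OF _ t]) measurable
 also have "\<dots> <= exp (1 / 2) * (\<integral>g. (if \<bar>g\<bar> <= G then exp (- \<kappa> * g^2) else 1) \<partial>gauss)"
 proof (intro mult_left_mono integral_mono bd)
  show "integrable gauss (\<lambda>g. norm (char (distr M borel ?S) (g / t)))"
   using D.cmod_char_le_1 by (intro N.integrable_const_bound[of _ 1]) auto
  have "(if \<bar>g\<bar> <= G then exp (- \<kappa> * g^2) else 1) <= exp (\<bar>\<kappa>\<bar> * G^2)" for g
  proof (cases "\<bar>g\<bar> <= G")
   case True
   have "- \<kappa> * g^2 <= \<bar>\<kappa>\<bar> * g^2" by (intro mult_right_mono) auto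
   also have "\<dots> <= \<bar>\<kappa>\<bar> * G^2" using True by (intro mult_left_mono) (auto simp: abs_le_square_iff[symmetric])
   finally show ?thesis using True by simp
  qed auto
  then show "integrable gauss (\<lambda>g. if \<bar>g\<bar> <= G then exp (- \<kappa> * g^2) else 1)"
   by (intro N.integrable_const_bound[of _ "exp (\<bar>\<kappa>\<bar> * G^2)"]) (auto intro!: AE_I2)
 qed simp
 finally show ?thesis .
qed

text \<open>A single branch suffices: with the other branches and \<open>W i\<close> frozen, the sum
  is affine in the exponential of \<open>X i\<close>, and \<open>nn_integral_negative_moment\<close>
  bounds its moment by a multiple of \<open>|W i| powr (-1/2)\<close>, whatever the other branches
  are.\<close>

lemma reciprocal_sqrt_branch_sum:
 assumes i: "i \<in> A" and \<sigma>: "Re b \<noteq> 0" and c: "c > 0"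
 shows "(\<integral>\<^sup>+w. reciprocal_sqrt (branch_sum b c w) \<partial>M)
  <= ennreal (2 * exp ((Re b * c)^2 / 8) * (1 + 5 * (\<bar>Re b\<bar> * c) powr (- (1 / 2)))) * (\<integral>\<^sup>+w. reciprocal_sqrt (W i w) \<partial>M)"
proof -
 let ?I = "\<integral>\<^sup>+w. reciprocal_sqrt (W i w) \<partial>M"
 note [measurable] = XW_rv[OF i]
 define K where "K = 2 * exp ((Re b * c)^2 / 8) * (1 + 5 * (\<bar>Re b\<bar> * c) powr (- (1 / 2)))"
 have K0: "K > 0" by (simp add: K_def add_pos_nonneg)
 define R where "R p = (\<Sum>j\<in>A - {i}. exp (b * of_real (c * fst (p j))) * snd (p j))" for p :: "'i \<Rightarrow> real \<times> complex"
 define r where "r w = R (\<lambda>j\<in>A - {i}. (X j w, W j w))" for w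
 define f where "f p = reciprocal_sqrt (snd p + snd (fst p) * exp (b * of_real (c * fst (fst p))))" for p :: "(real \<times> complex) \<times> complex"
 have f[measurable]: "f \<in> borel_measurable ((borel \<Otimes>\<^sub>M borel) \<Otimes>\<^sub>M borel)" unfolding f_def by measurable
 have Rm: "R \<in> borel_measurable (PiM (A - {i}) (\<lambda>_. borel \<Otimes>\<^sub>M borel))"
  unfolding R_def by (intro borel_measurable_sum) measurable
 have "indep_pair (borel \<Otimes>\<^sub>M borel) (\<lambda>w. (\<lambda>p. p i) (\<lambda>j\<in>{i}. (X j w, W j w))) borel (\<lambda>w. R (\<lambda>j\<in>A - {i}. (X j w, W j w)))"
  using i by (intro indep_pair_of_disjoint[OF indep_pairs]) (auto intro: Rm measurable_component_singleton)
 then have ind: "indep_pair (borel \<Otimes>\<^sub>M borel) (\<lambda>w. (X i w, W i w)) borel r" by (simp add: r_def[abs_def])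
 have bs: "branch_sum b c w = r w + W i w * exp (b * of_real (c * X i w))" for w
  unfolding branch_sum_def r_def R_def sum.remove[OF finite_A i] by (simp add: mult.commute add.commute)
 have inner: "(\<integral>\<^sup>+p. f (p, r0) \<partial>distr M (borel \<Otimes>\<^sub>M borel) (\<lambda>w. (X i w, W i w))) <= ennreal K * ?I" for r0
 proof -
  have "(\<integral>\<^sup>+p. f (p, r0) \<partial>distr M (borel \<Otimes>\<^sub>M borel) (\<lambda>w. (X i w, W i w))) = (\<integral>\<^sup>+w. f ((X i w, W i w), r0) \<partial>M)"
   by (subst nn_integral_distr) measurable
  also have "\<dots> = (\<integral>\<^sup>+w. (\<integral>\<^sup>+x. f ((x, W i w), r0) \<partial>gauss) \<partial>M)"
   using nn_integral_XW[OF i, of "\<lambda>p. f (p, r0)"] by simp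
  also have "\<dots> <= (\<integral>\<^sup>+w. ennreal K * reciprocal_sqrt (W i w) \<partial>M)"
  proof (intro nn_integral_mono)
   fix w
   show "(\<integral>\<^sup>+x. f ((x, W i w), r0) \<partial>gauss) <= ennreal K * reciprocal_sqrt (W i w)"
   proof (cases "W i w = 0")
    case True
    then show ?thesis using K0 by (simp add: reciprocal_sqrt_def ennreal_mult_top)
   next
    case False
    have "(\<integral>\<^sup>+x. f ((x, W i w), r0) \<partial>gauss)
     = (\<integral>\<^sup>+x. ennreal (norm (r0 + W i w * exp (b * of_real (c * x))) powr (- (1 / 2))) \<partial>gauss)"
     by (intro nn_integral_cong_AE eventually_mono[OF AE_affine_exp_neq_0[OF \<sigma> c False, of r0]]) (simp add: f_def reciprocal_sqrt_def)
    also have "\<dots> <= ennreal (norm (W i w) powr (- (1 / 2)) * K)"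
     using nn_integral_negative_moment[OF \<sigma> c False, of r0] by (simp only: K_def)
    also have "\<dots> = ennreal K * reciprocal_sqrt (W i w)"
     using K0 False by (simp add: reciprocal_sqrt_def ennreal_mult' mult.commute)
    finally show ?thesis .
   qed
  qed
  also have "\<dots> = ennreal K * ?I" by (intro nn_integral_cmult) measurable
  finally show ?thesis .
 qed
 have "(\<integral>\<^sup>+w. reciprocal_sqrt (branch_sum b c w) \<partial>M) = (\<integral>\<^sup>+w. f ((X i w, W i w), r w) \<partial>M)"
  by (simp add: bs f_def)
 also have "\<dots> = (\<integral>\<^sup>+w. (\<integral>\<^sup>+p. f (p, r w) \<partial>distr M (borel \<Otimes>\<^sub>M borel) (\<lambda>w. (X i w, W i w))) \<partial>M)"
  by (rule nn_integral_indep_pair[OF ind f])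
 also have "\<dots> <= (\<integral>\<^sup>+w. ennreal K * ?I \<partial>M)"
  by (intro nn_integral_mono inner)
 also have "\<dots> = ennreal K * ?I" by (simp add: emeasure_space_1)
 finally show ?thesis by (simp add: K_def)
qed

end

section \<open>Cascades\<close>

text \<open>\<open>ks\<close> lists the levels still to be branched, \<open>\<eta>\<close> is the
  node reached so far and \<open>x\<close> the field on the nodes. With the levels in a list, the
  induction over levels becomes list induction.\<close>

primrec cascade :: "(nat \<Rightarrow> nat) \<Rightarrow> (nat \<Rightarrow> real) \<Rightarrow> complex \<Rightarrow> nat list \<Rightarrow> nat list \<Rightarrow> (nat list \<Rightarrow> real) \<Rightarrow> complex" where
 "cascade N c b [] \<eta> x = 1"
| "cascade N c b (k # ks) \<eta> x =
  (\<Sum>i\<in>{1..N k}. exp (b * of_real (c k * x (\<eta> @ [i]))) * cascade N c b ks (\<eta> @ [i]) x)"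

primrec desc :: "(nat \<Rightarrow> nat) \<Rightarrow> nat list \<Rightarrow> nat list \<Rightarrow> nat list set" where
 "desc N [] \<eta> = {}"
| "desc N (k # ks) \<eta> = (\<Union>i\<in>{1..N k}. insert (\<eta> @ [i]) (desc N ks (\<eta> @ [i])))"

lemma desc_prefix: "\<zeta> \<in> desc N ks \<eta> ==> take (length \<eta>) \<zeta> = \<eta> \<and> length \<eta> < length \<zeta>"
proof (induction ks arbitrary: \<eta>)
 case (Cons k ks)
 then obtain i where "\<zeta> = \<eta> @ [i] \<or> \<zeta> \<in> desc N ks (\<eta> @ [i])" by auto
 then show ?case
 proof
  assume "\<zeta> \<in> desc N ks (\<eta> @ [i])"
  from Cons.IH[OF this] have "take (Suc (length \<eta>)) \<zeta> = \<eta> @ [i]" "Suc (length \<eta>) < length \<zeta>" by auto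
  then have "take (length \<eta>) (take (Suc (length \<eta>)) \<zeta>) = \<eta>" by simp
  then show ?thesis using \<open>Suc (length \<eta>) < length \<zeta>\<close> by (simp add: min_def)
 qed simp
qed simp

lemma desc_child_prefix:
 assumes "\<zeta> \<in> insert (\<eta> @ [i]) (desc N ks (\<eta> @ [i]))"
 shows "take (Suc (length \<eta>)) \<zeta> = \<eta> @ [i]"
 using assms desc_prefix[of \<zeta> N ks "\<eta> @ [i]"] by auto

lemma desc_child_subset:
 "i \<in> {1..N k} ==> insert (\<eta> @ [i]) (desc N ks (\<eta> @ [i])) \<subseteq> desc N (k # ks) \<eta>"
 unfolding desc.simps by blast

lemma cascade_cong:
 assumes "\<And>\<zeta>. \<zeta> \<in> desc N ks \<eta> ==> x \<zeta> = y \<zeta>"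
 shows "cascade N c b ks \<eta> x = cascade N c b ks \<eta> y"
 using assms
proof (induction ks arbitrary: \<eta>)
 case (Cons k ks)
 have "cascade N c b ks (\<eta> @ [i]) x = cascade N c b ks (\<eta> @ [i]) y" if "i \<in> {1..N k}" for i
  using that by (intro Cons.IH Cons.prems) auto
 moreover have "x (\<eta> @ [i]) = y (\<eta> @ [i])" if "i \<in> {1..N k}" for i using that by (intro Cons.prems) auto
 ultimately show ?case by simp
qed simp

lemma measurable_cascade:
 assumes "desc N ks \<eta> \<subseteq> K"
 shows "cascade N c b ks \<eta> \<in> borel_measurable (PiM K (\<lambda>_. borel))"
 using assms
proof (induction ks arbitrary: \<eta>)
 case (Cons k ks)
 have [measurable]: "cascade N c b ks (\<eta> @ [i]) \<in> borel_measurable (PiM K (\<lambda>_. borel))" if "i \<in> {1..N k}" for i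
  using order_trans[OF desc_child_subset[of _ N k, OF that] Cons.prems] by (intro Cons.IH) auto
 have [measurable]: "(\<lambda>x. x (\<eta> @ [i])) \<in> borel_measurable (PiM K (\<lambda>_. borel))" if "i \<in> {1..N k}" for i
  using order_trans[OF desc_child_subset[of _ N k, OF that] Cons.prems] by (intro measurable_component_singleton) auto
 have "cascade N c b (k # ks) \<eta> = (\<lambda>x. \<Sum>i\<in>{1..N k}. exp (b * of_real (c k * x (\<eta> @ [i]))) * cascade N c b ks (\<eta> @ [i]) x)"
  by (simp add: fun_eq_iff)
 also have "\<dots> \<in> borel_measurable (PiM K (\<lambda>_. borel))" by measurable
 finally show ?case .
next
 case Nil
 have "cascade N c b [] \<eta> = (\<lambda>x. 1)" by (simp add: fun_eq_iff)
 then show ?case by simp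
qed

context prob_space
begin

text \<open>Keeps the branching structure and forgets nodes and prefixes: all subtrees of one
  generation satisfy the same predicate, so that estimates can be stated uniformly in
  \<open>S\<close> and proved by induction on \<open>ks\<close>.\<close>

inductive cascade_rv :: "(nat \<Rightarrow> nat) \<Rightarrow> (nat \<Rightarrow> real) \<Rightarrow> complex \<Rightarrow> nat list \<Rightarrow> ('a \<Rightarrow> complex) \<Rightarrow> bool"
 for N c b where
 Nil: "cascade_rv N c b [] (\<lambda>_. 1)"
| Cons: "branching M {1..N k} X W ==> (\<And>i. i \<in> {1..N k} ==> cascade_rv N c b ks (W i)) ==>
  cascade_rv N c b (k # ks) (branching.branch_sum {1..N k} X W b (c k))"

inductive_cases cascade_rv_NilE: "cascade_rv N c b [] S"
lemma branching_cascade: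
 assumes ind: "indep_vars (\<lambda>_. borel) \<xi> I" and normal: "\<And>\<zeta>. \<zeta> \<in> I ==> distr M borel (\<xi> \<zeta>) = gauss"
  and I: "desc N (k # ks) \<eta> \<subseteq> I"
 shows "branching M {1..N k} (\<lambda>i. \<xi> (\<eta> @ [i])) (\<lambda>i w. cascade N c b ks (\<eta> @ [i]) (\<lambda>\<zeta>. \<xi> \<zeta> w))"
proof -
 let ?D = "\<lambda>i. desc N ks (\<eta> @ [i])"
 let ?K = "\<lambda>i. insert (\<eta> @ [i]) (?D i)"
 have K: "?K i \<subseteq> I" if "i \<in> {1..N k}" for i
  using order_trans[OF desc_child_subset[of _ N k, OF that] I] .
 have cs: "cascade N c b ks (\<eta> @ [i]) (\<lambda>\<zeta>\<in>L. \<xi> \<zeta> w) = cascade N c b ks (\<eta> @ [i]) (\<lambda>\<zeta>. \<xi> \<zeta> w)"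
  if "?D i \<subseteq> L" for L i w using that by (intro cascade_cong) auto
 show ?thesis
 proof
  have "indep_vars (\<lambda>_. borel \<Otimes>\<^sub>M borel)
   (\<lambda>i w. (\<lambda>x. (x (\<eta> @ [i]), cascade N c b ks (\<eta> @ [i]) x)) (\<lambda>\<zeta>\<in>?K i. \<xi> \<zeta> w)) {1..N k}"
  proof (rule indep_vars_of_disjoint[OF ind])
   show "disjoint_family_on ?K {1..N k}"
    unfolding disjoint_family_on_def using desc_child_prefix by (metis (no_types, lifting) append1_eq_conv disjoint_iff)
   show "(\<lambda>x. (x (\<eta> @ [i]), cascade N c b ks (\<eta> @ [i]) x)) \<in> PiM (?K i) (\<lambda>_. borel) \<rightarrow>\<^sub>M borel \<Otimes>\<^sub>M borel" for i
    by (intro measurable_Pair measurable_cascade measurable_component_singleton) auto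
  qed (use K in auto)
  then show "indep_vars (\<lambda>_. borel \<Otimes>\<^sub>M borel) (\<lambda>i w. (\<xi> (\<eta> @ [i]) w, cascade N c b ks (\<eta> @ [i]) (\<lambda>\<zeta>. \<xi> \<zeta> w))) {1..N k}"
   by (simp add: cs subset_insertI)
  fix i assume i: "i \<in> {1..N k}"
  show "distr M borel (\<xi> (\<eta> @ [i])) = gauss" using K[OF i] by (intro normal) auto
  have "indep_pair borel (\<lambda>w. (\<lambda>x. x (\<eta> @ [i])) (\<lambda>\<zeta>\<in>{\<eta> @ [i]}. \<xi> \<zeta> w)) borel (\<lambda>w. cascade N c b ks (\<eta> @ [i]) (\<lambda>\<zeta>\<in>?D i. \<xi> \<zeta> w))"
  proof (rule indep_pair_of_disjoint[OF ind])
   show "{\<eta> @ [i]} \<inter> ?D i = {}" using desc_prefix[of "\<eta> @ [i]" N ks "\<eta> @ [i]"] by auto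
  qed (use K[OF i] in \<open>auto intro!: measurable_cascade measurable_component_singleton\<close>)
  then show "indep_pair borel (\<xi> (\<eta> @ [i])) borel (\<lambda>w. cascade N c b ks (\<eta> @ [i]) (\<lambda>\<zeta>. \<xi> \<zeta> w))"
   by (simp add: cs)
 qed simp
qed

lemma cascade_rv_cascade:
 assumes ind: "indep_vars (\<lambda>_. borel) \<xi> I" and normal: "\<And>\<zeta>. \<zeta> \<in> I ==> distr M borel (\<xi> \<zeta>) = gauss"
  and I: "desc N ks \<eta> \<subseteq> I"
 shows "cascade_rv N c \<beta> ks (\<lambda>w. cascade N c \<beta> ks \<eta> (\<lambda>\<zeta>. \<xi> \<zeta> w))"
 using I
proof (induction ks arbitrary: \<eta>)
 case Nil
 show ?case by (simp add: cascade_rv.Nil)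
next
 case (Cons k ks)
 interpret b: branching M "{1..N k}" "\<lambda>i. \<xi> (\<eta> @ [i])" "\<lambda>i w. cascade N c \<beta> ks (\<eta> @ [i]) (\<lambda>\<zeta>. \<xi> \<zeta> w)"
  by (rule branching_cascade[OF ind normal Cons.prems])
 have "cascade_rv N c \<beta> (k # ks) (b.branch_sum \<beta> (c k))"
 proof (rule cascade_rv.Cons[where X = "\<lambda>i. \<xi> (\<eta> @ [i])" and W = "\<lambda>i w. cascade N c \<beta> ks (\<eta> @ [i]) (\<lambda>\<zeta>. \<xi> \<zeta> w)"])
  show "cascade_rv N c \<beta> ks (\<lambda>w. cascade N c \<beta> ks (\<eta> @ [i]) (\<lambda>\<zeta>. \<xi> \<zeta> w))" if "i \<in> {1..N k}" for i
   using order_trans[OF desc_child_subset[of _ N k, OF that] Cons.prems] by (intro Cons.IH) auto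
 qed (rule b.branching_axioms)
 then show ?case unfolding b.branch_sum_def[abs_def] cascade.simps(2) .
qed

end

section \<open>The partition function as a cascade\<close>

lemma grem_paths_snoc:
 assumes "length \<eta> = j"
 shows "\<eta> @ [i] \<in> grem_paths N (Suc j) \<longleftrightarrow> \<eta> \<in> grem_paths N j \<and> i \<in> {1..N (Suc j)}"
proof -
 have "\<eta> @ [i] \<in> grem_paths N (Suc j) \<longleftrightarrow>
  (\<forall>l\<in>insert (Suc j) {1..j}. 1 <= (\<eta> @ [i]) ! (l - 1) \<and> (\<eta> @ [i]) ! (l - 1) <= N l)"
  using assms by (simp add: grem_paths_def atLeastAtMostSuc_conv)
 also have "\<dots> \<longleftrightarrow> 1 <= i \<and> i <= N (Suc j) \<and> (\<forall>l\<in>{1..j}. 1 <= \<eta> ! (l - 1) \<and> \<eta> ! (l - 1) <= N l)"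
 proof -
  have "(\<eta> @ [i]) ! (l - 1) = \<eta> ! (l - 1)" if "l \<in> {1..j}" for l using that assms by (auto simp: nth_append)
  then show ?thesis using assms by (simp add: nth_append)
 qed
 finally show ?thesis using assms by (auto simp: grem_paths_def)
qed

lemma grem_paths_take: "\<epsilon> \<in> grem_paths N d ==> j <= d ==> take j \<epsilon> \<in> grem_paths N j"
 by (auto simp: grem_paths_def)

lemma desc_subset_grem_nodes:
 assumes "j <= d" "\<eta> \<in> grem_paths N j"
 shows "desc N [Suc j..<Suc d] \<eta> \<subseteq> grem_nodes N d"
 using assms
proof (induction j arbitrary: \<eta> rule: inc_induct)
 case (step j)
 have len: "length \<eta> = j" using step.prems by (simp add: grem_paths_def)
 have "insert (\<eta> @ [i]) (desc N [Suc (Suc j)..<Suc d] (\<eta> @ [i])) \<subseteq> grem_nodes N d" if "i \<in> {1..N (Suc j)}" for i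
 proof -
  have p: "\<eta> @ [i] \<in> grem_paths N (Suc j)" using that step.prems by (simp add: grem_paths_snoc[OF len])
  then have "\<eta> @ [i] \<in> grem_nodes N d" unfolding grem_nodes_def using step.hyps by force
  then show ?thesis using step.IH[OF p] by simp
 qed
 moreover have "[Suc j..<Suc d] = Suc j # [Suc (Suc j)..<Suc d]" using step.hyps by (simp add: upt_conv_Cons)
 ultimately show ?case by (simp only: desc.simps) blast
qed simp

lemma finite_grem_paths: "finite (grem_paths N d)"
proof (induction d)
 case 0
 show ?case by (rule finite_subset[of _ "{[]}"]) (auto simp: grem_paths_def)
next
 case (Suc d)
 have "grem_paths N (Suc d) \<subseteq> (\<lambda>(\<eta>, i). \<eta> @ [i]) ` (grem_paths N d \<times> {1..N (Suc d)})"
 proof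
  fix \<epsilon> assume e: "\<epsilon> \<in> grem_paths N (Suc d)"
  then have "length \<epsilon> = Suc d" by (simp add: grem_paths_def)
  then obtain \<eta> i where ei: "\<epsilon> = \<eta> @ [i]" "length \<eta> = d" by (metis length_Suc_conv_rev)
  then show "\<epsilon> \<in> (\<lambda>(\<eta>, i). \<eta> @ [i]) ` (grem_paths N d \<times> {1..N (Suc d)})"
   using e grem_paths_snoc[OF ei(2)] by force
 qed
 then show ?case by (rule finite_subset) (use Suc in auto)
qed

text \<open>Downward induction on the depth \<open>j\<close>: the paths through
  \<open>\<eta>\<close> are split by their next entry, whose exponential factor comes out of the
  sum.\<close>

lemma cascade_eq_path_sum:
 assumes "j <= d" "\<eta> \<in> grem_paths N j"
 shows "cascade N c b [Suc j..<Suc d] \<eta> x =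
  (\<Sum>\<epsilon>\<in>{\<epsilon> \<in> grem_paths N d. take j \<epsilon> = \<eta>}. exp (b * of_real (\<Sum>k=Suc j..d. c k * x (take k \<epsilon>))))"
 using assms
proof (induction j arbitrary: \<eta> rule: inc_induct)
 case base
 then have "{\<epsilon> \<in> grem_paths N d. take d \<epsilon> = \<eta>} = {\<eta>}" by (auto simp: grem_paths_def)
 then show ?case by simp
next
 case (step j)
 have len: "length \<eta> = j" using step.prems by (simp add: grem_paths_def)
 let ?E = "\<lambda>i. {\<epsilon> \<in> grem_paths N d. take (Suc j) \<epsilon> = \<eta> @ [i]}"
 have Un: "{\<epsilon> \<in> grem_paths N d. take j \<epsilon> = \<eta>} = (\<Union>i\<in>{1..N (Suc j)}. ?E i)"
 proof (intro equalityI subsetI)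
  fix \<epsilon> assume e: "\<epsilon> \<in> {\<epsilon> \<in> grem_paths N d. take j \<epsilon> = \<eta>}"
  then have "length \<epsilon> = d" by (simp add: grem_paths_def)
  then have t: "take (Suc j) \<epsilon> = \<eta> @ [\<epsilon> ! j]" using e step.hyps by (simp add: take_Suc_conv_app_nth)
  moreover have "take (Suc j) \<epsilon> \<in> grem_paths N (Suc j)" using e step.hyps by (intro grem_paths_take) auto
  ultimately have "\<epsilon> ! j \<in> {1..N (Suc j)}" by (simp add: grem_paths_snoc[OF len])
  then show "\<epsilon> \<in> (\<Union>i\<in>{1..N (Suc j)}. ?E i)" using e t by blast
 next
  fix \<epsilon> assume "\<epsilon> \<in> (\<Union>i\<in>{1..N (Suc j)}. ?E i)"
  then obtain i where e: "\<epsilon> \<in> grem_paths N d" "take (Suc j) \<epsilon> = \<eta> @ [i]" by blast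
  have "take j (take (Suc j) \<epsilon>) = \<eta>" unfolding e(2) using len by simp
  moreover have "take j (take (Suc j) \<epsilon>) = take j \<epsilon>" by (simp only: take_take) simp
  ultimately show "\<epsilon> \<in> {\<epsilon> \<in> grem_paths N d. take j \<epsilon> = \<eta>}" using e(1) by simp
 qed
 have "(\<Sum>\<epsilon>\<in>{\<epsilon> \<in> grem_paths N d. take j \<epsilon> = \<eta>}. exp (b * of_real (\<Sum>k=Suc j..d. c k * x (take k \<epsilon>))))
  = (\<Sum>i\<in>{1..N (Suc j)}. \<Sum>\<epsilon>\<in>?E i. exp (b * of_real (\<Sum>k=Suc j..d. c k * x (take k \<epsilon>))))"
  unfolding Un using finite_grem_paths by (intro sum.UNION_disjoint) auto
 also have "\<dots> = (\<Sum>i\<in>{1..N (Suc j)}. exp (b * of_real (c (Suc j) * x (\<eta> @ [i]))) * cascade N c b [Suc (Suc j)..<Suc d] (\<eta> @ [i]) x)"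
 proof (intro sum.cong refl)
  fix i assume "i \<in> {1..N (Suc j)}"
  then have p: "\<eta> @ [i] \<in> grem_paths N (Suc j)" using step.prems by (simp add: grem_paths_snoc[OF len])
  have "exp (b * of_real (\<Sum>k=Suc j..d. c k * x (take k \<epsilon>))) =
   exp (b * of_real (c (Suc j) * x (\<eta> @ [i]))) * exp (b * of_real (\<Sum>k=Suc (Suc j)..d. c k * x (take k \<epsilon>)))"
   if "\<epsilon> \<in> ?E i" for \<epsilon>
  proof -
   have "(\<Sum>k=Suc j..d. c k * x (take k \<epsilon>)) = c (Suc j) * x (take (Suc j) \<epsilon>) + (\<Sum>k=Suc (Suc j)..d. c k * x (take k \<epsilon>))"
    using step.hyps by (intro sum.atLeast_Suc_atMost) simp
   then show ?thesis using that by (simp only: of_real_add distrib_left exp_add mem_Collect_eq)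
  qed
  then show "(\<Sum>\<epsilon>\<in>?E i. exp (b * of_real (\<Sum>k=Suc j..d. c k * x (take k \<epsilon>)))) =
   exp (b * of_real (c (Suc j) * x (\<eta> @ [i]))) * cascade N c b [Suc (Suc j)..<Suc d] (\<eta> @ [i]) x"
   unfolding step.IH[OF p] sum_distrib_left by (rule sum.cong[OF refl])
 qed
 also have "\<dots> = cascade N c b (Suc j # [Suc (Suc j)..<Suc d]) \<eta> x" by simp
 also have "Suc j # [Suc (Suc j)..<Suc d] = [Suc j..<Suc d]" using step.hyps by (simp add: upt_conv_Cons)
 finally show ?case ..
qed

lemma grem_partition_eq_cascade:
 "grem_partition d a N \<xi> n w b = cascade N (\<lambda>k. sqrt (real n) * sqrt (a k)) b [1..<Suc d] [] (\<lambda>\<zeta>. \<xi> \<zeta> w)"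
 using cascade_eq_path_sum[of 0 d "[]" N "\<lambda>k. sqrt (real n) * sqrt (a k)" b "\<lambda>\<zeta>. \<xi> \<zeta> w"]
 by (simp add: grem_partition_def grem_energy_def grem_paths_def sum_distrib_left mult.assoc)

section \<open>Upper and lower bounds for the partition function\<close>

context prob_space
begin

lemma Lq_bound_weaken:
 assumes "Lq_bound q Y C" "0 <= C" "C <= C'" "0 <= q"
 shows "Lq_bound q Y C'"
 using assms powr_mono2[of q C C'] unfolding Lq_bound_def by auto

lemma cascade_rv_expectation:
 assumes "cascade_rv N c \<beta> ks S"
 shows "integrable M S \<and> expectation S = (\<Prod>k\<leftarrow>ks. of_nat (N k) * exp (\<beta>^2 * of_real ((c k)^2) / 2))"
 using assms
proof induction
 case Nil
 show ?case by (simp add: prob_space)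
next
 case (Cons k X W ks)
 interpret b: branching M "{1..N k}" X W by (rule Cons.hyps)
 show ?case using b.branch_sum_expectation Cons.IH by simp
qed

lemma cascade_rv_ConsE':
 assumes "cascade_rv N c b (k # ks) S"
 obtains X W where "S = branching.branch_sum {1..N k} X W b (c k)" "branching M {1..N k} X W"
  "\<And>i. i \<in> {1..N k} ==> cascade_rv N c b ks (W i)"
 using assms
proof cases
 case (Cons X W)
 then show thesis using that by blast
qed

lemma cascade_rv_rv: "cascade_rv N c b ks S ==> random_variable borel S"
 using cascade_rv_expectation[of N c b ks S] by auto

end

text \<open>The root of \<open>N <= 2 * \<alpha>^n\<close> contributes the rate
  \<open>ln \<alpha> / q\<close> and the Gaussian factor the rate
  \<open>q * \<sigma>^2 * a / 2\<close>; the last assumption, divided by \<open>q\<close>, bounds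
  their sum by \<open>p\<close>.\<close>

lemma moment_const_le:
 fixes \<alpha> q p \<sigma> a r N :: real
 assumes "\<alpha> > 1" "q > 0" "r > 0" "0 < N" "N <= 2 * \<alpha> ^ n" and p: "ln \<alpha> + q^2 * \<sigma>^2 * a / 2 <= q * p"
 shows "(r * N) powr (1 / q) * exp (q * \<sigma>^2 * (real n * a) / 2) <= (2 * r) powr (1 / q) * exp (real n * p)"
proof -
 have "(r * N) powr (1 / q) <= ((2 * r) * \<alpha> ^ n) powr (1 / q)"
  using assms mult_left_mono[OF assms(5), of r] by (intro powr_mono2) auto
 also have "\<dots> = (2 * r) powr (1 / q) * (\<alpha> ^ n) powr (1 / q)"
  using assms by (subst powr_mult) auto
 also have "(\<alpha> ^ n) powr (1 / q) = exp (real n * (ln \<alpha> / q))"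
  using assms by (simp add: powr_def ln_realpow)
 finally have 1: "(r * N) powr (1 / q) <= (2 * r) powr (1 / q) * exp (real n * (ln \<alpha> / q))" .
 have "ln \<alpha> / q + q * \<sigma>^2 * a / 2 = (ln \<alpha> + q^2 * \<sigma>^2 * a / 2) / q"
  using assms(2) by (simp add: add_divide_distrib power2_eq_square)
 also have "\<dots> <= q * p / q" using p assms(2) by (intro divide_right_mono) auto
 also have "\<dots> = p" using assms(2) by simp
 finally have 2: "real n * (ln \<alpha> / q + q * \<sigma>^2 * a / 2) <= real n * p" by (intro mult_left_mono) auto
 have "(r * N) powr (1 / q) * exp (q * \<sigma>^2 * (real n * a) / 2)
  <= (2 * r) powr (1 / q) * exp (real n * (ln \<alpha> / q)) * exp (q * \<sigma>^2 * (real n * a) / 2)"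
  using 1 by (rule mult_right_mono) simp
 also have "\<dots> = (2 * r) powr (1 / q) * exp (real n * (ln \<alpha> / q + q * \<sigma>^2 * a / 2))"
  by (simp add: distrib_left exp_add mult_ac)
 also have "\<dots> <= (2 * r) powr (1 / q) * exp (real n * p)"
  using 2 by (intro mult_left_mono) auto
 finally show ?thesis .
qed

locale grem = prob_space +
 fixes d :: nat and a \<alpha> :: "nat \<Rightarrow> real" and N :: "nat \<Rightarrow> nat \<Rightarrow> nat" and \<xi> :: "nat \<Rightarrow> nat list \<Rightarrow> 'a \<Rightarrow> real"
 assumes a: "j \<in> {1..d} ==> a j > 0" and \<alpha>: "j \<in> {1..d} ==> \<alpha> j > 1"
  and N_lim: "j \<in> {1..d} ==> (\<lambda>n. real (N n j) / \<alpha> j ^ n) \<longlonglongrightarrow> 1"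
  and indep: "indep_vars (\<lambda>_. borel) (\<xi> n) (grem_nodes (N n) d)"
  and normal: "\<eta> \<in> grem_nodes (N n) d ==> distr M borel (\<xi> n \<eta>) = gauss"
  and mono: "strict_mono_on {1..d} (\<lambda>k. crit (a k) (\<alpha> k))"
begin

definition c :: "nat \<Rightarrow> nat \<Rightarrow> real" where "c n k = sqrt (real n) * sqrt (a k)"

definition p :: "complex \<Rightarrow> nat \<Rightarrow> real" where "p b k = level_p (a k) (\<alpha> k) b"

definition P :: "complex \<Rightarrow> nat list \<Rightarrow> real" where "P b ks = (\<Sum>k\<leftarrow>ks. p b k)"

text \<open>A whole cascade is measured at the order of its first level, the smallest among its
  levels because the critical values increase. For the empty list, where the sum is constant, the
  cap 2 is a neutral value.\<close>

definition moment :: "complex \<Rightarrow> nat list \<Rightarrow> real" where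
 "moment b ks = (case ks of [] \<Rightarrow> 2 | k # _ \<Rightarrow> level.q (a k) (\<alpha> k) b)"

lemma P_simps [simp]: "P b [] = 0" "P b (k # ks) = p b k + P b ks"
 by (simp_all add: P_def)

lemma level: "k \<in> {1..d} ==> level (a k) (\<alpha> k)"
 by (intro level.intro a \<alpha>)

lemma c_square: "k \<in> {1..d} ==> (c n k)\<^sup>2 = real n * a k"
 using a[of k] by (simp add: c_def power_mult_distrib)

lemma c_pos: "k \<in> {1..d} ==> n > 0 ==> c n k > 0"
 using a[of k] by (simp add: c_def)

lemma N_bounds:
 assumes k: "k \<in> {1..d}"
 shows "\<forall>\<^sub>F n in sequentially. \<alpha> k ^ n / 2 <= real (N n k) \<and> real (N n k) <= 2 * \<alpha> k ^ n"
proof -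
 have "\<forall>\<^sub>F n in sequentially. 1 / 2 < real (N n k) / \<alpha> k ^ n \<and> real (N n k) / \<alpha> k ^ n < 2"
  using order_tendstoD[OF N_lim[OF k], of "1 / 2"] order_tendstoD[OF N_lim[OF k], of 2] by (auto simp: eventually_conj_iff)
 then show ?thesis
 proof eventually_elim
  case (elim n)
  have "\<alpha> k ^ n > 0" using \<alpha>[OF k] by simp
  then show ?case using elim by (simp add: field_simps)
 qed
qed

lemma moment_pos: "Re b \<noteq> 0 ==> set ks \<subseteq> {1..d} ==> 0 < moment b ks"
 by (cases ks) (auto simp: moment_def intro!: level.q_bounds(1)[OF level])

lemma moment_Cons_le:
 assumes "Re b \<noteq> 0" "sorted_wrt (<) (k # ks)" "set (k # ks) \<subseteq> {1..d}"
 shows "moment b (k # ks) <= moment b ks"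
proof (cases ks)
 case Nil
 then show ?thesis using level.q_bounds(2)[OF level[of k]] assms by (simp add: moment_def)
next
 case (Cons k' ks')
 then have k: "k \<in> {1..d}" "k' \<in> {1..d}" "k < k'" using assms by auto
 then have "crit (a k) (\<alpha> k) < crit (a k') (\<alpha> k')" using strict_mono_onD[OF mono] by blast
 then have "crit (a k) (\<alpha> k) / \<bar>Re b\<bar> <= crit (a k') (\<alpha> k') / \<bar>Re b\<bar>" by (intro divide_right_mono) auto
 then show ?thesis using Cons by (simp add: moment_def level.q_def[OF level[OF k(1)]] level.q_def[OF level[OF k(2)]] level.s_def[OF level[OF k(1)]] level.s_def[OF level[OF k(2)]])
qed

text \<open>The induction hypothesis holds at the order of the remaining levels, which is at least
  \<open>r\<close>, so \<open>Lq_bound_mono\<close> carries it down to \<open>r\<close>. One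
  branching step follows: by subadditivity for \<open>r <= 1\<close>, and for \<open>r > 1\<close>
  by bounding the rate of the fluctuations with \<open>moment_le_level_p\<close> and that of the
  mean with \<open>mean_le_level_p\<close>.\<close>

lemma upper_bound:
 assumes \<sigma>: "Re \<beta> \<noteq> 0" and ks: "sorted_wrt (<) ks" "set ks \<subseteq> {1..d}"
 shows "\<exists>C>0. \<forall>\<^sub>F n in sequentially. \<forall>S. cascade_rv (N n) (c n) \<beta> ks S \<longrightarrow> Lq_bound (moment \<beta> ks) S (C * exp (real n * P \<beta> ks))"
 using ks
proof (induction ks)
 case Nil
 have "Lq_bound 2 (\<lambda>_. 1) 1" by (simp add: Lq_bound_def prob_space)
 then show ?case by (intro exI[of _ 1] conjI always_eventually allI impI) (auto elim!: cascade_rv_NilE simp: moment_def)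
next
 case (Cons k ks)
 then have k: "k \<in> {1..d}" and ks: "set ks \<subseteq> {1..d}" "sorted_wrt (<) ks" by auto
 interpret l: level "a k" "\<alpha> k" by (rule level[OF k])
 from Cons.IH[OF ks(2,1)] obtain C where C: "C > 0"
  and IH: "\<forall>\<^sub>F n in sequentially. \<forall>S. cascade_rv (N n) (c n) \<beta> ks S \<longrightarrow> Lq_bound (moment \<beta> ks) S (C * exp (real n * P \<beta> ks))"
  by blast
 define r where "r = moment \<beta> (k # ks)"
 have r: "0 < r" "r <= 2" using l.q_bounds(1)[OF \<sigma>] l.q_bounds(2) by (simp_all add: r_def moment_def)
 have rle: "r <= moment \<beta> ks" unfolding r_def by (rule moment_Cons_le[OF \<sigma> Cons.prems])
 have mom: "ln (\<alpha> k) + r^2 * (Re \<beta>)^2 * a k / 2 <= r * p \<beta> k"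
  using l.moment_le_level_p(1)[OF \<sigma>] by (simp add: r_def moment_def p_def)
 \<comment> \<open>96 is 2 * 48, with 48 from \<open>centered_Lq\<close> and 2 from
   \<open>N n k <= 2 * \<alpha> k ^ n\<close>; the summand 2 is the same factor in the mean, and 8
   comes from \<open>Lq_bound_branch_sum\<close>.\<close>
 define C' where "C' = (if r <= 1 then 2 powr (1 / r) * C else 8 * ((96 powr (1 / r) + 2) * C))"
 have C': "C' > 0" using C by (simp add: C'_def add_nonneg_pos)
 have "\<forall>\<^sub>F n in sequentially. \<forall>S. cascade_rv (N n) (c n) \<beta> (k # ks) S \<longrightarrow> Lq_bound r S (C' * exp (real n * P \<beta> (k # ks)))"
  using IH N_bounds[OF k]
 proof eventually_elim
  case (elim n)
  have \<alpha>n: "\<alpha> k ^ n > 0" using \<alpha>[OF k] by simp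
  then have Npos: "0 < real (N n k)" using elim(2) by linarith
  show ?case
  proof (intro allI impI)
   fix S assume "cascade_rv (N n) (c n) \<beta> (k # ks) S"
   then obtain X W where S: "S = branching.branch_sum {1..N n k} X W \<beta> (c n k)"
    and b: "branching M {1..N n k} X W" and W: "\<And>i. i \<in> {1..N n k} ==> cascade_rv (N n) (c n) \<beta> ks (W i)"
    by (elim cascade_rv_ConsE') blast
   interpret b: branching M "{1..N n k}" X W by (rule b)
   define D where "D = C * exp (real n * P \<beta> ks)"
   have D: "D > 0" using C by (simp add: D_def)
   have LW: "Lq_bound r (W i) D" if "i \<in> {1..N n k}" for i
    by (rule Lq_bound_mono[OF elim(1)[rule_format, OF W[OF that], folded D_def] r(1) rle D])
   have cd: "card {1..N n k} = N n k" by simp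
   show "Lq_bound r S (C' * exp (real n * P \<beta> (k # ks)))"
   proof (cases "r <= 1")
    case True
    have "(1 * real (N n k)) powr (1 / r) * exp (r * (Re \<beta>)^2 * (real n * a k) / 2) <= (2 * 1) powr (1 / r) * exp (real n * p \<beta> k)"
     using elim(2) Npos r mom by (intro moment_const_le[OF \<alpha>[OF k]]) auto
    from mult_right_mono[OF this, of D] D
    have le: "real (N n k) powr (1 / r) * (exp (r * (Re \<beta>)^2 * (c n k)^2 / 2) * D) <= C' * exp (real n * P \<beta> (k # ks))"
     unfolding c_square[OF k] by (simp add: C'_def True D_def distrib_left exp_add mult_ac)
    show ?thesis
     unfolding S by (rule Lq_bound_weaken[OF b.Lq_bound_branch_sum_small[OF LW D r(1) True, of \<beta> "c n k", unfolded cd] _ le]) (use D r in auto)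
   next
    case False
    have 1: "(48 * real (N n k)) powr (1 / r) * exp (r * (Re \<beta>)^2 * (real n * a k) / 2) <= (2 * 48) powr (1 / r) * exp (real n * p \<beta> k)"
     using elim(2) Npos r mom by (intro moment_const_le[OF \<alpha>[OF k]]) auto
    have 2: "real (N n k) * exp (Re (\<beta>^2) * (real n * a k) / 2) <= 2 * exp (real n * p \<beta> k)"
    proof -
     have "real (N n k) * exp (Re (\<beta>^2) * (real n * a k) / 2) <= 2 * \<alpha> k ^ n * exp (Re (\<beta>^2) * (real n * a k) / 2)"
      using elim(2) by (intro mult_right_mono) auto
     also have "\<alpha> k ^ n = exp (real n * ln (\<alpha> k))" using \<alpha>[OF k] by (simp add: exp_of_nat_mult)
     also have "2 * exp (real n * ln (\<alpha> k)) * exp (Re (\<beta>^2) * (real n * a k) / 2)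
      = 2 * exp (real n * (ln (\<alpha> k) + a k / 2 * ((Re \<beta>)^2 - (Im \<beta>)^2)))"
      unfolding Re_power2 mult.assoc exp_add[symmetric] by (simp add: field_simps)
     also have "\<dots> <= 2 * exp (real n * p \<beta> k)"
     proof -
      have "1 < level.q (a k) (\<alpha> k) \<beta>" using False by (simp add: r_def moment_def)
      from l.mean_le_level_p[OF \<sigma> this] show ?thesis by (simp add: p_def mult_left_mono)
     qed
     finally show ?thesis .
    qed
    have "8 * ((48 * real (N n k)) powr (1 / r) * (exp (r * (Re \<beta>)^2 * (c n k)^2 / 2) * D) + real (N n k) * (exp (Re (\<beta>^2) * (c n k)^2 / 2) * D))
     = 8 * (((48 * real (N n k)) powr (1 / r) * exp (r * (Re \<beta>)^2 * (real n * a k) / 2)) * D + (real (N n k) * exp (Re (\<beta>^2) * (real n * a k) / 2)) * D)"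
     unfolding c_square[OF k] by (simp only: mult.assoc)
    also have "\<dots> <= 8 * (((2 * 48) powr (1 / r) * exp (real n * p \<beta> k)) * D + (2 * exp (real n * p \<beta> k)) * D)"
     using 1 2 D by (intro mult_left_mono add_mono mult_right_mono) auto
    also have "\<dots> = C' * exp (real n * P \<beta> (k # ks))"
     using False by (simp add: C'_def D_def distrib_left exp_add algebra_simps)
    finally have le: "8 * ((48 * real (N n k)) powr (1 / r) * (exp (r * (Re \<beta>)^2 * (c n k)^2 / 2) * D) + real (N n k) * (exp (Re (\<beta>^2) * (c n k)^2 / 2) * D))
     <= C' * exp (real n * P \<beta> (k # ks))" .
    have r1: "1 <= r" and ne: "{1..N n k} \<noteq> {}" using False Npos by auto
    have "Lq_bound r S (8 * ((48 * real (N n k)) powr (1 / r) * (exp (r * (Re \<beta>)^2 * (c n k)^2 / 2) * D) + real (N n k) * (exp (Re (\<beta>^2) * (c n k)^2 / 2) * D)))"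
     unfolding S by (rule b.Lq_bound_branch_sum[OF LW D r1 r(2) ne, of \<beta> "c n k", unfolded cd])
    then show ?thesis
     by (rule Lq_bound_weaken[OF _ _ le]) (use D r in auto)
   qed
  qed
 qed
 then show ?case using C' unfolding r_def by blast
qed

text \<open>In phase E, \<open>level_p\<close> is exactly the growth rate of the mean of a level;
  each level loses a factor 1/2 through the lower bound on \<open>N n k\<close>.\<close>

lemma mean_lower_bound:
 assumes "\<And>k. k \<in> set ks ==> k \<in> {1..d} \<and> b \<in> phase_E (crit (a k) (\<alpha> k)) \<and> \<alpha> k ^ n / 2 <= real (N n k)"
 shows "(1 / 2) ^ length ks * exp (real n * P b ks) <= norm (\<Prod>k\<leftarrow>ks. of_nat (N n k) * exp (b^2 * of_real ((c n k)^2) / 2))"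
 using assms
proof (induction ks)
 case (Cons k ks)
 then have k: "k \<in> {1..d}" and E: "b \<in> phase_E (crit (a k) (\<alpha> k))" and Nk: "\<alpha> k ^ n / 2 <= real (N n k)" by auto
 interpret l: level "a k" "\<alpha> k" by (rule level[OF k])
 have "1 / 2 * exp (real n * p b k) = \<alpha> k ^ n / 2 * exp (Re (b^2) * (real n * a k) / 2)"
 proof -
  have h1: "\<alpha> k ^ n = exp (real n * ln (\<alpha> k))" using \<alpha>[OF k] by (simp add: exp_of_nat_mult)
  have h2: "p b k = ln (\<alpha> k) + a k / 2 * ((Re b)^2 - (Im b)^2)"
   using l.level_p_E E by (simp add: p_def l.s_def l.ln_\<alpha>)
  show ?thesis unfolding h1 h2 Re_power2 by (simp add: field_simps flip: exp_add)
 qed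
 also have "\<dots> <= real (N n k) * exp (Re (b^2) * (real n * a k) / 2)" using Nk by (intro mult_right_mono) auto
 also have "\<dots> = norm (of_nat (N n k) * exp (b^2 * of_real ((c n k)^2) / 2))"
  unfolding norm_mult norm_exp_eq_Re c_square[OF k] by simp
 finally have 1: "1 / 2 * exp (real n * p b k) <= norm (of_nat (N n k) * exp (b^2 * of_real ((c n k)^2) / 2))" .
 have IH: "(1 / 2) ^ length ks * exp (real n * P b ks) <= norm (\<Prod>k\<leftarrow>ks. of_nat (N n k) * exp (b^2 * of_real ((c n k)^2) / 2))"
  using Cons by simp
 have "(1 / 2) ^ length (k # ks) * exp (real n * P b (k # ks)) = (1 / 2 * exp (real n * p b k)) * ((1 / 2) ^ length ks * exp (real n * P b ks))"
  by (simp add: distrib_left exp_add)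
 also have "\<dots> <= norm (of_nat (N n k) * exp (b^2 * of_real ((c n k)^2) / 2)) * norm (\<Prod>k\<leftarrow>ks. of_nat (N n k) * exp (b^2 * of_real ((c n k)^2) / 2))"
  using 1 IH by (intro mult_mono) auto
 finally show ?case by (simp only: norm_mult list.map prod_list.Cons)
qed simp

text \<open>By \<open>phase_E_mono\<close> all levels of the list are in phase E, so the mean has
  rate \<open>P\<close>. The L^r norm of the fluctuations, with \<open>r > 1\<close>, has the
  strictly smaller rate \<open>p' + P \<beta> ks\<close>, and Markov's inequality makes deviations
  comparable with the mean exponentially unlikely.\<close>

lemma lower_bound_E:
 assumes \<sigma>: "Re \<beta> \<noteq> 0" and ks: "sorted_wrt (<) (k # ks)" "set (k # ks) \<subseteq> {1..d}"
  and E: "\<beta> \<in> phase_E (crit (a k) (\<alpha> k))" and \<epsilon>: "\<epsilon> > 0"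
 shows "\<exists>\<delta>. \<delta> \<longlonglongrightarrow> 0 \<and> (\<forall>\<^sub>F n in sequentially. \<forall>S. cascade_rv (N n) (c n) \<beta> (k # ks) S \<longrightarrow>
  prob {w \<in> space M. norm (S w) < exp (real n * (P \<beta> (k # ks) - \<epsilon>))} <= \<delta> n)"
proof -
 let ?P = "P \<beta> (k # ks)"
 have k: "k \<in> {1..d}" and ks': "set ks \<subseteq> {1..d}" "sorted_wrt (<) ks" using ks by auto
 interpret l: level "a k" "\<alpha> k" by (rule level[OF k])
 have Es: "\<beta> \<in> phase_E l.s" using E by (simp add: l.s_def)
 have allE: "\<beta> \<in> phase_E (crit (a j) (\<alpha> j))" if "j \<in> set (k # ks)" for j
 proof (cases "j = k")
  case False
  then have "k < j" "j \<in> {1..d}" using that ks by auto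
  then have "crit (a k) (\<alpha> k) < crit (a j) (\<alpha> j)" using strict_mono_onD[OF mono k] by blast
  then show ?thesis using phase_E_mono[OF l.s_pos _ Es] by (simp add: l.s_def)
 qed (use E in simp)
 obtain C where C: "C > 0"
  and U: "\<forall>\<^sub>F n in sequentially. \<forall>S. cascade_rv (N n) (c n) \<beta> ks S \<longrightarrow> Lq_bound (moment \<beta> ks) S (C * exp (real n * P \<beta> ks))"
  using upper_bound[OF \<sigma> ks'(2,1)] by blast
 define r where "r = moment \<beta> (k # ks)"
 have r: "1 < r" "r <= 2" using l.q_E[OF \<sigma> Es] l.q_bounds(2) by (simp_all add: r_def moment_def)
 have rle: "r <= moment \<beta> ks" unfolding r_def by (rule moment_Cons_le[OF \<sigma> ks])
 \<comment> \<open>The rate of the fluctuations created at level \<open>k\<close>; the gap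
   \<open>\<gamma>\<close> below comes from the strict inequality in
   \<open>moment_le_level_p\<close>.\<close>
 define p' where "p' = (ln (\<alpha> k) + r^2 * (Re \<beta>)^2 * a k / 2) / r"
 have "ln (\<alpha> k) + r^2 * (Re \<beta>)^2 * a k / 2 < r * p \<beta> k"
  using l.moment_le_level_p(2)[OF \<sigma> Es] by (simp add: r_def moment_def p_def)
 then have p': "p' < p \<beta> k" using r by (simp add: p'_def field_simps)
 have mom: "ln (\<alpha> k) + r^2 * (Re \<beta>)^2 * a k / 2 <= r * p'" using r by (simp add: p'_def)
 define m where "m = (1 / 2 :: real) ^ length (k # ks)"
 have m: "m > 0" by (simp add: m_def)
 define \<gamma> where "\<gamma> = p \<beta> k - p'"
 have \<gamma>: "\<gamma> > 0" using p' by (simp add: \<gamma>_def)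
 define K where "K = 96 powr (1 / r) * C / (m / 2)"
 have K: "K > 0" using C m by (simp add: K_def)
 define \<delta> where "\<delta> n = (K * exp (- (real n * \<gamma>))) powr r" for n
 have "\<delta> \<longlonglongrightarrow> 0" unfolding \<delta>_def using K \<gamma> r by real_asymp
 moreover have "\<forall>\<^sub>F n in sequentially. \<forall>S. cascade_rv (N n) (c n) \<beta> (k # ks) S \<longrightarrow>
  prob {w \<in> space M. norm (S w) < exp (real n * (?P - \<epsilon>))} <= \<delta> n"
 proof -
  have ev: "\<forall>\<^sub>F n in sequentially. \<forall>j\<in>set (k # ks). \<alpha> j ^ n / 2 <= real (N n j)"
   using ks(2) by (intro eventually_ball_finite ballI) (auto intro!: eventually_mono[OF N_bounds])
  have "(\<lambda>n. exp (- (real n * \<epsilon>))) \<longlonglongrightarrow> 0" using \<epsilon> by real_asymp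
  then have "\<forall>\<^sub>F n in sequentially. exp (- (real n * \<epsilon>)) < m / 2" using m by (intro order_tendstoD(2)) auto
  then show ?thesis
   using U N_bounds[OF k] ev
  proof eventually_elim
   case (elim n)
   have \<alpha>n: "\<alpha> k ^ n > 0" using \<alpha>[OF k] by simp
   then have Npos: "0 < real (N n k)" using elim(3) by linarith
   show ?case
   proof (intro allI impI)
    fix S assume cS: "cascade_rv (N n) (c n) \<beta> (k # ks) S"
    then obtain X W where S: "S = branching.branch_sum {1..N n k} X W \<beta> (c n k)"
     and b: "branching M {1..N n k} X W" and W: "\<And>i. i \<in> {1..N n k} ==> cascade_rv (N n) (c n) \<beta> ks (W i)"
     by (elim cascade_rv_ConsE') blast
    interpret b: branching M "{1..N n k}" X W by (rule b)
    have [measurable]: "random_variable borel S" by (rule cascade_rv_rv[OF cS])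
    define D where "D = C * exp (real n * P \<beta> ks)"
    have D: "D > 0" using C by (simp add: D_def)
    have LW: "Lq_bound r (W i) D" if "i \<in> {1..N n k}" for i
     by (rule Lq_bound_mono[OF elim(2)[rule_format, OF W[OF that], folded D_def] _ rle D]) (use r in simp)
    have cd: "card {1..N n k} = N n k" by simp
    define Z where "Z w = S w - expectation S" for w
    have Z1: "Lq_bound r Z ((48 * real (N n k)) powr (1 / r) * (exp (r * (Re \<beta>)^2 * (c n k)^2 / 2) * D))"
     unfolding Z_def S by (rule b.Lq_bound_branch_sum_centered[OF LW D less_imp_le[OF r(1)] r(2), of \<beta> "c n k", unfolded cd])
    have Z2: "(48 * real (N n k)) powr (1 / r) * (exp (r * (Re \<beta>)^2 * (c n k)^2 / 2) * D) <= (2 * 48) powr (1 / r) * exp (real n * p') * D"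
    proof -
     have "(48 * real (N n k)) powr (1 / r) * exp (r * (Re \<beta>)^2 * (real n * a k) / 2) <= (2 * 48) powr (1 / r) * exp (real n * p')"
      using elim(3) Npos r mom by (intro moment_const_le[OF \<alpha>[OF k]]) auto
     from mult_right_mono[OF this less_imp_le[OF D]] show ?thesis unfolding c_square[OF k] by (simp only: mult.assoc)
    qed
    have LZ: "Lq_bound r Z ((2 * 48) powr (1 / r) * exp (real n * p') * D)"
     by (rule Lq_bound_weaken[OF Z1 _ Z2]) (use D r in auto)
    have mean: "m * exp (real n * ?P) <= norm (expectation S)"
     unfolding m_def conjunct2[OF cascade_rv_expectation[OF cS]]
    proof (rule mean_lower_bound)
     fix j assume "j \<in> set (k # ks)"
     then show "j \<in> {1..d} \<and> \<beta> \<in> phase_E (crit (a j) (\<alpha> j)) \<and> \<alpha> j ^ n / 2 <= real (N n j)"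
      using allE[of j] elim(4) ks(2) by blast
    qed
    have small: "exp (real n * (?P - \<epsilon>)) <= m / 2 * exp (real n * ?P)"
    proof -
     have "exp (real n * (?P - \<epsilon>)) = exp (- (real n * \<epsilon>)) * exp (real n * ?P)"
      unfolding exp_add[symmetric] by (simp add: right_diff_distrib)
     also have "\<dots> <= m / 2 * exp (real n * ?P)" using elim(1) by (intro mult_right_mono) auto
     finally show ?thesis .
    qed
    let ?t = "m / 2 * exp (real n * ?P)"
    have "norm (Z w) >= ?t" if "norm (S w) < exp (real n * (?P - \<epsilon>))" for w
    proof -
     have "norm (expectation S) <= norm (S w) + norm (Z w)"
      unfolding Z_def using norm_triangle_ineq2[of "expectation S" "S w"] by (simp add: norm_minus_commute)
     then show ?thesis using that mean small by linarith
    qed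
    then have "prob {w \<in> space M. norm (S w) < exp (real n * (?P - \<epsilon>))} <= prob {w \<in> space M. norm (Z w) >= ?t}"
     unfolding Z_def by (intro finite_measure_mono) auto
    also have "\<dots> <= ((2 * 48) powr (1 / r) * exp (real n * p') * D / ?t) powr r"
     using r D m by (intro Markov_Lq[OF LZ]) auto
    also have "(2 * 48) powr (1 / r) * exp (real n * p') * D / ?t = K * exp (- (real n * \<gamma>))"
    proof -
     have e: "exp (real n * p') * exp (real n * P \<beta> ks) = exp (- (real n * \<gamma>)) * exp (real n * ?P)"
      unfolding exp_add[symmetric] by (simp add: \<gamma>_def algebra_simps)
     have "(2 * 48) powr (1 / r) * exp (real n * p') * D = 96 powr (1 / r) * C * (exp (real n * p') * exp (real n * P \<beta> ks))"
      by (simp add: D_def mult_ac)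
     also have "\<dots> / ?t = K * exp (- (real n * \<gamma>))"
     proof -
      have c: "x * C * (y * E) / (z * E) = x * C / z * y" if "E > 0" for x y z E :: real using that by simp
      show ?thesis unfolding e K_def by (rule c) simp
     qed
     finally show ?thesis .
    qed
    finally show "prob {w \<in> space M. norm (S w) < exp (real n * (?P - \<epsilon>))} <= \<delta> n" by (simp add: \<delta>_def)
   qed
  qed
 qed
 ultimately show ?thesis by blast
qed

end

text \<open>Dominated convergence with bound 1: for fixed \<open>g\<close>, almost surely nonzero,
  \<open>|g| <= G n\<close> holds eventually and \<open>\<kappa> n * g^2\<close> tends to
  infinity.\<close>

lemma small_ball_integral_tendsto:
 fixes \<kappa> G :: "nat \<Rightarrow> real"
 assumes \<kappa>: "filterlim \<kappa> at_top sequentially" and G: "filterlim G at_top sequentially" and pos: "\<And>n. \<kappa> n >= 0"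
 shows "(\<lambda>n. \<integral>g. (if \<bar>g\<bar> <= G n then exp (- \<kappa> n * g^2) else 1) \<partial>gauss) \<longlonglongrightarrow> 0"
proof -
 interpret N: real_distribution gauss by (rule real_dist_normal_dist)
 have "(\<lambda>n. \<integral>g. (if \<bar>g\<bar> <= G n then exp (- \<kappa> n * g^2) else 1) \<partial>gauss) \<longlonglongrightarrow> (\<integral>g. 0 \<partial>gauss)"
 proof (rule integral_dominated_convergence)
  show "integrable gauss (\<lambda>_. 1 :: real)" by simp
  have "AE g in lborel. g \<noteq> (0 :: real)" by (rule AE_lborel_singleton)
  then have "AE g in gauss. g \<noteq> (0 :: real)" by (subst AE_density) auto
  then show "AE g in gauss. (\<lambda>n. if \<bar>g\<bar> <= G n then exp (- \<kappa> n * g^2) else 1) \<longlonglongrightarrow> 0"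
  proof eventually_elim
   case (elim g)
   have "filterlim (\<lambda>n. g^2 * \<kappa> n) at_top sequentially"
    by (rule filterlim_tendsto_pos_mult_at_top[OF tendsto_const _ \<kappa>]) (use elim in simp)
   then have "filterlim (\<lambda>n. - (g^2 * \<kappa> n)) at_bot sequentially"
    by (simp add: filterlim_uminus_at_top)
   then have lim: "(\<lambda>n. exp (- \<kappa> n * g^2)) \<longlonglongrightarrow> 0"
    using filterlim_compose[OF exp_at_bot] by (simp add: mult.commute)
   have "\<forall>\<^sub>F n in sequentially. \<bar>g\<bar> <= G n" using G by (simp add: filterlim_at_top)
   then have "\<forall>\<^sub>F n in sequentially. exp (- \<kappa> n * g^2) = (if \<bar>g\<bar> <= G n then exp (- \<kappa> n * g^2) else 1)"
    by eventually_elim simp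
   then show ?case by (rule Lim_transform_eventually[OF lim])
  qed
  show "AE g in gauss. norm (if \<bar>g\<bar> <= G n then exp (- \<kappa> n * g^2) else 1) <= 1" for n
   using pos[of n] by (intro AE_I2) auto
 qed measurable
 then show ?thesis by simp
qed

section \<open>The lower bound outside phase E, and for all levels together\<close>

context grem
begin

text \<open>The weights \<open>W i\<close> lie in \<open>[w0, w1]\<close> with probability at least
  1/2, by the lower and upper bounds for \<open>ks\<close>. \<open>small_ball\<close> is applied
  near the Gaussian value \<open>x0\<close> of modulus \<open>c n k * v\<close>, with
  \<open>v\<close> from \<open>window_exists\<close>, whose two inequalities make
  \<open>\<kappa>\<close> and \<open>G\<close> grow exponentially.\<close>

lemma lower_bound_not_E:
 assumes \<sigma>: "Re \<beta> \<noteq> 0" and \<tau>: "Im \<beta> \<noteq> 0" and ks: "sorted_wrt (<) (k # ks)" "set (k # ks) \<subseteq> {1..d}"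
  and nE: "\<beta> \<notin> phase_E (crit (a k) (\<alpha> k))" and \<epsilon>: "\<epsilon> > 0"
  and IH: "\<And>\<epsilon>. \<epsilon> > 0 ==> \<exists>\<delta>. \<delta> \<longlonglongrightarrow> 0 \<and> (\<forall>\<^sub>F n in sequentially. \<forall>S. cascade_rv (N n) (c n) \<beta> ks S \<longrightarrow>
   prob {z \<in> space M. norm (S z) < exp (real n * (P \<beta> ks - \<epsilon>))} <= \<delta> n)"
 shows "\<exists>\<delta>. \<delta> \<longlonglongrightarrow> 0 \<and> (\<forall>\<^sub>F n in sequentially. \<forall>S. cascade_rv (N n) (c n) \<beta> (k # ks) S \<longrightarrow>
  prob {z \<in> space M. norm (S z) < exp (real n * (P \<beta> (k # ks) - \<epsilon>))} <= \<delta> n)"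
proof -
 let ?P = "P \<beta> (k # ks)"
 have k: "k \<in> {1..d}" and ks': "set ks \<subseteq> {1..d}" "sorted_wrt (<) ks" using ks by auto
 interpret l: level "a k" "\<alpha> k" by (rule level[OF k])
 have nEs: "\<beta> \<notin> phase_E l.s" using nE by (simp add: l.s_def)
 have ak: "a k > 0" by (rule a[OF k])
 obtain v \<epsilon>1 \<epsilon>' where v: "0 <= v" and \<epsilon>1: "0 < \<epsilon>1" and \<epsilon>': "\<epsilon>' <= \<epsilon>"
  and w1: "0 < ln (\<alpha> k) - a k * v^2 / 2 + 2 * a k * \<bar>Re \<beta>\<bar> * v - 2 * p \<beta> k + 2 * (\<epsilon>' - \<epsilon>1)"
  and w2: "0 < p \<beta> k - \<epsilon>' - \<epsilon>1 - a k * \<bar>Re \<beta>\<bar> * v"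
  using l.window_exists[OF \<sigma> nEs \<epsilon>] unfolding p_def by metis
 define \<Gamma> where "\<Gamma> = ln (\<alpha> k) - a k * v^2 / 2 + 2 * a k * \<bar>Re \<beta>\<bar> * v - 2 * p \<beta> k + 2 * (\<epsilon>' - \<epsilon>1)"
 define \<Delta> where "\<Delta> = p \<beta> k - \<epsilon>' - \<epsilon>1 - a k * \<bar>Re \<beta>\<bar> * v"
 have \<Gamma>: "\<Gamma> > 0" and \<Delta>: "\<Delta> > 0" using w1 w2 by (simp_all add: \<Gamma>_def \<Delta>_def)
 define b where "b = 2 * pi * \<bar>Re \<beta>\<bar> / \<bar>Im \<beta>\<bar>"
 \<comment> \<open>\<open>B\<close> absorbs, uniformly in \<open>n\<close>, the part of
   \<open>(|x0| + 2 * h)^2 / 2\<close> beyond \<open>n * a k * v^2 / 2\<close>; this works because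
   \<open>c n k * h\<close> is constant and \<open>h\<close> is bounded. In \<open>K\<close>, 64 is
   16 * 2 * 2, from \<open>char_window\<close>, from the event of probability 1/2 and from
   \<open>N n k >= \<alpha> k ^ n / 2\<close>. The \<open>sqrt (real n)\<close> in
   \<open>\<kappa>\<close> comes from \<open>h\<close>.\<close>
 define B where "B = 2 * v * pi / \<bar>Im \<beta>\<bar> + 2 * (pi / (\<bar>Im \<beta>\<bar> * sqrt (a k)))^2"
 define K where "K = exp (- B - 2 * b) / sqrt (2 * pi) * (pi / (\<bar>Im \<beta>\<bar> * sqrt (a k))) / 64"
 have K: "K > 0" using \<tau> ak by (simp add: K_def)
 define \<kappa> where "\<kappa> n = K / sqrt (real n) * exp (real n * \<Gamma>)" for n
 define G where "G n = exp (real n * \<Delta> - b)" for n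
 define \<delta> where "\<delta> n = exp (1 / 2) * (\<integral>g. (if \<bar>g\<bar> <= G n then exp (- \<kappa> n * g^2) else 1) \<partial>gauss)" for n
 have "\<delta> \<longlonglongrightarrow> exp (1 / 2) * 0"
  unfolding \<delta>_def
 proof (intro tendsto_mult tendsto_const small_ball_integral_tendsto)
  show "filterlim \<kappa> at_top sequentially" unfolding \<kappa>_def using K \<Gamma> by real_asymp
  show "filterlim G at_top sequentially" unfolding G_def using \<Delta> by real_asymp
  show "\<kappa> n >= 0" for n using K by (simp add: \<kappa>_def)
 qed
 then have \<delta>: "\<delta> \<longlonglongrightarrow> 0" by simp
 obtain C where C: "C > 0"
  and U: "\<forall>\<^sub>F n in sequentially. \<forall>S. cascade_rv (N n) (c n) \<beta> ks S \<longrightarrow> Lq_bound (moment \<beta> ks) S (C * exp (real n * P \<beta> ks))"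
  using upper_bound[OF \<sigma> ks'(2,1)] by blast
 obtain \<delta>' where d': "\<delta>' \<longlonglongrightarrow> 0"
  and L: "\<forall>\<^sub>F n in sequentially. \<forall>S. cascade_rv (N n) (c n) \<beta> ks S \<longrightarrow>
   prob {z \<in> space M. norm (S z) < exp (real n * (P \<beta> ks - \<epsilon>1))} <= \<delta>' n"
  using IH[OF \<epsilon>1] by blast
 define r where "r = moment \<beta> ks"
 have r: "r > 0" unfolding r_def by (rule moment_pos[OF \<sigma> ks'(1)])
 have "(\<lambda>n. (C * exp (- (real n * \<epsilon>1))) powr r) \<longlonglongrightarrow> 0" using C \<epsilon>1 r by real_asymp
 then have e1: "\<forall>\<^sub>F n in sequentially. (C * exp (- (real n * \<epsilon>1))) powr r < 1 / 4" by (rule order_tendstoD) simp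
 have e2: "\<forall>\<^sub>F n in sequentially. \<delta>' n < 1 / 4" using d' by (rule order_tendstoD) simp
 have "\<forall>\<^sub>F n in sequentially. \<forall>S. cascade_rv (N n) (c n) \<beta> (k # ks) S \<longrightarrow>
  prob {z \<in> space M. norm (S z) < exp (real n * (?P - \<epsilon>))} <= \<delta> n"
  using e1 e2 U L N_bounds[OF k] eventually_gt_at_top[of 0]
 proof eventually_elim
  case (elim n)
  have n: "n > 0" by (rule elim)
  show ?case
  proof (intro allI impI)
   fix S assume cS: "cascade_rv (N n) (c n) \<beta> (k # ks) S"
   then obtain X W where S: "S = branching.branch_sum {1..N n k} X W \<beta> (c n k)"
    and br: "branching M {1..N n k} X W" and W: "\<And>i. i \<in> {1..N n k} ==> cascade_rv (N n) (c n) \<beta> ks (W i)"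
    by (elim cascade_rv_ConsE') blast
   interpret b: branching M "{1..N n k}" X W by (rule br)
   have [measurable]: "random_variable borel S" by (rule cascade_rv_rv[OF cS])
   have cd: "card {1..N n k} = N n k" by simp
   define w0 where "w0 = exp (real n * (P \<beta> ks - \<epsilon>1))"
   define w1 where "w1 = exp (real n * (P \<beta> ks + \<epsilon>1))"
   define t where "t = exp (real n * (?P - \<epsilon>'))"
   have w: "0 < w0" "w0 <= w1" using \<epsilon>1 by (auto simp: w0_def w1_def intro!: mult_left_mono)
   have t: "t > 0" by (simp add: t_def)
   \<comment> \<open>Each failure has probability at most 1/4: \<open>|W i|\<close> too small by the
     induction hypothesis, too large by Markov's inequality.\<close>
   have Wp: "prob {z \<in> space M. w0 <= norm (W i z) \<and> norm (W i z) <= w1} >= 1 / 2" if i: "i \<in> {1..N n k}" for i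
   proof -
    note [measurable] = cascade_rv_rv[OF W[OF i]]
    have p1: "prob {z \<in> space M. norm (W i z) < w0} <= 1 / 4"
     using elim(4)[rule_format, OF W[OF i]] elim(2) unfolding w0_def by linarith
    have "prob {z \<in> space M. norm (W i z) >= w1} <= (C * exp (real n * P \<beta> ks) / w1) powr r"
     by (rule Markov_Lq[OF elim(3)[rule_format, OF W[OF i], folded r_def] r]) (use C in \<open>auto simp: w1_def\<close>)
    also have "C * exp (real n * P \<beta> ks) / w1 = C * exp (- (real n * \<epsilon>1))"
     unfolding w1_def times_divide_eq_right[symmetric] exp_diff[symmetric] by (simp add: distrib_left)
    finally have p2: "prob {z \<in> space M. norm (W i z) >= w1} <= 1 / 4" using elim(1) by linarith
    have "space M = {z \<in> space M. w0 <= norm (W i z) \<and> norm (W i z) <= w1} \<union> ({z \<in> space M. norm (W i z) < w0} \<union> {z \<in> space M. norm (W i z) >= w1})"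
     by auto
    then have "prob (space M) = prob ({z \<in> space M. w0 <= norm (W i z) \<and> norm (W i z) <= w1} \<union> ({z \<in> space M. norm (W i z) < w0} \<union> {z \<in> space M. norm (W i z) >= w1}))"
     by (rule arg_cong)
    also have "\<dots> <= prob {z \<in> space M. w0 <= norm (W i z) \<and> norm (W i z) <= w1} + prob ({z \<in> space M. norm (W i z) < w0} \<union> {z \<in> space M. norm (W i z) >= w1})"
     by (rule measure_Un_le) measurable
    also have "prob ({z \<in> space M. norm (W i z) < w0} \<union> {z \<in> space M. norm (W i z) >= w1}) <= prob {z \<in> space M. norm (W i z) < w0} + prob {z \<in> space M. norm (W i z) >= w1}"
     by (rule measure_Un_le) measurable
    finally show ?thesis using p1 p2 unfolding prob_space by linarith
   qed
   \<comment> \<open>The sign of \<open>Re \<beta>\<close> makes the exponential large at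
     \<open>x0\<close>: its modulus there is
     \<open>exp (n * a k * |Re \<beta>| * v)\<close>.\<close>
   define x0 where "x0 = sgn (Re \<beta>) * (sqrt (real n) * sqrt (a k) * v)"
   define h where "h = pi / (\<bar>Im \<beta>\<bar> * c n k)"
   have sg: "sgn (Re \<beta>) * Re \<beta> = \<bar>Re \<beta>\<bar>" "\<bar>sgn (Re \<beta>)\<bar> = 1" using \<sigma> by (auto simp: sgn_if)
   have c2: "c n k * c n k = real n * a k" using c_square[OF k, of n] by (simp add: power2_eq_square)
   have ax0: "\<bar>x0\<bar> = c n k * v" using sg(2) v ak by (simp add: x0_def abs_mult c_def)
   have V: "Re \<beta> * c n k * x0 = real n * (a k * \<bar>Re \<beta>\<bar> * v)"
   proof -
    have "Re \<beta> * c n k * x0 = (sgn (Re \<beta>) * Re \<beta>) * (c n k * c n k) * v" by (simp add: x0_def c_def mult_ac)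
    then show ?thesis unfolding sg c2 by (simp add: mult_ac)
   qed
   have cn: "c n k > 0" by (rule c_pos[OF k n])
   have hx: "(\<bar>x0\<bar> + 2 * h)^2 / 2 <= real n * (a k * v^2 / 2) + B"
   proof -
    have "h <= pi / (\<bar>Im \<beta>\<bar> * sqrt (a k))"
     unfolding h_def c_def using n ak \<tau> by (intro divide_left_mono mult_left_mono) (auto simp: mult_le_cancel_right1)
    then have h2: "h^2 <= (pi / (\<bar>Im \<beta>\<bar> * sqrt (a k)))^2" using cn by (intro power_mono) (auto simp: h_def)
    have xh: "c n k * h = pi / \<bar>Im \<beta>\<bar>" using cn by (simp add: h_def)
    have "(\<bar>x0\<bar> + 2 * h)^2 / 2 = (c n k * c n k) * v^2 / 2 + 2 * v * (c n k * h) + 2 * h^2"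
     unfolding ax0 by (simp add: square_simps)
    also have "\<dots> <= real n * (a k * v^2 / 2) + B" unfolding c2 xh B_def using h2 by simp
    finally show ?thesis .
   qed
   have E1: "w0 * exp (Re \<beta> * c n k * x0) * exp (- b) / t = exp (real n * (a k * \<bar>Re \<beta>\<bar> * v - p \<beta> k + \<epsilon>' - \<epsilon>1) - b)"
    unfolding w0_def t_def V exp_add[symmetric] exp_diff[symmetric] by (simp add: algebra_simps)
   have \<kappa>': "\<kappa> n <= real (card {1..N n k}) * (exp (- (\<bar>x0\<bar> + 2 * h)\<^sup>2 / 2) / sqrt (2 * pi) * (h / 16 * (w0 * exp (Re \<beta> * c n k * x0) * exp (- b) / t)^2) / 2)"
   proof -
    define H where "H = h / 16 * (w0 * exp (Re \<beta> * c n k * x0) * exp (- b) / t)^2"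
    have H0: "H >= 0" using cn by (simp add: H_def h_def)
    have H: "H = pi / (\<bar>Im \<beta>\<bar> * sqrt (a k)) / sqrt (real n) / 16 * exp (real n * (2 * (a k * \<bar>Re \<beta>\<bar> * v - p \<beta> k + \<epsilon>' - \<epsilon>1)) - 2 * b)"
     unfolding H_def E1 unfolding h_def c_def exp_double[symmetric] by (simp add: algebra_simps)
    have "\<alpha> k ^ n = exp (real n * ln (\<alpha> k))" using \<alpha>[OF k] by (simp add: exp_of_nat_mult)
    then have A: "exp (real n * ln (\<alpha> k)) / 2 <= real (card {1..N n k})" using elim(5) unfolding cd by simp
    have "\<kappa> n = exp (real n * ln (\<alpha> k)) / 2 * (exp (- (real n * (a k * v^2 / 2) + B)) / sqrt (2 * pi) * H / 2)"
    proof -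
     have "exp (real n * \<Gamma>) * exp (- B - 2 * b) = exp (real n * ln (\<alpha> k)) * (exp (- (real n * (a k * v^2 / 2) + B)) * exp (real n * (2 * (a k * \<bar>Re \<beta>\<bar> * v - p \<beta> k + \<epsilon>' - \<epsilon>1)) - 2 * b))"
      unfolding exp_add[symmetric] \<Gamma>_def by (simp add: field_simps)
     note this[symmetric]
     moreover have "exp (real n * ln (\<alpha> k)) / 2 * (exp (- (real n * (a k * v^2 / 2) + B)) / sqrt (2 * pi) * H / 2)
      = (exp (real n * ln (\<alpha> k)) * (exp (- (real n * (a k * v^2 / 2) + B)) * exp (real n * (2 * (a k * \<bar>Re \<beta>\<bar> * v - p \<beta> k + \<epsilon>' - \<epsilon>1)) - 2 * b)))
       * (pi / (\<bar>Im \<beta>\<bar> * sqrt (a k)) / sqrt (real n) / 64 / sqrt (2 * pi))"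
     proof -
      have "A / 2 * (E / s2 * (w / r / 16 * F) / 2) = A * (E * F) * (w / r / 64 / s2)" for A E F s2 w r :: real
       by (simp add: mult_ac)
      then show ?thesis unfolding H .
     qed
     moreover have "K / sqrt (real n) * exp (real n * \<Gamma>) = exp (real n * \<Gamma>) * exp (- B - 2 * b) * (pi / (\<bar>Im \<beta>\<bar> * sqrt (a k)) / sqrt (real n) / 64 / sqrt (2 * pi))"
     proof -
      have "E / s2 * w / 64 / r * A = A * E * (w / r / 64 / s2)" for A E s2 w r :: real by (simp add: mult_ac)
      then show ?thesis unfolding K_def .
     qed
     ultimately show ?thesis by (simp only: \<kappa>_def)
    qed
    also have "\<dots> <= real (card {1..N n k}) * (exp (- (\<bar>x0\<bar> + 2 * h)\<^sup>2 / 2) / sqrt (2 * pi) * H / 2)"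
     using A hx H0 by (intro mult_mono divide_right_mono mult_right_mono) auto
    finally show ?thesis by (simp only: H_def)
   qed
   have G': "G n <= t / (w1 * exp (Re \<beta> * c n k * x0) * exp b)"
    unfolding G_def t_def w1_def V exp_add[symmetric] exp_diff[symmetric] \<Delta>_def by (simp add: algebra_simps)
   have "prob {z \<in> space M. norm (S z) < exp (real n * (?P - \<epsilon>))} <= prob {z \<in> space M. norm (S z) < t}"
   proof (intro finite_measure_mono)
    have "exp (real n * (?P - \<epsilon>)) <= t" unfolding t_def exp_le_cancel_iff using \<epsilon>' by (intro mult_left_mono) auto
    then show "{z \<in> space M. norm (S z) < exp (real n * (?P - \<epsilon>))} \<subseteq> {z \<in> space M. norm (S z) < t}" by auto
   qed measurable
   also have "\<dots> <= \<delta> n"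
    unfolding \<delta>_def S by (rule b.small_ball[OF \<tau> cn w Wp t \<kappa>'[unfolded h_def b_def] G'[unfolded b_def]])
   finally show "prob {z \<in> space M. norm (S z) < exp (real n * (?P - \<epsilon>))} <= \<delta> n" .
  qed
 qed
 then show ?thesis using \<delta> by blast
qed

lemma lower_bound:
 assumes \<sigma>: "Re b \<noteq> 0" and \<tau>: "Im b \<noteq> 0" and ks: "sorted_wrt (<) ks" "set ks \<subseteq> {1..d}" and \<epsilon>: "\<epsilon> > 0"
 shows "\<exists>\<delta>. \<delta> \<longlonglongrightarrow> 0 \<and> (\<forall>\<^sub>F n in sequentially. \<forall>S. cascade_rv (N n) (c n) b ks S \<longrightarrow>
  prob {w \<in> space M. norm (S w) < exp (real n * (P b ks - \<epsilon>))} <= \<delta> n)"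
 using ks \<epsilon>
proof (induction ks arbitrary: \<epsilon>)
 case Nil
 have "prob {w \<in> space M. norm (S w) < exp (real n * (P b [] - \<epsilon>))} <= 0" if "cascade_rv (N n) (c n) b [] S" for n S
 proof -
  have "S = (\<lambda>_. 1)" using that by (elim cascade_rv_NilE)
  moreover have "exp (real n * (P b [] - \<epsilon>)) <= 1" using Nil by simp
  ultimately have "{w \<in> space M. norm (S w) < exp (real n * (P b [] - \<epsilon>))} = {}" by auto
  then show ?thesis by (simp only: measure_empty)
 qed
 then show ?case by (intro exI[of _ "\<lambda>_. 0"] conjI always_eventually allI impI tendsto_const)
next
 case (Cons k ks)
 show ?case
 proof (cases "b \<in> phase_E (crit (a k) (\<alpha> k))")
  case True
  show ?thesis by (rule lower_bound_E[OF \<sigma> Cons.prems(1,2) True Cons.prems(3)])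
 next
  case False
  show ?thesis
  proof (rule lower_bound_not_E[OF \<sigma> \<tau> Cons.prems(1,2) False Cons.prems(3)])
   fix \<epsilon> :: real assume "\<epsilon> > 0"
   then show "\<exists>\<delta>. \<delta> \<longlonglongrightarrow> 0 \<and> (\<forall>\<^sub>F n in sequentially. \<forall>S. cascade_rv (N n) (c n) b ks S \<longrightarrow>
    prob {w \<in> space M. norm (S w) < exp (real n * (P b ks - \<epsilon>))} <= \<delta> n)"
    using Cons.prems by (intro Cons.IH) auto
  qed
 qed
qed

end

section \<open>Logarithmic moments\<close>

text \<open>Write \<open>ln y = K + t\<close> and use \<open>t^2 <= 2 * exp t\<close>.
  \<open>K\<close> will be the logarithm of a moment bound, so that the last term has bounded
  expectation however large \<open>K\<close> is.\<close>

lemma ln_plus_square_le: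
 fixes y K :: real
 assumes "K >= 0" "y >= 1"
 shows "(ln y)^2 <= 2 * K^2 + 4 * (y * exp (- K))"
proof (cases "ln y <= K")
 case True
 have "(ln y)^2 <= K^2" using True assms by (intro power_mono) auto
 moreover have "0 <= K^2" "0 <= y * exp (- K)" using assms by auto
 ultimately show ?thesis by linarith
next
 case False
 define t where "t = ln y - K"
 have t: "t >= 0" "ln y = K + t" using False by (auto simp: t_def)
 have "y * exp (- K) = exp t" using assms by (simp add: t_def exp_diff exp_minus field_simps)
 moreover have "t^2 <= 2 * exp t" using exp_lower_Taylor_quadratic[OF t(1)] t(1) by simp
 moreover have "(K + t)^2 <= 2 * K^2 + 2 * t^2" using zero_le_power2[of "K - t"] by (simp add: square_simps)
 ultimately show ?thesis unfolding t(2) by linarith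
qed

text \<open>\<open>K1\<close> treats \<open>|z| >= 1\<close> through the first moment and
  \<open>K2\<close> treats \<open>|z| < 1\<close> through the moment of order -1/2. In the second
  case \<open>ln_plus_square_le\<close> is applied to \<open>|z| powr (-1/2)\<close>; undoing the
  factor 1/2 in its logarithm multiplies the constants by 4, to 8 and 16.\<close>

lemma ln_square_le_moments:
 assumes K1: "K1 >= 0" and K2: "K2 >= 0"
 shows "ennreal ((ln (norm z))^2) <= ennreal (2 * K1^2 + 8 * K2^2) + ennreal (4 * exp (- K1)) * ennreal (norm z) + ennreal (16 * exp (- K2)) * reciprocal_sqrt z"
proof (cases "z = 0")
 case False
 define y where "y = norm z"
 have y: "y > 0" using False by (simp add: y_def)
 have "(ln y)^2 <= (2 * K1^2 + 8 * K2^2) + (4 * exp (- K1)) * y + (16 * exp (- K2)) * y powr (- (1 / 2))"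
 proof (cases "y >= 1")
  case True
  have "(ln y)^2 <= 2 * K1^2 + 4 * (y * exp (- K1))" by (rule ln_plus_square_le[OF K1 True])
  moreover have "0 <= 8 * K2^2" "0 <= 16 * exp (- K2) * y powr (- (1 / 2))" by auto
  moreover have "4 * (y * exp (- K1)) = 4 * exp (- K1) * y" by simp
  ultimately show ?thesis by linarith
 next
  case False
  have "1 <= y powr (- (1 / 2))" using powr_mono2'[of "- (1 / 2)" y 1] y False by simp
  from ln_plus_square_le[OF K2 this]
  have "(ln (y powr (- (1 / 2))))^2 <= 2 * K2^2 + 4 * (y powr (- (1 / 2)) * exp (- K2))" .
  moreover have "ln (y powr (- (1 / 2))) = - (ln y / 2)" using y by (simp add: ln_powr)
  ultimately have "4 * (- (ln y / 2))^2 <= 4 * (2 * K2^2 + 4 * (y powr (- (1 / 2)) * exp (- K2)))"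
   by (simp only: mult_le_cancel_left_pos zero_less_numeral)
  then have "(ln y)^2 <= 8 * K2^2 + (16 * exp (- K2)) * y powr (- (1 / 2))" by (simp add: power_divide mult_ac)
  moreover have "0 <= 2 * K1^2 + (4 * exp (- K1)) * y" using y by simp
  ultimately have "(ln y)^2 <= (2 * K1^2 + (4 * exp (- K1)) * y) + (8 * K2^2 + (16 * exp (- K2)) * y powr (- (1 / 2)))"
   by (rule add_increasing[rotated])
  then show ?thesis by (simp only: add_ac)
 qed
 then have "ennreal ((ln y)^2) <= ennreal ((2 * K1^2 + 8 * K2^2) + (4 * exp (- K1)) * y + (16 * exp (- K2)) * y powr (- (1 / 2)))"
  by (rule ennreal_leI)
 also have "\<dots> = ennreal (2 * K1^2 + 8 * K2^2) + ennreal (4 * exp (- K1)) * ennreal y + ennreal (16 * exp (- K2)) * ennreal (y powr (- (1 / 2)))"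
  using y by (subst ennreal_plus; simp add: ennreal_mult')+
 finally show ?thesis using False by (simp add: y_def reciprocal_sqrt_def)
qed simp

lemma ln_1_add_square_le:
 fixes u :: real
 assumes "u >= 0"
 shows "(ln (1 + u))^2 <= 4 * (1 + u)"
 using ln_plus_square_le[of 0 "1 + u"] assms by simp

context prob_space
begin

lemma cascade_rv_first_moment:
 assumes "cascade_rv N c \<beta> ks S" "\<And>k. k \<in> set ks ==> N k > 0"
 shows "Lq_bound 1 S (\<Prod>k\<leftarrow>ks. real (N k) * exp ((Re \<beta>)^2 * (c k)^2 / 2)) \<and> 0 < (\<Prod>k\<leftarrow>ks. real (N k) * exp ((Re \<beta>)^2 * (c k)^2 / 2))"
 using assms
proof induction
 case Nil
 show ?case by (simp add: Lq_bound_def prob_space)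
next
 case (Cons k X W ks)
 interpret b: branching M "{1..N k}" X W by (rule Cons.hyps)
 define D where "D = (\<Prod>k\<leftarrow>ks. real (N k) * exp ((Re \<beta>)^2 * (c k)^2 / 2))"
 have Nk: "N k > 0" using Cons.prems by simp
 then have "1 \<in> {1..N k}" by simp
 then have D: "D > 0" using Cons.IH[of 1] Cons.prems unfolding D_def by auto
 have W: "Lq_bound 1 (W i) D" if "i \<in> {1..N k}" for i using Cons.IH[OF that] Cons.prems unfolding D_def by auto
 have "Lq_bound 1 (b.branch_sum \<beta> (c k)) (real (card {1..N k}) powr (1 / 1) * (exp (1 * (Re \<beta>)^2 * (c k)^2 / 2) * D))"
  by (rule b.Lq_bound_branch_sum_small[OF W D]) auto
 then show ?case using D Nk by (simp add: D_def mult.assoc)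
qed

text \<open>Follows one path of the tree, always the child with index 1, with one factor from
  \<open>reciprocal_sqrt_branch_sum\<close> per level.\<close>

lemma cascade_rv_reciprocal_sqrt:
 assumes "cascade_rv N c \<beta> ks S" "Re \<beta> \<noteq> 0" "\<And>k. k \<in> set ks ==> N k > 0 \<and> c k > 0"
 shows "(\<integral>\<^sup>+w. reciprocal_sqrt (S w) \<partial>M) <= ennreal (\<Prod>k\<leftarrow>ks. 2 * exp ((Re \<beta> * c k)^2 / 8) * (1 + 5 * (\<bar>Re \<beta>\<bar> * c k) powr (- (1 / 2))))"
 using assms
proof induction
 case Nil
 show ?case by (simp add: reciprocal_sqrt_def emeasure_space_1)
next
 case (Cons k X W ks)
 interpret b: branching M "{1..N k}" X W by (rule Cons.hyps)
 define K where "K k = 2 * exp ((Re \<beta> * c k)^2 / 8) * (1 + 5 * (\<bar>Re \<beta>\<bar> * c k) powr (- (1 / 2)))" for k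
 have K0: "K k >= 0" for k by (simp add: K_def)
 have one: "1 \<in> {1..N k}" "c k > 0" using Cons.prems by (auto simp: Suc_le_eq)
 have "(\<integral>\<^sup>+w. reciprocal_sqrt (b.branch_sum \<beta> (c k) w) \<partial>M) <= ennreal (K k) * (\<integral>\<^sup>+w. reciprocal_sqrt (W 1 w) \<partial>M)"
  unfolding K_def by (rule b.reciprocal_sqrt_branch_sum[OF one(1) Cons.prems(1) one(2)])
 also have "\<dots> <= ennreal (K k) * ennreal (\<Prod>k\<leftarrow>ks. K k)"
  using Cons.IH[OF one(1)] Cons.prems unfolding K_def by (intro mult_left_mono) auto
 also have "\<dots> = ennreal (K k * (\<Prod>k\<leftarrow>ks. K k))" using K0 by (simp add: ennreal_mult')
 finally show ?case by (simp add: K_def)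
qed

end

context grem
begin

lemma prod_list_le_exp:
 fixes f g :: "'b \<Rightarrow> real"
 assumes "\<And>k. k \<in> set ks ==> 0 <= f k \<and> f k <= exp (g k)"
 shows "0 <= (\<Prod>k\<leftarrow>ks. f k) \<and> (\<Prod>k\<leftarrow>ks. f k) <= exp (\<Sum>k\<leftarrow>ks. g k)"
 using assms
proof (induction ks)
 case (Cons k ks)
 then have "f k * (\<Prod>k\<leftarrow>ks. f k) <= exp (g k) * exp (\<Sum>k\<leftarrow>ks. g k)" by (intro mult_mono) auto
 then show ?case using Cons by (simp add: exp_add)
qed simp

text \<open>The first moment and the moment of order -1/2 are at most exponential in
  \<open>n\<close>, so the expectation of the squared logarithm is at most of order
  \<open>n^2\<close>. Small \<open>|Re b|\<close> enters through \<open>ln (1 + u)\<close> with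
  \<open>u = |Re b| powr (-1/2)\<close>, once for each level; its square is at most
  \<open>4 * (1 + u)\<close>, which is integrable across the imaginary axis.\<close>

lemma log_moment:
 assumes R: "R > 0" and ks: "set ks \<subseteq> {1..d}"
 shows "\<exists>C\<ge>0. \<forall>\<^sub>F n in sequentially. \<forall>b. \<bar>Re b\<bar> <= R \<and> Re b \<noteq> 0 \<longrightarrow> (\<forall>S. cascade_rv (N n) (c n) b ks S \<longrightarrow>
  (\<integral>\<^sup>+v. ennreal ((ln (norm (S v)) / real n)^2) \<partial>M) <= ennreal (C * (1 + \<bar>Re b\<bar> powr (- (1 / 2)))))"
proof -
 define m where "m = real (length ks)"
 \<comment> \<open>\<open>H1\<close> and \<open>H2\<close> are exponential rates of the two moments,
   uniform for \<open>|Re b| <= R\<close>. The term \<open>a k powr (- (1 / 4))\<close> is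
   \<open>sqrt (a k) powr (-1/2)\<close>, from the factor
   \<open>(|Re b| * c n k) powr (-1/2)\<close>.\<close>
 define H1 where "H1 = (\<Sum>k\<leftarrow>ks. ln 2 + ln (\<alpha> k) + R^2 * a k / 2)"
 define H2 where "H2 = (\<Sum>k\<leftarrow>ks. ln 2 + R^2 * a k / 8 + 5 * a k powr (- (1 / 4)))"
 have H1: "H1 >= 0" unfolding H1_def
 proof (intro sum_list_nonneg)
  fix y assume "y \<in> set (map (\<lambda>k. ln 2 + ln (\<alpha> k) + R^2 * a k / 2) ks)"
  then obtain k where k: "k \<in> {1..d}" "y = ln 2 + ln (\<alpha> k) + R^2 * a k / 2" using ks by auto
  then show "0 <= y" using a[OF k(1)] \<alpha>[OF k(1)] by (simp add: add_nonneg_nonneg)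
 qed
 have H2: "H2 >= 0" unfolding H2_def
 proof (intro sum_list_nonneg)
  fix y assume "y \<in> set (map (\<lambda>k. ln 2 + R^2 * a k / 8 + 5 * a k powr (- (1 / 4))) ks)"
  then obtain k where k: "k \<in> {1..d}" "y = ln 2 + R^2 * a k / 8 + 5 * a k powr (- (1 / 4))" using ks by auto
  then show "0 <= y" using a[OF k(1)] by (simp add: add_nonneg_nonneg)
 qed
 \<comment> \<open>From \<open>2 * K1^2 + 8 * K2^2 + 4 + 16\<close>, where the square of the sum
   \<open>K2\<close> is at most twice the sum of the squares: \<open>16 * H2^2\<close> and, with
   \<open>ln_1_add_square_le\<close>, \<open>64 * m^2\<close>.\<close>
 define C where "C = 2 * H1^2 + 16 * H2^2 + 64 * m^2 + 20"
 have C: "C >= 0" by (simp add: C_def)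
 have "\<forall>\<^sub>F n in sequentially. \<forall>k\<in>set ks. \<alpha> k ^ n / 2 <= real (N n k) \<and> real (N n k) <= 2 * \<alpha> k ^ n"
  using ks by (intro eventually_ball_finite ballI N_bounds) auto
 then have "\<forall>\<^sub>F n in sequentially. \<forall>b. \<bar>Re b\<bar> <= R \<and> Re b \<noteq> 0 \<longrightarrow> (\<forall>S. cascade_rv (N n) (c n) b ks S \<longrightarrow>
  (\<integral>\<^sup>+v. ennreal ((ln (norm (S v)) / real n)^2) \<partial>M) <= ennreal (C * (1 + \<bar>Re b\<bar> powr (- (1 / 2)))))"
  using eventually_gt_at_top[of 0]
 proof eventually_elim
  case (elim n)
  have n: "n > 0" "real n >= 1" using elim(2) by auto
  have Npos: "N n k > 0" if "k \<in> set ks" for k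
  proof -
   have "0 < \<alpha> k ^ n / 2" using \<alpha>[of k] that ks by auto
   then have "0 < real (N n k)" using elim(1) that by (metis less_le_trans)
   then show ?thesis by simp
  qed
  have cpos: "c n k > 0" if "k \<in> set ks" for k using c_pos[of k n] that ks n by auto
  show ?case
  proof (intro allI impI, elim conjE)
   fix b S assume bR: "\<bar>Re b\<bar> <= R" and \<sigma>: "Re b \<noteq> 0" and S: "cascade_rv (N n) (c n) b ks S"
   note [measurable] = cascade_rv_rv[OF S]
   define u where "u = \<bar>Re b\<bar> powr (- (1 / 2))"
   let ?A = "\<Prod>k\<leftarrow>ks. real (N n k) * exp ((Re b)^2 * (c n k)^2 / 2)"
   have u: "u >= 0" by (simp add: u_def)
   have \<sigma>R: "(Re b)^2 <= R^2" using bR R by (intro abs_le_square_iff[THEN iffD1]) simp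
   have m1: "?A <= exp (real n * H1)"
   proof -
    have "?A <= exp (\<Sum>k\<leftarrow>ks. real n * (ln 2 + ln (\<alpha> k) + R^2 * a k / 2))"
    proof (rule conjunct2[OF prod_list_le_exp], intro conjI)
     fix k assume k: "k \<in> set ks"
     then have kd: "k \<in> {1..d}" using ks by auto
     have "real (N n k) <= 2 * \<alpha> k ^ n" using elim(1) k by blast
     also have "\<dots> = exp (ln 2 + real n * ln (\<alpha> k))" using \<alpha>[OF kd] by (simp add: exp_add exp_of_nat_mult)
     also have "\<dots> <= exp (real n * ln 2 + real n * ln (\<alpha> k))" using n by simp
     finally have 1: "real (N n k) <= exp (real n * ln 2 + real n * ln (\<alpha> k))" .
     have "(Re b)^2 * (real n * a k) <= R^2 * (real n * a k)" using \<sigma>R a[OF kd] by (intro mult_right_mono) auto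
     then have 2: "exp ((Re b)^2 * (c n k)^2 / 2) <= exp (real n * (R^2 * a k / 2))" unfolding c_square[OF kd] by (simp add: mult_ac)
     have "real (N n k) * exp ((Re b)^2 * (c n k)^2 / 2) <= exp (real n * ln 2 + real n * ln (\<alpha> k)) * exp (real n * (R^2 * a k / 2))"
      using 1 2 by (intro mult_mono) auto
     then show "real (N n k) * exp ((Re b)^2 * (c n k)^2 / 2) <= exp (real n * (ln 2 + ln (\<alpha> k) + R^2 * a k / 2))"
      by (simp add: distrib_left exp_add mult.assoc)
    qed simp
    then show ?thesis by (simp add: H1_def sum_list_const_mult)
   qed
   have m2: "(\<Prod>k\<leftarrow>ks. 2 * exp ((Re b * c n k)^2 / 8) * (1 + 5 * (\<bar>Re b\<bar> * c n k) powr (- (1 / 2)))) <= exp (real n * H2 + m * ln (1 + u))"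
   proof -
    have "(\<Prod>k\<leftarrow>ks. 2 * exp ((Re b * c n k)^2 / 8) * (1 + 5 * (\<bar>Re b\<bar> * c n k) powr (- (1 / 2)))) <= exp (\<Sum>k\<leftarrow>ks. real n * (ln 2 + R^2 * a k / 8 + 5 * a k powr (- (1 / 4))) + ln (1 + u))"
    proof (rule conjunct2[OF prod_list_le_exp], intro conjI)
     fix k assume k: "k \<in> set ks"
     then have kd: "k \<in> {1..d}" using ks by auto
     note ak = a[OF kd]
     define w where "w = a k powr (- (1 / 4))"
     have w: "w >= 0" by (simp add: w_def)
     have "sqrt (a k) <= c n k" using n ak by (simp add: c_def mult_le_cancel_right1)
     then have "\<bar>Re b\<bar> * sqrt (a k) <= \<bar>Re b\<bar> * c n k" by (intro mult_left_mono) auto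
     then have "(\<bar>Re b\<bar> * c n k) powr (- (1 / 2)) <= (\<bar>Re b\<bar> * sqrt (a k)) powr (- (1 / 2))"
      using \<sigma> ak by (intro powr_mono2') auto
     also have "\<dots> = u * w" using ak by (simp add: powr_mult u_def w_def powr_half_sqrt[symmetric] powr_powr)
     finally have 3: "(\<bar>Re b\<bar> * c n k) powr (- (1 / 2)) <= u * w" .
     have "1 + 5 * (\<bar>Re b\<bar> * c n k) powr (- (1 / 2)) <= (1 + 5 * w) * (1 + u)"
      using 3 u w by (simp add: algebra_simps)
     also have "\<dots> <= exp (real n * (5 * w)) * (1 + u)"
     proof (intro mult_right_mono)
      have "1 + 5 * w <= exp (5 * w)" by (rule exp_ge_add_one_self)
      also have "\<dots> <= exp (real n * (5 * w))" using n w mult_right_mono[of 1 "real n" "5 * w"] by simp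
      finally show "1 + 5 * w <= exp (real n * (5 * w))" .
     qed (use u in simp)
     also have "\<dots> = exp (real n * (5 * w)) * exp (ln (1 + u))" using u by simp
     finally have 4: "1 + 5 * (\<bar>Re b\<bar> * c n k) powr (- (1 / 2)) <= exp (real n * (5 * w)) * exp (ln (1 + u))" .
     have "(Re b)^2 * (real n * a k) <= R^2 * (real n * a k)" using \<sigma>R ak by (intro mult_right_mono) auto
     then have 5: "exp ((Re b * c n k)^2 / 8) <= exp (real n * (R^2 * a k / 8))"
      unfolding power_mult_distrib c_square[OF kd] by (simp add: mult_ac)
     have "ln 2 <= real n * ln 2" using n mult_right_mono[of 1 "real n" "ln 2"] by simp
     then have "exp (ln 2) <= exp (real n * ln 2)" unfolding exp_le_cancel_iff .
     then have 6: "2 <= exp (real n * ln 2)" unfolding exp_ln[OF zero_less_numeral] .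
     have "2 * exp ((Re b * c n k)^2 / 8) * (1 + 5 * (\<bar>Re b\<bar> * c n k) powr (- (1 / 2)))
      <= exp (real n * ln 2) * exp (real n * (R^2 * a k / 8)) * (exp (real n * (5 * w)) * exp (ln (1 + u)))"
      using 4 5 6 by (intro mult_mono) (auto intro: add_nonneg_nonneg)
     also have "\<dots> = exp (real n * (ln 2 + R^2 * a k / 8 + 5 * w) + ln (1 + u))"
      unfolding exp_add[symmetric] by (simp add: distrib_left)
     finally show "2 * exp ((Re b * c n k)^2 / 8) * (1 + 5 * (\<bar>Re b\<bar> * c n k) powr (- (1 / 2))) <= exp (real n * (ln 2 + R^2 * a k / 8 + 5 * a k powr (- (1 / 4))) + ln (1 + u))"
      by (simp only: w_def)
    qed (auto intro: mult_nonneg_nonneg add_nonneg_nonneg)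
    then show ?thesis by (simp add: H2_def m_def sum_list_addf sum_list_const_mult sum_list_triv)
   qed
   define K1 where "K1 = real n * H1"
   define K2 where "K2 = real n * H2 + m * ln (1 + u)"
   have lu: "ln (1 + u) >= 0" using u by simp
   have K: "K1 >= 0" "K2 >= 0" using H1 H2 lu by (auto simp: K1_def K2_def m_def)
   have e1: "(\<integral>\<^sup>+v. ennreal (norm (S v)) \<partial>M) <= ennreal (exp K1)"
   proof -
    have L: "Lq_bound 1 S ?A"
     and pos: "0 < ?A"
     using cascade_rv_first_moment[OF S] Npos by auto
    have "integrable M (\<lambda>v. norm (S v))" using L by (simp add: Lq_bound_def)
    then have "(\<integral>\<^sup>+v. ennreal (norm (S v)) \<partial>M) = ennreal (expectation (\<lambda>v. norm (S v)))"
     by (intro nn_integral_eq_integral) auto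
    also have "\<dots> <= ennreal (exp K1)"
    proof (rule ennreal_leI)
     have "expectation (\<lambda>v. norm (S v)) <= ?A"
      using L pos unfolding Lq_bound_def by simp
     then show "expectation (\<lambda>v. norm (S v)) <= exp K1" using m1 by (simp add: K1_def)
    qed
    finally show ?thesis .
   qed
   have e2: "(\<integral>\<^sup>+v. reciprocal_sqrt (S v) \<partial>M) <= ennreal (exp K2)"
    using order_trans[OF cascade_rv_reciprocal_sqrt[OF S \<sigma>] ennreal_leI[OF m2]] Npos cpos by (simp add: K2_def)
   have "(\<integral>\<^sup>+v. ennreal ((ln (norm (S v)))^2) \<partial>M)
    <= (\<integral>\<^sup>+v. ennreal (2 * K1^2 + 8 * K2^2) + ennreal (4 * exp (- K1)) * ennreal (norm (S v)) + ennreal (16 * exp (- K2)) * reciprocal_sqrt (S v) \<partial>M)"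
    by (intro nn_integral_mono ln_square_le_moments K)
   also have "\<dots> = ennreal (2 * K1^2 + 8 * K2^2) + ennreal (4 * exp (- K1)) * (\<integral>\<^sup>+v. ennreal (norm (S v)) \<partial>M) + ennreal (16 * exp (- K2)) * (\<integral>\<^sup>+v. reciprocal_sqrt (S v) \<partial>M)"
    by (simp add: nn_integral_add nn_integral_cmult emeasure_space_1)
   also have "\<dots> <= ennreal (2 * K1^2 + 8 * K2^2) + ennreal (4 * exp (- K1)) * ennreal (exp K1) + ennreal (16 * exp (- K2)) * ennreal (exp K2)"
    using e1 e2 by (intro add_mono mult_left_mono) auto
   also have "\<dots> = ennreal (2 * K1^2 + 8 * K2^2 + 20)"
   proof -
    have c1: "ennreal (4 * exp (- K1)) * ennreal (exp K1) = ennreal 4" by (simp add: mult.assoc flip: ennreal_mult' exp_add)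
    have c2: "ennreal (16 * exp (- K2)) * ennreal (exp K2) = ennreal 16" by (simp add: mult.assoc flip: ennreal_mult' exp_add)
    have "ennreal (2 * K1^2 + 8 * K2^2) + ennreal 4 + ennreal 16 = ennreal (2 * K1^2 + 8 * K2^2 + 4 + 16)"
     by (subst ennreal_plus; simp)+
    then show ?thesis unfolding c1 c2 by (simp only: add.assoc) simp
   qed
   also have "\<dots> <= ennreal ((real n)^2 * (C * (1 + u)))"
   proof (rule ennreal_leI)
    have n2: "1 <= (real n)^2" using n by simp
    have "K2^2 <= 2 * (real n * H2)^2 + 2 * (m * ln (1 + u))^2"
     unfolding K2_def using zero_le_power2[of "real n * H2 - m * ln (1 + u)"] by (simp add: square_simps)
    also have "(m * ln (1 + u))^2 <= m^2 * (4 * (1 + u))"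
     unfolding power_mult_distrib by (intro mult_left_mono ln_1_add_square_le u) simp
    also have "\<dots> <= (real n)^2 * (m^2 * (4 * (1 + u)))"
     using n2 u mult_right_mono[of 1 "(real n)^2" "m^2 * (4 * (1 + u))"] by simp
    finally have K2b: "K2^2 <= 2 * (real n * H2)^2 + 2 * ((real n)^2 * (m^2 * (4 * (1 + u))))" by simp
    have nn: "x <= x * (1 + u)" if "x >= 0" for x using mult_left_mono[of 1 "1 + u" x] that u by simp
    have "2 * K1^2 + 8 * K2^2 + 20 <= 2 * ((real n)^2 * H1^2) + 8 * (2 * ((real n)^2 * H2^2) + 2 * ((real n)^2 * (m^2 * (4 * (1 + u))))) + 20 * (real n)^2"
     using K2b n2 by (simp add: K1_def power_mult_distrib)
    also have "\<dots> = (real n)^2 * ((2 * H1^2 + 16 * H2^2 + 20) + 64 * m^2 * (1 + u))" by (simp add: algebra_simps)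
    also have "\<dots> <= (real n)^2 * ((2 * H1^2 + 16 * H2^2 + 20) * (1 + u) + 64 * m^2 * (1 + u))"
     by (intro mult_left_mono add_right_mono nn) auto
    also have "\<dots> = (real n)^2 * (C * (1 + u))" by (simp add: C_def algebra_simps)
    finally show "2 * K1^2 + 8 * K2^2 + 20 <= (real n)^2 * (C * (1 + u))" .
   qed
   finally have main: "(\<integral>\<^sup>+v. ennreal ((ln (norm (S v)))^2) \<partial>M) <= ennreal ((real n)^2 * (C * (1 + u)))" .
   have "(\<integral>\<^sup>+v. ennreal ((ln (norm (S v)) / real n)^2) \<partial>M) = ennreal (1 / (real n)^2) * (\<integral>\<^sup>+v. ennreal ((ln (norm (S v)))^2) \<partial>M)"
    by (subst nn_integral_cmult[symmetric]) (auto simp: power_divide ennreal_mult'[symmetric])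
   also have "\<dots> <= ennreal (1 / (real n)^2) * ennreal ((real n)^2 * (C * (1 + u)))" using main by (rule mult_left_mono) simp
   also have "\<dots> = ennreal (C * (1 + u))" using n C u by (simp add: ennreal_mult'[symmetric])
   finally show "(\<integral>\<^sup>+v. ennreal ((ln (norm (S v)) / real n)^2) \<partial>M) <= ennreal (C * (1 + \<bar>Re b\<bar> powr (- (1 / 2))))" by (simp add: u_def)
  qed
 qed
 then show ?thesis using C by blast
qed

end

section \<open>Convergence of the potentials and of the zeros\<close>

context grem
begin

definition Z :: "nat \<Rightarrow> 'a \<Rightarrow> complex \<Rightarrow> complex" where
 "Z n w = grem_partition d a (N n) (\<xi> n) n w"

definition u :: "nat \<Rightarrow> 'a \<Rightarrow> complex \<Rightarrow> real" where
 "u n w b = ln (norm (Z n w b)) / real n"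

lemma cascade_rv_Z: "cascade_rv (N n) (c n) b [1..<Suc d] (\<lambda>w. Z n w b)"
proof -
 have "[] \<in> grem_paths (N n) 0" by (simp add: grem_paths_def)
 from desc_subset_grem_nodes[OF _ this, of d]
 have "desc (N n) [1..<Suc d] [] \<subseteq> grem_nodes (N n) d" by simp
 from cascade_rv_cascade[OF indep normal this]
 have "cascade_rv (N n) (c n) b [1..<Suc d] (\<lambda>w. cascade (N n) (c n) b [1..<Suc d] [] (\<lambda>\<zeta>. \<xi> n \<zeta> w))" by blast
 moreover have "c n = (\<lambda>k. sqrt (real n) * sqrt (a k))" by (simp add: c_def fun_eq_iff)
 ultimately show ?thesis by (simp only: Z_def grem_partition_eq_cascade)
qed

lemma levels: "sorted_wrt (<) [1..<Suc d]" "set [1..<Suc d] \<subseteq> {1..d}"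
 by (auto simp del: upt_Suc)

lemma P_levels: "P b [1..<Suc d] = grem_p d a \<alpha> b"
proof -
 have "(\<Sum>k\<leftarrow>[1..<Suc d]. p b k) = (\<Sum>k\<in>set [1..<Suc d]. p b k)"
  by (rule sum_list_distinct_conv_sum_set) simp
 also have "set [1..<Suc d] = {1..d}" by (simp only: set_upt atLeastLessThanSuc_atLeastAtMost)
 finally show ?thesis by (simp add: P_def grem_p_def p_def)
qed

lemma measurable_Z: "(\<lambda>(w, z). Z n w z) \<in> borel_measurable (M \<Otimes>\<^sub>M borel)"
proof -
 have rv: "random_variable borel (\<xi> n (take j \<epsilon>))" if "\<epsilon> \<in> grem_paths (N n) d" "j \<in> {1..d}" for \<epsilon> j
 proof -
  have "take j \<epsilon> \<in> grem_nodes (N n) d" unfolding grem_nodes_def using grem_paths_take[OF that(1), of j] that(2) by auto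
  then show ?thesis using indep[of n] by (simp add: indep_vars_def)
 qed
 have "(\<lambda>(w, z). Z n w z) = (\<lambda>x. \<Sum>\<epsilon>\<in>grem_paths (N n) d. exp (snd x * of_real (sqrt (real n) * (\<Sum>j=1..d. sqrt (a j) * \<xi> n (take j \<epsilon>) (fst x)))))"
  by (auto simp: Z_def grem_partition_def grem_energy_def fun_eq_iff)
 also have "\<dots> \<in> borel_measurable (M \<Otimes>\<^sub>M borel)"
 proof (rule borel_measurable_sum)
  fix \<epsilon> assume \<epsilon>: "\<epsilon> \<in> grem_paths (N n) d"
  have "(\<lambda>x. \<Sum>j=1..d. sqrt (a j) * \<xi> n (take j \<epsilon>) (fst x)) \<in> borel_measurable (M \<Otimes>\<^sub>M (borel :: complex measure))"
   using measurable_compose[OF measurable_fst rv[OF \<epsilon>]] by (intro borel_measurable_sum borel_measurable_times borel_measurable_const) auto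
  then show "(\<lambda>x. exp (snd x * of_real (sqrt (real n) * (\<Sum>j=1..d. sqrt (a j) * \<xi> n (take j \<epsilon>) (fst x))))) \<in> borel_measurable (M \<Otimes>\<^sub>M (borel :: complex measure))"
   by measurable
 qed
 finally show ?thesis .
qed

lemma measurable_u: "(\<lambda>(w, z). u n w z) \<in> borel_measurable (M \<Otimes>\<^sub>M borel)"
proof -
 have "(\<lambda>x. ln (norm ((\<lambda>(w, z). Z n w z) x)) / real n) \<in> borel_measurable (M \<Otimes>\<^sub>M (borel :: complex measure))"
  using measurable_Z[of n] by measurable
 then show ?thesis by (simp add: u_def split_beta')
qed

lemma measurable_u_fixed [measurable]: "(\<lambda>w. u n w z) \<in> borel_measurable M"
proof -
 have "(\<lambda>w. (w, z)) \<in> M \<rightarrow>\<^sub>M M \<Otimes>\<^sub>M borel" by simp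
 from measurable_compose[OF this measurable_u] show ?thesis by simp
qed

lemma holomorphic_Z: "Z n w holomorphic_on UNIV"
 unfolding Z_def grem_partition_def by (intro holomorphic_intros)

text \<open>At 0 every summand is 1, so the value is the number of paths, nonzero once all
  \<open>N n k\<close> are positive. This keeps \<open>Z n w\<close> from vanishing identically, for
  every outcome.\<close>

lemma Z_0_eventually: "\<forall>\<^sub>F n in sequentially. \<forall>w. Z n w 0 \<noteq> 0"
proof -
 have "\<forall>\<^sub>F n in sequentially. \<forall>k\<in>{1..d}. \<alpha> k ^ n / 2 <= real (N n k) \<and> real (N n k) <= 2 * \<alpha> k ^ n"
  by (intro eventually_ball_finite ballI N_bounds) auto
 then show ?thesis
 proof eventually_elim
  case (elim n)
  have N1: "1 <= N n k" if "k \<in> {1..d}" for k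
  proof -
   have "0 < \<alpha> k ^ n / 2" using \<alpha>[OF that] by simp
   then have "0 < real (N n k)" using elim that by (metis less_le_trans)
   then show ?thesis by simp
  qed
  then have "replicate d 1 \<in> grem_paths (N n) d" unfolding grem_paths_def by auto
  then have "card (grem_paths (N n) d) \<noteq> 0" using finite_grem_paths by auto
  then show ?case by (simp add: Z_def grem_partition_def)
 qed
qed

text \<open>Convergence in probability, from \<open>lower_bound\<close> on one side and
  \<open>upper_bound\<close> with Markov's inequality on the other, becomes convergence in mean
  through the bounded second moment of \<open>u n w \<beta>\<close>.\<close>

lemma log_converges_L1:
 assumes \<sigma>: "Re \<beta> \<noteq> 0" and \<tau>: "Im \<beta> \<noteq> 0"
 shows "(\<lambda>n. \<integral>\<^sup>+w. ennreal \<bar>u n w \<beta> - grem_p d a \<alpha> \<beta>\<bar> \<partial>M) \<longlonglongrightarrow> 0"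
proof (rule order_tendstoI)
 define p0 where "p0 = grem_p d a \<alpha> \<beta>"
 obtain C where C: "C >= 0" and LM: "\<forall>\<^sub>F n in sequentially. \<forall>\<beta>'. \<bar>Re \<beta>'\<bar> <= \<bar>Re \<beta>\<bar> \<and> Re \<beta>' \<noteq> 0 \<longrightarrow> (\<forall>S. cascade_rv (N n) (c n) \<beta>' [1..<Suc d] S \<longrightarrow>
  (\<integral>\<^sup>+w. ennreal ((ln (norm (S w)) / real n)^2) \<partial>M) <= ennreal (C * (1 + \<bar>Re \<beta>'\<bar> powr (- (1 / 2)))))"
  using log_moment[of "\<bar>Re \<beta>\<bar>", OF _ levels(2)] \<sigma> by auto
 define B where "B = C * (1 + \<bar>Re \<beta>\<bar> powr (- (1 / 2)))"
 have B: "B >= 0" using C by (simp add: B_def)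
 obtain C1 where C1: "C1 > 0" and U: "\<forall>\<^sub>F n in sequentially. \<forall>S. cascade_rv (N n) (c n) \<beta> [1..<Suc d] S \<longrightarrow>
  Lq_bound (moment \<beta> [1..<Suc d]) S (C1 * exp (real n * p0))"
  using upper_bound[OF \<sigma> levels] unfolding P_levels p0_def by blast
 define r where "r = moment \<beta> [1..<Suc d]"
 have r: "r > 0" unfolding r_def by (rule moment_pos[OF \<sigma> levels(2)])
 fix x :: ennreal assume x: "0 < x"
 obtain y where y: "0 < y" "ennreal y <= x"
 proof (cases x)
  case (real y)
  then show thesis using x by (intro that[of y]) auto
 next
  case top
  then show thesis by (intro that[of 1]) auto
 qed
 define e where "e = y / 4"
 have e: "e > 0" using y by (simp add: e_def)
 \<comment> \<open>A truncation level so large that \<open>2 * p0^2 / K + 2 * B / K <= e\<close>.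
   The event of a deviation of at least \<open>e\<close> will have probability at most
   \<open>e / K\<close>, so the total error is at most \<open>3 * e\<close>, below
   \<open>y = 4 * e\<close>.\<close>
 define K where "K = 2 * (p0^2 + B + 1) / e"
 have K: "K > 0" using B e by (simp add: K_def add_nonneg_pos)
 have Ke: "2 * p0^2 / K + 2 / K * B <= e"
 proof -
  have "2 * p0^2 / K + 2 / K * B = e * ((p0^2 + B) / (p0^2 + B + 1))"
   using B e by (simp add: K_def add_nonneg_pos divide_simps) (simp add: algebra_simps)
  also have "\<dots> <= e * 1" using B e by (intro mult_left_mono) (auto simp: divide_le_eq_1 add_nonneg_pos)
  finally show ?thesis by simp
 qed
 obtain \<delta> where \<delta>: "\<delta> \<longlonglongrightarrow> 0" and L: "\<forall>\<^sub>F n in sequentially. \<forall>S. cascade_rv (N n) (c n) \<beta> [1..<Suc d] S \<longrightarrow>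
  prob {w \<in> space M. norm (S w) < exp (real n * (p0 - e / 2))} <= \<delta> n"
  using lower_bound[OF \<sigma> \<tau> levels, of "e / 2"] e unfolding P_levels p0_def by auto
 have "(\<lambda>n. (C1 * exp (- (real n * e))) powr r) \<longlonglongrightarrow> 0" using C1 e r by real_asymp
 from tendsto_add[OF \<delta> this] have "(\<lambda>n. \<delta> n + (C1 * exp (- (real n * e))) powr r) \<longlonglongrightarrow> 0" by simp
 then have small: "\<forall>\<^sub>F n in sequentially. \<delta> n + (C1 * exp (- (real n * e))) powr r < e / K"
  using e K by (intro order_tendstoD(2)) auto
 show "\<forall>\<^sub>F n in sequentially. (\<integral>\<^sup>+w. ennreal \<bar>u n w \<beta> - grem_p d a \<alpha> \<beta>\<bar> \<partial>M) < x"
  using LM U L small eventually_gt_at_top[of 0]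
 proof eventually_elim
  case (elim n)
  have n: "n > 0" by (rule elim)
  define S where "S w = Z n w \<beta>" for w
  have cS: "cascade_rv (N n) (c n) \<beta> [1..<Suc d] S" unfolding S_def by (rule cascade_rv_Z)
  note [measurable] = cascade_rv_rv[OF cS]
  have u: "u n w \<beta> = ln (norm (S w)) / real n" for w by (simp add: u_def S_def)
  have m2: "(\<integral>\<^sup>+w. ennreal ((u n w \<beta>)^2) \<partial>M) <= ennreal B"
   unfolding u B_def using elim(1)[rule_format, OF conjI[OF order_refl \<sigma>] cS] .
  define A where "A = {w \<in> space M. e <= \<bar>u n w \<beta> - p0\<bar>}"
  have Am[measurable]: "A \<in> events" unfolding A_def by measurable
  have pA: "prob A <= e / K"
  proof -
   have sub: "A \<subseteq> {w \<in> space M. norm (S w) < exp (real n * (p0 - e / 2))} \<union> {w \<in> space M. norm (S w) >= exp (real n * (p0 + e))}"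
   proof
    fix w assume w: "w \<in> A"
    show "w \<in> {w \<in> space M. norm (S w) < exp (real n * (p0 - e / 2))} \<union> {w \<in> space M. norm (S w) >= exp (real n * (p0 + e))}"
    proof (rule ccontr)
     assume "\<not> ?thesis"
     then have lo: "exp (real n * (p0 - e / 2)) <= norm (S w)" and hi: "norm (S w) < exp (real n * (p0 + e))"
      using w by (auto simp: A_def)
     have pos: "norm (S w) > 0" using lo exp_gt_zero less_le_trans by blast
     have "real n * (p0 - e / 2) <= ln (norm (S w))" using lo pos by (simp add: ln_ge_iff)
     moreover have "ln (norm (S w)) < real n * (p0 + e)" using hi pos by (metis exp_less_cancel_iff exp_ln)
     ultimately have "p0 - e / 2 <= u n w \<beta>" "u n w \<beta> < p0 + e" unfolding u using n by (simp_all add: field_simps)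
     moreover have "e <= \<bar>u n w \<beta> - p0\<bar>" using w by (simp add: A_def)
     ultimately show False using e by linarith
    qed
   qed
   have "prob A <= prob ({w \<in> space M. norm (S w) < exp (real n * (p0 - e / 2))} \<union> {w \<in> space M. norm (S w) >= exp (real n * (p0 + e))})"
    by (rule finite_measure_mono[OF sub]) measurable
   also have "\<dots> <= prob {w \<in> space M. norm (S w) < exp (real n * (p0 - e / 2))} + prob {w \<in> space M. norm (S w) >= exp (real n * (p0 + e))}"
    by (rule measure_Un_le) measurable
   also have "prob {w \<in> space M. norm (S w) >= exp (real n * (p0 + e))} <= (C1 * exp (real n * p0) / exp (real n * (p0 + e))) powr r"
    by (rule Markov_Lq[OF elim(2)[rule_format, OF cS, folded r_def] r]) (use C1 in auto)
   also have "C1 * exp (real n * p0) / exp (real n * (p0 + e)) = C1 * exp (- (real n * e))"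
    unfolding times_divide_eq_right[symmetric] exp_diff[symmetric] by (simp add: distrib_left)
   finally show ?thesis using elim(3)[rule_format, OF cS] elim(4) by linarith
  qed
  have pw: "ennreal \<bar>u n w \<beta> - p0\<bar> <= ennreal (e + 2 * p0^2 / K) + ennreal K * indicator A w + ennreal (2 / K) * ennreal ((u n w \<beta>)^2)"
   if "w \<in> space M" for w
  proof -
   define D where "D = \<bar>u n w \<beta> - p0\<bar>"
   have "D^2 <= 2 * p0^2 + 2 * (u n w \<beta>)^2"
    unfolding D_def using zero_le_power2[of "u n w \<beta> + p0"] by (simp add: square_simps)
   then have "D^2 / K <= (2 * p0^2 + 2 * (u n w \<beta>)^2) / K" using K by (intro divide_right_mono) auto
   then have D2: "D^2 / K <= 2 * p0^2 / K + 2 / K * (u n w \<beta>)^2" by (simp add: add_divide_distrib)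
   have "D <= e + K * indicator A w + D^2 / K"
   proof (cases "w \<in> A")
    case True
    have "D <= K + D^2 / K"
    proof (cases "D <= K")
     case False
     then have "K * D <= D * D" using K by (intro mult_right_mono) auto
     then have "D <= D^2 / K" using K by (simp add: field_simps power2_eq_square)
     then show ?thesis using K by linarith
    qed (use K in \<open>simp add: add_increasing2\<close>)
    then show ?thesis using True e by simp
   next
    case False
    then have "D < e" using that by (simp add: A_def D_def)
    moreover have "0 <= D^2 / K" using K by simp
    ultimately show ?thesis using False by simp
   qed
   then have "D <= (e + 2 * p0^2 / K) + K * indicator A w + 2 / K * (u n w \<beta>)^2" using D2 by linarith
   then have "ennreal D <= ennreal ((e + 2 * p0^2 / K) + K * indicator A w + 2 / K * (u n w \<beta>)^2)" by (rule ennreal_leI)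
   also have "\<dots> = ennreal (e + 2 * p0^2 / K) + ennreal (K * indicator A w) + ennreal (2 / K * (u n w \<beta>)^2)"
    using e K by (subst ennreal_plus; (auto intro: add_nonneg_nonneg)[1])+
   also have "ennreal (K * indicator A w) = ennreal K * indicator A w" by (simp add: indicator_def)
   also have "ennreal (2 / K * (u n w \<beta>)^2) = ennreal (2 / K) * ennreal ((u n w \<beta>)^2)" using K by (subst ennreal_mult) auto
   finally show ?thesis by (simp add: D_def)
  qed
  have "(\<integral>\<^sup>+w. ennreal \<bar>u n w \<beta> - p0\<bar> \<partial>M) <= (\<integral>\<^sup>+w. ennreal (e + 2 * p0^2 / K) + ennreal K * indicator A w + ennreal (2 / K) * ennreal ((u n w \<beta>)^2) \<partial>M)"
   by (rule nn_integral_mono[OF pw])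
  also have "\<dots> = ennreal (e + 2 * p0^2 / K) + ennreal K * ennreal (prob A) + ennreal (2 / K) * (\<integral>\<^sup>+w. ennreal ((u n w \<beta>)^2) \<partial>M)"
   by (simp add: nn_integral_add nn_integral_cmult emeasure_space_1 nn_integral_cmult_indicator emeasure_eq_measure prob_space)
  also have "\<dots> <= ennreal (e + 2 * p0^2 / K) + ennreal K * ennreal (e / K) + ennreal (2 / K) * ennreal B"
   using m2 pA by (intro add_mono mult_left_mono ennreal_leI) auto
  also have "\<dots> = ennreal (e + 2 * p0^2 / K + e + 2 / K * B)"
  proof -
   have k: "ennreal K * ennreal (e / K) = ennreal e" "ennreal (2 / K) * ennreal B = ennreal (2 / K * B)"
    using K B e by (simp_all flip: ennreal_mult)
   have "ennreal x + ennreal e + ennreal y = ennreal (x + e + y)" if "x >= 0" "y >= 0" for x y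
    using that e by (simp add: ennreal_plus)
   from this[of "e + 2 * p0^2 / K" "2 / K * B"] show ?thesis unfolding k using e K B by simp
  qed
  also have "\<dots> < ennreal y" using Ke e K B by (intro ennreal_lessI) (auto simp: e_def)
  finally show "(\<integral>\<^sup>+w. ennreal \<bar>u n w \<beta> - grem_p d a \<alpha> \<beta>\<bar> \<partial>M) < x" using y(2) unfolding p0_def by (rule less_le_trans)
 qed
qed simp

text \<open>The dominating function for the passage to integrals over \<open>\<beta>\<close>,
  obtained from \<open>2 * D <= 1 + D^2\<close> and the second moment of the logarithm.\<close>

lemma log_L1_bound:
 assumes R: "R > 0"
 shows "\<exists>C\<ge>0. \<forall>\<^sub>F n in sequentially. \<forall>\<beta>. \<bar>Re \<beta>\<bar> <= R \<and> Re \<beta> \<noteq> 0 \<longrightarrow>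
  (\<integral>\<^sup>+w. ennreal \<bar>u n w \<beta> - grem_p d a \<alpha> \<beta>\<bar> \<partial>M) <= ennreal (1 + 2 * (grem_p d a \<alpha> \<beta>)^2 + 2 * C * (1 + \<bar>Re \<beta>\<bar> powr (- (1 / 2))))"
proof -
 obtain C where C: "C >= 0" and LM: "\<forall>\<^sub>F n in sequentially. \<forall>\<beta>. \<bar>Re \<beta>\<bar> <= R \<and> Re \<beta> \<noteq> 0 \<longrightarrow> (\<forall>S. cascade_rv (N n) (c n) \<beta> [1..<Suc d] S \<longrightarrow>
  (\<integral>\<^sup>+w. ennreal ((ln (norm (S w)) / real n)^2) \<partial>M) <= ennreal (C * (1 + \<bar>Re \<beta>\<bar> powr (- (1 / 2)))))"
  using log_moment[OF R levels(2)] by auto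
 have "\<forall>\<^sub>F n in sequentially. \<forall>\<beta>. \<bar>Re \<beta>\<bar> <= R \<and> Re \<beta> \<noteq> 0 \<longrightarrow>
  (\<integral>\<^sup>+w. ennreal \<bar>u n w \<beta> - grem_p d a \<alpha> \<beta>\<bar> \<partial>M) <= ennreal (1 + 2 * (grem_p d a \<alpha> \<beta>)^2 + 2 * C * (1 + \<bar>Re \<beta>\<bar> powr (- (1 / 2))))"
  using LM
 proof eventually_elim
  case (elim n)
  show ?case
  proof (intro allI impI)
   fix \<beta> assume b: "\<bar>Re \<beta>\<bar> <= R \<and> Re \<beta> \<noteq> 0"
   define p0 where "p0 = grem_p d a \<alpha> \<beta>"
   define B where "B = C * (1 + \<bar>Re \<beta>\<bar> powr (- (1 / 2)))"
   have B: "B >= 0" using C by (simp add: B_def)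
   have m2: "(\<integral>\<^sup>+w. ennreal ((u n w \<beta>)^2) \<partial>M) <= ennreal B"
    unfolding u_def B_def using elim[rule_format, OF b cascade_rv_Z] .
   have pw: "ennreal \<bar>u n w \<beta> - p0\<bar> <= ennreal (1 + 2 * p0^2) + 2 * ennreal ((u n w \<beta>)^2)" for w
   proof -
    define D where "D = \<bar>u n w \<beta> - p0\<bar>"
    have "D^2 <= 2 * p0^2 + 2 * (u n w \<beta>)^2"
     unfolding D_def using zero_le_power2[of "u n w \<beta> + p0"] by (simp add: square_simps)
    moreover have "2 * D <= 1 + D^2" using zero_le_power2[of "D - 1"] unfolding power2_diff by simp
    moreover have "0 <= D" by (simp add: D_def)
    ultimately have "D <= (1 + 2 * p0^2) + 2 * (u n w \<beta>)^2" by linarith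
    then have "\<bar>u n w \<beta> - p0\<bar> <= (1 + 2 * p0^2) + 2 * (u n w \<beta>)^2" unfolding D_def .
    then have "ennreal \<bar>u n w \<beta> - p0\<bar> <= ennreal ((1 + 2 * p0^2) + 2 * (u n w \<beta>)^2)" by (rule ennreal_leI)
    also have "\<dots> = ennreal (1 + 2 * p0^2) + 2 * ennreal ((u n w \<beta>)^2)"
     by (subst ennreal_plus) (auto simp: ennreal_mult intro: add_nonneg_nonneg)
    finally show ?thesis .
   qed
   have "(\<integral>\<^sup>+w. ennreal \<bar>u n w \<beta> - p0\<bar> \<partial>M) <= (\<integral>\<^sup>+w. ennreal (1 + 2 * p0^2) + 2 * ennreal ((u n w \<beta>)^2) \<partial>M)"
    by (rule nn_integral_mono[OF pw])
   also have "\<dots> = ennreal (1 + 2 * p0^2) + 2 * (\<integral>\<^sup>+w. ennreal ((u n w \<beta>)^2) \<partial>M)"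
    by (simp add: nn_integral_add nn_integral_cmult emeasure_space_1)
   also have "\<dots> <= ennreal (1 + 2 * p0^2) + 2 * ennreal B" using m2 by (intro add_mono mult_left_mono) auto
   also have "\<dots> = ennreal (1 + 2 * p0^2 + 2 * B)"
    using B by (subst ennreal_plus) (auto simp: ennreal_mult intro: add_nonneg_nonneg)
   finally show "(\<integral>\<^sup>+w. ennreal \<bar>u n w \<beta> - grem_p d a \<alpha> \<beta>\<bar> \<partial>M) <= ennreal (1 + 2 * (grem_p d a \<alpha> \<beta>)^2 + 2 * C * (1 + \<bar>Re \<beta>\<bar> powr (- (1 / 2))))"
    by (simp only: p0_def B_def mult.assoc)
  qed
 qed
 then show ?thesis using C by blast
qed

end

section \<open>From potentials to zeros\<close>

context grem
begin

text \<open>Tonelli turns the expectation into an integral over \<open>z\<close> of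
  \<open>|L z|\<close> times the mean error at \<open>z\<close>. That error tends to 0 off the two
  axes, and \<open>log_L1_bound\<close> dominates it, with the integrable singularity
  \<open>|Re z| powr (-1/2)\<close>.\<close>

lemma potential_converges:
 assumes L: "continuous_on UNIV L" and LR: "\<And>z. norm z > R ==> L z = (0 :: real)"
 shows "(\<lambda>n. \<integral>\<^sup>+v. ennreal \<bar>\<integral>z. (u n v z - grem_p d a \<alpha> z) * L z \<partial>lborel\<bar> \<partial>M) \<longlonglongrightarrow> 0"
proof -
 let ?p = "grem_p d a \<alpha>"
 have cp: "continuous_on UNIV ?p" by (rule continuous_grem_p[OF a \<alpha>])
 have [measurable]: "?p \<in> borel_measurable borel" "L \<in> borel_measurable borel"
  using cp L by (auto intro: borel_measurable_continuous_onI)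
 have um[measurable]: "(\<lambda>x. u n (fst x) (snd x)) \<in> borel_measurable (M \<Otimes>\<^sub>M borel)" for n
  using measurable_u[of n] by (simp add: split_beta')
 interpret pair: pair_sigma_finite M lborel ..
 define E where "E n z = (\<integral>\<^sup>+v. ennreal \<bar>u n v z - ?p z\<bar> \<partial>M)" for n z
 have Em[measurable]: "E n \<in> borel_measurable borel" for n
 proof -
  have "(\<lambda>(z, v). ennreal \<bar>u n v z - ?p z\<bar>) \<in> borel_measurable (borel \<Otimes>\<^sub>M M)"
  proof -
   have "(\<lambda>x. u n (fst (snd x, fst x)) (snd (snd x, fst x))) \<in> borel_measurable (borel \<Otimes>\<^sub>M M)"
    by (rule measurable_compose[OF _ um]) measurable
   then show ?thesis by (simp add: split_beta')
  qed
  then show ?thesis unfolding E_def by (rule borel_measurable_nn_integral)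
 qed
 have le: "(\<integral>\<^sup>+v. ennreal \<bar>\<integral>z. (u n v z - ?p z) * L z \<partial>lborel\<bar> \<partial>M) <= (\<integral>\<^sup>+z. ennreal \<bar>L z\<bar> * E n z \<partial>lborel)" for n
 proof -
  have "(\<integral>\<^sup>+v. ennreal \<bar>\<integral>z. (u n v z - ?p z) * L z \<partial>lborel\<bar> \<partial>M) <= (\<integral>\<^sup>+v. (\<integral>\<^sup>+z. ennreal (\<bar>u n v z - ?p z\<bar> * \<bar>L z\<bar>) \<partial>lborel) \<partial>M)"
  proof (intro nn_integral_mono)
   fix v
   show "ennreal \<bar>\<integral>z. (u n v z - ?p z) * L z \<partial>lborel\<bar> <= (\<integral>\<^sup>+z. ennreal (\<bar>u n v z - ?p z\<bar> * \<bar>L z\<bar>) \<partial>lborel)"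
   \<comment> \<open>The Bochner integral of a non-integrable function is 0 by convention, and then
     the bound is trivial.\<close>
   proof (cases "integrable lborel (\<lambda>z. (u n v z - ?p z) * L z)")
    case True
    from integral_norm_bound_ennreal[OF this] show ?thesis by (simp only: real_norm_def abs_mult)
   qed (simp add: not_integrable_integral_eq)
  qed
  also have "\<dots> = (\<integral>\<^sup>+z. (\<integral>\<^sup>+v. ennreal (\<bar>u n v z - ?p z\<bar> * \<bar>L z\<bar>) \<partial>M) \<partial>lborel)"
  proof (rule pair.Fubini'[symmetric])
   have "(\<lambda>x. ennreal (\<bar>u n (fst x) (snd x) - ?p (snd x)\<bar> * \<bar>L (snd x)\<bar>)) \<in> borel_measurable (M \<Otimes>\<^sub>M borel)" by measurable
   then show "(\<lambda>(v, z). ennreal (\<bar>u n v z - ?p z\<bar> * \<bar>L z\<bar>)) \<in> borel_measurable (M \<Otimes>\<^sub>M lborel)"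
    by (simp add: split_beta' measurable_cong_sets[OF sets_pair_measure_cong[OF refl sets_lborel] refl])
  qed
  also have "\<dots> = (\<integral>\<^sup>+z. ennreal \<bar>L z\<bar> * E n z \<partial>lborel)"
   unfolding E_def by (intro nn_integral_cong, subst nn_integral_cmult[symmetric]) (auto simp: ennreal_mult' mult.commute)
  finally show ?thesis .
 qed
 define R' where "R' = \<bar>R\<bar> + 1"
 have R': "R' > 0" by (simp add: R'_def)
 obtain C where C: "C >= 0" and bd: "\<forall>\<^sub>F n in sequentially. \<forall>b. \<bar>Re b\<bar> <= R' \<and> Re b \<noteq> 0 \<longrightarrow>
  E n b <= ennreal (1 + 2 * (?p b)^2 + 2 * C * (1 + \<bar>Re b\<bar> powr (- (1 / 2))))"
  using log_L1_bound[OF R'] unfolding E_def by auto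
 obtain n0 where n0: "\<And>n b. n >= n0 ==> \<bar>Re b\<bar> <= R' ==> Re b \<noteq> 0 ==>
  E n b <= ennreal (1 + 2 * (?p b)^2 + 2 * C * (1 + \<bar>Re b\<bar> powr (- (1 / 2))))"
  using bd unfolding eventually_sequentially by blast
 define w where "w z = \<bar>L z\<bar> * (1 + 2 * (?p z)^2 + 2 * C * (1 + \<bar>Re z\<bar> powr (- (1 / 2))))" for z
 have w0: "w z >= 0" for z using C by (auto simp: w_def intro!: mult_nonneg_nonneg add_nonneg_nonneg)
 have wi: "integrable lborel w"
 proof -
  have 1: "integrable lborel (\<lambda>z. \<bar>L z\<bar> * (1 + 2 * (?p z)^2 + 2 * C))"
   by (rule integrable_cont_compact_support[of _ R]) (auto intro!: continuous_intros L cp simp: LR)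
  have "bounded (L ` cball 0 R)"
   by (intro compact_imp_bounded compact_continuous_image continuous_on_subset[OF L]) auto
  then obtain B where "\<forall>y\<in>L ` cball 0 R. norm y <= B" unfolding bounded_iff by blast
  then have B: "norm (L z) <= B" if "z \<in> cball 0 R" for z using that by blast
  have 2: "integrable lborel (\<lambda>z. \<bar>L z\<bar> * \<bar>Re z\<bar> powr (- (1 / 2)))"
  proof (rule Bochner_Integration.integrable_bound[OF integrable_mult_right[OF integrable_inverse_sqrt_Re[of R 0], of B]])
   show "AE z in lborel. norm (\<bar>L z\<bar> * \<bar>Re z\<bar> powr (- (1 / 2))) <= norm (B * (indicator (cball 0 R) z * \<bar>Re z - 0\<bar> powr (- (1 / 2))))"
   proof (intro AE_I2)
    fix z
    show "norm (\<bar>L z\<bar> * \<bar>Re z\<bar> powr (- (1 / 2))) <= norm (B * (indicator (cball 0 R) z * \<bar>Re z - 0\<bar> powr (- (1 / 2))))"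
    proof (cases "z \<in> cball 0 R")
     case True
     have "\<bar>L z\<bar> <= \<bar>B\<bar>" using B[OF True] by simp
     then show ?thesis using True by (simp add: abs_mult mult_right_mono)
    next
     case False
     then show ?thesis using LR[of z] by simp
    qed
   qed
  qed measurable
  have "w = (\<lambda>z. \<bar>L z\<bar> * (1 + 2 * (?p z)^2 + 2 * C) + 2 * C * (\<bar>L z\<bar> * \<bar>Re z\<bar> powr (- (1 / 2))))"
   by (simp add: w_def fun_eq_iff algebra_simps)
  then show ?thesis using Bochner_Integration.integrable_add[OF 1 integrable_mult_right[OF 2, of "2 * C"]] by simp
 qed
 \<comment> \<open>The domination holds from \<open>n0\<close> on, hence the shifted index.\<close>
 have "(\<lambda>n. \<integral>\<^sup>+z. ennreal \<bar>L z\<bar> * E (n + n0) z \<partial>lborel) \<longlonglongrightarrow> (\<integral>\<^sup>+z. 0 \<partial>(lborel :: complex measure))"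
 proof (rule nn_integral_dominated_convergence)
  show "(\<lambda>z. ennreal (w z)) \<in> borel_measurable lborel" using wi by auto
  show "(\<integral>\<^sup>+z. ennreal (w z) \<partial>lborel) < \<infinity>" using wi w0 by (simp add: nn_integral_eq_integral)
  show "AE z in lborel. ennreal \<bar>L z\<bar> * E (n + n0) z <= ennreal (w z)" for n
   using AE_Re_neq[of 0]
  proof eventually_elim
   case (elim z)
   show ?case
   proof (cases "norm z > R")
    case True
    then show ?thesis using LR by simp
   next
    case False
    then have "\<bar>Re z\<bar> <= R'" using abs_Re_le_cmod[of z] by (simp add: R'_def)
    then have "ennreal \<bar>L z\<bar> * E (n + n0) z <= ennreal \<bar>L z\<bar> * ennreal (1 + 2 * (?p z)^2 + 2 * C * (1 + \<bar>Re z\<bar> powr (- (1 / 2))))"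
     using elim by (intro mult_left_mono n0) auto
    also have "\<dots> = ennreal (w z)" unfolding w_def by (rule ennreal_mult'[symmetric]) simp
    finally show ?thesis .
   qed
  qed
  show "AE z in lborel. (\<lambda>n. ennreal \<bar>L z\<bar> * E (n + n0) z) \<longlonglongrightarrow> 0"
   using AE_Re_neq[of 0] AE_Im_neq[of 0]
  proof eventually_elim
   case (elim z)
   have "(\<lambda>n. E (n + n0) z) \<longlonglongrightarrow> 0"
    using LIMSEQ_ignore_initial_segment[OF log_converges_L1[OF elim], of n0] by (simp add: E_def)
   then have "(\<lambda>n. ennreal \<bar>L z\<bar> * E (n + n0) z) \<longlonglongrightarrow> ennreal \<bar>L z\<bar> * 0" by (intro tendsto_mult_ennreal tendsto_const) auto
   then show ?case by simp
  qed
 qed measurable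
 then have "(\<lambda>n. \<integral>\<^sup>+z. ennreal \<bar>L z\<bar> * E (n + n0) z \<partial>lborel) \<longlonglongrightarrow> 0" by simp
 then have "(\<lambda>n. \<integral>\<^sup>+z. ennreal \<bar>L z\<bar> * E n z \<partial>lborel) \<longlonglongrightarrow> 0" by (rule LIMSEQ_offset)
 then show ?thesis
  by (rule tendsto_sandwich[OF always_eventually always_eventually tendsto_const, rotated 2]) (use le in auto)
qed

lemma zeros_integral:
 assumes \<phi>: "C2c \<phi> L" and n: "n > 0" and Z0: "Z n w 0 \<noteq> 0"
 shows "integrable lborel (\<lambda>z. u n w z * L z)"
  and "(\<integral>z. \<phi> z \<partial>scale_measure (ennreal (1 / real n)) (zeros_measure (Z n w))) = (LBINT z. u n w z * L z) / (2 * pi)"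
proof -
 obtain \<phi>x \<phi>y \<phi>xx \<phi>yy R where C2: "C2_on UNIV \<phi> \<phi>x \<phi>y \<phi>xx \<phi>yy" and z: "\<And>z. norm z > R ==> \<phi> z = 0"
  and L: "L = (\<lambda>z. \<phi>xx z + \<phi>yy z)" using \<phi> unfolding C2c_def by blast
 have PL: "integrable lborel (\<lambda>z. ln (norm (Z n w z)) * (\<phi>xx z + \<phi>yy z))"
  "(LBINT z. ln (norm (Z n w z)) * (\<phi>xx z + \<phi>yy z)) = 2 * pi * (\<integral>z. \<phi> z \<partial>zeros_measure (Z n w))"
  using Poincare_Lelong[OF holomorphic_Z Z0 C2, of R] z by blast+
 have eq: "(\<lambda>z. u n w z * L z) = (\<lambda>z. 1 / real n * (ln (norm (Z n w z)) * (\<phi>xx z + \<phi>yy z)))"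
  by (simp add: u_def L fun_eq_iff)
 show "integrable lborel (\<lambda>z. u n w z * L z)" unfolding eq by (rule integrable_mult_right[OF PL(1)])
 have "\<phi> \<in> borel_measurable (zeros_measure (Z n w))"
  using C2_onD(1)[OF C2] by (simp add: borel_measurable_continuous_onI measurable_cong_sets[OF sets_zeros_measure refl])
 then have "(\<integral>z. \<phi> z \<partial>scale_measure (ennreal (1 / real n)) (zeros_measure (Z n w))) = 1 / real n * (\<integral>z. \<phi> z \<partial>zeros_measure (Z n w))"
  by (intro integral_scale_measure) auto
 moreover have "(LBINT z. u n w z * L z) = 1 / real n * (2 * pi * (\<integral>z. \<phi> z \<partial>zeros_measure (Z n w)))"
  unfolding eq PL(2)[symmetric] by (rule integral_mult_right_zero)
 ultimately show "(\<integral>z. \<phi> z \<partial>scale_measure (ennreal (1 / real n)) (zeros_measure (Z n w))) = (LBINT z. u n w z * L z) / (2 * pi)"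
  by simp
qed

text \<open>For each test function the difference of the two integrals is
  \<open>1 / (2 * pi)\<close> times the integral of
  \<open>u n \<omega> - grem_p d a \<alpha>\<close> against its Laplacian:
  \<open>zeros_integral\<close> rewrites one side and \<open>grem_p_Laplacian\<close> the other.
  \<open>potential_converges\<close> and Markov's inequality give convergence in probability, which
  suffices for a deterministic limit.\<close>

lemma zeros_converge:
 "converges_in_distribution M vague_topology
  (\<lambda>n \<omega>. scale_measure (ennreal (1 / real n)) (zeros_measure (Z n \<omega>)))
  (\<lambda>\<omega>. scale_measure (ennreal (1 / (2 * pi))) (grem_Xi d a \<alpha>))"
proof (rule converges_in_distribution_vagueI[OF prob_space_axioms])
 let ?X = "\<lambda>n \<omega>. scale_measure (ennreal (1 / real n)) (zeros_measure (Z n \<omega>))"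
 let ?\<mu> = "scale_measure (ennreal (1 / (2 * pi))) (grem_Xi d a \<alpha>)"
 let ?p = "grem_p d a \<alpha>"
 have cp: "continuous_on UNIV ?p" by (rule continuous_grem_p[OF a \<alpha>])
 have Xi: "grem_Xi d a \<alpha> \<in> radon_measures" by (rule radon_grem_Xi[OF a \<alpha>])
 then show "?\<mu> \<in> radon_measures" by (rule radon_scale)
 have good: "\<forall>\<^sub>F n in sequentially. n > 0 \<and> (\<forall>\<omega>. Z n \<omega> 0 \<noteq> 0)"
  using Z_0_eventually eventually_gt_at_top[of 0] by eventually_elim auto
 show "\<forall>\<^sub>F n in sequentially. \<forall>\<omega>\<in>space M. ?X n \<omega> \<in> radon_measures"
  using good by eventually_elim (auto intro!: radon_scale zeros_measure_radon[OF holomorphic_Z])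
 obtain L where L: "\<And>k. C2c (test_fun k) (L k)" using C2c_test_fun by metis
 have Lc: "continuous_on UNIV (L k)" for k by (rule C2cE[OF L[of k]])
 have LR: "\<exists>R. \<forall>z. norm z > R \<longrightarrow> L k z = 0" for k
 proof (rule C2cE[OF L[of k]])
  fix R assume "\<And>z. norm z > R ==> L k z = 0"
  then show ?thesis by blast
 qed
 have um: "(\<lambda>\<omega>. (LBINT z. (u n \<omega> z - ?p z) * L k z)) \<in> borel_measurable M"
  and um': "(\<lambda>\<omega>. (LBINT z. u n \<omega> z * L k z)) \<in> borel_measurable M" for n k
 proof -
  have [measurable]: "?p \<in> borel_measurable borel" "L k \<in> borel_measurable borel"
   by (rule borel_measurable_continuous_onI[OF cp] borel_measurable_continuous_onI[OF Lc])+
  have [measurable]: "(\<lambda>x. u n (fst x) (snd x)) \<in> borel_measurable (M \<Otimes>\<^sub>M borel)"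
   using measurable_u[of n] by (simp add: split_beta')
  have s: "f \<in> borel_measurable (M \<Otimes>\<^sub>M lborel)" if "f \<in> borel_measurable (M \<Otimes>\<^sub>M (borel :: complex measure))" for f :: "'a \<times> complex \<Rightarrow> real"
   using that by (simp add: measurable_cong_sets[OF sets_pair_measure_cong[OF refl sets_lborel] refl])
  have "(\<lambda>x. (u n (fst x) (snd x) - ?p (snd x)) * L k (snd x)) \<in> borel_measurable (M \<Otimes>\<^sub>M borel)" by measurable
  from s[OF this] show "(\<lambda>\<omega>. (LBINT z. (u n \<omega> z - ?p z) * L k z)) \<in> borel_measurable M"
   by (intro lborel.borel_measurable_lebesgue_integral) (simp add: split_beta')
  have "(\<lambda>x. u n (fst x) (snd x) * L k (snd x)) \<in> borel_measurable (M \<Otimes>\<^sub>M borel)" by measurable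
  from s[OF this] show "(\<lambda>\<omega>. (LBINT z. u n \<omega> z * L k z)) \<in> borel_measurable M"
   by (intro lborel.borel_measurable_lebesgue_integral) (simp add: split_beta')
 qed
 show "\<forall>\<^sub>F n in sequentially. \<forall>k. (\<lambda>\<omega>. \<integral>z. test_fun k z \<partial>?X n \<omega>) \<in> borel_measurable M"
  using good
 proof eventually_elim
  case (elim n)
  then have "(\<lambda>\<omega>. \<integral>z. test_fun k z \<partial>?X n \<omega>) = (\<lambda>\<omega>. (LBINT z. u n \<omega> z * L k z) / (2 * pi))" for k
   using zeros_integral(2)[OF L] by (intro ext) blast
  then show ?case using um' by simp
 qed
 fix k and e :: real assume e: "e > 0"
 have diff: "(\<integral>z. test_fun k z \<partial>?X n \<omega>) - (\<integral>z. test_fun k z \<partial>?\<mu>) = (LBINT z. (u n \<omega> z - ?p z) * L k z) / (2 * pi)"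
  if n: "n > 0" "Z n \<omega> 0 \<noteq> 0" for n \<omega>
 proof -
  obtain R where R: "\<And>z. norm z > R ==> L k z = 0" using LR[of k] by metis
  have ip: "integrable lborel (\<lambda>z. ?p z * L k z)"
   by (rule integrable_cont_compact_support[of _ R]) (auto intro!: continuous_intros Lc cp simp: R)
  have "test_fun k \<in> borel_measurable (grem_Xi d a \<alpha>)"
   using Xi continuous_test_fun[of UNIV k] by (simp add: radon_measures_def borel_measurable_continuous_onI measurable_cong_sets[of "grem_Xi d a \<alpha>" borel])
  then have "(\<integral>z. test_fun k z \<partial>?\<mu>) = 1 / (2 * pi) * (\<integral>z. test_fun k z \<partial>grem_Xi d a \<alpha>)"
   by (intro integral_scale_measure) auto
  also have "(\<integral>z. test_fun k z \<partial>grem_Xi d a \<alpha>) = (LBINT z. ?p z * L k z)"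
   by (rule grem_p_Laplacian[OF a \<alpha> L, symmetric])
  finally have "(\<integral>z. test_fun k z \<partial>?X n \<omega>) - (\<integral>z. test_fun k z \<partial>?\<mu>) = ((LBINT z. u n \<omega> z * L k z) - (LBINT z. ?p z * L k z)) / (2 * pi)"
   using zeros_integral(2)[OF L n] by (simp add: diff_divide_distrib)
  also have "(LBINT z. u n \<omega> z * L k z) - (LBINT z. ?p z * L k z) = (LBINT z. (u n \<omega> z - ?p z) * L k z)"
   unfolding left_diff_distrib using zeros_integral(1)[OF L n] ip by (rule Bochner_Integration.integral_diff[symmetric])
  finally show ?thesis .
 qed
 define G where "G n \<omega> = \<bar>\<integral>z. (u n \<omega> z - ?p z) * L k z \<partial>lborel\<bar>" for n \<omega>
 have Gm[measurable]: "G n \<in> borel_measurable M" for n unfolding G_def using um by measurable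
 define e' where "e' = e * (2 * pi)"
 have e': "e' > 0" using e by (simp add: e'_def)
 have Glim: "(\<lambda>n. \<integral>\<^sup>+\<omega>. ennreal (G n \<omega>) \<partial>M) \<longlonglongrightarrow> 0"
 proof -
  obtain R where R: "\<And>z. norm z > R ==> L k z = 0" using LR[of k] by metis
  have "(\<lambda>n. \<integral>\<^sup>+\<omega>. ennreal \<bar>\<integral>z. (u n \<omega> z - ?p z) * L k z \<partial>lborel\<bar> \<partial>M) \<longlonglongrightarrow> 0"
   by (rule potential_converges[of "L k" R, OF Lc]) (rule R)
  then show ?thesis unfolding G_def .
 qed
 have Markov: "ennreal (e' * prob {\<omega> \<in> space M. e' <= G n \<omega>}) <= (\<integral>\<^sup>+\<omega>. ennreal (G n \<omega>) \<partial>M)" for n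
 proof -
  have "ennreal (e' * prob {\<omega> \<in> space M. e' <= G n \<omega>}) = (\<integral>\<^sup>+\<omega>. ennreal e' * indicator {\<omega> \<in> space M. e' <= G n \<omega>} \<omega> \<partial>M)"
   using e' by (subst nn_integral_cmult_indicator) (auto simp: emeasure_eq_measure ennreal_mult')
  also have "\<dots> <= (\<integral>\<^sup>+\<omega>. ennreal (G n \<omega>) \<partial>M)"
   by (intro nn_integral_mono) (auto simp: indicator_def intro: ennreal_leI)
  finally show ?thesis .
 qed
 have "(\<lambda>n. ennreal (e' * prob {\<omega> \<in> space M. e' <= G n \<omega>})) \<longlonglongrightarrow> 0"
  by (rule tendsto_sandwich[OF always_eventually always_eventually tendsto_const Glim]) (use Markov in auto)
 then have "(\<lambda>n. e' * prob {\<omega> \<in> space M. e' <= G n \<omega>}) \<longlonglongrightarrow> 0"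
  using e' by (subst (asm) ennreal_tendsto_0_iff) auto
 then have "(\<lambda>n. 1 / e' * (e' * prob {\<omega> \<in> space M. e' <= G n \<omega>})) \<longlonglongrightarrow> 1 / e' * 0" by (intro tendsto_mult tendsto_const)
 then have lim: "(\<lambda>n. prob {\<omega> \<in> space M. e' <= G n \<omega>}) \<longlonglongrightarrow> 0" using e' by simp
 have "\<forall>\<^sub>F n in sequentially. prob {\<omega> \<in> space M. e' <= G n \<omega>} =
  prob {\<omega> \<in> space M. \<bar>(\<integral>z. test_fun k z \<partial>?X n \<omega>) - (\<integral>z. test_fun k z \<partial>?\<mu>)\<bar> >= e}"
  using good
 proof eventually_elim
  case (elim n)
  have "e' <= G n \<omega> \<longleftrightarrow> e <= \<bar>(\<integral>z. test_fun k z \<partial>?X n \<omega>) - (\<integral>z. test_fun k z \<partial>?\<mu>)\<bar>" for \<omega>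
  proof -
   have "\<bar>(\<integral>z. test_fun k z \<partial>?X n \<omega>) - (\<integral>z. test_fun k z \<partial>?\<mu>)\<bar> = G n \<omega> / (2 * pi)"
    using elim by (subst diff) (auto simp: G_def)
   then show ?thesis by (simp add: e'_def pos_le_divide_eq)
  qed
  then show ?case by simp
 qed
 then show "(\<lambda>n. prob {\<omega> \<in> space M. \<bar>(\<integral>z. test_fun k z \<partial>?X n \<omega>) - (\<integral>z. test_fun k z \<partial>?\<mu>)\<bar> >= e}) \<longlonglongrightarrow> 0"
  by (rule Lim_transform_eventually[OF lim])
qed

end

theorem theorem2p3:
  fixes P :: "'w measure" and d :: nat and a \<alpha> :: "nat \<Rightarrow> real"
    and N :: "nat \<Rightarrow> nat \<Rightarrow> nat" and \<xi> :: "nat \<Rightarrow> nat list \<Rightarrow> 'w \<Rightarrow> real"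
  assumes "prob_space P"
    and "\<And>j. j \<in> {1..d} \<Longrightarrow> a j > 0"
    and "\<And>j. j \<in> {1..d} \<Longrightarrow> \<alpha> j > 1"
    and "\<And>j. j \<in> {1..d} \<Longrightarrow> (\<lambda>n. real (N n j) / \<alpha> j ^ n) \<longlonglongrightarrow> 1"
    and "\<And>n. prob_space.indep_vars P (\<lambda>_. borel) (\<xi> n) (grem_nodes (N n) d)"
    and "\<And>n \<eta>. \<eta> \<in> grem_nodes (N n) d \<Longrightarrow>
           distributed P lborel (\<xi> n \<eta>) (\<lambda>x. ennreal (std_normal_density x))"
    and "strict_mono_on {1..d} (\<lambda>k. crit (a k) (\<alpha> k))"
  shows "converges_in_distribution P vague_topology
           (\<lambda>n \<omega>. scale_measure (ennreal (1 / real n))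
              (zeros_measure (grem_partition d a (N n) (\<xi> n) n \<omega>)))
           (\<lambda>\<omega>. scale_measure (ennreal (1 / (2 * pi))) (grem_Xi d a \<alpha>))
       \<and> has_distributional_laplacian (grem_p d a \<alpha>) (grem_Xi d a \<alpha>)"
proof
  interpret prob_space P by fact
  \<comment> \<open>\<open>distributed\<close> refers to \<open>lborel\<close> and the cascade
    lemmas to \<open>borel\<close>; both push-forwards are the same measure.\<close>
  have normal: "distr P borel (\<xi> n \<eta>) = std_normal_distribution" if "\<eta> \<in> grem_nodes (N n) d" for n \<eta>
  proof -
    have "distr P borel (\<xi> n \<eta>) = distr P lborel (\<xi> n \<eta>)" by (intro distr_cong) auto
    then show ?thesis using distributed_distr_eq_density[OF assms(6)[OF that]] by simp
  qed
  interpret grem P d a \<alpha> N \<xi>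
    by unfold_locales (use assms normal in auto)
  show "converges_in_distribution P vague_topology
     (\<lambda>n \<omega>. scale_measure (ennreal (1 / real n)) (zeros_measure (grem_partition d a (N n) (\<xi> n) n \<omega>)))
     (\<lambda>\<omega>. scale_measure (ennreal (1 / (2 * pi))) (grem_Xi d a \<alpha>))"
    using zeros_converge unfolding Z_def .
  show "has_distributional_laplacian (grem_p d a \<alpha>) (grem_Xi d a \<alpha>)"
    by (rule grem_p_distributional_Laplacian[OF assms(2,3)])
qed

end
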